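(* Let $0<\beta<\frac{\pi}{2}$ be fixed and let $N$ be a non-negative integer. Put $\xi=\nu(\tan\beta-\beta)-\frac{\pi}{4}$. (a) For every integer $n\ge 0$, \[ U_n(i\cot\beta)=(-1)^n\frac{(i\cot\beta)^n}{2^n n!}\left[\frac{d^{2n}}{dt^{2n}}\left(\frac12\,\frac{t^2}{i\cot\beta\,(t-\sinh t)+\cosh t-1}\right)^{n+\frac12}\right]_{t=0} =\frac{i^n}{2(2\pi\cot\beta)^{\frac12}}\int_0^{+\infty}t^{n-\frac12}e^{-t(\tan\beta-\beta)}\left(1+e^{-2\pi t}\right)iH^{(1)}_{it}(it\sec\beta)\,dt . \] (b) For a complex number $w$ with $-\frac{\pi}{2}<\arg w<\frac{3\pi}{2}$ define \[ R_N^{(H)}(w,\beta)=\frac{1}{2(2\pi\cot\beta)^{\frac12}(iw)^N}\int_0^{+\infty}\frac{t^{N-\frac12}e^{-t(\tan\beta-\beta)}}{1+it/w}\left(1+e^{-2\pi t}\right)iH^{(1)}_{it}(it\sec\beta)\,dt . \] Then \[ H^{(1)}_\nu(\nu\sec\beta)=\frac{e^{i\nu(\tan\beta-\beta)-\frac{\pi}{4}i}}{\left(\frac12\nu\pi\tan\beta\right)^{\frac12}}\left(\sum_{n=0}^{N-1}(-1)^n\frac{U_n(i\cot\beta)}{\nu^n}+R_N^{(H)}(\nu,\beta)\right)\quad\text{for }-\tfrac{\pi}{2}<\arg\nu<\tfrac{3\pi}{2}, \] \[ H^{(2)}_\nu(\nu\sec\beta)=\frac{e^{-i\nu(\tan\beta-\beta)+\frac{\pi}{4}i}}{\left(\frac12\nu\pi\tan\beta\right)^{\frac12}}\left(\sum_{n=0}^{N-1}\frac{U_n(i\cot\beta)}{\nu^n}+R_N^{(H)}(\nu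 e^{\pi i},\beta)\right)\quad\text{for }-\tfrac{3\pi}{2}<\arg\nu<\tfrac{\pi}{2}. \] (c) For $|\arg\nu|<\frac{\pi}{2}$, \[ J_\nu(\nu\sec\beta)=\left(\frac{2}{\nu\pi\tan\beta}\right)^{\frac12}\left(\cos\xi\sum_{n=0}^{N-1}\frac{U_{2n}(i\cot\beta)}{\nu^{2n}}-i\sin\xi\sum_{n=0}^{N-1}\frac{U_{2n+1}(i\cot\beta)}{\nu^{2n+1}}+R_N^{(J)}(\nu,\beta)\right), \] \[ Y_\nu(\nu\sec\beta)=\left(\frac{2}{\nu\pi\tan\beta}\right)^{\frac12}\left(\sin\xi\sum_{n=0}^{N-1}\frac{U_{2n}(i\cot\beta)}{\nu^{2n}}+i\cos\xi\sum_{n=0}^{N-1}\frac{U_{2n+1}(i\cot\beta)}{\nu^{2n+1}}+R_N^{(Y)}(\nu,\beta)\right), \] where, writing $F(t)=\left(1+e^{-2\pi t}\right)iH^{(1)}_{it}(it\sec\beta)$ and $c_\beta=2(2\pi\cot\beta)^{\frac12}$, \[ R_N^{(J)}(\nu,\beta)=\cos\xi\,\frac{(-1)^N}{c_\beta\,\nu^{2N}}\int_0^{+\infty}\frac{t^{2N-\frac12}e^{-t(\tan\beta-\beta)}}{1+(t/\nu)^2}F(t)\,dt+\sin\xi\,\frac{(-1)^N}{c_\beta\,\nu^{2N+1}}\int_0^{+\infty}\frac{t^{2N+\frac12}e^{-t(\tan\beta-\beta)}}{1+(t/\nu)^2}F(t)\,dt, \] \[ R_N^{(Y)}(\nu,\beta)=\sin\xi\,\frac{(-1)^N}{c_\beta\,\nu^{2N}}\int_0^{+\infty}\frac{t^{2N-\frac12}e^{-t(\tan\beta-\beta)}}{1+(t/\nu)^2}F(t)\,dt-\cos\xi\,\frac{(-1)^N}{c_\beta\,\nu^{2N+1}}\int_0^{+\infty}\frac{t^{2N+\frac12}e^{-t(\tan\beta-\beta)}}{1+(t/\nu)^2}F(t)\,dt.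 \]
   Context: $H^{(1)}_\nu$, $H^{(2)}_\nu$ are the Hankel functions and $J_\nu$, $Y_\nu$ the Bessel functions of the first and second kind. For fixed $\beta$, the functions $\nu\mapsto H^{(1)}_\nu(\nu\sec\beta)$, $H^{(2)}_\nu(\nu\sec\beta)$ are understood as analytic continuations in $\nu$ (on the Riemann surface of $\log\nu$) from $\nu>0$, where they take their standard values. All square roots (e.g. $\nu^{1/2}$, $t^{n-1/2}$) are positive on the positive real line and defined by analytic continuation elsewhere. For $t>0$ the quantity $iH^{(1)}_{it}(it\sec\beta)$ is the standard value $\frac{2}{\pi}e^{\pi t/2}K_{it}(t\sec\beta)$, $K$ being the modified Bessel function of the third kind. Empty sums are zero. *)

theory Defs
  imports "HOL-Analysis.Analysis" "HOL-Computational_Algebra.Polynomial"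
begin

text \<open>Bessel J of complex order mu and argument z, where the argument is given by a
  chosen logarithm L of z (z = exp L).  This realises the analytic continuation on the
  Riemann surface of the logarithm: (z/2)^(mu+2k) = exp((mu+2k)(L - ln 2)).\<close>
definition besselJ_log :: "complex \<Rightarrow> complex \<Rightarrow> complex" where
  "besselJ_log mu L = (\<Sum>k. (-1) ^ k * exp ((mu + 2 * of_nat k) * (L - of_real (ln 2)))
        * rGamma (mu + of_nat k + 1) / fact k)"

definition hankel1_nonint :: "complex \<Rightarrow> complex \<Rightarrow> complex" where
  "hankel1_nonint mu L =
     (besselJ_log (- mu) L - exp (- mu * of_real pi * \<i>) * besselJ_log mu L) / (\<i> * sin (mu * of_real pi))"

definition hankel2_nonint :: "complex \<Rightarrow> complex \<Rightarrow> complex" where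
  "hankel2_nonint mu L =
     (besselJ_log (- mu) L - exp (mu * of_real pi * \<i>) * besselJ_log mu L) / (- \<i> * sin (mu * of_real pi))"

definition besselY_nonint :: "complex \<Rightarrow> complex \<Rightarrow> complex" where
  "besselY_nonint mu L =
     (besselJ_log mu L * cos (mu * of_real pi) - besselJ_log (- mu) L) / sin (mu * of_real pi)"

definition hankel1_log :: "complex \<Rightarrow> complex \<Rightarrow> complex" where
  "hankel1_log mu L = (if mu \<in> \<int> then Lim (at mu) (\<lambda>m. hankel1_nonint m L) else hankel1_nonint mu L)"

definition hankel2_log :: "complex \<Rightarrow> complex \<Rightarrow> complex" where
  "hankel2_log mu L = (if mu \<in> \<int> then Lim (at mu) (\<lambda>m. hankel2_nonint m L) else hankel2_nonint mu L)"

definition besselY_log :: "complex \<Rightarrow> complex \<Rightarrow> complex" where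
  "besselY_log mu L = (if mu \<in> \<int> then Lim (at mu) (\<lambda>m. besselY_nonint m L) else besselY_nonint mu L)"

definition poly_int :: "complex poly \<Rightarrow> complex poly" where
  "poly_int p = pCons 0 (Poly (map (\<lambda>i. coeff p i / of_nat (Suc i)) [0..<Suc (degree p)]))"

fun debyeU :: "nat \<Rightarrow> complex poly" where
  "debyeU 0 = 1"
| "debyeU (Suc k) = smult (1/2) ([:0, 0, 1:] * [:1, 0, -1:] * pderiv (debyeU k))
                    + smult (1/8) (poly_int ([:1, 0, -5:] * debyeU k))"

abbreviation U :: "nat \<Rightarrow> complex \<Rightarrow> complex" where
  "U n p \<equiv> poly (debyeU n) p"

definition Fker :: "real \<Rightarrow> real \<Rightarrow> complex" where
  "Fker \<beta> t = (1 + of_real (exp (- 2 * pi * t)))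
      * (\<i> * hankel1_log (\<i> * of_real t) (Ln (\<i> * of_real t / of_real (cos \<beta>))))"

definition cbeta :: "real \<Rightarrow> real" where
  "cbeta \<beta> = 2 * sqrt (2 * pi * (cos \<beta> / sin \<beta>))"

definition RH :: "nat \<Rightarrow> complex \<Rightarrow> real \<Rightarrow> complex" where
  "RH N w \<beta> = 1 / (of_real (cbeta \<beta>) * (\<i> * w) ^ N) *
     integral {0<..} (\<lambda>t. of_real (t powr (real N - 1/2) * exp (- t * (tan \<beta> - \<beta>)))
                          / (1 + \<i> * of_real t / w) * Fker \<beta> t)"

definition IJ :: "nat \<Rightarrow> complex \<Rightarrow> real \<Rightarrow> real \<Rightarrow> complex" where
  "IJ m \<nu> \<beta> a = integral {0<..} (\<lambda>t. of_real (t powr (real m + a) * exp (- t * (tan \<beta> - \<beta>)))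
                          / (1 + (of_real t / \<nu>) ^ 2) * Fker \<beta> t)"

definition RJ :: "nat \<Rightarrow> complex \<Rightarrow> real \<Rightarrow> complex" where
  "RJ N \<nu> \<beta> = (let \<xi> = \<nu> * of_real (tan \<beta> - \<beta>) - of_real (pi / 4) in
     cos \<xi> * (-1) ^ N / (of_real (cbeta \<beta>) * \<nu> ^ (2 * N)) * IJ (2 * N) \<nu> \<beta> (- 1/2)
   + sin \<xi> * (-1) ^ N / (of_real (cbeta \<beta>) * \<nu> ^ (2 * N + 1)) * IJ (2 * N) \<nu> \<beta> (1/2))"

definition RY :: "nat \<Rightarrow> complex \<Rightarrow> real \<Rightarrow> complex" where
  "RY N \<nu> \<beta> = (let \<xi> = \<nu> * of_real (tan \<beta> - \<beta>) - of_real (pi / 4) in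
     sin \<xi> * (-1) ^ N / (of_real (cbeta \<beta>) * \<nu> ^ (2 * N)) * IJ (2 * N) \<nu> \<beta> (- 1/2)
   - cos \<xi> * (-1) ^ N / (of_real (cbeta \<beta>) * \<nu> ^ (2 * N + 1)) * IJ (2 * N) \<nu> \<beta> (1/2))"

end

theory Submission
  imports Defs "HOL-Complex_Analysis.Complex_Analysis" "HOL-Real_Asymp.Real_Asymp" "HOL-Probability.Distributions"
begin

text \<open>Put \<open>a = tan \<beta> - \<beta>\<close> and \<open>\<phi>(\<omega>) = a + \<i> (sec \<beta> sinh \<omega> - \<omega>)\<close>. The integral representation of \<open>K\<close>
  makes \<open>\<pi> exp (- t a) \<i> H(\<i> t)\<close> the integral of \<open>exp (- t \<phi>)\<close> over the line \<open>Im \<omega> = - \<beta>/2\<close>, and as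
  \<open>\<phi>(\<omega> + 2 \<pi> \<i>) = \<phi>(\<omega>) + 2 \<pi>\<close>, the factor \<open>1 + exp (- 2 \<pi> t)\<close> adds the same integral over the line
  \<open>Im \<omega> = 2 \<pi> - \<beta>/2\<close>. Between the two lines \<open>\<phi>\<close> has only the double zero \<open>\<i> \<beta>\<close>, so it has a holomorphic
  square root \<open>r\<close>, which is the principal one on the lower line and its negative on the upper line.

  Integrating \<open>t\<^sup>n\<^sup>-\<^sup>1\<^sup>/\<^sup>2\<close> first turns the moments of the kernel into integrals of \<open>r\<^sup>-\<^sup>(\<^sup>2\<^sup>n\<^sup>+\<^sup>1\<^sup>)\<close> over the
  two lines in opposite directions, that is, into a residue at \<open>\<i> \<beta>\<close>. This is the Taylor coefficient
  in (a), which satisfies the recurrence of the Debye polynomials up to total derivatives.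

  For the weight \<open>t\<^sup>-\<^sup>1\<^sup>/\<^sup>2 / (1 + t/x)\<close> the inner integral is an entire function \<open>E(\<plusminus>r)\<close> of error function
  type. Both lines can then be moved to \<open>Im \<omega> = \<pi>/2\<close>, where \<open>E(u) + E(-u) = 2 \<pi> \<surd>x exp (x u\<^sup>2)\<close>
  reproduces the Hankel function. This is the case \<open>N = 0\<close> of (b) on the ray \<open>\<nu> = \<i> x\<close>, and it extends
  to all other \<open>\<nu>\<close> by analytic continuation in \<open>log \<nu>\<close>. For general \<open>N\<close> one expands the geometric
  series, and (c) follows by adding and subtracting the two Hankel functions.\<close>

section \<open>Holomorphic parameter integrals and shifts of horizontal lines\<close>

text \<open>The Laplace transforms in \<open>t\<close> converge only where the phase has positive
  real part, and there they are functions of its principal square root. Around the saddle the real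
  part changes sign, so the contours can be moved only after the transforms have been rewritten
  through \<open>r\<close>, which vanishes at the saddle and comes out with the other sign: odd
  powers of \<open>r\<close> turn the sum over the two lines into a difference, and an entire
  function of \<open>r\<close> does not see the saddle at all. On the ray \<open>\<nu> = i x\<close>
  the factor \<open>1 + i t / \<nu>\<close> becomes the positive \<open>1 + t / x\<close>. The Debye
  recurrence contains an integral in \<open>p\<close>. Differentiating once removes it, and what is
  left is a linear relation between Taylor coefficients of one common index, which holds because a
  total derivative has no residue. At integer orders the functions are limits in the order with the
  argument held fixed, whereas the continuation moves order and argument together. Comparing the two
  requires an estimate of the numerator of the Hankel function near integer orders.\<close>

lemma holomorphic_on_integral:
  fixes f :: "complex \<Rightarrow> 'a \<Rightarrow> complex"
  assumes S: "open S"
    and hol: "\<And>x. x \<in> space M \<Longrightarrow> (\<lambda>z. f z x) holomorphic_on S"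
    and meas: "\<And>z. z \<in> S \<Longrightarrow> f z \<in> borel_measurable M"
    and dom: "\<And>z. z \<in> S \<Longrightarrow> \<exists>\<rho>>0. \<exists>w. cball z \<rho> \<subseteq> S \<and> integrable M w \<and>
                (\<forall>u\<in>cball z \<rho>. \<forall>x\<in>space M. norm (f u x) \<le> w x)"
  shows "(\<lambda>z. LINT x|M. f z x) holomorphic_on S"
proof -
  have "\<exists>D. ((\<lambda>z. LINT x|M. f z x) has_field_derivative D) (at z0)" if z0: "z0 \<in> S" for z0
  proof -
    obtain \<rho> w where \<rho>: "\<rho> > 0" "cball z0 \<rho> \<subseteq> S" and w: "integrable M w"
      and wb: "\<And>u x. u \<in> cball z0 \<rho> \<Longrightarrow> x \<in> space M \<Longrightarrow> norm (f u x) \<le> w x"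
      using dom[OF z0] by blast
    define D where "D = (\<lambda>x. deriv (\<lambda>z. f z x) z0)"
    define Q where "Q = (\<lambda>z x. (f z x - f z0 x) / (z - z0))"
    have int: "integrable M (f u)" if "u \<in> cball z0 \<rho>" for u
      by (rule Bochner_Integration.integrable_bound[OF w])
         (use that \<rho> meas wb in \<open>auto intro!: AE_I2 intro: order_trans[OF _ abs_ge_self]\<close>)
    have Qlim: "((\<lambda>z. Q z x) \<longlongrightarrow> D x) (at z0)" if "x \<in> space M" for x
      unfolding Q_def D_def
      using holomorphic_derivI[OF hol[OF that] S z0] by (simp add: has_field_derivative_iff)
    \<comment> \<open>Cauchy's inequality on discs of radius \<open>\<rho>/2\<close> turns the bound
      \<open>w\<close> for the integrand into one for its derivative, and hence for the difference
      quotients.\<close>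
    have Qbound: "norm (Q z x) \<le> w x / (\<rho>/2)" if "x \<in> space M" "z \<in> cball z0 (\<rho>/2)" "z \<noteq> z0" for x z
    proof -
      have der: "norm (deriv (\<lambda>z. f z x) u) \<le> w x / (\<rho>/2)" if u: "u \<in> cball z0 (\<rho>/2)" for u
      proof -
        have sub: "cball u (\<rho>/2) \<subseteq> cball z0 \<rho>"
        proof
          fix y assume "y \<in> cball u (\<rho>/2)"
          then have "dist z0 y \<le> dist z0 u + dist u y" "dist u y \<le> \<rho>/2" by (auto intro: dist_triangle)
          then show "y \<in> cball z0 \<rho>" using u by auto
        qed
        have "norm ((deriv ^^ 1) (\<lambda>z. f z x) u) \<le> fact 1 * w x / (\<rho>/2) ^ 1"
        proof (rule Cauchy_inequality)
          have "(\<lambda>z. f z x) holomorphic_on cball u (\<rho>/2)"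
            using hol[OF \<open>x \<in> space M\<close>] sub \<rho> holomorphic_on_subset by (meson order_trans)
          then show "(\<lambda>z. f z x) holomorphic_on ball u (\<rho>/2)" "continuous_on (cball u (\<rho>/2)) (\<lambda>z. f z x)"
            using holomorphic_on_subset ball_subset_cball holomorphic_on_imp_continuous_on by blast+
          fix y assume "norm (u - y) = \<rho>/2"
          then have "y \<in> cball u (\<rho>/2)" by (auto simp: dist_norm)
          then show "norm (f y x) \<le> w x" using sub wb that \<open>x \<in> space M\<close> by blast
        qed (use \<rho> in auto)
        then show ?thesis by simp
      qed
      have "norm (f z x - f z0 x) \<le> w x / (\<rho>/2) * norm (z - z0)"
      proof (rule field_differentiable_bound[of "cball z0 (\<rho>/2)" _ "deriv (\<lambda>z. f z x)"])
        fix u assume u: "u \<in> cball z0 (\<rho>/2)"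
        then have "u \<in> S" using \<rho>(1) by (intro subsetD[OF \<rho>(2)]) auto
        then show "((\<lambda>z. f z x) has_field_derivative deriv (\<lambda>z. f z x) u) (at u within cball z0 (\<rho>/2))"
          using holomorphic_derivI[OF hol[OF \<open>x \<in> space M\<close>] S] by blast
      qed (use that \<rho> der in auto)
      then show ?thesis using that by (simp add: Q_def norm_divide divide_le_eq)
    qed
    have seq: "((\<lambda>n. LINT x|M. Q (X n) x) \<longlonglongrightarrow> (LINT x|M. D x))"
      if X: "\<And>n. X n \<in> cball z0 (\<rho>/2)" "\<And>n. X n \<noteq> z0" "X \<longlonglongrightarrow> z0" for X
    proof (rule integral_dominated_convergence)
      have XS: "X n \<in> S" for n
        using X(1)[of n] \<rho> by (auto intro!: subsetD[OF \<rho>(2)])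
      have Xlim: "(\<lambda>n. Q (X n) x) \<longlonglongrightarrow> D x" if "x \<in> space M" for x
        using Qlim[OF that] X by (auto simp: tendsto_at_iff_sequentially o_def)
      show mQ: "Q (X n) \<in> borel_measurable M" for n
        unfolding Q_def using meas[OF XS[of n]] meas[OF z0] by measurable
      show "D \<in> borel_measurable M"
        by (rule borel_measurable_LIMSEQ_metric[OF mQ Xlim])
      show "integrable M (\<lambda>x. w x / (\<rho>/2))" using w by simp
      show "AE x in M. (\<lambda>n. Q (X n) x) \<longlonglongrightarrow> D x" using Xlim by auto
      show "AE x in M. norm (Q (X n) x) \<le> w x / (\<rho>/2)" for n
        using Qbound X by (auto intro!: AE_I2)
    qed
    have "((\<lambda>z. LINT x|M. Q z x) \<longlongrightarrow> (LINT x|M. D x)) (at z0 within cball z0 (\<rho>/2))"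
      unfolding tendsto_at_iff_sequentially o_def using seq by auto
    then have "((\<lambda>z. LINT x|M. Q z x) \<longlongrightarrow> (LINT x|M. D x)) (at z0)"
      using \<rho> by (subst (asm) at_within_interior) (auto simp: interior_cball)
    moreover have "eventually (\<lambda>z. (LINT x|M. Q z x) = ((LINT x|M. f z x) - (LINT x|M. f z0 x)) / (z - z0)) (at z0)"
    proof -
      have "eventually (\<lambda>z. z \<in> ball z0 \<rho>) (at z0)" using \<rho> by (intro eventually_at_in_open') auto
      then show ?thesis
        by eventually_elim (use int \<rho> in \<open>auto simp: Q_def intro!: Bochner_Integration.integral_diff\<close>)
    qed
    ultimately have "((\<lambda>z. LINT x|M. f z x) has_field_derivative (LINT x|M. D x)) (at z0)"
      unfolding has_field_derivative_iff by (rule Lim_transform_eventually)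
    then show ?thesis by blast
  qed
  then show ?thesis
    using S by (auto simp: holomorphic_on_open)
qed

text \<open>Carries Laplace transforms that were computed for real \<open>s > 0\<close> over to
  complex arguments.\<close>

lemma holomorphic_eq_on_right_half_plane:
  assumes "f holomorphic_on {z. Re z > 0}" "g holomorphic_on {z. Re z > 0}"
    and "\<And>x. x > 0 \<Longrightarrow> f (of_real x) = g (of_real x)" and "Re z > 0"
  shows "f z = g z"
proof -
  have "f z - g z = 0"
  proof (rule analytic_continuation[where S = "{z. Re z > 0}" and U = "of_real ` {0<..}" and \<xi> = 1
        and f = "\<lambda>z. f z - g z" and w = z])
    show "(\<lambda>z. f z - g z) holomorphic_on {z. Re z > 0}" using assms by (intro holomorphic_intros)
    show "open {z. Re z > 0}" by (simp add: open_halfspace_Re_gt)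
    show "connected {z. Re z > 0}" by (intro convex_connected convex_halfspace_Re_gt)
    have "(1::real) islimpt {0<..}" by (simp add: islimpt_greaterThanLessThan1 open_imp_islimpt)
    then show "(1::complex) islimpt of_real ` {0<..}"
      unfolding islimpt_approachable
    proof (intro allI impI)
      fix e :: real assume "e > 0"
      then show "\<exists>x'\<in>complex_of_real ` {0<..}. x' \<noteq> 1 \<and> dist x' 1 < e"
        by (intro bexI[of _ "of_real (1 + e/2)"] imageI) (auto simp: dist_norm)
    qed
  qed (use assms in auto)
  then show ?thesis by simp
qed

lemma integrable_exp_neg_abs:
  fixes c :: real assumes "c > 0"
  shows "integrable lborel (\<lambda>x::real. exp (- c * \<bar>x\<bar>))"
proof -
  have 1: "set_integrable lborel {0..} (\<lambda>x. exp (- c * \<bar>x\<bar>))"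
  proof -
    have "(\<lambda>x. exp (- c * x)) absolutely_integrable_on {0..}"
      using has_integral_exp_minus_to_infinity[OF assms, of 0]
      by (intro nonnegative_absolutely_integrable_1) (auto simp: integrable_on_def)
    then have "set_integrable lebesgue {0..} (\<lambda>x. exp (- c * x))" .
    then have "set_integrable lborel {0..} (\<lambda>x. exp (- c * x))"
      unfolding set_integrable_def by (subst (asm) integrable_completion) auto
    then show ?thesis by (rule set_integrable_cong[THEN iffD1, rotated 3]) auto
  qed
  have 2: "set_integrable lborel {..0} (\<lambda>x. exp (- c * \<bar>x\<bar>))"
  proof -
    have "integrable lborel (\<lambda>x. indicator {0..} (0 + (-1) * x) *\<^sub>R exp (- c * \<bar>0 + (-1) * x\<bar>))"
      using 1 unfolding set_integrable_def by (intro lborel_integrable_real_affine) auto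
    then show ?thesis unfolding set_integrable_def
      by (rule Bochner_Integration.integrable_cong[THEN iffD1, rotated 2]) (auto simp: indicator_def)
  qed
  have "set_integrable lborel ({0..} \<union> {..0}) (\<lambda>x. exp (- c * \<bar>x\<bar>))"
    using 1 2 by (rule set_integrable_Un) auto
  moreover have "{0..} \<union> {..0} = (UNIV::real set)" by auto
  ultimately show ?thesis by (simp add: set_integrable_def)
qed

lemma integrable_exp_decay:
  fixes f :: "real \<Rightarrow> complex"
  assumes cont: "continuous_on UNIV f" and c: "c > 0"
    and bound: "\<And>x. \<bar>x\<bar> \<ge> S \<Longrightarrow> norm (f x) \<le> C * exp (- c * \<bar>x\<bar>)"
  shows "integrable lborel f"
proof -
  have "compact (f ` {-\<bar>S\<bar>..\<bar>S\<bar>})"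
    using cont by (intro compact_continuous_image) (auto intro: continuous_on_subset)
  then obtain B where B: "\<And>x. \<bar>x\<bar> \<le> \<bar>S\<bar> \<Longrightarrow> norm (f x) \<le> B"
    by (force dest!: compact_imp_bounded simp: bounded_iff)
  \<comment> \<open>The second summand covers the bounded part, where
    \<open>exp (c * \<bar>S\<bar> - c * \<bar>x\<bar>)\<close> is at least 1.\<close>
  define K where "K = \<bar>C\<bar> + \<bar>B\<bar> * exp (c * \<bar>S\<bar>)"
  have "norm (f x) \<le> K * exp (- c * \<bar>x\<bar>)" for x
  proof (cases "\<bar>x\<bar> \<le> \<bar>S\<bar>")
    case True
    have "norm (f x) \<le> \<bar>B\<bar> * 1" using B[OF True] by simp
    also have "\<dots> \<le> \<bar>B\<bar> * exp (c * \<bar>S\<bar> - c * \<bar>x\<bar>)" using True c by (intro mult_left_mono) auto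
    also have "\<dots> \<le> K * exp (- c * \<bar>x\<bar>)" by (simp add: K_def exp_diff exp_minus field_simps)
    finally show ?thesis .
  next
    case False
    then have "norm (f x) \<le> C * exp (- c * \<bar>x\<bar>)" using bound by auto
    also have "\<dots> \<le> K * exp (- c * \<bar>x\<bar>)" by (intro mult_right_mono) (auto simp: K_def intro: add_increasing2)
    finally show ?thesis .
  qed
  then show ?thesis
    using integrable_exp_neg_abs[OF c] cont
    by (intro Bochner_Integration.integrable_bound[of lborel "\<lambda>x. K * exp (- c * \<bar>x\<bar>)" f])
       (auto intro!: AE_I2 borel_measurable_continuous_onI intro: order_trans[OF _ abs_ge_self])
qed

section \<open>Shifts of horizontal lines\<close>

lemma contour_integral_linepath_horizontal:
  fixes \<theta> R :: real assumes "R > 0"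
  shows "contour_integral (linepath (of_real (-R) + \<i> * of_real \<theta>) (of_real R + \<i> * of_real \<theta>)) f
       = integral {-R..R} (\<lambda>x. f (of_real x + \<i> * of_real \<theta>))"
proof -
  have "linepath (of_real (-R) + \<i> * of_real \<theta>) (of_real R + \<i> * of_real \<theta>)
      = (+) (\<i> * of_real \<theta>) \<circ> linepath (of_real (-R)) (of_real R)"
    by (auto simp: linepath_def fun_eq_iff algebra_simps scaleR_conv_of_real)
  then show ?thesis
    using assms by (simp add: contour_integral_translate contour_integral_linepath_Reals_eq del: of_real_minus)
qed

lemma integral_symmetric_intervals_tendsto:
  fixes f :: "real \<Rightarrow> complex"
  assumes f: "integrable lborel f"
  shows "(\<lambda>n. integral {- real n..real n} f) \<longlonglongrightarrow> (LINT x|lborel. f x)"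
proof -
  have "(\<lambda>n. LINT x|lborel. indicator {- real n..real n} x *\<^sub>R f x) \<longlonglongrightarrow> (LINT x|lborel. f x)"
  proof (rule integral_dominated_convergence)
    show "integrable lborel (\<lambda>x. norm (f x))" using f by simp
    show "AE x in lborel. (\<lambda>n. indicat_real {- real n..real n} x *\<^sub>R f x) \<longlonglongrightarrow> f x"
    proof (intro AE_I2)
      fix x :: real
      obtain m :: nat where "\<bar>x\<bar> \<le> real m" using real_arch_simple by blast
      then have "eventually (\<lambda>n. indicat_real {- real n..real n} x *\<^sub>R f x = f x) sequentially"
        by (intro eventually_sequentiallyI[of m]) (auto simp: indicator_def)
      then show "(\<lambda>n. indicat_real {- real n..real n} x *\<^sub>R f x) \<longlonglongrightarrow> f x"
        by (rule tendsto_eventually)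
    qed
  qed (use f in \<open>auto simp: indicator_def\<close>)
  moreover have "(LINT x|lborel. indicator {- real n..real n} x *\<^sub>R f x) = integral {- real n..real n} f" for n
  proof -
    have "set_integrable lborel {- real n..real n} f"
      using f unfolding set_integrable_def by (intro integrable_mult_indicator) auto
    from set_borel_integral_eq_integral(2)[OF this] show ?thesis
      by (simp add: set_lebesgue_integral_def)
  qed
  ultimately show ?thesis by simp
qed

text \<open>The residue theorem on rectangles with vertical sides at plus and minus
  \<open>n\<close>, for \<open>n\<close> so large that \<open>p\<close> lies inside. The decay is
  uniform in the height, so the vertical sides tend to 0 and only the two lines survive; the upper
  one is traversed from right to left, hence the minus sign.\<close>

lemma horizontal_line_integrals_diff:
  fixes f :: "complex \<Rightarrow> complex" and a \<alpha> \<gamma> b :: real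
  assumes hol: "f holomorphic_on {z. a < Im z \<and> Im z < b} - {p}"
    and ineq: "a < \<alpha>" "\<alpha> < Im p" "Im p < \<gamma>" "\<gamma> < b" and c: "c > 0"
    and decay: "\<And>\<sigma> \<theta>. \<bar>\<sigma>\<bar> \<ge> S \<Longrightarrow> \<alpha> \<le> \<theta> \<Longrightarrow> \<theta> \<le> \<gamma> \<Longrightarrow>
                 norm (f (of_real \<sigma> + \<i> * of_real \<theta>)) \<le> C * exp (- c * \<bar>\<sigma>\<bar>)"
  shows "integrable lborel (\<lambda>\<sigma>. f (of_real \<sigma> + \<i> * of_real \<alpha>))"
    and "integrable lborel (\<lambda>\<sigma>. f (of_real \<sigma> + \<i> * of_real \<gamma>))"
    and "(LINT \<sigma>|lborel. f (of_real \<sigma> + \<i> * of_real \<alpha>)) - (LINT \<sigma>|lborel. f (of_real \<sigma> + \<i> * of_real \<gamma>))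
          = 2 * pi * \<i> * residue f p"
proof -
  let ?D = "{z. a < Im z \<and> Im z < b}"
  have opD: "open ?D"
    using open_Int[OF open_halfspace_Im_gt[of a] open_halfspace_Im_lt[of b]] by (simp add: Collect_conj_eq)
  have cvD: "convex ?D"
    using convex_Int[OF convex_halfspace_Im_gt[of a] convex_halfspace_Im_lt[of b]] by (simp add: Collect_conj_eq)
  have contf: "continuous_on (?D - {p}) f" using hol by (rule holomorphic_on_imp_continuous_on)
  have line: "integrable lborel (\<lambda>\<sigma>. f (of_real \<sigma> + \<i> * of_real \<theta>))"
    if "\<alpha> \<le> \<theta>" "\<theta> \<le> \<gamma>" "\<theta> \<noteq> Im p" for \<theta>
  proof (rule integrable_exp_decay[OF _ c decay])
    show "continuous_on UNIV (\<lambda>\<sigma>. f (of_real \<sigma> + \<i> * of_real \<theta>))"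
      by (rule continuous_on_compose2[OF contf]) (use that ineq in \<open>auto intro!: continuous_intros\<close>)
  qed (use that in auto)
  show i1: "integrable lborel (\<lambda>\<sigma>. f (of_real \<sigma> + \<i> * of_real \<alpha>))"
    and i2: "integrable lborel (\<lambda>\<sigma>. f (of_real \<sigma> + \<i> * of_real \<gamma>))"
    using line ineq by auto
  define I where "I = (\<lambda>\<theta> n. integral {- real n..real n} (\<lambda>\<sigma>. f (of_real \<sigma> + \<i> * of_real \<theta>)))"
  have bd: "norm (I \<alpha> n - I \<gamma> n - 2 * pi * \<i> * residue f p)
              \<le> 2 * ((C * exp (- c * real n)) * (\<gamma> - \<alpha>))"
    if n: "real n > \<bar>S\<bar>" "real n > \<bar>Re p\<bar>" for n
  proof -
    define R where "R = real n"
    define z1 z2 z3 z4 where z: "z1 = of_real (-R) + \<i> * of_real \<alpha>" "z2 = of_real R + \<i> * of_real \<alpha>"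
      "z3 = of_real R + \<i> * of_real \<gamma>" "z4 = of_real (-R) + \<i> * of_real \<gamma>"
    have R: "R > 0" "R > \<bar>S\<bar>" "R > \<bar>Re p\<bar>" using n by (auto simp: R_def)
    \<comment> \<open>No sign is assumed for \<open>C\<close>; it is read off from the decay bound
      at one point.\<close>
    have C0: "0 \<le> C * exp (- c * R)"
      using order_trans[OF norm_ge_zero decay[of R \<alpha>]] R ineq by simp
    have rect: "rectpath z1 z3 = linepath z1 z2 +++ linepath z2 z3 +++ linepath z3 z4 +++ linepath z4 z1"
      by (simp add: rectpath_def Let_def z Complex_eq)
    have segs: "closed_segment z1 z2 \<subseteq> ?D - {p}" "closed_segment z2 z3 \<subseteq> ?D - {p}"
      "closed_segment z3 z4 \<subseteq> ?D - {p}" "closed_segment z4 z1 \<subseteq> ?D - {p}"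
    proof -
      have D: "closed_segment u v \<subseteq> ?D" if "u \<in> ?D" "v \<in> ?D" for u v
        using closed_segment_subset[OF that cvD] .
      have P: "p \<notin> closed_segment u v" if "Im u = Im v" "Im p \<noteq> Im u" for u v
      proof
        assume "p \<in> closed_segment u v"
        then obtain k where "p = (1 - k) *\<^sub>R u + k *\<^sub>R v" by (auto simp: closed_segment_def)
        then have "Im p = (1 - k) * Im u + k * Im v" by simp
        then show False using that by (simp add: algebra_simps)
      qed
      have Q: "p \<notin> closed_segment u v" if "Re u = Re v" "Re p \<noteq> Re u" for u v
      proof
        assume "p \<in> closed_segment u v"
        then obtain k where "p = (1 - k) *\<^sub>R u + k *\<^sub>R v" by (auto simp: closed_segment_def)
        then have "Re p = (1 - k) * Re u + k * Re v" by simp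
        then show False using that by (simp add: algebra_simps)
      qed
      have zD: "z1 \<in> ?D" "z2 \<in> ?D" "z3 \<in> ?D" "z4 \<in> ?D" using ineq by (auto simp: z)
      have rp: "Im z1 = Im z2" "Im p \<noteq> Im z1" "Re z2 = Re z3" "Re p \<noteq> Re z2"
        "Im z3 = Im z4" "Im p \<noteq> Im z3" "Re z4 = Re z1" "Re p \<noteq> Re z4"
        using ineq R(3) by (auto simp: z)
      show "closed_segment z1 z2 \<subseteq> ?D - {p}" "closed_segment z2 z3 \<subseteq> ?D - {p}"
        "closed_segment z3 z4 \<subseteq> ?D - {p}" "closed_segment z4 z1 \<subseteq> ?D - {p}"
        using D[OF zD(1,2)] D[OF zD(2,3)] D[OF zD(3,4)] D[OF zD(4,1)]
          P[of z1 z2, OF rp(1,2)] Q[of z2 z3, OF rp(3,4)] P[of z3 z4, OF rp(5,6)] Q[of z4 z1, OF rp(7,8)] by auto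
    qed
    have ci: "f contour_integrable_on linepath u v" if "closed_segment u v \<subseteq> ?D - {p}" for u v
      using continuous_on_subset[OF contf that] by (rule contour_integrable_continuous_linepath)
    have pin: "p \<in> box z1 z3" using ineq R by (auto simp: in_box_complex_iff z)
    have "contour_integral (rectpath z1 z3) f
          = 2 * pi * \<i> * (\<Sum>q\<in>{p}. winding_number (rectpath z1 z3) q * residue f q)"
    proof (rule Residue_theorem[OF opD convex_connected[OF cvD]])
      show "path_image (rectpath z1 z3) \<subseteq> ?D - {p}"
        unfolding rect using segs by (simp add: path_image_join)
      show "\<forall>z. z \<notin> ?D \<longrightarrow> winding_number (rectpath z1 z3) z = 0"
      proof (intro allI impI winding_number_rectpath_outside)
        fix w assume "w \<notin> ?D"
        then show "w \<notin> cbox z1 z3" using ineq by (auto simp: in_cbox_complex_iff z)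
      qed (use ineq R in \<open>auto simp: z\<close>)
    qed (use hol in auto)
    then have "contour_integral (rectpath z1 z3) f = 2 * pi * \<i> * residue f p"
      using winding_number_rectpath[OF pin] by simp
    moreover have "contour_integral (rectpath z1 z3) f = contour_integral (linepath z1 z2) f
        + contour_integral (linepath z2 z3) f + contour_integral (linepath z3 z4) f + contour_integral (linepath z4 z1) f"
      unfolding rect using ci[OF segs(1)] ci[OF segs(2)] ci[OF segs(3)] ci[OF segs(4)] by (simp add: contour_integrable_joinI)
    moreover have "contour_integral (linepath z1 z2) f = I \<alpha> n"
      unfolding z I_def using contour_integral_linepath_horizontal[OF R(1)] by (simp add: R_def)
    moreover have "contour_integral (linepath z3 z4) f = - I \<gamma> n"
    proof -
      have "contour_integral (linepath z3 z4) f = - contour_integral (linepath z4 z3) f"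
        using contour_integral_reverse_linepath[of z4 z3 f] segs(3) continuous_on_subset[OF contf]
        by (simp add: closed_segment_commute)
      then show ?thesis
        unfolding z I_def using contour_integral_linepath_horizontal[OF R(1)] by (simp add: R_def)
    qed
    moreover have "norm (contour_integral (linepath z2 z3) f) \<le> (C * exp (- c * R)) * norm (z3 - z2)"
    proof (rule contour_integral_bound_linepath[OF ci[OF segs(2)] C0])
      fix x assume "x \<in> closed_segment z2 z3"
      then obtain u where u: "0 \<le> u" "u \<le> 1" "x = (1 - u) *\<^sub>R z2 + u *\<^sub>R z3" by (auto simp: closed_segment_def)
      have "x = of_real R + \<i> * of_real ((1 - u) * \<alpha> + u * \<gamma>)"
        by (simp add: u z scaleR_conv_of_real algebra_simps)
      moreover have "\<alpha> \<le> (1 - u) * \<alpha> + u * \<gamma>" "(1 - u) * \<alpha> + u * \<gamma> \<le> \<gamma>"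
        using convex_bound_le[of \<alpha> \<gamma> \<gamma> "1-u" u] convex_bound_le[of "-\<alpha>" "-\<alpha>" "-\<gamma>" "1-u" u] u ineq
        by (auto simp: algebra_simps mult_left_mono)
      ultimately show "norm (f x) \<le> C * exp (- c * R)"
        using decay[of R "(1 - u) * \<alpha> + u * \<gamma>"] R by simp
    qed
    moreover have "norm (contour_integral (linepath z4 z1) f) \<le> (C * exp (- c * R)) * norm (z1 - z4)"
    proof (rule contour_integral_bound_linepath[OF ci[OF segs(4)] C0])
      fix x assume "x \<in> closed_segment z4 z1"
      then obtain u where u: "0 \<le> u" "u \<le> 1" "x = (1 - u) *\<^sub>R z4 + u *\<^sub>R z1" by (auto simp: closed_segment_def)
      have "x = of_real (-R) + \<i> * of_real (u * \<alpha> + (1 - u) * \<gamma>)"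
        by (simp add: u z scaleR_conv_of_real algebra_simps)
      moreover have "\<alpha> \<le> u * \<alpha> + (1 - u) * \<gamma>" "u * \<alpha> + (1 - u) * \<gamma> \<le> \<gamma>"
        using convex_bound_le[of \<alpha> \<gamma> \<gamma> u "1-u"] convex_bound_le[of "-\<alpha>" "-\<alpha>" "-\<gamma>" u "1-u"] u ineq
        by (auto simp: algebra_simps mult_left_mono)
      ultimately show "norm (f x) \<le> C * exp (- c * R)"
        using decay[of "-R" "u * \<alpha> + (1 - u) * \<gamma>"] R by simp
    qed
    moreover have "norm (z3 - z2) = \<gamma> - \<alpha>" "norm (z1 - z4) = \<gamma> - \<alpha>"
    proof -
      have "z3 - z2 = \<i> * of_real (\<gamma> - \<alpha>)" "z1 - z4 = \<i> * of_real (- (\<gamma> - \<alpha>))"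
        by (auto simp: z algebra_simps)
      then show "norm (z3 - z2) = \<gamma> - \<alpha>" "norm (z1 - z4) = \<gamma> - \<alpha>"
        using ineq by (simp_all only: norm_mult norm_of_real norm_ii) auto
    qed
    ultimately have e: "2 * pi * \<i> * residue f p = I \<alpha> n + contour_integral (linepath z2 z3) f
        + - I \<gamma> n + contour_integral (linepath z4 z1) f"
      and b: "norm (contour_integral (linepath z2 z3) f) \<le> C * exp (- c * R) * (\<gamma> - \<alpha>)"
        "norm (contour_integral (linepath z4 z1) f) \<le> C * exp (- c * R) * (\<gamma> - \<alpha>)"
      by auto
    have *: "I \<alpha> n - I \<gamma> n - 2 * pi * \<i> * residue f p
        = - (contour_integral (linepath z2 z3) f + contour_integral (linepath z4 z1) f)"
      unfolding e by simp
    from b have "norm (contour_integral (linepath z2 z3) f + contour_integral (linepath z4 z1) f)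
         \<le> 2 * (C * exp (- c * R) * (\<gamma> - \<alpha>))"
      by (intro norm_triangle_le) linarith
    then show ?thesis unfolding * norm_minus_cancel by (simp only: R_def)
  qed
  have "(\<lambda>n. I \<alpha> n - I \<gamma> n - 2 * pi * \<i> * residue f p) \<longlonglongrightarrow> 0"
  proof (rule Lim_null_comparison)
    have "eventually (\<lambda>n. real n > max \<bar>S\<bar> \<bar>Re p\<bar>) sequentially"
      by real_asymp
    then show "eventually (\<lambda>n. norm (I \<alpha> n - I \<gamma> n - 2 * pi * \<i> * residue f p)
              \<le> 2 * ((C * exp (- c * real n)) * (\<gamma> - \<alpha>))) sequentially"
      by eventually_elim (use bd in auto)
    show "(\<lambda>n. 2 * ((C * exp (- c * real n)) * (\<gamma> - \<alpha>))) \<longlonglongrightarrow> 0"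
      using c by real_asymp
  qed
  moreover have "(\<lambda>n. I \<alpha> n - I \<gamma> n - 2 * pi * \<i> * residue f p) \<longlonglongrightarrow>
      (LINT \<sigma>|lborel. f (of_real \<sigma> + \<i> * of_real \<alpha>)) - (LINT \<sigma>|lborel. f (of_real \<sigma> + \<i> * of_real \<gamma>))
       - 2 * pi * \<i> * residue f p"
    unfolding I_def using i1 i2 by (intro tendsto_intros integral_symmetric_intervals_tendsto)
  ultimately have "0 = (LINT \<sigma>|lborel. f (of_real \<sigma> + \<i> * of_real \<alpha>)) - (LINT \<sigma>|lborel. f (of_real \<sigma> + \<i> * of_real \<gamma>))
       - 2 * pi * \<i> * residue f p"
    using LIMSEQ_unique by blast
  then show "(LINT \<sigma>|lborel. f (of_real \<sigma> + \<i> * of_real \<alpha>)) - (LINT \<sigma>|lborel. f (of_real \<sigma> + \<i> * of_real \<gamma>))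
          = 2 * pi * \<i> * residue f p" by simp
qed

text \<open>Obtained from the residue version by puncturing the strip midway between the lines,
  where the residue of a holomorphic function is 0.\<close>

lemma horizontal_line_integrals_eq:
  fixes f :: "complex \<Rightarrow> complex" and a \<alpha> \<gamma> b :: real
  assumes hol: "f holomorphic_on {z. a < Im z \<and> Im z < b}"
    and ineq: "a < \<alpha>" "\<alpha> < \<gamma>" "\<gamma> < b" and c: "c > 0"
    and decay: "\<And>\<sigma> \<theta>. \<bar>\<sigma>\<bar> \<ge> S \<Longrightarrow> \<alpha> \<le> \<theta> \<Longrightarrow> \<theta> \<le> \<gamma> \<Longrightarrow>
                 norm (f (of_real \<sigma> + \<i> * of_real \<theta>)) \<le> C * exp (- c * \<bar>\<sigma>\<bar>)"
  shows "integrable lborel (\<lambda>\<sigma>. f (of_real \<sigma> + \<i> * of_real \<alpha>))"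
    and "integrable lborel (\<lambda>\<sigma>. f (of_real \<sigma> + \<i> * of_real \<gamma>))"
    and "(LINT \<sigma>|lborel. f (of_real \<sigma> + \<i> * of_real \<alpha>)) = (LINT \<sigma>|lborel. f (of_real \<sigma> + \<i> * of_real \<gamma>))"
proof -
  define p where "p = \<i> * of_real ((\<alpha> + \<gamma>) / 2)"
  have p: "\<alpha> < Im p" "Im p < \<gamma>" using ineq by (auto simp: p_def)
  have opD: "open {z. a < Im z \<and> Im z < b}"
    using open_Int[OF open_halfspace_Im_gt[of a] open_halfspace_Im_lt[of b]] by (simp add: Collect_conj_eq)
  have res: "residue f p = 0"
    by (rule residue_holo[OF opD _ hol]) (use p ineq in auto)
  have hol': "f holomorphic_on {z. a < Im z \<and> Im z < b} - {p}" using hol by (rule holomorphic_on_subset) auto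
  note * = horizontal_line_integrals_diff[OF hol' ineq(1) p ineq(3) c decay]
  show "integrable lborel (\<lambda>\<sigma>. f (of_real \<sigma> + \<i> * of_real \<alpha>))"
    and "integrable lborel (\<lambda>\<sigma>. f (of_real \<sigma> + \<i> * of_real \<gamma>))"
    and "(LINT \<sigma>|lborel. f (of_real \<sigma> + \<i> * of_real \<alpha>)) = (LINT \<sigma>|lborel. f (of_real \<sigma> + \<i> * of_real \<gamma>))"
    using * res by auto
qed

section \<open>The Hankel function of imaginary order\<close>

lemma laplace_exp_complex:
  fixes s :: complex assumes s: "Re s > 0"
  shows "set_integrable lborel {0..} (\<lambda>x. exp (- s * of_real x))"
    and "(LINT x:{0..}|lborel. exp (- s * of_real x)) = 1 / s"
proof -
  have 0: "set_integrable lborel {0..} (\<lambda>x. exp (- Re s * \<bar>x\<bar>))"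
    using integrable_exp_neg_abs[OF s] unfolding set_integrable_def
    by (intro integrable_mult_indicator) auto
  show 1: "set_integrable lborel {0..} (\<lambda>x. exp (- s * of_real x))"
    unfolding set_integrable_def
    by (rule Bochner_Integration.integrable_bound[OF 0[unfolded set_integrable_def]])
       (auto intro!: AE_I2 simp: indicator_def)
  have 2: "set_integrable lborel {0<..} (\<lambda>x. exp (- s * of_real x))"
    by (rule set_integrable_subset[OF 1]) auto
  have "(LBINT x=0..\<infinity>. exp (- s * of_real x)) = 0 - (- 1 / s)"
  proof (rule interval_integral_FTC_integrable)
    fix x :: real
    have "((\<lambda>z. - exp (- s * z) / s) has_field_derivative exp (- s * of_real x)) (at (of_real x))"
      using s by (auto intro!: derivative_eq_intros)
    then show "((\<lambda>x. - exp (- s * of_real x) / s) has_vector_derivative exp (- s * of_real x)) (at x)"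
      using has_vector_derivative_real_field by blast
    show "isCont (\<lambda>x. exp (- s * of_real x)) x" by (intro continuous_intros)
  next
    show "set_integrable lborel (einterval 0 \<infinity>) (\<lambda>x. exp (- s * complex_of_real x))"
      using 2 by (simp add: zero_ereal_def)
    show "(((\<lambda>x. - exp (- s * complex_of_real x) / s) \<circ> real_of_ereal) \<longlongrightarrow> - 1 / s) (at_right 0)"
    proof -
      have "((\<lambda>x. - exp (- s * complex_of_real x) / s) \<longlongrightarrow> - exp (- s * complex_of_real 0) / s) (at_right 0)"
        using s by (intro tendsto_intros) auto
      then show ?thesis unfolding zero_ereal_def ereal_tendsto_simps1 by simp
    qed
    show "(((\<lambda>x. - exp (- s * complex_of_real x) / s) \<circ> real_of_ereal) \<longlongrightarrow> 0) (at_left \<infinity>)"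
    proof -
      have "((\<lambda>x. exp (- r * x)) \<longlongrightarrow> 0) at_top" if "r > 0" for r :: real
        using that by real_asymp
      from tendsto_divide_zero[OF this[OF s], of "norm s"]
      have "((\<lambda>x. exp (- Re s * x) / norm s) \<longlongrightarrow> 0) at_top" .
      then have "((\<lambda>x. - exp (- s * complex_of_real x) / s) \<longlongrightarrow> 0) at_top"
        by (rule Lim_null_comparison[rotated]) (auto simp: norm_divide)
      then show ?thesis unfolding ereal_tendsto_simps1 by simp
    qed
  qed simp
  then show "(LINT x:{0..}|lborel. exp (- s * of_real x)) = 1 / s"
    by (subst set_integral_discrete_difference[where X = "{0}" and B = "{0<..}"])
       (auto simp: interval_integral_to_infinity_eq zero_ereal_def)
qed

lemma integral_Ici_vector_derivative:
  fixes F f :: "real \<Rightarrow> complex"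
  assumes F: "\<And>x. (F has_vector_derivative f x) (at x)" and cont: "continuous_on UNIV f"
    and int: "set_integrable lborel {0..} f" and lim: "(F \<longlongrightarrow> L) at_top"
  shows "(LINT x:{0..}|lborel. f x) = L - F 0"
proof -
  have cont': "isCont f x" for x using cont by (auto simp: continuous_on_eq_continuous_at)
  have int': "set_integrable lborel {0<..} f"
    by (rule set_integrable_subset[OF int]) auto
  have "(LBINT x=0..\<infinity>. f x) = L - F 0"
  proof (rule interval_integral_FTC_integrable)
    show "set_integrable lborel (einterval 0 \<infinity>) f"
      using int' by (simp add: zero_ereal_def)
    have "isCont F 0" using F by (rule has_vector_derivative_continuous)
    then have "(F \<longlongrightarrow> F 0) (at_right 0)"
      by (simp add: continuous_at filterlim_at_split)
    then show "((F \<circ> real_of_ereal) \<longlongrightarrow> F 0) (at_right 0)"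
      unfolding zero_ereal_def ereal_tendsto_simps1 .
    show "((F \<circ> real_of_ereal) \<longlongrightarrow> L) (at_left \<infinity>)"
      unfolding ereal_tendsto_simps1 by (rule lim)
  qed (use F cont' in auto)
  then show ?thesis
    by (subst set_integral_discrete_difference[where X = "{0}" and B = "{0<..}"])
       (auto simp: interval_integral_to_infinity_eq zero_ereal_def)
qed

text \<open>The kernel is the incomplete Gamma function \<open>\<Gamma>(c, y)\<close> after the substitution \<open>v = y e\<^sup>x\<close>.\<close>

definition gamma_kernel :: "real \<Rightarrow> complex \<Rightarrow> real \<Rightarrow> complex" where
  "gamma_kernel y c x = exp (of_real (- y * exp x) + c * of_real x)"

definition upper_gamma :: "real \<Rightarrow> complex \<Rightarrow> complex" where
  "upper_gamma y c = (LINT x:{0..}|lborel. gamma_kernel y c x)"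

text \<open>This is \<open>y^(-c)\<close> times the lower incomplete Gamma function, written as its
  expansion into simple poles, so that it makes sense for \<open>Re c \<le> 0\<close> as
  well.\<close>

definition lower_gamma :: "real \<Rightarrow> complex \<Rightarrow> complex" where
  "lower_gamma y c = (\<Sum>j. of_real ((- y) ^ j / fact j) / (c + of_nat j))"

lemma norm_gamma_kernel: "norm (gamma_kernel y c x) = exp (- y * exp x + Re c * x)"
  by (simp add: gamma_kernel_def)

lemma continuous_on_gamma_kernel [continuous_intros]: "continuous_on A (gamma_kernel y c)"
  unfolding gamma_kernel_def by (intro continuous_intros)

lemma borel_measurable_gamma_kernel [measurable]: "gamma_kernel y c \<in> borel_measurable borel"
  by (intro borel_measurable_continuous_onI continuous_intros)

text \<open>Since \<open>exp x\<close> dominates \<open>x\<^sup>2 / 2\<close>, the exponent plus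
  \<open>x\<close> is at most \<open>(Re c + 1) * x - y * x\<^sup>2 / 2\<close>, and completing the
  square shows that this quadratic has the maximum
  \<open>(Re c + 1)\<^sup>2 / (2 * y)\<close>.\<close>

lemma gamma_kernel_decay:
  assumes "y > 0" "x \<ge> 0"
  shows "norm (gamma_kernel y c x) \<le> exp ((Re c + 1)\<^sup>2 / (2 * y)) * exp (- x)"
proof -
  have "exp x \<ge> x\<^sup>2 / 2" using exp_lower_Taylor_quadratic[OF assms(2)] assms by simp
  then have "y * exp x \<ge> y * (x\<^sup>2 / 2)" using assms by (intro mult_left_mono) auto
  moreover have "(Re c + 1) * x - y * (x\<^sup>2 / 2) \<le> (Re c + 1)\<^sup>2 / (2 * y)"
  proof -
    have "0 \<le> (y * x - (Re c + 1))\<^sup>2 / (2 * y)" using assms by simp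
    also have "\<dots> = (Re c + 1)\<^sup>2 / (2 * y) - ((Re c + 1) * x - y * (x\<^sup>2 / 2))"
      using assms by (simp add: field_simps power2_eq_square)
    finally show ?thesis by simp
  qed
  ultimately have "- y * exp x + Re c * x \<le> (Re c + 1)\<^sup>2 / (2 * y) - x" by (simp add: algebra_simps)
  then show ?thesis by (simp add: norm_gamma_kernel flip: exp_add)
qed

lemma set_integrable_exp_neg: "set_integrable lborel {0..} (\<lambda>x::real. exp (- x))"
proof -
  have "set_integrable lborel {0..} (\<lambda>x::real. exp (- 1 * \<bar>x\<bar>))"
    using integrable_exp_neg_abs[of 1] unfolding set_integrable_def
    by (intro integrable_mult_indicator) auto
  then show ?thesis unfolding set_integrable_def
    by (rule Bochner_Integration.integrable_cong[THEN iffD1, rotated 2]) (auto simp: indicator_def)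
qed

lemma set_integrable_gamma_kernel:
  assumes "y > 0" shows "set_integrable lborel {0..} (gamma_kernel y c)"
  unfolding set_integrable_def
proof (rule Bochner_Integration.integrable_bound)
  show "integrable lborel (\<lambda>x. exp ((Re c + 1)\<^sup>2 / (2 * y)) * (indicator {0..} x *\<^sub>R exp (- x)))"
    using set_integrable_exp_neg unfolding set_integrable_def by (rule integrable_mult_right)
  show "AE x in lborel. norm (indicat_real {0..} x *\<^sub>R gamma_kernel y c x)
         \<le> norm (exp ((Re c + 1)\<^sup>2 / (2 * y)) * (indicat_real {0..} x *\<^sub>R exp (- x)))"
    using gamma_kernel_decay[OF assms, of _ c] by (auto intro!: AE_I2 simp: indicator_def)
qed simp

text \<open>Integration of the derivative of the kernel: the factor \<open>exp x\<close> coming from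
  the inner function raises \<open>c\<close> by 1, and the boundary value at 0 is
  \<open>exp (- y)\<close>.\<close>

lemma upper_gamma_recurrence:
  assumes y: "y > 0"
  shows "c * upper_gamma y c = of_real y * upper_gamma y (c + 1) - of_real (exp (- y))"
proof -
  have eq: "(c - of_real (y * exp x)) * gamma_kernel y c x
        = c * gamma_kernel y c x - of_real y * gamma_kernel y (c + 1) x" for x
  proof -
    have "gamma_kernel y (c + 1) x = of_real (exp x) * gamma_kernel y c x"
      by (simp add: gamma_kernel_def algebra_simps flip: exp_add exp_of_real)
    then show ?thesis by (simp add: algebra_simps)
  qed
  have "(LINT x:{0..}|lborel. (c - of_real (y * exp x)) * gamma_kernel y c x) = 0 - gamma_kernel y c 0"
  proof (rule integral_Ici_vector_derivative)
    fix x :: real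
    have "((\<lambda>z. exp (- of_real y * exp z + c * z)) has_field_derivative
            (c - of_real (y * exp x)) * gamma_kernel y c x) (at (of_real x))"
      unfolding gamma_kernel_def by (auto intro!: derivative_eq_intros simp: algebra_simps simp flip: exp_of_real)
    then have "((\<lambda>x. exp (- of_real y * exp (of_real x) + c * of_real x)) has_vector_derivative
            (c - of_real (y * exp x)) * gamma_kernel y c x) (at x)"
      by (rule has_vector_derivative_real_field)
    then show "(gamma_kernel y c has_vector_derivative (c - of_real (y * exp x)) * gamma_kernel y c x) (at x)"
      by (simp add: gamma_kernel_def[abs_def] flip: exp_of_real)
    show "continuous_on UNIV (\<lambda>x. (c - of_real (y * exp x)) * gamma_kernel y c x)"
      by (intro continuous_intros)
    show "set_integrable lborel {0..} (\<lambda>x. (c - of_real (y * exp x)) * gamma_kernel y c x)"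
      unfolding eq by (intro set_integral_diff set_integrable_mult_right set_integrable_gamma_kernel y)
    have "((\<lambda>x. exp ((Re c + 1)\<^sup>2 / (2 * y)) * exp (- x)) \<longlongrightarrow> exp ((Re c + 1)\<^sup>2 / (2 * y)) * 0) at_top"
      by (intro tendsto_intros) real_asymp
    then have "((\<lambda>x. exp ((Re c + 1)\<^sup>2 / (2 * y)) * exp (- x)) \<longlongrightarrow> 0) at_top" by simp
    then show "(gamma_kernel y c \<longlongrightarrow> 0) at_top"
      by (rule Lim_null_comparison[rotated])
         (use gamma_kernel_decay[OF y, of _ c] in \<open>auto intro!: eventually_at_top_linorderI[of 0]\<close>)
  qed
  moreover have "(LINT x:{0..}|lborel. (c - of_real (y * exp x)) * gamma_kernel y c x)
      = c * upper_gamma y c - of_real y * upper_gamma y (c + 1)"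
    unfolding eq upper_gamma_def
    by (subst set_integral_diff) (auto intro!: set_integrable_mult_right set_integrable_gamma_kernel y)
  ultimately show ?thesis by (simp add: gamma_kernel_def algebra_simps flip: exp_of_real)
qed

lemma set_integrable_lborelI:
  assumes "set_integrable lebesgue S f" "f \<in> borel_measurable borel" "S \<in> sets borel"
  shows "set_integrable lborel S (f :: real \<Rightarrow> 'a :: {banach, second_countable_topology})"
  using assms unfolding set_integrable_def by (subst (asm) integrable_completion) auto

text \<open>For \<open>x \<ge> 0\<close> one has \<open>exp (- x) \<le> 1\<close>, so the series of
  \<open>exp (- y * exp (- x))\<close> is dominated termwise by that of \<open>exp y\<close> times
  \<open>norm (h x)\<close>, and sum and integral may be interchanged.\<close>

lemma exp_series_integral:
  fixes h :: "real \<Rightarrow> complex"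
  assumes h: "set_integrable lborel {0..} h" and y: "y \<ge> 0"
  shows "(\<lambda>j. of_real ((- y) ^ j / fact j) * (LINT x:{0..}|lborel. h x * exp (- of_nat j * of_real x)))
           sums (LINT x:{0..}|lborel. h x * of_real (exp (- y * exp (- x))))"
proof -
  define f where "f = (\<lambda>j x. (indicat_real {0..} x *\<^sub>R h x) * (of_real ((- y) ^ j / fact j) * exp (- of_nat j * of_real x)))"
  have hm: "(\<lambda>x. indicat_real {0..} x *\<^sub>R h x) \<in> borel_measurable borel"
    using h borel_measurable_integrable unfolding set_integrable_def by fastforce
  have nf: "norm (f j x) \<le> y ^ j / fact j * norm (indicat_real {0..} x *\<^sub>R h x)" for j x
  proof (cases "x \<ge> 0")
    case True
    then have "norm (f j x) = y ^ j / fact j * (norm (h x) * exp (- real j * x))"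
      using y by (simp add: f_def norm_mult norm_divide norm_power)
    also have "\<dots> \<le> y ^ j / fact j * (norm (h x) * 1)"
      using True y by (intro mult_left_mono) auto
    finally show ?thesis using True by simp
  qed (simp add: f_def)
  have fm: "f j \<in> borel_measurable lborel" for j
  proof -
    have "(\<lambda>x::real. of_real ((- y) ^ j / fact j) * exp (- of_nat j * of_real x) :: complex) \<in> borel_measurable borel"
      by (intro borel_measurable_continuous_onI continuous_intros)
    from borel_measurable_times[OF hm this] show ?thesis by (simp add: f_def)
  qed
  have hn: "integrable lborel (\<lambda>x. norm (indicat_real {0..} x *\<^sub>R h x))"
    using h unfolding set_integrable_def by (rule integrable_norm)
  have fi: "integrable lborel (f j)" for j
    by (rule Bochner_Integration.integrable_bound[OF integrable_mult_right[OF hn, of "y ^ j / fact j"] fm])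
       (use nf y in \<open>auto intro!: AE_I2\<close>)
  have sy: "summable (\<lambda>j. y ^ j / fact j * B)" for B
    using summable_exp[of y] by (intro summable_mult2) (simp add: field_simps)
  have "(\<lambda>j. integral\<^sup>L lborel (f j)) sums (LINT x|lborel. (\<Sum>j. f j x))"
  proof (rule sums_integral[OF fi])
    show "AE x in lborel. summable (\<lambda>j. norm (f j x))"
      by (intro AE_I2 summable_comparison_test'[OF sy]) (use nf in auto)
    show "summable (\<lambda>j. LINT x|lborel. norm (f j x))"
    proof (rule summable_comparison_test'[OF sy])
      fix j :: nat
      have "norm (LINT x|lborel. norm (f j x)) = (LINT x|lborel. norm (f j x))" by simp
      also have "\<dots> \<le> (LINT x|lborel. y ^ j / fact j * norm (indicat_real {0..} x *\<^sub>R h x))"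
        using nf by (rule integral_mono[OF integrable_norm[OF fi] integrable_mult_right[OF hn]])
      also have "\<dots> = y ^ j / fact j * (LINT x|lborel. norm (indicat_real {0..} x *\<^sub>R h x))" by simp
      finally show "norm (LINT x|lborel. norm (f j x)) \<le> y ^ j / fact j * (LINT x|lborel. norm (indicat_real {0..} x *\<^sub>R h x))" .
    qed
  qed
  moreover have "(\<Sum>j. f j x) = indicat_real {0..} x *\<^sub>R (h x * of_real (exp (- y * exp (- x))))" for x
  proof -
    have "(\<lambda>j. ((- of_real y * exp (- of_real x)) ^ j /\<^sub>R fact j)) sums exp (- of_real y * exp (- of_real x :: complex))"
      by (rule exp_converges)
    moreover have "(- of_real y * exp (- of_real x)) ^ j /\<^sub>R fact j
        = of_real ((- y) ^ j / fact j) * exp (- of_nat j * of_real x :: complex)" for j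
    proof -
      have "(- of_real y * exp (- of_real x)) ^ j = (- of_real y) ^ j * exp (- of_real x :: complex) ^ j"
        by (rule power_mult_distrib)
      then show ?thesis by (simp add: scaleR_conv_of_real field_simps flip: exp_of_nat_mult)
    qed
    ultimately have "(\<lambda>j. of_real ((- y) ^ j / fact j) * exp (- of_nat j * of_real x :: complex)) sums
        of_real (exp (- y * exp (- x)))"
      by (simp flip: exp_of_real)
    from sums_mult[OF this, of "indicat_real {0..} x *\<^sub>R h x"]
    show ?thesis by (simp add: f_def mult_ac sums_iff)
  qed
  moreover have "integral\<^sup>L lborel (f j) = of_real ((- y) ^ j / fact j) * (LINT x:{0..}|lborel. h x * exp (- of_nat j * of_real x))" for j
    unfolding set_lebesgue_integral_def f_def by (subst integral_mult_right_zero[symmetric]) (simp add: mult_ac scaleR_conv_of_real)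
  ultimately show ?thesis by (simp add: set_lebesgue_integral_def)
qed

text \<open>Euler's integral under \<open>v = y * exp x\<close>. The condition on
  \<open>Re c\<close> secures integrability at minus infinity, where
  \<open>exp (- y * exp x)\<close> tends to 1.\<close>

lemma integral_gamma_kernel:
  assumes y: "y > 0" and c: "Re c > 0"
  shows "integrable lborel (gamma_kernel y c)"
    and "(LINT x|lborel. gamma_kernel y c x) = exp (- c * of_real (ln y)) * Gamma c"
proof -
  let ?f = "\<lambda>t. complex_of_real t powr (c - 1) / of_real (exp t)"
  have "set_integrable lborel {0..} (\<lambda>x. exp (- c * of_real x))" by (rule laplace_exp_complex[OF c])
  then have "integrable lborel (\<lambda>x. indicat_real {0..} (0 + (-1) * x) *\<^sub>R exp (- c * of_real (0 + (-1) * x)))"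
    unfolding set_integrable_def by (rule lborel_integrable_real_affine) auto
  then have "set_integrable lborel {..0} (\<lambda>x. exp (c * of_real x))"
    unfolding set_integrable_def by (rule Bochner_Integration.integrable_cong[THEN iffD1, rotated 2]) (auto simp: indicator_def)
  then have neg: "set_integrable lborel {..0} (gamma_kernel y c)"
    unfolding set_integrable_def
    by (rule Bochner_Integration.integrable_bound) (use y in \<open>auto intro!: AE_I2 simp: indicator_def norm_gamma_kernel\<close>)
  have "set_integrable lborel ({..0} \<union> {0..}) (gamma_kernel y c)"
    using neg set_integrable_gamma_kernel[OF y] by (rule set_integrable_Un) auto
  moreover have "{..0} \<union> {0..} = (UNIV :: real set)" by auto
  ultimately show int: "integrable lborel (gamma_kernel y c)" by (simp add: set_integrable_def)
  have G: "set_integrable lborel {0<..} ?f"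
    using absolutely_integrable_Gamma_integral'[OF c] by (rule set_integrable_lborelI) auto
  have eq: "(y * exp x) *\<^sub>R ?f (y * exp x) = exp (c * of_real (ln y)) * gamma_kernel y c x" for x
  proof -
    have "complex_of_real (y * exp x) powr (c - 1) = exp ((c - 1) * of_real (ln y + x))"
      using y by (subst powr_def) (simp add: Ln_of_real ln_mult del: of_real_mult)
    moreover have "complex_of_real (y * exp x) = exp (of_real (ln y + x))"
    proof -
      have "y * exp x = exp (ln y + x)" using y by (simp add: exp_add)
      then show ?thesis by (simp only: exp_of_real)
    qed
    ultimately have "(y * exp x) *\<^sub>R ?f (y * exp x)
        = exp (of_real (ln y + x)) * exp ((c - 1) * of_real (ln y + x)) * exp (of_real (- (y * exp x)))"
      by (simp add: scaleR_conv_of_real exp_minus field_simps flip: exp_of_real)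
    also have "\<dots> = exp (c * of_real (ln y)) * gamma_kernel y c x"
      by (simp add: gamma_kernel_def algebra_simps flip: exp_add)
    finally show ?thesis .
  qed
  have "(LBINT x=0..\<infinity>. ?f x) = (LBINT x=-\<infinity>..\<infinity>. (y * exp x) *\<^sub>R ?f (y * exp x))"
  proof (rule interval_integral_substitution_integrable)
    show "set_integrable lborel (einterval (-\<infinity>) \<infinity>) (\<lambda>x. (y * exp x) *\<^sub>R ?f (y * exp x))"
      unfolding eq using int by (simp add: set_integrable_def)
    show "set_integrable lborel (einterval 0 \<infinity>) ?f" using G by (simp add: zero_ereal_def)
    show "((ereal \<circ> (\<lambda>x. y * exp x) \<circ> real_of_ereal) \<longlongrightarrow> 0) (at_right (-\<infinity>))"
      unfolding ereal_tendsto_simps1 zero_ereal_def ereal_tendsto_simps2 using y by real_asymp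
    show "((ereal \<circ> (\<lambda>x. y * exp x) \<circ> real_of_ereal) \<longlongrightarrow> \<infinity>) (at_left \<infinity>)"
      unfolding ereal_tendsto_simps1 ereal_tendsto_simps2 using y by real_asymp
    show "isCont ?f (y * exp x)" for x
    proof -
      have "isCont ?f v" if "v > 0" for v using that by (auto intro!: continuous_intros)
      then show ?thesis using y by simp
    qed
  qed (use y in \<open>auto intro!: derivative_eq_intros\<close>)
  moreover have "(LBINT x=0..\<infinity>. ?f x) = Gamma c"
  proof -
    have "(LBINT x=0..\<infinity>. ?f x) = (LINT x:{0<..}|lborel. ?f x)"
      by (simp add: interval_integral_to_infinity_eq zero_ereal_def)
    also have "\<dots> = integral {0<..} ?f" by (rule set_borel_integral_eq_integral(2)[OF G])
    also have "\<dots> = Gamma c" using Gamma_integral_complex'[OF c] by (rule integral_unique)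
    finally show ?thesis .
  qed
  moreover have "(LBINT x=-\<infinity>..\<infinity>. (y * exp x) *\<^sub>R ?f (y * exp x)) = exp (c * of_real (ln y)) * (LINT x|lborel. gamma_kernel y c x)"
    unfolding eq by (simp add: interval_lebesgue_integral_def set_lebesgue_integral_def)
  ultimately show "(LINT x|lborel. gamma_kernel y c x) = exp (- c * of_real (ln y)) * Gamma c"
    by (simp add: exp_minus field_simps)
qed

lemma norm_add_of_nat_ge: "norm (c + of_nat j) \<ge> \<bar>Im c\<bar>"
  using abs_Im_le_cmod[of "c + of_nat j"] by simp

lemma summable_norm_power_div_fact: "summable (\<lambda>j. norm (of_real ((- y) ^ j / fact j) :: complex))"
proof -
  have "(\<lambda>j. norm (of_real ((- y) ^ j / fact j) :: complex)) = (\<lambda>j. \<bar>y\<bar> ^ j / fact j)"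
    by (simp add: norm_divide norm_power fun_eq_iff power_abs)
  then show ?thesis using summable_exp[of "\<bar>y\<bar>"] by (simp add: field_simps)
qed

lemma norm_lower_gamma_term:
  assumes "Im c \<noteq> 0"
  shows "norm (of_real ((- y) ^ j / fact j) / (c + of_nat j)) \<le> norm (of_real ((- y) ^ j / fact j) :: complex) * (1 / \<bar>Im c\<bar>)"
proof -
  have "1 / norm (c + of_nat j) \<le> 1 / \<bar>Im c\<bar>"
    using norm_add_of_nat_ge[of c j] assms by (intro divide_left_mono) (auto intro!: mult_pos_pos simp: complex_eq_iff)
  from mult_left_mono[OF this, of "norm (of_real ((- y) ^ j / fact j) :: complex)"]
  show ?thesis by (simp only: norm_divide) simp
qed

lemma summable_lower_gamma:
  assumes "Im c \<noteq> 0"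
  shows "summable (\<lambda>j. norm (of_real ((- y) ^ j / fact j) / (c + of_nat j)))"
proof (rule summable_comparison_test'[OF summable_mult2[OF summable_norm_power_div_fact[of y], of "1 / \<bar>Im c\<bar>"], of 0])
  fix j
  show "norm (norm (of_real ((- y) ^ j / fact j) / (c + of_nat j)))
      \<le> norm (of_real ((- y) ^ j / fact j) :: complex) * (1 / \<bar>Im c\<bar>)"
    using norm_lower_gamma_term[OF assms, of y j] by (simp only: real_norm_def abs_norm_cancel)
qed

lemma lower_gamma_sums:
  assumes "Im c \<noteq> 0"
  shows "(\<lambda>j. of_real ((- y) ^ j / fact j) / (c + of_nat j)) sums lower_gamma y c"
  unfolding lower_gamma_def by (rule summable_sums[OF summable_norm_cancel[OF summable_lower_gamma[OF assms]]])

lemma lower_gamma_recurrence: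
  assumes c: "Im c \<noteq> 0"
  shows "c * lower_gamma y c = of_real y * lower_gamma y (c + 1) + of_real (exp (- y))"
proof -
  have cj: "c + of_nat j \<noteq> 0" for j using c by (auto simp: complex_eq_iff)
  have cj': "c + 1 + of_nat j \<noteq> 0" for j using c by (auto simp: complex_eq_iff)
  have "(\<lambda>j. of_nat j * (of_real ((- y) ^ j / fact j) / (c + of_nat j))) sums (- of_real y * lower_gamma y (c + 1))"
  \<comment> \<open>The factor \<open>j\<close> kills the term of index 0, so the series may be
    shifted by one.\<close>
  proof (rule sums_Suc_imp)
    have "(\<lambda>j. - of_real y * (of_real ((- y) ^ j / fact j) / (c + 1 + of_nat j))) sums (- of_real y * lower_gamma y (c + 1))"
      using lower_gamma_sums[of "c + 1" y] c by (intro sums_mult) auto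
    moreover have "- of_real y * (of_real ((- y) ^ j / fact j) / (c + 1 + of_nat j))
       = of_nat (Suc j) * (of_real ((- y) ^ Suc j / fact (Suc j)) / (c + of_nat (Suc j)))" for j
      using cj'[of j] by (simp add: divide_simps add_ac del: of_nat_Suc fact_Suc) (simp add: fact_Suc add_ac)
    ultimately show "(\<lambda>j. of_nat (Suc j) * (of_real ((- y) ^ Suc j / fact (Suc j)) / (c + of_nat (Suc j))))
        sums (- of_real y * lower_gamma y (c + 1))" by simp
  qed simp
  from sums_add[OF sums_mult[OF lower_gamma_sums[OF c, of y], of c] this]
  have "(\<lambda>j. of_real ((- y) ^ j / fact j)) sums (c * lower_gamma y c - of_real y * lower_gamma y (c + 1))"
  proof -
    have "c * X + of_nat j * X = of_real ((- y) ^ j / fact j)" if "X = of_real ((- y) ^ j / fact j) / (c + of_nat j)" for j X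
    proof -
      have "c * X + of_nat j * X = (c + of_nat j) * X" by (simp add: algebra_simps)
      then show ?thesis using cj[of j] that by simp
    qed
    then show ?thesis
      using sums_add[OF sums_mult[OF lower_gamma_sums[OF c, of y], of c]
        \<open>(\<lambda>j. of_nat j * (of_real ((- y) ^ j / fact j) / (c + of_nat j))) sums (- of_real y * lower_gamma y (c + 1))\<close>]
      by simp
  qed
  moreover have "(\<lambda>j. complex_of_real ((- y) ^ j / fact j)) sums of_real (exp (- y))"
    using exp_converges[of "- y"] by (subst sums_of_real_iff) (simp add: field_simps)
  ultimately show ?thesis using sums_unique2 by (fastforce simp: algebra_simps)
qed

text \<open>Euler's integral is split at \<open>x = 0\<close>. After reflection, the negative half
  line gives \<open>exp (- c * x)\<close> integrated against an exponential series, and each term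
  contributes one of the fractions \<open>1 / (c + j)\<close>.\<close>

lemma upper_gamma_eq_of_Re_pos:
  assumes y: "y > 0" and c: "Re c > 0"
  shows "upper_gamma y c = exp (- c * of_real (ln y)) * Gamma c - lower_gamma y c"
proof -
  have int: "integrable lborel (gamma_kernel y c)" by (rule integral_gamma_kernel[OF y c])
  have si: "set_integrable lborel A (gamma_kernel y c)" if "A \<in> sets borel" for A
    using int that unfolding set_integrable_def by (intro integrable_mult_indicator) auto
  have "(LINT x|lborel. gamma_kernel y c x) = (LINT x:{..<0} \<union> {0..}|lborel. gamma_kernel y c x)"
  proof -
    have "{..<0} \<union> {0..} = (UNIV :: real set)" by auto
    then show ?thesis by (simp add: set_lebesgue_integral_def)
  qed
  also have "\<dots> = (LINT x:{..<0}|lborel. gamma_kernel y c x) + upper_gamma y c"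
    unfolding upper_gamma_def by (rule set_integral_Un) (auto intro!: si)
  also have "(LINT x:{..<0}|lborel. gamma_kernel y c x) = (LINT x:{..0}|lborel. gamma_kernel y c x)"
    by (rule set_integral_discrete_difference[where X = "{0}"]) auto
  also have "\<dots> = (LINT x:{0..}|lborel. exp (- c * of_real x) * of_real (exp (- y * exp (- x))))"
  proof -
    have "(LINT x:{..0}|lborel. gamma_kernel y c x)
        = (LINT x|lborel. indicat_real {..0} (0 + (-1) * x) *\<^sub>R gamma_kernel y c (0 + (-1) * x))"
      unfolding set_lebesgue_integral_def by (subst lborel_integral_real_affine[of "-1" _ 0]) auto
    also have "\<dots> = (LINT x:{0..}|lborel. exp (- c * of_real x) * of_real (exp (- y * exp (- x))))"
    proof -
      have "gamma_kernel y c (- x) = exp (- c * of_real x) * of_real (exp (- y * exp (- x)))" for x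
      proof -
        have e: "c * of_real (- x) = - c * of_real x" by simp
        show ?thesis
          by (simp only: gamma_kernel_def exp_add exp_of_real e mult.commute[of "of_real (exp (- y * exp (- x)))"])
      qed
      then show ?thesis
        unfolding set_lebesgue_integral_def
        by (intro Bochner_Integration.integral_cong) (auto simp: indicator_def)
    qed
    finally show ?thesis .
  qed
  also have "\<dots> = lower_gamma y c"
  proof -
    have "(LINT x:{0..}|lborel. exp (- c * of_real x) * exp (- of_nat j * of_real x)) = 1 / (c + of_nat j)" for j
      using laplace_exp_complex(2)[of "c + of_nat j"] c by (simp add: algebra_simps flip: exp_add)
    then show ?thesis
      using exp_series_integral[OF laplace_exp_complex(1)[OF c], of y] y
      by (simp add: lower_gamma_def sums_iff)
  qed
  finally show ?thesis using integral_gamma_kernel(2)[OF y c] by (simp add: algebra_simps)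
qed

text \<open>Both sides satisfy the same first-order recurrence in \<open>c\<close>, so the identity
  descends from \<open>Re c > 0\<close> one unit at a time. The condition
  \<open>Im c \<noteq> 0\<close> keeps away from the poles of Gamma and allows the division by
  \<open>c\<close>.\<close>

lemma upper_gamma_eq:
  assumes y: "y > 0" and c: "Im c \<noteq> 0"
  shows "upper_gamma y c = exp (- c * of_real (ln y)) * Gamma c - lower_gamma y c"
proof -
  have main: "\<forall>c. Im c \<noteq> 0 \<and> Re c + real n > 0 \<longrightarrow> upper_gamma y c = exp (- c * of_real (ln y)) * Gamma c - lower_gamma y c" for n
  proof (induction n)
    case 0
    then show ?case using upper_gamma_eq_of_Re_pos[OF y] by simp
  next
    case (Suc n)
    show ?case
    proof (intro allI impI)
      fix c :: complex assume *: "Im c \<noteq> 0 \<and> Re c + real (Suc n) > 0"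
      then have c0: "c \<noteq> 0" by auto
      have IH: "upper_gamma y (c + 1) = exp (- (c + 1) * of_real (ln y)) * Gamma (c + 1) - lower_gamma y (c + 1)"
        by (intro Suc.IH[rule_format]) (use * in auto)
      have "c \<notin> \<int>\<^sub>\<le>\<^sub>0" using * by (auto elim!: nonpos_Ints_cases)
      then have G: "Gamma (c + 1) = c * Gamma c" by (rule Gamma_plus1)
      have e: "of_real y * exp (- (c + 1) * of_real (ln y)) = exp (- c * of_real (ln y))"
      proof -
        have "complex_of_real y = exp (of_real (ln y))" using y by (simp only: exp_of_real exp_ln)
        then have "of_real y * exp (- (c + 1) * of_real (ln y)) = exp (of_real (ln y)) * exp (- (c + 1) * of_real (ln y))" by simp
        also have "\<dots> = exp (- c * of_real (ln y))" by (simp add: algebra_simps flip: exp_add)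
        finally show ?thesis .
      qed
      have "c * upper_gamma y c = of_real y * exp (- (c + 1) * of_real (ln y)) * Gamma (c + 1)
          - (of_real y * lower_gamma y (c + 1) + of_real (exp (- y)))"
        unfolding upper_gamma_recurrence[OF y] IH by (simp add: algebra_simps)
      also have "\<dots> = c * (exp (- c * of_real (ln y)) * Gamma c - lower_gamma y c)"
        unfolding e G using lower_gamma_recurrence[of c y] * by (simp add: algebra_simps)
      finally show "upper_gamma y c = exp (- c * of_real (ln y)) * Gamma c - lower_gamma y c"
        using c0 by simp
    qed
  qed
  obtain n where "- Re c < real n" using reals_Archimedean2 by blast
  then have n: "Re c + real n > 0" by linarith
  show ?thesis by (rule main[rule_format, OF conjI[OF c n]])
qed

section \<open>The integral of \<open>K\<close> as a series of Gamma values\<close>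

lemma integral_exp_cosh_half:
  fixes \<mu> :: complex
  assumes y: "y > 0"
  shows "set_integrable lborel {0..} (\<lambda>x. exp (- of_real (2 * y * cosh x) + \<mu> * of_real x))"
    and "(\<lambda>k. of_real ((- y) ^ k / fact k) * upper_gamma y (\<mu> - of_nat k))
           sums (LINT x:{0..}|lborel. exp (- of_real (2 * y * cosh x) + \<mu> * of_real x))"
proof -
  \<comment> \<open>By \<open>2 cosh x = exp x + exp (- x)\<close> the integrand splits. The first
    exponential belongs to the incomplete Gamma kernel; the second is bounded on the half line and
    is expanded in its power series, every factor \<open>exp (- x)\<close> lowering
    \<open>\<mu>\<close> by 1.\<close>
  have eq: "gamma_kernel y \<mu> x * of_real (exp (- y * exp (- x))) = exp (- of_real (2 * y * cosh x) + \<mu> * of_real x)" for x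
  proof -
    have "- of_real (2 * y * cosh x) = (of_real (- y * exp x) + of_real (- y * exp (- x)) :: complex)"
      unfolding of_real_add[symmetric] of_real_minus[symmetric] by (simp add: cosh_def algebra_simps)
    then show ?thesis by (simp only: gamma_kernel_def exp_add exp_of_real mult_ac)
  qed
  have eq': "gamma_kernel y \<mu> x * exp (- of_nat k * of_real x) = gamma_kernel y (\<mu> - of_nat k) x" for x k
    by (simp add: gamma_kernel_def algebra_simps flip: exp_add)
  show "set_integrable lborel {0..} (\<lambda>x. exp (- of_real (2 * y * cosh x) + \<mu> * of_real x))"
    unfolding set_integrable_def
  proof (rule Bochner_Integration.integrable_bound[OF set_integrable_gamma_kernel[OF y, of \<mu>, unfolded set_integrable_def]])
    show "(\<lambda>x. indicat_real {0..} x *\<^sub>R exp (- of_real (2 * y * cosh x) + \<mu> * of_real x)) \<in> borel_measurable lborel"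
    proof -
      have [measurable]: "(\<lambda>x. exp (- of_real (2 * y * cosh x) + \<mu> * of_real x)) \<in> borel_measurable borel"
        by (intro borel_measurable_continuous_onI continuous_intros)
      show ?thesis by measurable
    qed
    show "AE x in lborel. norm (indicat_real {0..} x *\<^sub>R exp (- of_real (2 * y * cosh x) + \<mu> * of_real x))
        \<le> norm (indicat_real {0..} x *\<^sub>R gamma_kernel y \<mu> x)"
      unfolding eq[symmetric] using y by (auto intro!: AE_I2 mult_left_le simp: indicator_def norm_mult)
  qed
  show "(\<lambda>k. of_real ((- y) ^ k / fact k) * upper_gamma y (\<mu> - of_nat k))
           sums (LINT x:{0..}|lborel. exp (- of_real (2 * y * cosh x) + \<mu> * of_real x))"
    using exp_series_integral[OF set_integrable_gamma_kernel[OF y, of \<mu>], of y] y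
    unfolding eq eq' upper_gamma_def by simp
qed

lemma suminf_suminf_swap:
  fixes f :: "nat \<Rightarrow> nat \<Rightarrow> complex"
  assumes bound: "\<And>k j. norm (f k j) \<le> u k * u j" and u: "summable u" "\<And>k. u k \<ge> 0"
  shows "(\<Sum>k. \<Sum>j. f k j) = (\<Sum>j. \<Sum>k. f k j)"
proof -
  have u': "u summable_on UNIV" using u by (intro norm_summable_imp_summable_on) simp
  have uu: "(\<lambda>(k, j). u k * u j) summable_on UNIV \<times> UNIV"
    by (rule summable_on_SigmaI[where g = "\<lambda>k. u k * infsum u UNIV"])
       (use u u' in \<open>auto intro!: has_sum_cmult_right has_sum_infsum summable_on_cmult_left\<close>)
  have s: "(\<lambda>(k, j). f k j) summable_on UNIV \<times> UNIV"
    by (rule abs_summable_summable, rule Infinite_Sum.abs_summable_on_comparison_test'[OF uu]) (use bound in auto)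
  have bound': "norm (f k j) \<le> u j * u k" for k j by (subst mult.commute) (rule bound)
  have s': "(\<lambda>(j, k). f k j) summable_on UNIV \<times> UNIV"
    by (rule abs_summable_summable, rule Infinite_Sum.abs_summable_on_comparison_test'[OF uu])
       (use bound' in auto)
  have inf: "(\<Sum>n. g n) = infsum g UNIV" if "g summable_on UNIV" for g :: "nat \<Rightarrow> complex"
    using has_sum_imp_sums[OF has_sum_infsum[OF that]] by (simp add: sums_iff)
  have row: "f k summable_on UNIV" for k
    using u u' bound by (intro norm_summable_imp_summable_on summable_comparison_test'[OF summable_mult[OF u(1), of "u k"]]) auto
  have col: "(\<lambda>k. f k j) summable_on UNIV" for j
    using u u' bound by (intro norm_summable_imp_summable_on summable_comparison_test'[OF summable_mult2[OF u(1), of "u j"]]) auto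
  show ?thesis
    unfolding inf[OF row] inf[OF col]
    using infsum_swap_banach[OF s] inf[OF summable_on_Sigma_banach[OF s]] inf[OF summable_on_Sigma_banach[OF s']] by simp
qed

lemma norm_lower_gamma_le:
  assumes "Im c \<noteq> 0"
  shows "norm (lower_gamma y c) \<le> (\<Sum>j. norm (of_real ((- y) ^ j / fact j) :: complex)) * (1 / \<bar>Im c\<bar>)"
proof -
  have "norm (lower_gamma y c) \<le> (\<Sum>j. norm (of_real ((- y) ^ j / fact j) :: complex) * (1 / \<bar>Im c\<bar>))"
    unfolding lower_gamma_def
    by (rule norm_suminf_le[OF norm_lower_gamma_term[OF assms] summable_mult2[OF summable_norm_power_div_fact]])
  also have "\<dots> = (\<Sum>j. norm (of_real ((- y) ^ j / fact j) :: complex)) * (1 / \<bar>Im c\<bar>)"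
    by (rule suminf_mult2[OF summable_norm_power_div_fact, symmetric])
  finally show ?thesis .
qed

lemma summable_lower_gamma_series:
  assumes "Im \<mu> \<noteq> 0"
  shows "summable (\<lambda>k. of_real ((- y) ^ k / fact k) * lower_gamma y (\<mu> - of_nat k))"
proof (rule summable_comparison_test'[OF summable_mult2[OF summable_norm_power_div_fact[of y]], of 0])
  fix k
  show "norm (of_real ((- y) ^ k / fact k) * lower_gamma y (\<mu> - of_nat k))
     \<le> norm (of_real ((- y) ^ k / fact k) :: complex) * ((\<Sum>j. norm (of_real ((- y) ^ j / fact j) :: complex)) * (1 / \<bar>Im \<mu>\<bar>))"
    unfolding norm_mult using norm_lower_gamma_le[of "\<mu> - of_nat k" y] assms by (intro mult_left_mono) auto
qed

text \<open>The double series has the terms \<open>a k * a j / (\<mu> - k + j)\<close> and converges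
  absolutely. Interchanging \<open>k\<close> and \<open>j\<close> in it amounts to replacing
  \<open>\<mu>\<close> by \<open>- \<mu>\<close> and changing the sign.\<close>

lemma lower_gamma_double_series:
  assumes "Im \<mu> \<noteq> 0"
  shows "(\<Sum>k. of_real ((- y) ^ k / fact k) * lower_gamma y (\<mu> - of_nat k))
       = - (\<Sum>k. of_real ((- y) ^ k / fact k) * lower_gamma y (- \<mu> - of_nat k))"
proof -
  define a where "a = (\<lambda>k. complex_of_real ((- y) ^ k / fact k))"
  define f where "f = (\<lambda>k j. a k * (a j / (\<mu> - of_nat k + of_nat j)))"
  have an: "summable (\<lambda>k. norm (a k))" unfolding a_def by (rule summable_norm_power_div_fact)
  have Im: "Im (\<mu> - of_nat k) \<noteq> 0" "Im (- \<mu> - of_nat k) \<noteq> 0" for k using assms by auto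
  \<comment> \<open>The constant \<open>1 / \<bar>Im \<mu>\<bar>\<close> is split evenly between the
    two indices, because the interchange of sums asks for a bound of the form
    \<open>u k * u j\<close>.\<close>
  define r where "r = sqrt (1 / \<bar>Im \<mu>\<bar>)"
  have r: "r * r = 1 / \<bar>Im \<mu>\<bar>" "r \<ge> 0" by (auto simp: r_def)
  have fb: "norm (f k j) \<le> (norm (a k) * r) * (norm (a j) * r)" for k j
  proof -
    have "norm (f k j) = norm (a k) * norm (a j / (\<mu> - of_nat k + of_nat j))" unfolding f_def by (rule norm_mult)
    also have "\<dots> \<le> norm (a k) * (norm (a j) * (1 / \<bar>Im (\<mu> - of_nat k)\<bar>))"
      unfolding a_def by (intro mult_left_mono norm_lower_gamma_term Im norm_ge_zero)
    also have "\<dots> = norm (a k) * (norm (a j) * (r * r))" by (simp add: r)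
    finally show ?thesis by (simp add: mult_ac)
  qed
  have row: "(\<lambda>j. f k j) sums (a k * lower_gamma y (\<mu> - of_nat k))" for k
    unfolding f_def a_def using lower_gamma_sums[OF Im(1), of y k] by (intro sums_mult) (simp add: add_ac)
  have col: "(\<lambda>k. f k j) sums (- (a j * lower_gamma y (- \<mu> - of_nat j)))" for j
  proof -
    have "(\<lambda>k. - (a j * (a k / (- \<mu> - of_nat j + of_nat k)))) sums (- (a j * lower_gamma y (- \<mu> - of_nat j)))"
      unfolding a_def using lower_gamma_sums[OF Im(2), of y j] by (intro sums_mult sums_minus) (simp add: add_ac)
    moreover have "- (a j * (a k / (- \<mu> - of_nat j + of_nat k))) = f k j" for k
    proof -
      have "- \<mu> - of_nat j + of_nat k = - (\<mu> - of_nat k + of_nat j)" by simp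
      then show ?thesis unfolding f_def by (simp only: divide_minus_right) simp
    qed
    ultimately show ?thesis by simp
  qed
  have sw: "(\<Sum>k. \<Sum>j. f k j) = (\<Sum>j. \<Sum>k. f k j)"
    by (rule suminf_suminf_swap[OF fb]) (use an r in \<open>auto intro: summable_mult2\<close>)
  have "(\<Sum>k. a k * lower_gamma y (\<mu> - of_nat k)) = (\<Sum>j. - (a j * lower_gamma y (- \<mu> - of_nat j)))"
    using sw row col by (simp add: sums_iff)
  moreover have "summable (\<lambda>j. a j * lower_gamma y (- \<mu> - of_nat j))"
    unfolding a_def using assms by (intro summable_lower_gamma_series) auto
  ultimately show ?thesis by (simp add: a_def suminf_minus)
qed

text \<open>Expanding \<open>exp (- y e\<^sup>-\<^sup>x)\<close> over each half line produces a single series of Gamma values and a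
  double series; the double series of the two half lines cancel.\<close>

lemma integral_exp_cosh:
  fixes \<mu> :: complex
  assumes y: "y > 0" and \<mu>: "Im \<mu> \<noteq> 0"
  defines "T \<equiv> (\<lambda>\<mu> k. of_real ((- y) ^ k / fact k) * (exp (- (\<mu> - of_nat k) * of_real (ln y)) * Gamma (\<mu> - of_nat k)))"
  shows "integrable lborel (\<lambda>x. exp (- of_real (2 * y * cosh x) + \<mu> * of_real x))"
    and "summable (T \<mu>)" and "summable (T (- \<mu>))"
    and "(LINT x|lborel. exp (- of_real (2 * y * cosh x) + \<mu> * of_real x)) = suminf (T \<mu>) + suminf (T (- \<mu>))"
proof -
  define h where "h = (\<lambda>\<mu> x. exp (- of_real (2 * y * cosh x) + \<mu> * of_real x) :: complex)"
  define d where "d = (\<lambda>\<mu> k. of_real ((- y) ^ k / fact k) * lower_gamma y (\<mu> - of_nat k))"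
  have half: "T \<mu> sums ((LINT x:{0..}|lborel. h \<mu> x) + suminf (d \<mu>))" if "Im \<mu> \<noteq> 0" for \<mu>
  proof -
    have T: "T \<mu> = (\<lambda>k. of_real ((- y) ^ k / fact k) * upper_gamma y (\<mu> - of_nat k) + d \<mu> k)"
      using that by (subst upper_gamma_eq[OF y]) (auto simp: T_def d_def algebra_simps)
    have "d \<mu> sums suminf (d \<mu>)"
      unfolding d_def using summable_lower_gamma_series[OF that] by (rule summable_sums)
    then show ?thesis
      unfolding T h_def by (rule sums_add[OF integral_exp_cosh_half(2)[OF y, of \<mu>]])
  qed
  have \<mu>': "Im (- \<mu>) \<noteq> 0" using \<mu> by simp
  show "summable (T \<mu>)" "summable (T (- \<mu>))" using half[OF \<mu>] half[OF \<mu>'] by (auto simp: sums_iff)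
  have hp: "set_integrable lborel {0..} (h \<mu>)" for \<mu> unfolding h_def by (rule integral_exp_cosh_half(1)[OF y])
  have "integrable lborel (\<lambda>x. indicat_real {0..} (0 + (-1) * x) *\<^sub>R h (- \<mu>) (0 + (-1) * x))"
    using hp[of "- \<mu>"] unfolding set_integrable_def by (rule lborel_integrable_real_affine) auto
  then have neg: "set_integrable lborel {..0} (h \<mu>)"
    unfolding set_integrable_def by (rule Bochner_Integration.integrable_cong[THEN iffD1, rotated 2]) (auto simp: indicator_def h_def)
  have neg': "set_integrable lborel {..<0} (h \<mu>)" by (rule set_integrable_subset[OF neg]) auto
  have UN: "{..<0} \<union> {0..} = (UNIV :: real set)" by auto
  have "set_integrable lborel ({..<0} \<union> {0..}) (h \<mu>)"
    using neg' hp by (rule set_integrable_Un) auto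
  then show "integrable lborel (\<lambda>x. exp (- of_real (2 * y * cosh x) + \<mu> * of_real x))"
    by (simp add: UN set_integrable_def h_def)
  have "(LINT x|lborel. h \<mu> x) = (LINT x:{..<0} \<union> {0..}|lborel. h \<mu> x)"
    by (simp add: UN set_lebesgue_integral_def)
  also have "\<dots> = (LINT x:{..<0}|lborel. h \<mu> x) + (LINT x:{0..}|lborel. h \<mu> x)"
    using neg' hp by (intro set_integral_Un) auto
  also have "(LINT x:{..<0}|lborel. h \<mu> x) = (LINT x:{..0}|lborel. h \<mu> x)"
    by (rule set_integral_discrete_difference[where X = "{0}"]) auto
  also have "\<dots> = (LINT x:{0..}|lborel. h (- \<mu>) x)"
  proof -
    have "(LINT x:{..0}|lborel. h \<mu> x)
        = (LINT x|lborel. indicat_real {..0} (0 + (-1) * x) *\<^sub>R h \<mu> (0 + (-1) * x))"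
      unfolding set_lebesgue_integral_def by (subst lborel_integral_real_affine[of "-1" _ 0]) auto
    also have "\<dots> = (LINT x:{0..}|lborel. h (- \<mu>) x)"
      unfolding set_lebesgue_integral_def
      by (intro Bochner_Integration.integral_cong) (auto simp: indicator_def h_def)
    finally show ?thesis .
  qed
  finally show "(LINT x|lborel. exp (- of_real (2 * y * cosh x) + \<mu> * of_real x)) = suminf (T \<mu>) + suminf (T (- \<mu>))"
    using half[OF \<mu>] half[OF \<mu>'] lower_gamma_double_series[OF \<mu>, of y] by (simp add: sums_iff h_def d_def)
qed

text \<open>The integral is twice \<open>K\<close> of order \<open>i t\<close> at
  \<open>2 y\<close>, so this is the classical relation between \<open>K\<close> and the Hankel
  function at \<open>2 i y\<close>, a point with logarithm \<open>ln (2 * y) + i pi / 2\<close>. It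
  is proved by matching the two series of Gamma values with the power series of the two functions
  \<open>J\<close>.\<close>

lemma hankel1_imaginary_order:
  fixes t y :: real
  assumes t: "t \<noteq> 0" and y: "y > 0"
  shows "\<i> * hankel1_nonint (\<i> * of_real t) (of_real (ln (2 * y)) + \<i> * of_real (pi / 2))
       = of_real (exp (pi * t / 2) / pi) * (LINT x|lborel. exp (- of_real (2 * y * cosh x) + \<i> * of_real (t * x)))"
proof -
  define \<mu> where "\<mu> = \<i> * of_real t"
  define L where "L = of_real (ln (2 * y)) + \<i> * of_real (pi / 2)"
  define T :: "complex \<Rightarrow> nat \<Rightarrow> complex" where "T = (\<lambda>\<mu> k. of_real ((- y) ^ k / fact k) * (exp (- (\<mu> - of_nat k) * of_real (ln y)) * Gamma (\<mu> - of_nat k)))"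
  have Im: "Im \<mu> \<noteq> 0" "Im (- \<mu>) \<noteq> 0" using t by (auto simp: \<mu>_def)
  have Lln: "L - of_real (ln 2) = of_real (ln y) + \<i> * of_real (pi / 2)"
    using y by (simp add: L_def ln_mult)
  have J: "besselJ_log (- \<mu>) L = exp (- \<mu> * \<i> * of_real (pi / 2)) * (sin (of_real pi * \<mu>) / of_real pi) * suminf (T \<mu>)"
    if Im: "Im \<mu> \<noteq> 0" for \<mu>
  proof -
    have s0: "sin (of_real pi * \<mu>) \<noteq> 0"
    proof
      assume "sin (of_real pi * \<mu>) = 0"
      then obtain n :: int where "of_real pi * \<mu> = of_real (real_of_int n * pi)" by (auto simp: sin_eq_0)
      then have "Im (of_real pi * \<mu>) = 0" by (metis Im_complex_of_real)
      then show False using Im by simp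
    qed
    \<comment> \<open>The reflection formula converts the reciprocal Gamma values of the power
      series into the Gamma values of the integral.\<close>
    have G: "rGamma (- \<mu> + of_nat k + 1) = (- 1) ^ k * Gamma (\<mu> - of_nat k) * (sin (of_real pi * \<mu>) / of_real pi)" for k
    proof -
      have "Gamma (\<mu> - of_nat k) * Gamma (1 - (\<mu> - of_nat k)) = of_real pi / sin (of_real pi * (\<mu> - of_nat k))"
        by (rule Gamma_reflection_complex)
      also have "sin (of_real pi * (\<mu> - of_nat k)) = (-1) ^ k * sin (of_real pi * \<mu>)"
      proof -
        have "sin (of_real pi * (\<mu> - of_nat k)) = sin (of_real pi * \<mu>) * cos (of_real (pi * real k)) - cos (of_real pi * \<mu>) * sin (of_real (pi * real k))"
        proof -
          have "of_real pi * (\<mu> - of_nat k) = of_real pi * \<mu> - of_real (pi * real k)"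
            by (simp add: algebra_simps)
          then show ?thesis by (simp only: sin_diff)
        qed
        also have "\<dots> = (-1) ^ k * sin (of_real pi * \<mu>)"
          unfolding sin_of_real cos_of_real using sin_npi2[of k] cos_npi2[of k] by simp
        finally show ?thesis .
      qed
      finally have R: "Gamma (\<mu> - of_nat k) * Gamma (1 - (\<mu> - of_nat k)) = of_real pi / ((-1) ^ k * sin (of_real pi * \<mu>))" .
      then have "Gamma (1 - (\<mu> - of_nat k)) \<noteq> 0" using s0 by auto
      moreover have "- \<mu> + of_nat k + 1 = 1 - (\<mu> - of_nat k)" by simp
      ultimately have "rGamma (- \<mu> + of_nat k + 1) = 1 / Gamma (1 - (\<mu> - of_nat k))"
        by (simp add: Gamma_def field_simps)
      also have "\<dots> = Gamma (\<mu> - of_nat k) * ((-1) ^ k * sin (of_real pi * \<mu>)) / of_real pi"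
      proof -
        have "1 / b = a * S / p" if "a * b = p / S" "b \<noteq> 0" "S \<noteq> 0" "p \<noteq> 0" for a b p S :: complex
          using that by (simp add: field_simps)
        from this[OF R \<open>Gamma (1 - (\<mu> - of_nat k)) \<noteq> 0\<close>] show ?thesis using s0 by simp
      qed
      finally show ?thesis by (simp add: mult_ac)
    qed
    have trm: "(-1) ^ k * exp ((- \<mu> + 2 * of_nat k) * (L - of_real (ln 2))) * rGamma (- \<mu> + of_nat k + 1) / fact k
        = (exp (- \<mu> * \<i> * of_real (pi / 2)) * (sin (of_real pi * \<mu>) / of_real pi)) * T \<mu> k" for k
    proof -
      have "exp ((- \<mu> + 2 * of_nat k) * (L - of_real (ln 2)))
          = exp (- (\<mu> - of_nat k) * of_real (ln y)) * exp (of_nat k * of_real (ln y))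
            * exp (- \<mu> * \<i> * of_real (pi / 2)) * exp (of_nat k * (\<i> * of_real pi))"
        unfolding Lln by (simp add: algebra_simps add_divide_distrib diff_divide_distrib flip: exp_add)
      also have "exp (of_nat k * (\<i> * of_real pi)) = (-1 :: complex) ^ k"
        by (simp add: exp_of_nat_mult)
      also have "exp (of_nat k * of_real (ln y)) = (of_real y ^ k :: complex)"
        using y by (simp add: exp_of_nat_mult exp_of_real)
      finally have E: "exp ((- \<mu> + 2 * of_nat k) * (L - of_real (ln 2)))
          = exp (- (\<mu> - of_nat k) * of_real (ln y)) * of_real y ^ k * exp (- \<mu> * \<i> * of_real (pi / 2)) * (-1) ^ k" .
      have Y: "of_real ((- y) ^ k / fact k) = (-1) ^ k * of_real y ^ k / (fact k :: complex)"
        by (simp add: power_minus[of y])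
      show ?thesis unfolding E G T_def Y by (cases "even k") (simp_all add: field_simps)
    qed
    have "summable (T \<mu>)" unfolding T_def by (rule integral_exp_cosh(2)[OF y Im])
    then show ?thesis unfolding besselJ_log_def trm by (rule suminf_mult)
  qed
  have s0: "sin (\<mu> * of_real pi) \<noteq> 0"
  proof
    assume "sin (\<mu> * of_real pi) = 0"
    then obtain n :: int where "\<mu> * of_real pi = of_real (real_of_int n * pi)" by (auto simp: sin_eq_0)
    then have "Im (\<mu> * of_real pi) = 0" by (metis Im_complex_of_real)
    then show False using Im by simp
  qed
  have "\<i> * hankel1_nonint \<mu> L = (besselJ_log (- \<mu>) L - exp (- \<mu> * of_real pi * \<i>) * besselJ_log (- (- \<mu>)) L) / sin (\<mu> * of_real pi)"
    by (simp add: hankel1_nonint_def)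
  also have "\<dots> = exp (- \<mu> * \<i> * of_real (pi / 2)) / of_real pi * (suminf (T \<mu>) + suminf (T (- \<mu>)))"
  proof -
    \<comment> \<open>This equalises the exponential prefactors of the two series, which then add up
      to the full integral.\<close>
    have "exp (- \<mu> * of_real pi * \<i>) * exp (- (- \<mu>) * \<i> * of_real (pi / 2)) = exp (- \<mu> * \<i> * of_real (pi / 2))"
      by (simp add: field_simps flip: exp_add)
    moreover have "besselJ_log (- \<mu>) L - exp (- \<mu> * of_real pi * \<i>) * besselJ_log (- (- \<mu>)) L
      = sin (\<mu> * of_real pi) / of_real pi * (exp (- \<mu> * \<i> * of_real (pi / 2)) * suminf (T \<mu>) +
          (exp (- \<mu> * of_real pi * \<i>) * exp (- (- \<mu>) * \<i> * of_real (pi / 2))) * suminf (T (- \<mu>)))"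
    proof -
      have S: "sin (of_real pi * \<mu>) = sin (\<mu> * of_real pi)" "sin (of_real pi * - \<mu>) = - sin (\<mu> * of_real pi)"
        by (simp_all add: mult.commute)
      have "A * (S / p) * T1 - e * (B * (- S / p) * T2) = S / p * (A * T1 + (e * B) * T2)" for A B S p T1 T2 e :: complex
        by (simp add: algebra_simps)
      then show ?thesis unfolding J[OF Im(1)] J[OF Im(2)] S .
    qed
    ultimately show ?thesis using s0 by (simp only: distrib_left[symmetric]) simp
  qed
  also have "exp (- \<mu> * \<i> * of_real (pi / 2)) = of_real (exp (pi * t / 2))"
    by (simp add: \<mu>_def exp_of_real[symmetric] algebra_simps)
  also have "suminf (T \<mu>) + suminf (T (- \<mu>)) = (LINT x|lborel. exp (- of_real (2 * y * cosh x) + \<mu> * of_real x))"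
    unfolding T_def by (rule integral_exp_cosh(4)[OF y Im(1), symmetric])
  finally show ?thesis by (simp add: \<mu>_def L_def mult_ac)
qed

section \<open>Debye polynomials as Taylor coefficients\<close>

definition fps_cosh1 :: "complex fps" where
  "fps_cosh1 = fps_const (1/2) * (fps_exp 1 + fps_exp (-1)) - 1"

definition fps_sinh1 :: "complex fps" where
  "fps_sinh1 = fps_const (1/2) * (fps_exp 1 - fps_exp (-1))"

definition fps_phase :: "complex \<Rightarrow> complex fps" where
  "fps_phase p = fps_const p * (fps_X - fps_sinh1) + fps_cosh1"

definition fps_phase_ratio :: "complex \<Rightarrow> complex fps" where
  "fps_phase_ratio p = fps_shift 2 (fps_const 2 * fps_phase p)"

definition fps_phase_ratio_deriv :: "complex fps" where
  "fps_phase_ratio_deriv = fps_shift 2 (fps_const 2 * (fps_X - fps_sinh1))"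

text \<open>The complex power of twice the phase over the square of the variable. The constant term
  of that ratio is 1 for every \<open>p\<close>, so the binomial series defines the power and no
  branch has to be chosen.\<close>

definition fps_phase_powr :: "complex \<Rightarrow> complex \<Rightarrow> complex fps" where
  "fps_phase_powr \<alpha> p = fps_compose (fps_binomial \<alpha>) (fps_phase_ratio p - 1)"

lemma fps_const_minus_one: "fps_const (-1 :: complex) = -1"
  by (metis fps_const_1_eq_1 fps_const_neg)

lemma fps_deriv_cosh1: "fps_deriv fps_cosh1 = fps_sinh1"
  by (simp add: fps_cosh1_def fps_sinh1_def fps_const_minus_one algebra_simps)

lemma fps_deriv_sinh1: "fps_deriv fps_sinh1 = fps_cosh1 + 1"
  by (simp add: fps_cosh1_def fps_sinh1_def fps_const_minus_one algebra_simps)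

lemma fps_sinh1_square: "fps_sinh1 ^ 2 = fps_cosh1 ^ 2 + 2 * fps_cosh1"
proof -
  define h where "h = fps_const (1/2 :: complex)"
  define a b where "a = fps_exp (1::complex)" and "b = fps_exp (-1::complex)"
  have ab: "a * b = 1" unfolding a_def b_def by (simp flip: fps_exp_add_mult)
  have h: "2 * h = 1" unfolding h_def by (simp add: numeral_fps_const)
  have "(h * (a - b)) ^ 2 = (h * (a + b) - 1) ^ 2 + 2 * (h * (a + b) - 1)"
    using ab h by algebra
  then show ?thesis by (simp add: fps_sinh1_def fps_cosh1_def h_def a_def b_def)
qed

lemma fps_phase_nth_low:
  "fps_phase p $ 0 = 0" "fps_phase p $ Suc 0 = 0" "fps_phase p $ 2 = 1/2"
  by (simp_all add: fps_phase_def fps_cosh1_def fps_sinh1_def numeral_2_eq_2)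

lemma fps_X_square_mult_shift:
  fixes f :: "complex fps"
  assumes "f $ 0 = 0" "f $ Suc 0 = 0"
  shows "fps_X ^ 2 * fps_shift 2 f = f"
proof (rule fps_ext)
  fix n
  consider "n = 0" | "n = Suc 0" | m where "n = Suc (Suc m)" by (metis not0_implies_Suc)
  then show "(fps_X ^ 2 * fps_shift 2 f) $ n = f $ n"
    by cases (use assms in \<open>auto simp: fps_X_power_mult_nth\<close>)
qed

lemma fps_X_square_phase_ratio: "fps_X ^ 2 * fps_phase_ratio p = 2 * fps_phase p"
  unfolding fps_phase_ratio_def
  by (subst fps_X_square_mult_shift) (simp_all add: fps_phase_nth_low numeral_fps_const)

lemma fps_X_square_phase_ratio_deriv: "fps_X ^ 2 * fps_phase_ratio_deriv = 2 * (fps_X - fps_sinh1)"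
  unfolding fps_phase_ratio_deriv_def
  by (subst fps_X_square_mult_shift) (simp_all add: fps_sinh1_def numeral_fps_const)

lemma fps_phase_ratio_nth_0 [simp]: "fps_phase_ratio p $ 0 = 1"
  using fps_phase_nth_low(3)[of p] by (simp add: fps_phase_ratio_def numeral_2_eq_2 mult.commute)

lemma fps_phase_powr_add: "fps_phase_powr (\<alpha> + \<beta>) p = fps_phase_powr \<alpha> p * fps_phase_powr \<beta> p"
  by (simp add: fps_phase_powr_def fps_binomial_add_mult fps_compose_mult_distrib)

lemma fps_phase_powr_1: "fps_phase_powr 1 p = fps_phase_ratio p"
  by (simp add: fps_phase_powr_def fps_binomial_1 fps_compose_add_distrib)

lemma fps_phase_powr_step: "fps_phase_powr \<alpha> p = fps_phase_powr (\<alpha> - 1) p * fps_phase_ratio p"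
  using fps_phase_powr_add[of "\<alpha> - 1" 1 p] by (simp add: fps_phase_powr_1)

lemma fps_deriv_binomial: "fps_deriv (fps_binomial \<alpha>) = fps_const \<alpha> * fps_binomial (\<alpha> - 1 :: complex)"
proof -
  have eq: "fps_binomial \<alpha> = fps_binomial (\<alpha> - 1) * (1 + fps_X)"
    using fps_binomial_add_mult[of "\<alpha> - 1" 1] by (simp add: fps_binomial_1)
  have "(1 + fps_X :: complex fps) $ 0 \<noteq> 0" by simp
  then have nz: "(1 + fps_X :: complex fps) \<noteq> 0" by (metis fps_zero_nth)
  have "fps_deriv (fps_binomial \<alpha>) = fps_const \<alpha> * fps_binomial (\<alpha> - 1) * (1 + fps_X) / (1 + fps_X)"
    unfolding fps_binomial_deriv by (simp only: eq mult.assoc)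
  also have "\<dots> = fps_const \<alpha> * fps_binomial (\<alpha> - 1)" using nz by (rule nonzero_mult_div_cancel_right)
  finally show ?thesis .
qed

lemma fps_deriv_phase_powr:
  "fps_deriv (fps_phase_powr \<alpha> p) = fps_const \<alpha> * fps_phase_powr (\<alpha> - 1) p * fps_deriv (fps_phase_ratio p)"
  by (simp add: fps_phase_powr_def fps_compose_deriv fps_deriv_binomial fps_compose_mult_distrib)

text \<open>Differentiation in the parameter on which the series depends, coefficient by
  coefficient, in contrast to \<open>fps_deriv\<close>, which acts on the formal variable.\<close>

definition has_coeff_deriv :: "(complex \<Rightarrow> complex fps) \<Rightarrow> complex fps \<Rightarrow> complex \<Rightarrow> bool" where
  "has_coeff_deriv F F' p \<longleftrightarrow> (\<forall>k. ((\<lambda>p. F p $ k) has_field_derivative F' $ k) (at p))"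

lemma has_coeff_deriv_const: "has_coeff_deriv (\<lambda>_. c) 0 p"
  by (simp add: has_coeff_deriv_def)

lemma has_coeff_deriv_mult:
  assumes "has_coeff_deriv F F' p" "has_coeff_deriv G G' p"
  shows "has_coeff_deriv (\<lambda>p. F p * G p) (F' * G p + F p * G') p"
  unfolding has_coeff_deriv_def
proof
  fix k
  have "((\<lambda>p. \<Sum>i=0..k. F p $ i * G p $ (k - i)) has_field_derivative
      (\<Sum>i=0..k. F' $ i * G p $ (k - i) + F p $ i * G' $ (k - i))) (at p)"
    by (rule DERIV_sum) (use assms in \<open>auto simp: has_coeff_deriv_def intro!: derivative_eq_intros\<close>)
  then show "((\<lambda>p. (F p * G p) $ k) has_field_derivative (F' * G p + F p * G') $ k) (at p)"
    by (simp add: fps_mult_nth sum.distrib)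
qed

lemma has_coeff_deriv_phase_ratio: "has_coeff_deriv (\<lambda>p. fps_phase_ratio p - 1) fps_phase_ratio_deriv p"
  unfolding has_coeff_deriv_def
  by (auto simp: fps_phase_ratio_def fps_phase_ratio_deriv_def fps_phase_def
           intro!: derivative_eq_intros)

lemma has_coeff_deriv_phase_ratio_power:
  "has_coeff_deriv (\<lambda>p. (fps_phase_ratio p - 1) ^ i)
     (of_nat i * (fps_phase_ratio p - 1) ^ (i - 1) * fps_phase_ratio_deriv) p"
proof (induction i)
  case 0
  then show ?case using has_coeff_deriv_const[of 1] by simp
next
  case (Suc i)
  have "fps_phase_ratio_deriv * (fps_phase_ratio p - 1) ^ i
      + (fps_phase_ratio p - 1) * (of_nat i * (fps_phase_ratio p - 1) ^ (i - 1) * fps_phase_ratio_deriv)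
      = of_nat (Suc i) * (fps_phase_ratio p - 1) ^ (Suc i - 1) * fps_phase_ratio_deriv"
    by (cases i) (simp_all add: algebra_simps)
  with has_coeff_deriv_mult[OF has_coeff_deriv_phase_ratio Suc.IH] show ?case by simp
qed

lemma fps_power_nth_eq_0: "(c :: complex fps) $ 0 = 0 \<Longrightarrow> n < i \<Longrightarrow> (c ^ i) $ n = 0"
  by (rule startsby_zero_power_prefix[rule_format]) auto

text \<open>As \<open>fps_phase_ratio p - 1\<close> has no constant term, each coefficient of the
  binomial series in it is a finite sum and can be differentiated termwise; the result is a
  composition with the derived binomial series.\<close>

lemma has_coeff_deriv_phase_powr:
  "has_coeff_deriv (fps_phase_powr \<alpha>) (fps_const \<alpha> * fps_phase_powr (\<alpha> - 1) p * fps_phase_ratio_deriv) p"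
  unfolding has_coeff_deriv_def
proof
  fix k
  define G where "G = (\<lambda>p. fps_phase_ratio p - 1)"
  have G0: "G p $ 0 = 0" for p by (simp add: G_def)
  \<comment> \<open>The summand with index \<open>Suc k\<close> is 0. It is included because
    lowering the exponents by one then leaves a sum that runs exactly to \<open>k\<close>.\<close>
  have eq: "fps_phase_powr \<alpha> p $ k = (\<Sum>i=0..Suc k. (\<alpha> gchoose i) * (G p ^ i $ k))" for p
    using fps_power_nth_eq_0[OF G0, of k "Suc k"] by (simp add: fps_phase_powr_def fps_compose_nth G_def)
  have "((\<lambda>p. \<Sum>i=0..Suc k. (\<alpha> gchoose i) * (G p ^ i $ k)) has_field_derivative
      (\<Sum>i=0..Suc k. (\<alpha> gchoose i) * ((of_nat i * G p ^ (i - 1) * fps_phase_ratio_deriv) $ k))) (at p)"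
    by (rule DERIV_sum)
       (use has_coeff_deriv_phase_ratio_power in \<open>auto simp: has_coeff_deriv_def G_def intro!: DERIV_cmult\<close>)
  also have "(\<Sum>i=0..Suc k. (\<alpha> gchoose i) * ((of_nat i * G p ^ (i - 1) * fps_phase_ratio_deriv) $ k))
      = (\<Sum>j=0..k. (\<alpha> gchoose Suc j) * of_nat (Suc j) * ((G p ^ j * fps_phase_ratio_deriv) $ k))"
    by (subst sum.atLeast0_atMost_Suc_shift) (simp add: fps_of_nat[symmetric] mult.assoc del: of_nat_Suc)
  also have "\<dots> = (\<Sum>j=0..k. (fps_deriv (fps_binomial \<alpha>) $ j) * ((G p ^ j * fps_phase_ratio_deriv) $ k))"
    by (simp add: mult_ac)
  also have "\<dots> = (fps_compose (fps_deriv (fps_binomial \<alpha>)) (G p) * fps_phase_ratio_deriv) $ k"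
  proof -
    have "(fps_compose (fps_deriv (fps_binomial \<alpha>)) (G p) * fps_phase_ratio_deriv) $ k
        = (\<Sum>l=0..k. (\<Sum>j=0..l. fps_deriv (fps_binomial \<alpha>) $ j * (G p ^ j $ l)) * fps_phase_ratio_deriv $ (k - l))"
      by (simp add: fps_mult_nth fps_compose_nth)
    \<comment> \<open>For \<open>j > l\<close> the \<open>j\<close>-th power has no coefficient of
      index \<open>l\<close>, so the inner sum extends to a range independent of \<open>l\<close>,
      and the sums can be swapped.\<close>
    also have "\<dots> = (\<Sum>l=0..k. (\<Sum>j=0..k. fps_deriv (fps_binomial \<alpha>) $ j * (G p ^ j $ l)) * fps_phase_ratio_deriv $ (k - l))"
      by (intro sum.cong refl arg_cong2[where f = "(*)"] sum.mono_neutral_left)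
         (auto simp: fps_power_nth_eq_0[OF G0])
    also have "\<dots> = (\<Sum>j=0..k. \<Sum>l=0..k. fps_deriv (fps_binomial \<alpha>) $ j * (G p ^ j $ l) * fps_phase_ratio_deriv $ (k - l))"
      unfolding sum_distrib_right by (rule sum.swap)
    also have "\<dots> = (\<Sum>j=0..k. fps_deriv (fps_binomial \<alpha>) $ j * ((G p ^ j * fps_phase_ratio_deriv) $ k))"
      by (simp add: fps_mult_nth sum_distrib_left mult.assoc)
    finally show ?thesis by simp
  qed
  also have "fps_compose (fps_deriv (fps_binomial \<alpha>)) (G p) = fps_const \<alpha> * fps_phase_powr (\<alpha> - 1) p"
    using G0 by (simp add: fps_deriv_binomial fps_compose_mult_distrib fps_phase_powr_def G_def)
  finally show "((\<lambda>p. fps_phase_powr \<alpha> p $ k) has_field_derivative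
      (fps_const \<alpha> * fps_phase_powr (\<alpha> - 1) p * fps_phase_ratio_deriv) $ k) (at p)"
    unfolding eq .
qed

lemma fps_two_mult_cancel: "2 * f = 2 * g \<Longrightarrow> f = (g :: complex fps)"
  by (auto simp: fps_eq_iff numeral_fps_const)

lemma fps_nth_X_mult_deriv: "(fps_X * fps_deriv f) $ n = of_nat n * f $ n"
  by (cases n) auto

text \<open>With \<open>\<Phi>\<close> the phase, this is the vanishing of the residue of the total derivative of
  \<open>\<Phi>\<^sup>\<alpha>\<^sup>-\<^sup>1 K\<close>; the index is the order of the pole.\<close>

lemma fps_phase_total_derivative:
  fixes K :: "complex fps" and \<alpha> :: complex
  assumes K0: "K $ 0 = 0" and m: "of_nat m = 3 - 2 * \<alpha>"
  shows "(fps_phase_powr (\<alpha> - 2) p * (fps_const (\<alpha> - 1) * fps_deriv (fps_phase p) * K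
           + fps_phase p * fps_deriv K)) $ m = 0"
proof -
  define A where "A = fps_const \<alpha>"
  define H where "H = fps_shift 1 K"
  define B B3 F Q M where "B = fps_phase_powr (\<alpha> - 2) p" and "B3 = fps_phase_powr (\<alpha> - 3) p"
    and "F = fps_phase p" and "Q = fps_phase_ratio p" and "M = (of_nat m :: complex fps)"
  have K: "K = fps_X * H"
    unfolding H_def using K0 by (intro fps_ext) (auto simp: Suc_diff_1)
  have K': "fps_deriv K = H + fps_X * fps_deriv H" unfolding K by simp
  have B: "B = B3 * Q" unfolding B_def B3_def Q_def using fps_phase_powr_step[of "\<alpha> - 2" p] by simp
  have B': "fps_deriv B = (A - 2) * B3 * fps_deriv Q"
    unfolding B_def B3_def Q_def A_def using fps_deriv_phase_powr[of "\<alpha> - 2" p] by (simp add: numeral_fps_const)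
  have F: "2 * F = fps_X ^ 2 * Q" unfolding F_def Q_def by (rule fps_X_square_phase_ratio[symmetric])
  have "fps_deriv (2 * F) = fps_deriv (fps_X ^ 2 * Q)" by (simp only: F)
  then have F': "2 * fps_deriv F = 2 * fps_X * Q + fps_X ^ 2 * fps_deriv Q"
    by (simp add: numeral_fps_const power2_eq_square algebra_simps)
  have M: "M = 3 - 2 * A"
  proof -
    have "M = fps_const (of_nat m)" by (simp add: M_def fps_of_nat)
    then show ?thesis unfolding m A_def by (simp add: numeral_fps_const)
  qed
  have "2 * (fps_X * fps_deriv (B * F * H) - M * (B * F * H)) = 2 * (B * ((A - 1) * fps_deriv F * K + F * fps_deriv K))"
  proof -
    have alg: "2 * (X * (Bd * F * H + B * Fd * H + B * F * Hd) - M * (B * F * H)) = 2 * (B * ((A - 1) * Fd * (X * H) + F * (H + X * Hd)))"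
      if "Bd = (A - 2) * B3 * Qd" "B = B3 * Q" "2 * F = X ^ 2 * Q" "2 * Fd = 2 * X * Q + X ^ 2 * Qd" "M = 3 - 2 * A"
      for X Bd F H B Fd Hd M A B3 Q Qd :: "complex fps"
    proof -
      have 1: "2 * (Bd * F) = (A - 2) * B * (2 * Fd - 2 * X * Q)" using that(1-4) by algebra
      have 2: "X * (2 * X * Q) = 4 * F" using that(3) by algebra
      have "2 * (X * (Bd * F * H)) = (A - 2) * B * (2 * (X * Fd * H) - 4 * (F * H))"
        using 1 2 by algebra
      then show ?thesis unfolding that(5) by (simp add: algebra_simps)
    qed
    have "fps_deriv (B * F * H) = fps_deriv B * F * H + B * fps_deriv F * H + B * F * fps_deriv H"
      by (simp add: algebra_simps)
    then show ?thesis unfolding K' using alg[OF B' B F F' M, of H "fps_deriv H"] by (simp only: K)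
  qed
  then have "fps_X * fps_deriv (B * F * H) - M * (B * F * H) = B * ((A - 1) * fps_deriv F * K + F * fps_deriv K)"
    by (rule fps_two_mult_cancel)
  then have "(B * ((A - 1) * fps_deriv F * K + F * fps_deriv K)) $ m
      = (fps_X * fps_deriv (B * F * H)) $ m - (M * (B * F * H)) $ m"
    by (metis fps_sub_nth)
  \<comment> \<open>The operator \<open>X d/dX - m\<close> annihilates the coefficient of index
    \<open>m\<close>.\<close>
  also have "\<dots> = 0" unfolding fps_nth_X_mult_deriv M_def by (simp flip: fps_of_nat)
  finally show ?thesis
    unfolding B_def F_def A_def by (metis fps_const_1_eq_1 fps_const_sub)
qed

definition debye_coeff :: "nat \<Rightarrow> complex \<Rightarrow> complex" where
  "debye_coeff n p = fps_phase_powr (- (of_nat n + 1/2)) p $ (2 * n)"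

text \<open>The Debye recurrence, once differentiated, in terms of Taylor coefficients. With
  \<open>D\<close> the derivative of the phase \<open>F\<close> in \<open>p\<close>, the brackets of
  \<open>F * F\<close>, \<open>F * D\<close> and \<open>D * D\<close> correspond to
  \<open>debye_coeff n\<close> and its first two derivatives, those of \<open>F\<close> and
  \<open>D\<close> to \<open>debye_coeff (Suc n)\<close> and its derivative.\<close>

lemma debye_coeff_identity:
  fixes p \<alpha> :: complex and m :: nat
  assumes m: "of_nat m = 3 - 2 * \<alpha>"
  defines "br \<equiv> (\<lambda>f. (fps_phase_powr (\<alpha> - 2) p * f) $ m)" and "F \<equiv> fps_phase p" and "D \<equiv> fps_X - fps_sinh1"
  shows "(- (4 - 8 * p^2) * (2 * \<alpha> + 1) + (1 - p^2) * (2 * \<alpha> + 1) * (2 * \<alpha> + 3) + 1 - 5 * p^2) * br (F * F)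
       + (4 * (2 - 4 * p^2) * p * \<alpha> - 4 * (1 - p^2) * (2 * \<alpha> + 1) * p * \<alpha>) * br (F * D)
       + 4 * (1 - p^2) * p^2 * \<alpha> * (\<alpha> - 1) * br (D * D) + 4 * \<alpha> * (2 * \<alpha> - 1) * br F
       - 8 * \<alpha> * p * (\<alpha> - 1) * br D = 0"
proof -
  define P A C S where "P = fps_const p" and "A = fps_const \<alpha>" and "C = fps_cosh1" and "S = fps_sinh1"
  \<comment> \<open>\<open>K\<close> is the combination of \<open>S\<close>, \<open>C\<close> and
    \<open>F\<close> for which the wanted expression is \<open>-4\<close> times the total derivative
    \<open>T\<close>; with this choice the check is a polynomial identity modulo
    \<open>S^2 = C^2 + 2 * C\<close>.\<close>
  define K where "K = - A * (S + P * C) + P * F"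
  have F: "F = P * D + C" by (simp add: F_def D_def P_def C_def fps_phase_def)
  have D': "fps_deriv D = - C" by (simp add: D_def C_def fps_deriv_sinh1)
  have C': "fps_deriv C = S" "fps_deriv S = C + 1" by (simp_all add: C_def S_def fps_deriv_sinh1 fps_deriv_cosh1)
  have PA': "fps_deriv P = 0" "fps_deriv A = 0" by (simp_all add: P_def A_def)
  have F': "fps_deriv F = S - P * C" unfolding F by (simp add: D' C' PA')
  have K': "fps_deriv K = - A * (C + 1 + P * S) + P * (S - P * C)" unfolding K_def by (simp add: F' C' PA')
  have SC: "S ^ 2 = C ^ 2 + 2 * C" unfolding S_def C_def by (rule fps_sinh1_square)
  define T where "T = (A - 1) * fps_deriv F * K + F * fps_deriv K"
  have K0: "K $ 0 = 0"
    by (simp add: K_def A_def S_def P_def C_def F_def fps_phase_nth_low) (simp add: fps_sinh1_def fps_cosh1_def)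
  have T0: "br T = 0"
  proof -
    have "fps_const (\<alpha> - 1) = A - 1" unfolding A_def by (metis fps_const_1_eq_1 fps_const_sub)
    then show ?thesis
      using fps_phase_total_derivative[OF K0 m, of p] by (simp add: br_def T_def F_def)
  qed
  have lin: "br (f + g) = br f + br g" "br (f - g) = br f - br g" "br (fps_const c * f) = c * br f" for f g c
    by (simp_all add: br_def algebra_simps)
       (metis (no_types, opaque_lifting) fps_mult_left_const_nth mult.left_commute)
  have "(- (4 - 8 * P^2) * (2 * A + 1) + (1 - P^2) * (2 * A + 1) * (2 * A + 3) + 1 - 5 * P^2) * (F * F)
       + (4 * (2 - 4 * P^2) * P * A - 4 * (1 - P^2) * (2 * A + 1) * P * A) * (F * D)
       + 4 * (1 - P^2) * P^2 * A * (A - 1) * (D * D) + 4 * A * (2 * A - 1) * F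
       - 8 * A * P * (A - 1) * D = - 4 * T"
    unfolding T_def K' F' unfolding K_def unfolding F using SC by algebra
  moreover have "fps_const (- (4 - 8 * p^2) * (2 * \<alpha> + 1) + (1 - p^2) * (2 * \<alpha> + 1) * (2 * \<alpha> + 3) + 1 - 5 * p^2)
       = - (4 - 8 * P^2) * (2 * A + 1) + (1 - P^2) * (2 * A + 1) * (2 * A + 3) + 1 - 5 * P^2"
    "fps_const (4 * (2 - 4 * p^2) * p * \<alpha> - 4 * (1 - p^2) * (2 * \<alpha> + 1) * p * \<alpha>)
       = 4 * (2 - 4 * P^2) * P * A - 4 * (1 - P^2) * (2 * A + 1) * P * A"
    "fps_const (4 * (1 - p^2) * p^2 * \<alpha> * (\<alpha> - 1)) = 4 * (1 - P^2) * P^2 * A * (A - 1)"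
    "fps_const (4 * \<alpha> * (2 * \<alpha> - 1)) = 4 * A * (2 * A - 1)"
    "fps_const (8 * \<alpha> * p * (\<alpha> - 1)) = 8 * A * P * (A - 1)" "fps_const (- 4 :: complex) = - 4"
    unfolding P_def A_def numeral_fps_const fps_const_1_eq_1[symmetric]
    by (simp_all only: fps_const_add[symmetric] fps_const_sub[symmetric] fps_const_mult[symmetric] fps_const_neg[symmetric] fps_const_power[symmetric])
  ultimately have "fps_const (- (4 - 8 * p^2) * (2 * \<alpha> + 1) + (1 - p^2) * (2 * \<alpha> + 1) * (2 * \<alpha> + 3) + 1 - 5 * p^2) * (F * F)
       + fps_const (4 * (2 - 4 * p^2) * p * \<alpha> - 4 * (1 - p^2) * (2 * \<alpha> + 1) * p * \<alpha>) * (F * D)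
       + fps_const (4 * (1 - p^2) * p^2 * \<alpha> * (\<alpha> - 1)) * (D * D) + fps_const (4 * \<alpha> * (2 * \<alpha> - 1)) * F
       - fps_const (8 * \<alpha> * p * (\<alpha> - 1)) * D = fps_const (- 4) * T"
    by (simp only:)
  then have "br (fps_const (- (4 - 8 * p^2) * (2 * \<alpha> + 1) + (1 - p^2) * (2 * \<alpha> + 1) * (2 * \<alpha> + 3) + 1 - 5 * p^2) * (F * F)
       + fps_const (4 * (2 - 4 * p^2) * p * \<alpha> - 4 * (1 - p^2) * (2 * \<alpha> + 1) * p * \<alpha>) * (F * D)
       + fps_const (4 * (1 - p^2) * p^2 * \<alpha> * (\<alpha> - 1)) * (D * D) + fps_const (4 * \<alpha> * (2 * \<alpha> - 1)) * F
       - fps_const (8 * \<alpha> * p * (\<alpha> - 1)) * D) = br (fps_const (- 4) * T)"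
    by (simp only:)
  then show ?thesis unfolding lin T0 by simp
qed

section \<open>The Taylor coefficients of the analytic phase\<close>

definition phase_ratio :: "complex \<Rightarrow> complex \<Rightarrow> complex" where
  "phase_ratio p t = (if t = 0 then 1 else 2 * (p * (t - sinh t) + cosh t - 1) / t ^ 2)"

lemma phase_ratio_has_fps_expansion: "phase_ratio p has_fps_expansion fps_phase_ratio p"
proof -
  have "(\<lambda>t. 2 * (p * (t - 1/2 * (exp (1 * t) - exp (- 1 * t))) + (1/2 * (exp (1 * t) + exp (- 1 * t)) - 1)))
      has_fps_expansion fps_const 2 * fps_phase p"
    unfolding fps_phase_def fps_sinh1_def fps_cosh1_def by (intro fps_expansion_intros)
  moreover have "(\<lambda>t. 2 * (p * (t - 1/2 * (exp (1 * t) - exp (- 1 * t))) + (1/2 * (exp (1 * t) + exp (- 1 * t)) - 1)))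
      = (\<lambda>t. 2 * (p * (t - sinh t) + cosh t - 1))"
    by (auto simp: sinh_field_def cosh_field_def fun_eq_iff field_simps)
  ultimately have 1: "(\<lambda>t. 2 * (p * (t - sinh t) + cosh t - 1)) has_fps_expansion fps_const 2 * fps_phase p" by simp
  have "2 \<le> subdegree (fps_const 2 * fps_phase p)"
  proof (rule subdegree_geI)
    have "(fps_const 2 * fps_phase p) $ 2 \<noteq> 0" by (simp add: fps_phase_nth_low)
    then show "fps_const 2 * fps_phase p \<noteq> 0" by force
    fix i :: nat assume "i < 2"
    then have "i = 0 \<or> i = Suc 0" by auto
    then show "(fps_const 2 * fps_phase p) $ i = 0" by (auto simp: fps_phase_nth_low)
  qed
  from has_fps_expansion_shift[OF 1 this, of 1] show ?thesis
    by (simp add: fps_phase_nth_low phase_ratio_def[abs_def] fps_phase_ratio_def)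
qed

lemma holomorphic_phase_ratio: "phase_ratio p holomorphic_on UNIV"
proof -
  obtain s where s: "open s" "0 \<in> s" "phase_ratio p holomorphic_on s"
    using has_fps_expansion_imp_holomorphic[OF phase_ratio_has_fps_expansion] by metis
  have "(\<lambda>t. 2 * (p * (t - sinh t) + cosh t - 1) / t ^ 2) holomorphic_on - {0}"
    unfolding sinh_field_def cosh_field_def by (intro holomorphic_intros) auto
  then have "phase_ratio p holomorphic_on - {0}"
    by (rule holomorphic_transform) (simp add: phase_ratio_def)
  with s have "phase_ratio p holomorphic_on (s \<union> - {0})"
    by (intro holomorphic_on_Un) auto
  moreover have "s \<union> - {0} = UNIV" using s by auto
  ultimately show ?thesis by simp
qed

lemma phase_ratio_0 [simp]: "phase_ratio p 0 = 1" by (simp add: phase_ratio_def)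

lemma eventually_Re_pos_nhds:
  assumes "isCont f z" "Re (f z) > 0"
  shows "eventually (\<lambda>t. Re (f t) > 0) (nhds z)"
proof -
  have "isCont (\<lambda>t. Re (f t)) z" using assms(1) by (rule bounded_linear.isCont[OF bounded_linear_Re])
  then have "((\<lambda>t. Re (f t)) \<longlongrightarrow> Re (f z)) (at z)" by (simp add: isCont_def)
  from order_tendstoD(1)[OF this assms(2)] assms(2) show ?thesis by (simp add: eventually_nhds_conv_at)
qed

lemma eventually_Re_phase_ratio_pos: "eventually (\<lambda>t. Re (phase_ratio p t) > 0) (nhds 0)"
proof (rule eventually_Re_pos_nhds)
  show "isCont (phase_ratio p) 0"
    using holomorphic_on_imp_continuous_on[OF holomorphic_phase_ratio] by (simp add: continuous_on_eq_continuous_at)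
qed simp

lemma phase_ratio_powr_has_fps_expansion:
  "(\<lambda>t. phase_ratio p t powr \<alpha>) has_fps_expansion fps_phase_powr \<alpha> p"
proof -
  have "(\<lambda>t. phase_ratio p t - 1) has_fps_expansion fps_phase_ratio p - 1"
    by (intro fps_expansion_intros phase_ratio_has_fps_expansion)
  from has_fps_expansion_compose[OF has_fps_expansion_binomial_complex[of \<alpha>] this]
  show ?thesis by (simp add: fps_phase_powr_def o_def)
qed

text \<open>The root used between the contours is not the principal one globally, but near 0 it has
  positive real part, and there it agrees with \<open>csqrt\<close>.\<close>

lemma inverse_sqrt_power_has_fps_expansion:
  assumes cont: "isCont q 0" and q0: "q 0 = 1" and sq: "eventually (\<lambda>t. q t ^ 2 = phase_ratio p t) (nhds 0)"
  shows "(\<lambda>t. inverse (q t) ^ (2 * n + 1)) has_fps_expansion fps_phase_powr (- (of_nat n + 1/2)) p"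
proof -
  have "eventually (\<lambda>t. Re (q t) > 0) (nhds 0)" using cont q0 by (intro eventually_Re_pos_nhds) auto
  with sq eventually_Re_phase_ratio_pos[of p]
  have "eventually (\<lambda>t. inverse (q t) ^ (2 * n + 1) = phase_ratio p t powr (- (of_nat n + 1/2))) (nhds 0)"
  proof eventually_elim
    case (elim t)
    have nz: "phase_ratio p t \<noteq> 0" using elim by auto
    have "q t = csqrt (phase_ratio p t)" using elim csqrt_square[of "q t"] by auto
    also have "\<dots> = exp (Ln (phase_ratio p t) / 2)" using nz by (rule csqrt_exp_Ln)
    finally have "inverse (q t) = exp (- (Ln (phase_ratio p t) / 2))" by (simp add: exp_minus)
    then have "inverse (q t) ^ (2 * n + 1) = exp (of_nat (2 * n + 1) * - (Ln (phase_ratio p t) / 2))"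
      by (simp only: exp_of_nat_mult)
    also have "of_nat (2 * n + 1) * - (Ln (phase_ratio p t) / 2) = - (of_nat n + 1/2) * Ln (phase_ratio p t)"
      by (simp add: algebra_simps)
    finally show ?case using nz by (simp add: powr_def)
  qed
  then show ?thesis
    by (subst has_fps_expansion_cong[OF _ refl]) (auto intro: phase_ratio_powr_has_fps_expansion)
qed

text \<open>Near 0 the ratio has positive real part, so the logarithm of its inverse is minus its
  logarithm, and the principal power in (a) is the power of the ratio with exponent
  \<open>- (n + 1/2)\<close>.\<close>

lemma deriv_phase_ratio_powr:
  "(deriv ^^ (2 * n)) (\<lambda>t::complex. if t = 0 then 1 else
     ((1/2) * t ^ 2 / (p * (t - sinh t) + cosh t - 1)) powr (of_nat n + 1/2)) 0 = fact (2 * n) * debye_coeff n p"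
proof -
  let ?f = "\<lambda>t::complex. if t = 0 then 1 else ((1/2) * t ^ 2 / (p * (t - sinh t) + cosh t - 1)) powr (of_nat n + 1/2)"
  have "eventually (\<lambda>t. ?f t = phase_ratio p t powr (- (of_nat n + 1/2))) (nhds 0)"
    using eventually_Re_phase_ratio_pos[of p]
  proof eventually_elim
    case (elim t)
    show ?case
    proof (cases "t = 0")
      case False
      have nz: "phase_ratio p t \<noteq> 0" using elim by auto
      have "(1/2) * t ^ 2 / (p * (t - sinh t) + cosh t - 1) = inverse (phase_ratio p t)"
        using False nz by (simp add: phase_ratio_def field_simps)
      moreover have "Ln (inverse (phase_ratio p t)) = - Ln (phase_ratio p t)"
        using elim by (intro Ln_inverse) (auto simp: complex_nonpos_Reals_iff)
      moreover have "inverse (phase_ratio p t) powr (of_nat n + 1/2) = phase_ratio p t powr (- (of_nat n + 1/2))"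
        using nz calculation(2) by (simp add: powr_def algebra_simps)
      ultimately show ?thesis using False by simp
    qed simp
  qed
  then have "?f has_fps_expansion fps_phase_powr (- (of_nat n + 1/2)) p"
    by (subst has_fps_expansion_cong[OF _ refl]) (auto intro: phase_ratio_powr_has_fps_expansion)
  from fps_nth_fps_expansion[OF this, of "2 * n"] show ?thesis by (simp add: debye_coeff_def)
qed

text \<open>This is \<open>(-1)^n\<close> times the double factorial
  \<open>(2 n - 1)!!\<close>.\<close>

definition debye_factor :: "nat \<Rightarrow> complex" where
  "debye_factor n = (-1) ^ n * fact (2 * n) / (2 ^ n * fact n)"

lemma debye_factor_Suc: "debye_factor (Suc n) = - (2 * of_nat n + 1) * debye_factor n"
proof -
  have f: "fact (2 * Suc n) = 2 * of_nat (Suc n) * (2 * of_nat n + 1) * (fact (2 * n) :: complex)"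
    by (simp add: algebra_simps)
  have nz: "of_nat (Suc n) \<noteq> (0 :: complex)" by (rule of_nat_neq_0)
  have "(- 1 * e) * (2 * a * x * F) / (2 * t * (a * d)) = - x * (e * F / (t * d))" if "a \<noteq> 0" for e a x F t d :: complex
    using that by simp
  from this[OF nz] show ?thesis unfolding debye_factor_def f fact_Suc power_Suc .
qed

lemma fps_nth_X_square_mult: "(fps_X ^ 2 * f) $ (n + 2) = (f :: complex fps) $ n"
  by (simp add: fps_X_power_mult_nth)

text \<open>Everything is brought to the common power \<open>\<alpha> - 2\<close> and the common
  index \<open>2 * n + 4\<close>, the form in which \<open>debye_coeff_identity\<close> relates the
  brackets. Each factor \<open>fps_phase_ratio\<close> or \<open>fps_phase_ratio_deriv\<close> is
  traded for twice the phase or twice its \<open>p\<close>-derivative, at the cost of raising the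
  index by 2.\<close>

lemma debye_coeff_brackets:
  fixes n :: nat and p :: complex
  defines "\<alpha> \<equiv> - (of_nat n + 1/2)"
  defines "br \<equiv> (\<lambda>f. (fps_phase_powr (\<alpha> - 2) p * f) $ (2 * n + 4))" and "D \<equiv> fps_X - fps_sinh1"
  shows "debye_coeff n p = 4 * br (fps_phase p * fps_phase p)"
    and "(debye_coeff n has_field_derivative 4 * \<alpha> * br (fps_phase p * D)) (at p)"
    and "debye_coeff (Suc n) p = 2 * br (fps_phase p)"
    and "(debye_coeff (Suc n) has_field_derivative 2 * (\<alpha> - 1) * br D) (at p)"
    and "((\<lambda>p. \<alpha> * (fps_phase_powr (\<alpha> - 1) p * fps_phase_ratio_deriv) $ (2 * n))
           has_field_derivative 4 * \<alpha> * (\<alpha> - 1) * br (D * D)) (at p)"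
    and "\<alpha> * (fps_phase_powr (\<alpha> - 1) p * fps_phase_ratio_deriv) $ (2 * n) = 4 * \<alpha> * br (fps_phase p * D)"
proof -
  define B where "B = fps_phase_powr (\<alpha> - 2) p"
  define Q Z where "Q = fps_phase_ratio p" and "Z = fps_phase_ratio_deriv"
  have XQ: "fps_X ^ 2 * Q = 2 * fps_phase p" unfolding Q_def by (rule fps_X_square_phase_ratio)
  have XZ: "fps_X ^ 2 * Z = 2 * D" unfolding Z_def D_def by (rule fps_X_square_phase_ratio_deriv)
  have B1: "fps_phase_powr (\<alpha> - 1) p = B * Q"
    using fps_phase_powr_step[of "\<alpha> - 1" p] by (simp add: B_def Q_def)
  have B0: "fps_phase_powr \<alpha> p = B * Q * Q"
    using fps_phase_powr_step[of "\<alpha>" p] B1 by (simp add: Q_def)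
  have a1: "- (of_nat (Suc n) + 1/2) = \<alpha> - 1" by (simp add: \<alpha>_def)
  have idx: "2 * n + 2 + 2 = 2 * n + 4" "2 * Suc n = 2 * n + 2" by simp_all
  have sh4: "f $ (2 * n) = g $ (2 * n + 4)" if "fps_X ^ 2 * (fps_X ^ 2 * f) = g" for f g :: "complex fps"
    using fps_nth_X_square_mult[of "fps_X ^ 2 * f" "2 * n + 2"] fps_nth_X_square_mult[of f "2 * n"]
    unfolding that idx by simp
  have sh2: "f $ (2 * Suc n) = g $ (2 * n + 4)" if "fps_X ^ 2 * f = g" for f g :: "complex fps"
    using fps_nth_X_square_mult[of f "2 * n + 2"] unfolding that idx by simp
  have c4: "(fps_const 4 * f) $ k = 4 * f $ k" "(fps_const 2 * f) $ k = 2 * f $ k" for f :: "complex fps" and k by simp_all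
  note br = br_def B_def[symmetric]
  have "debye_coeff n p = (fps_const 4 * (B * (fps_phase p * fps_phase p))) $ (2 * n + 4)"
    unfolding debye_coeff_def \<alpha>_def[symmetric] B0
    by (rule sh4) (use XQ in \<open>simp only: numeral_fps_const[symmetric], algebra\<close>)
  then show "debye_coeff n p = 4 * br (fps_phase p * fps_phase p)" by (simp only: br c4)
  have W1: "(B * Q * Z) $ (2 * n) = 4 * br (fps_phase p * D)"
  proof -
    have "(B * Q * Z) $ (2 * n) = (fps_const 4 * (B * (fps_phase p * D))) $ (2 * n + 4)"
      by (rule sh4) (use XQ XZ in \<open>simp only: numeral_fps_const[symmetric], algebra\<close>)
    then show ?thesis by (simp only: br c4)
  qed
  have der: "((\<lambda>p. fps_phase_powr a p $ k) has_field_derivative a * (fps_phase_powr (a - 1) p * Z) $ k) (at p)" for a k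
    using has_coeff_deriv_phase_powr[of a p] by (simp add: has_coeff_deriv_def Z_def mult.assoc)
  show "(debye_coeff n has_field_derivative 4 * \<alpha> * br (fps_phase p * D)) (at p)"
    using der[of \<alpha> "2 * n"] W1 unfolding debye_coeff_def[abs_def] \<alpha>_def[symmetric] B1 by (simp add: mult_ac)
  have "debye_coeff (Suc n) p = (fps_const 2 * (B * fps_phase p)) $ (2 * n + 4)"
    unfolding debye_coeff_def a1 B1 by (rule sh2) (use XQ in \<open>simp only: numeral_fps_const[symmetric], algebra\<close>)
  then show "debye_coeff (Suc n) p = 2 * br (fps_phase p)" by (simp only: br c4)
  have "(B * Z) $ (2 * Suc n) = (fps_const 2 * (B * D)) $ (2 * n + 4)"
    by (rule sh2) (use XZ in \<open>simp only: numeral_fps_const[symmetric], algebra\<close>)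
  then have BZ: "(B * Z) $ (2 * Suc n) = 2 * br D" by (simp only: br c4)
  have a2: "\<alpha> - 1 - 1 = \<alpha> - 2" by simp
  show "(debye_coeff (Suc n) has_field_derivative 2 * (\<alpha> - 1) * br D) (at p)"
    using der[of "\<alpha> - 1" "2 * Suc n"] BZ unfolding debye_coeff_def[abs_def] a1 a2 B_def[symmetric] by (simp add: mult_ac)
  have "has_coeff_deriv (\<lambda>p. fps_phase_powr (\<alpha> - 1) p * Z) (fps_const (\<alpha> - 1) * fps_phase_powr (\<alpha> - 1 - 1) p * Z * Z + fps_phase_powr (\<alpha> - 1) p * 0) p"
    unfolding Z_def by (intro has_coeff_deriv_mult has_coeff_deriv_phase_powr has_coeff_deriv_const)
  then have "((\<lambda>p. (fps_phase_powr (\<alpha> - 1) p * Z) $ (2 * n)) has_field_derivative (\<alpha> - 1) * (B * (Z * Z)) $ (2 * n)) (at p)"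
    unfolding has_coeff_deriv_def a2 B_def[symmetric] by (simp add: mult.assoc)
  moreover have "(B * (Z * Z)) $ (2 * n) = 4 * br (D * D)"
  proof -
    have "(B * (Z * Z)) $ (2 * n) = (fps_const 4 * (B * (D * D))) $ (2 * n + 4)"
      by (rule sh4) (use XZ in \<open>simp only: numeral_fps_const[symmetric], algebra\<close>)
    then show ?thesis by (simp only: br c4)
  qed
  ultimately have "((\<lambda>p. (fps_phase_powr (\<alpha> - 1) p * Z) $ (2 * n)) has_field_derivative (\<alpha> - 1) * (4 * br (D * D))) (at p)"
    by simp
  from DERIV_cmult[OF this, of \<alpha>]
  show "((\<lambda>p. \<alpha> * (fps_phase_powr (\<alpha> - 1) p * fps_phase_ratio_deriv) $ (2 * n))
           has_field_derivative 4 * \<alpha> * (\<alpha> - 1) * br (D * D)) (at p)"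
    by (simp only: Z_def mult_ac)
  show "\<alpha> * (fps_phase_powr (\<alpha> - 1) p * fps_phase_ratio_deriv) $ (2 * n) = 4 * \<alpha> * br (fps_phase p * D)"
    using W1 by (simp add: B1 Z_def)
qed

lemma coeff_poly_int: "coeff (poly_int q) n = (if n = 0 then 0 else coeff q (n - 1) / of_nat n)"
proof (cases n)
  case (Suc k)
  show ?thesis
  proof (cases "k \<le> degree q")
    case True
    then have "k < Suc (degree q)" by simp
    then show ?thesis using Suc
      by (simp add: poly_int_def nth_default_def del: upt_Suc)
  next
    case False
    then show ?thesis using Suc by (simp add: poly_int_def nth_default_def coeff_eq_0 del: upt_Suc)
  qed
qed (simp add: poly_int_def)

lemma pderiv_poly_int: "pderiv (poly_int q) = q"
  by (rule poly_eqI) (simp add: coeff_pderiv coeff_poly_int del: of_nat_Suc)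

lemma poly_poly_int_0: "poly (poly_int q) 0 = 0"
  by (simp add: poly_0_coeff_0 coeff_poly_int)

text \<open>In the induction step both sides vanish at \<open>p = 0\<close>, so it is enough to
  compare their derivatives in \<open>p\<close>, where the integral of the recurrence has
  disappeared. The induction hypothesis holds for all \<open>p\<close> and thus also yields the
  first two derivatives of \<open>debyeU n\<close>.\<close>

theorem debyeU_eq_debye_coeff: "poly (debyeU n) p = debye_factor n * p ^ n * debye_coeff n p"
proof (induction n arbitrary: p)
  case 0
  show ?case
    by (simp add: debye_factor_def debye_coeff_def fps_phase_powr_def)
next
  case (Suc n)
  define \<alpha> :: complex where "\<alpha> = - (of_nat n + 1/2)"
  define D where "D = fps_X - fps_sinh1"
  define br where "br = (\<lambda>p f. (fps_phase_powr (\<alpha> - 2) p * f) $ (2 * n + 4))"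
  define W1 where "W1 = (\<lambda>p. \<alpha> * (fps_phase_powr (\<alpha> - 1) p * fps_phase_ratio_deriv) $ (2 * n))"
  define c where "c = debye_factor n"
  note B = debye_coeff_brackets[of n, folded \<alpha>_def D_def]
  have n\<alpha>: "of_nat n = - \<alpha> - 1/2" by (simp add: \<alpha>_def)
  define V1 where "V1 = (\<lambda>p. c * (of_nat n * p ^ (n - 1) * debye_coeff n p + p ^ n * W1 p))"
  have U: "poly (debyeU n) = (\<lambda>p. c * p ^ n * debye_coeff n p)" using Suc.IH by (auto simp: c_def)
  have W: "(debye_coeff n has_field_derivative W1 p) (at p)" for p
    unfolding W1_def B(6) by (rule B(2))
  have "(poly (debyeU n) has_field_derivative V1 p) (at p)" for p
    unfolding U V1_def by (auto intro!: derivative_eq_intros W simp: algebra_simps)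
  then have U1: "poly (pderiv (debyeU n)) = V1" using poly_DERIV DERIV_unique by blast
  define V2 where "V2 = (\<lambda>p. c * (of_nat n * of_nat (n - 1) * p ^ (n - 2) * debye_coeff n p + 2 * of_nat n * p ^ (n - 1) * W1 p
        + p ^ n * (4 * \<alpha> * (\<alpha> - 1) * br p (D * D))))"
  have W2: "(W1 has_field_derivative 4 * \<alpha> * (\<alpha> - 1) * br p (D * D)) (at p)" for p
    using B(5)[of p] by (simp add: W1_def[abs_def] br_def)
  have "(V1 has_field_derivative V2 p) (at p)" for p
    unfolding V1_def V2_def by (auto intro!: derivative_eq_intros W W2 simp: algebra_simps numeral_2_eq_2)
  then have U2: "poly (pderiv (pderiv (debyeU n))) = V2"
    using poly_DERIV DERIV_unique unfolding U1[symmetric] by blast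
  define f where "f = (\<lambda>p. poly (debyeU (Suc n)) p - debye_factor (Suc n) * p ^ Suc n * debye_coeff (Suc n) p)"
  have "(f has_field_derivative 0) (at p)" for p
  proof -
    have "poly (pderiv (debyeU (Suc n))) p = 1/2 * ((2 * p - 4 * p^3) * V1 p + (p^2 - p^4) * V2 p) + 1/8 * (1 - 5 * p^2) * (c * p ^ n * debye_coeff n p)"
    proof -
      define u R S where "u = debyeU n" and "R = [:0, 0, 1:] * [:1, 0, -1 :: complex:]" and "S = [:1, 0, -5 :: complex:]"
      have R: "poly R p = p^2 - p^4" "poly (pderiv R) p = 2 * p - 4 * p^3" "poly S p = 1 - 5 * p^2"
        by (simp_all add: R_def S_def pderiv_mult pderiv_pCons algebra_simps power2_eq_square power3_eq_cube power4_eq_xxxx)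
      have "pderiv (debyeU (Suc n)) = smult (1/2) (R * pderiv (pderiv u) + pderiv u * pderiv R) + smult (1/8) (S * u)"
        by (simp only: debyeU.simps u_def[symmetric] R_def[symmetric] S_def[symmetric] pderiv_add pderiv_smult pderiv_mult pderiv_poly_int)
      then show ?thesis
        by (simp only: poly_add poly_smult poly_mult R u_def U1 U2 fun_cong[OF U]) (simp add: algebra_simps)
    qed
    moreover have "((\<lambda>p. debye_factor (Suc n) * p ^ Suc n * debye_coeff (Suc n) p) has_field_derivative
        debye_factor (Suc n) * (of_nat (Suc n) * p ^ n * debye_coeff (Suc n) p + p ^ Suc n * (2 * (\<alpha> - 1) * br p D))) (at p)"
    proof -
      have "((\<lambda>p. p ^ Suc n) has_field_derivative of_nat (Suc n) * p ^ n) (at p)"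
        using DERIV_power_Suc[OF DERIV_ident, where n = n] by simp
      from DERIV_mult[OF this B(4)[of p]]
      have "((\<lambda>p. p ^ Suc n * debye_coeff (Suc n) p) has_field_derivative
          of_nat (Suc n) * p ^ n * debye_coeff (Suc n) p + p ^ Suc n * (2 * (\<alpha> - 1) * br p D)) (at p)"
        by (simp only: br_def mult_ac)
      from DERIV_cmult[OF this, of "debye_factor (Suc n)"] show ?thesis by (simp only: mult.assoc)
    qed
    moreover have "1/2 * ((2 * p - 4 * p^3) * V1 p + (p^2 - p^4) * V2 p) + 1/8 * (1 - 5 * p^2) * (c * p ^ n * debye_coeff n p)
        = debye_factor (Suc n) * (of_nat (Suc n) * p ^ n * debye_coeff (Suc n) p + p ^ Suc n * (2 * (\<alpha> - 1) * br p D))"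
    proof -
      define P F where "P = p ^ n" and "F = fps_phase p"
      have m: "of_nat (2 * n + 4) = 3 - 2 * \<alpha>" by (simp add: \<alpha>_def)
      have id: "(- (4 - 8 * p^2) * (2 * \<alpha> + 1) + (1 - p^2) * (2 * \<alpha> + 1) * (2 * \<alpha> + 3) + 1 - 5 * p^2) * br p (F * F)
       + (4 * (2 - 4 * p^2) * p * \<alpha> - 4 * (1 - p^2) * (2 * \<alpha> + 1) * p * \<alpha>) * br p (F * D)
       + 4 * (1 - p^2) * p^2 * \<alpha> * (\<alpha> - 1) * br p (D * D) + 4 * \<alpha> * (2 * \<alpha> - 1) * br p F
       - 8 * \<alpha> * p * (\<alpha> - 1) * br p D = 0"
        unfolding br_def F_def D_def by (rule debye_coeff_identity[OF m])
      \<comment> \<open>The truncated subtraction does no harm: for \<open>n = 0\<close> the factor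
        \<open>n\<close> vanishes.\<close>
      have P1: "p * (of_nat n * p ^ (n - 1)) = of_nat n * P" unfolding P_def by (cases n) auto
      have P2: "p^2 * (of_nat n * of_nat (n - 1) * p ^ (n - 2)) = of_nat n * (of_nat n - 1) * P"
      proof -
        consider "n = 0" | "n = 1" | k where "n = Suc (Suc k)" by (metis One_nat_def not0_implies_Suc)
        then show ?thesis unfolding P_def by cases (auto simp: power2_eq_square)
      qed
      have W: "debye_coeff n p = 4 * br p (F * F)" "W1 p = 4 * \<alpha> * br p (F * D)" "debye_coeff (Suc n) p = 2 * br p F"
        using B(1)[of p] B(6)[of p] B(3)[of p] by (simp_all add: br_def F_def W1_def)
      have v1: "p * V1 p = c * (of_nat n * P * (4 * br p (F * F)) + p * P * (4 * \<alpha> * br p (F * D)))"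
      proof -
        have "p * (c * (X * A + P * E)) = c * ((p * X) * A + p * P * E)" for X A E by (simp add: algebra_simps)
        then show ?thesis unfolding V1_def W P_def[symmetric] P1 by (simp only: P1)
      qed
      have v2: "p^2 * V2 p = c * (of_nat n * (of_nat n - 1) * P * (4 * br p (F * F)) + 2 * of_nat n * p * P * (4 * \<alpha> * br p (F * D))
          + p^2 * P * (4 * \<alpha> * (\<alpha> - 1) * br p (D * D)))"
      proof -
        have "p^2 * (c * (X * A + 2 * of_nat n * Y * E + P * G)) = c * ((p^2 * X) * A + 2 * p * (p * (of_nat n * Y)) * E + p^2 * P * G)"
          for X A Y E G by (simp add: algebra_simps power2_eq_square)
        then have "p^2 * V2 p = c * (of_nat n * (of_nat n - 1) * P * (4 * br p (F * F)) + 2 * p * (of_nat n * P) * (4 * \<alpha> * br p (F * D))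
          + p^2 * P * (4 * \<alpha> * (\<alpha> - 1) * br p (D * D)))"
          unfolding V2_def W P_def[symmetric] by (simp only: P1 P2)
        then show ?thesis by (simp only: mult_ac)
      qed
      have df: "debye_factor (Suc n) = 2 * \<alpha> * c" by (simp add: debye_factor_Suc \<alpha>_def c_def algebra_simps)
      \<comment> \<open>Doubling clears the fractions. The factors \<open>2 * p - 4 * p^3\<close>
        and \<open>p^2 - p^4\<close> supply the powers of \<open>p\<close> that turn
        \<open>V1\<close> and \<open>V2\<close> into \<open>p * V1 p\<close> and
        \<open>p^2 * V2 p\<close>, so that every term is a multiple of \<open>p ^ n\<close>.\<close>
      have "2 * (1/2 * ((2 * p - 4 * p^3) * V1 p + (p^2 - p^4) * V2 p) + 1/8 * (1 - 5 * p^2) * (c * P * debye_coeff n p)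
          - debye_factor (Suc n) * (of_nat (Suc n) * P * debye_coeff (Suc n) p + p * P * (2 * (\<alpha> - 1) * br p D)))
         = (2 - 4 * p^2) * (p * V1 p) + (1 - p^2) * (p^2 * V2 p) + (1 - 5 * p^2) * (c * P * br p (F * F))
          - 4 * \<alpha> * c * ((of_nat n + 1) * P * (2 * br p F) + p * P * (2 * (\<alpha> - 1) * br p D))"
        unfolding W df by (simp add: field_simps power2_eq_square power3_eq_cube power4_eq_xxxx)
      also have "\<dots> = c * P * ((- (4 - 8 * p^2) * (2 * \<alpha> + 1) + (1 - p^2) * (2 * \<alpha> + 1) * (2 * \<alpha> + 3) + 1 - 5 * p^2) * br p (F * F)
       + (4 * (2 - 4 * p^2) * p * \<alpha> - 4 * (1 - p^2) * (2 * \<alpha> + 1) * p * \<alpha>) * br p (F * D)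
       + 4 * (1 - p^2) * p^2 * \<alpha> * (\<alpha> - 1) * br p (D * D) + 4 * \<alpha> * (2 * \<alpha> - 1) * br p F
       - 8 * \<alpha> * p * (\<alpha> - 1) * br p D)"
        unfolding v1 v2 n\<alpha> by (simp add: field_simps power2_eq_square)
      finally have z: "2 * (1/2 * ((2 * p - 4 * p^3) * V1 p + (p^2 - p^4) * V2 p) + 1/8 * (1 - 5 * p^2) * (c * P * debye_coeff n p)
          - debye_factor (Suc n) * (of_nat (Suc n) * P * debye_coeff (Suc n) p + p * P * (2 * (\<alpha> - 1) * br p D))) = c * P * 0"
        unfolding id .
      have "a = b" if "2 * (a - b) = c * P * 0" for a b :: complex using that by simp
      from this[OF z] show ?thesis unfolding P_def power_Suc .
    qed
    ultimately show ?thesis unfolding f_def using DERIV_diff[OF poly_DERIV[of "debyeU (Suc n)" p]] by fastforce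
  qed
  then have "f p = f 0" using has_field_derivative_zero_constant[of UNIV f] by auto
  also have "f 0 = 0" by (simp add: f_def poly_poly_int_0)
  finally show ?case by (simp add: f_def)
qed

section \<open>The phase and its square root\<close>

lemma continuous_on_connected_pos:
  fixes f :: "'a::topological_space \<Rightarrow> real"
  assumes "connected S" "continuous_on S f" "\<And>x. x \<in> S \<Longrightarrow> f x \<noteq> 0" "x0 \<in> S" "f x0 > 0" "x \<in> S"
  shows "f x > 0"
proof (rule ccontr)
  assume "\<not> f x > 0"
  have "connected (f ` S)" using assms(1,2) by (intro connected_continuous_image)
  moreover have "f x \<in> f ` S" "f x0 \<in> f ` S" using assms by auto
  moreover have "f x \<le> 0" "0 \<le> f x0" using \<open>\<not> f x > 0\<close> assms by auto
  ultimately have "0 \<in> f ` S" by (rule connectedD_interval)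
  then show False using assms(3) by auto
qed

lemma sinh_gt_self: "0 < x \<Longrightarrow> x < sinh (x::real)"
proof -
  assume x: "0 < x"
  have "sinh 0 - 0 < sinh x - x"
  proof (rule DERIV_pos_imp_increasing_open[OF x])
    fix u :: real assume "0 < u"
    then have "cosh u > 1" using cosh_real_strict_mono[of 0 u] by simp
    then show "\<exists>y. ((\<lambda>x. sinh x - x) has_real_derivative y) (at u) \<and> 0 < y"
      by (intro exI[of _ "cosh u - 1"]) (auto intro!: derivative_eq_intros)
  qed (intro continuous_intros)
  then show ?thesis by simp
qed

lemma abs_sinh_gt: "x \<noteq> 0 \<Longrightarrow> \<bar>x\<bar> < \<bar>sinh (x::real)\<bar>"
  using sinh_gt_self[of x] sinh_gt_self[of "-x"] by (cases "x > 0") auto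

lemma sinh_less_mult_cosh: "0 < x \<Longrightarrow> sinh x < x * cosh (x::real)"
proof -
  assume x: "0 < x"
  have "0 * cosh 0 - sinh 0 < x * cosh x - sinh x"
  proof (rule DERIV_pos_imp_increasing_open[OF x])
    fix u :: real assume u: "0 < u"
    then show "\<exists>y. ((\<lambda>x. x * cosh x - sinh x) has_real_derivative y) (at u) \<and> 0 < y"
      by (intro exI[of _ "u * sinh u"]) (auto intro!: derivative_eq_intros)
  qed (intro continuous_intros)
  then show ?thesis by simp
qed

text \<open>Gives the positivity of \<open>lag\<close>, and later the comparison of
  \<open>lag\<close> with the same expression at a larger angle.\<close>

lemma tan_minus_self_less:
  assumes "0 \<le> x" "x < y" "y < pi / 2"
  shows "tan x - x < tan y - y"
proof -
  define f :: "real \<Rightarrow> real" where "f = (\<lambda>x. tan x - x)"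
  have "f x < f y"
  proof (rule DERIV_pos_imp_increasing_open[OF assms(2)])
    fix u assume u: "x < u" "u < y"
    then have c: "cos u > 0" and t: "tan u > 0" using assms by (auto intro!: cos_gt_zero_pi tan_gt_zero)
    have "inverse ((cos u)\<^sup>2) - 1 = (tan u)\<^sup>2"
      using tan_sec[of u] c by (simp add: power_inverse)
    then have "inverse ((cos u)\<^sup>2) - 1 > 0" using t by simp
    then show "\<exists>d. (f has_real_derivative d) (at u) \<and> 0 < d"
      unfolding f_def using c by (intro exI[of _ "inverse ((cos u)\<^sup>2) - 1"]) (auto intro!: derivative_eq_intros)
  next
    have "cos u \<noteq> 0" if "u \<in> {x..y}" for u
    proof -
      have "cos u > 0" using assms that by (intro cos_gt_zero_pi) auto
      then show ?thesis by simp
    qed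
    then show "continuous_on {x..y} f"
      unfolding f_def by (intro continuous_intros) auto
  qed
  then show ?thesis by (simp add: f_def)
qed

section \<open>The phase and its only zero in the strip\<close>

locale debye_angle =
  fixes \<beta> :: real
  assumes \<beta>_pos: "0 < \<beta>" and \<beta>_less: "\<beta> < pi / 2"
begin

definition lag :: real where "lag = tan \<beta> - \<beta>"

definition phase :: "complex \<Rightarrow> complex" where
  "phase \<omega> = of_real lag + \<i> * (sinh \<omega> / of_real (cos \<beta>) - \<omega>)"

definition cotp :: complex where "cotp = \<i> * of_real (cos \<beta> / sin \<beta>)"

lemma cos_\<beta>: "cos \<beta> > 0" using \<beta>_pos \<beta>_less by (intro cos_gt_zero_pi) auto

lemma sin_\<beta>: "sin \<beta> > 0" using \<beta>_pos \<beta>_less by (intro sin_gt_zero) auto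

lemma tan_\<beta>: "tan \<beta> > 0" using cos_\<beta> sin_\<beta> by (simp add: tan_def)

lemma lag_pos: "lag > 0" using tan_minus_self_less[of 0 \<beta>] \<beta>_pos \<beta>_less by (simp add: lag_def)

lemma Re_phase: "Re (phase (of_real \<sigma> + \<i> * of_real \<gamma>)) = \<gamma> + lag - cosh \<sigma> * sin \<gamma> / cos \<beta>"
  and Im_phase: "Im (phase (of_real \<sigma> + \<i> * of_real \<gamma>)) = sinh \<sigma> * cos \<gamma> / cos \<beta> - \<sigma>"
proof -
  have s: "sinh (of_real \<sigma> + \<i> * of_real \<gamma>) = of_real (sinh \<sigma> * cos \<gamma>) + \<i> * of_real (cosh \<sigma> * sin \<gamma>)"
  proof -
    have c: "cosh (\<i> * of_real \<gamma>) = of_real (cos \<gamma>)" "sinh (\<i> * of_real \<gamma>) = \<i> * of_real (sin \<gamma>)"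
      by (simp_all add: cosh_field_def sinh_field_def exp_Euler exp_minus_Euler cos_of_real sin_of_real)
    have "cosh (of_real \<sigma> :: complex) = of_real (cosh \<sigma>)" "sinh (of_real \<sigma> :: complex) = of_real (sinh \<sigma>)"
      by (simp_all add: cosh_field_def sinh_field_def flip: exp_of_real)
    then show ?thesis by (simp add: sinh_add c)
  qed
  have "phase (of_real \<sigma> + \<i> * of_real \<gamma>)
      = of_real (\<gamma> + lag - cosh \<sigma> * sin \<gamma> / cos \<beta>) + \<i> * of_real (sinh \<sigma> * cos \<gamma> / cos \<beta> - \<sigma>)"
    unfolding phase_def s by (simp add: algebra_simps add_divide_distrib)
  then show "Re (phase (of_real \<sigma> + \<i> * of_real \<gamma>)) = \<gamma> + lag - cosh \<sigma> * sin \<gamma> / cos \<beta>"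
    "Im (phase (of_real \<sigma> + \<i> * of_real \<gamma>)) = sinh \<sigma> * cos \<gamma> / cos \<beta> - \<sigma>" by simp_all
qed

lemma complex_coords: "\<omega> = of_real (Re \<omega>) + \<i> * of_real (Im \<omega>)"
  by (simp add: complex_eq_iff)

lemma holomorphic_phase [holomorphic_intros]: "phase holomorphic_on A"
proof -
  have eq: "phase = (\<lambda>\<omega>. of_real lag + \<i> * ((exp \<omega> - exp (- \<omega>)) / 2 / of_real (cos \<beta>) - \<omega>))"
    by (simp add: phase_def fun_eq_iff sinh_field_def)
  show ?thesis unfolding eq using cos_\<beta> by (intro holomorphic_intros) auto
qed

lemma continuous_on_phase [continuous_intros]: "continuous_on A phase"
  by (rule holomorphic_on_imp_continuous_on[OF holomorphic_phase])

lemma phase_periodic: "phase (\<omega> + 2 * of_real pi * \<i>) = phase \<omega> + 2 * of_real pi"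
proof -
  have "sinh (\<omega> + 2 * of_real pi * \<i>) = sinh \<omega>"
    by (simp add: sinh_field_def exp_add exp_diff exp_minus)
  then show ?thesis by (simp add: phase_def algebra_simps)
qed

text \<open>The link between contour and Taylor coefficients: centred at the saddle, the phase is
  the series of the preceding section with \<open>p = i cot \<beta>\<close>, and the double zero
  becomes visible as the factor \<open>\<tau> ^ 2\<close>.\<close>

lemma phase_at_saddle:
  "phase (\<i> * of_real \<beta> + \<tau>) = - of_real (tan \<beta> / 2) * \<tau> ^ 2 * phase_ratio cotp \<tau>"
proof -
  have c: "cosh (\<i> * of_real \<beta>) = of_real (cos \<beta>)" "sinh (\<i> * of_real \<beta>) = \<i> * of_real (sin \<beta>)"
    by (simp_all add: cosh_field_def sinh_field_def exp_Euler exp_minus_Euler cos_of_real sin_of_real)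
  have c0: "complex_of_real (cos \<beta>) \<noteq> 0" "complex_of_real (sin \<beta>) \<noteq> 0" using cos_\<beta> sin_\<beta> by auto
  have "phase (\<i> * of_real \<beta> + \<tau>) = of_real (tan \<beta>) * (1 - cosh \<tau>) + \<i> * (sinh \<tau> - \<tau>)"
    using c0 by (simp add: phase_def sinh_add c lag_def tan_def field_simps)
  also have "\<dots> = - of_real (tan \<beta> / 2) * (2 * (cotp * (\<tau> - sinh \<tau>) + cosh \<tau> - 1))"
    using c0 by (simp add: cotp_def tan_def field_simps)
  also have "\<dots> = - of_real (tan \<beta> / 2) * (\<tau> ^ 2 * phase_ratio cotp \<tau>)"
    by (cases "\<tau> = 0") (simp_all add: phase_ratio_def)
  finally show ?thesis by (simp add: mult.assoc)
qed

lemma imag_axis_phase_deriv: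
  "((\<lambda>\<gamma>. \<gamma> + lag - sin \<gamma> / cos \<beta>) has_real_derivative 1 - cos u / cos \<beta>) (at u)"
  using cos_\<beta> by (auto intro!: derivative_eq_intros)

text \<open>On the imaginary axis the phase is real with derivative
  \<open>1 - cos u / cos \<beta>\<close>. It falls up to \<open>\<beta>\<close>, where it is 0, and
  rises from there to \<open>pi\<close>; beyond \<open>pi\<close> the sine is at most 0 and every
  term has the right sign.\<close>

lemma imag_axis_phase_pos:
  assumes "- \<beta> < \<gamma>" "\<gamma> < 2 * pi" "\<gamma> \<noteq> \<beta>"
  shows "\<gamma> + lag - sin \<gamma> / cos \<beta> > 0"
proof -
  let ?k = "\<lambda>\<gamma>. \<gamma> + lag - sin \<gamma> / cos \<beta>"
  have k\<beta>: "?k \<beta> = 0" using cos_\<beta> by (simp add: lag_def tan_def)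
  consider "\<gamma> < \<beta>" | "\<beta> < \<gamma>" "\<gamma> \<le> pi" | "pi < \<gamma>" using assms by linarith
  then show ?thesis
  proof cases
    case 1
    have "?k \<gamma> > ?k \<beta>"
    proof (rule DERIV_neg_imp_decreasing_open[OF 1])
      fix u assume u: "\<gamma> < u" "u < \<beta>"
      have "cos \<bar>u\<bar> > cos \<beta>" using u assms \<beta>_less by (intro cos_monotone_0_pi) auto
      then show "\<exists>y. (?k has_real_derivative y) (at u) \<and> y < 0"
        using imag_axis_phase_deriv[of u] cos_\<beta> by (intro exI[of _ "1 - cos u / cos \<beta>"]) (auto simp: field_simps)
    qed (use cos_\<beta> in \<open>auto intro!: continuous_intros\<close>)
    then show ?thesis using k\<beta> by simp
  next
    case 2
    have "?k \<beta> < ?k \<gamma>"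
    proof (rule DERIV_pos_imp_increasing_open[OF 2(1)])
      fix u assume u: "\<beta> < u" "u < \<gamma>"
      have "cos u < cos \<beta>" using u 2 \<beta>_pos by (intro cos_monotone_0_pi) auto
      then show "\<exists>y. (?k has_real_derivative y) (at u) \<and> 0 < y"
        using imag_axis_phase_deriv[of u] cos_\<beta> by (intro exI[of _ "1 - cos u / cos \<beta>"]) (auto simp: field_simps)
    qed (use cos_\<beta> in \<open>auto intro!: continuous_intros\<close>)
    then show ?thesis using k\<beta> by simp
  next
    case 3
    have "sin \<gamma> \<le> 0" using 3 assms sin_le_zero[of \<gamma>] by auto
    then have "sin \<gamma> / cos \<beta> \<le> 0" using cos_\<beta> by (simp add: divide_nonpos_pos)
    then show ?thesis using 3 lag_pos pi_gt_zero by linarith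
  qed
qed

text \<open>On the imaginary axis the phase is positive. Off it,
  \<open>cos \<gamma> > cos \<beta>\<close> together with the strict inequality between
  \<open>\<bar>sinh \<sigma>\<bar>\<close> and \<open>\<bar>\<sigma>\<bar>\<close> keeps the
  imaginary part away from 0.\<close>

lemma phase_not_nonpos_lower:
  assumes "- \<beta> < Im \<omega>" "Im \<omega> < \<beta>"
  shows "phase \<omega> \<notin> \<real>\<^sub>\<le>\<^sub>0"
proof -
  define \<sigma> \<gamma> where "\<sigma> = Re \<omega>" and "\<gamma> = Im \<omega>"
  have \<omega>: "\<omega> = of_real \<sigma> + \<i> * of_real \<gamma>" unfolding \<sigma>_def \<gamma>_def by (rule complex_coords)
  show ?thesis
  proof (cases "\<sigma> = 0")
    case True
    have "Re (phase \<omega>) > 0"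
      unfolding \<omega> Re_phase using True imag_axis_phase_pos[of \<gamma>] assms[folded \<gamma>_def] \<beta>_less pi_gt_zero by simp
    then show ?thesis by (simp add: complex_nonpos_Reals_iff)
  next
    case False
    have "cos \<bar>\<gamma>\<bar> > cos \<beta>" using assms \<beta>_less by (intro cos_monotone_0_pi) (auto simp: \<gamma>_def)
    then have "cos \<gamma> / cos \<beta> > 1" using cos_\<beta> by simp
    then have "\<bar>sinh \<sigma> * (cos \<gamma> / cos \<beta>)\<bar> \<ge> \<bar>sinh \<sigma>\<bar> * 1" unfolding abs_mult by (intro mult_left_mono) (linarith, simp)
    then have "Im (phase \<omega>) \<noteq> 0" using abs_sinh_gt[OF False] by (auto simp: \<omega> Im_phase)
    then show ?thesis by (simp add: complex_nonpos_Reals_iff)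
  qed
qed

text \<open>Off the imaginary axis there are two cases. Up to height \<open>3 * pi / 2\<close> the
  cosine is at most 0, so the two terms of the imaginary part cannot cancel; above it the sine is at
  most 0 and the real part is positive.\<close>

lemma phase_not_nonpos_upper:
  assumes "pi / 2 \<le> Im \<omega>" "Im \<omega> < 2 * pi"
  shows "phase \<omega> \<notin> \<real>\<^sub>\<le>\<^sub>0"
proof -
  define \<sigma> \<gamma> where "\<sigma> = Re \<omega>" and "\<gamma> = Im \<omega>"
  have \<omega>: "\<omega> = of_real \<sigma> + \<i> * of_real \<gamma>" unfolding \<sigma>_def \<gamma>_def by (rule complex_coords)
  have \<gamma>: "pi / 2 \<le> \<gamma>" "\<gamma> < 2 * pi" using assms by (auto simp: \<gamma>_def)
  show ?thesis
  proof (cases "\<sigma> = 0")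
    case True
    have "Re (phase \<omega>) > 0"
      unfolding \<omega> Re_phase using True imag_axis_phase_pos[of \<gamma>] \<gamma> \<beta>_pos \<beta>_less pi_gt_zero by simp
    then show ?thesis by (simp add: complex_nonpos_Reals_iff)
  next
    case False
    show ?thesis
    proof (cases "\<gamma> \<le> 3 * pi / 2")
      case True
      have "cos (\<gamma> - pi) \<ge> 0" using \<gamma> True by (intro cos_ge_zero) auto
      then have "cos \<gamma> \<le> 0" by simp
      then have c: "cos \<gamma> / cos \<beta> \<le> 0" using cos_\<beta> by (simp add: divide_nonpos_pos)
      have "Im (phase \<omega>) \<noteq> 0"
      proof (cases "\<sigma> > 0")
        case True
        then have "sinh \<sigma> * (cos \<gamma> / cos \<beta>) \<le> 0" using c by (intro mult_nonneg_nonpos) auto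
        then show ?thesis using True by (auto simp: \<omega> Im_phase)
      next
        case f: False
        then have "sinh \<sigma> * (cos \<gamma> / cos \<beta>) \<ge> 0" using c by (intro mult_nonpos_nonpos) auto
        then show ?thesis using False f by (auto simp: \<omega> Im_phase)
      qed
      then show ?thesis by (simp add: complex_nonpos_Reals_iff)
    next
      case f: False
      have "sin \<gamma> \<le> 0" using f \<gamma> sin_le_zero[of \<gamma>] pi_gt_zero by (cases "\<gamma> > pi") auto
      then have "cosh \<sigma> * sin \<gamma> / cos \<beta> \<le> 0" using cos_\<beta> by (intro divide_nonpos_pos mult_nonneg_nonpos) auto
      then have "Re (phase \<omega>) > 0" using f lag_pos pi_gt_zero unfolding \<omega> Re_phase by linarith
      then show ?thesis by (simp add: complex_nonpos_Reals_iff)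
    qed
  qed
qed

text \<open>On the curve where the imaginary part vanishes, \<open>cos \<beta>\<close> can be
  eliminated: \<open>cosh \<sigma> * sin \<gamma> / cos \<beta>\<close> becomes
  \<open>\<sigma> coth \<sigma> tan \<gamma>\<close>, which exceeds \<open>tan \<gamma>\<close>,
  while \<open>tan x - x\<close> is increasing. In this part of the strip the phase does meet the
  negative real axis, so only its zeros can be excluded.\<close>

lemma phase_nonzero_middle_aux:
  assumes "\<beta> \<le> \<gamma>" "\<gamma> < pi / 2" "\<sigma> > 0" "sinh \<sigma> * cos \<gamma> / cos \<beta> = \<sigma>"
  shows "\<gamma> + lag - cosh \<sigma> * sin \<gamma> / cos \<beta> < 0"
proof -
  have cg: "cos \<gamma> > 0" using assms \<beta>_pos by (intro cos_gt_zero_pi) auto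
  have sg: "sin \<gamma> > 0" using assms \<beta>_pos by (intro sin_gt_zero) auto
  have cb: "cos \<beta> = sinh \<sigma> * cos \<gamma> / \<sigma>" using assms cos_\<beta> by (simp add: field_simps)
  have "tan \<gamma> < cosh \<sigma> * sin \<gamma> / cos \<beta>"
  proof -
    have "sinh \<sigma> * sin \<gamma> < \<sigma> * cosh \<sigma> * sin \<gamma>" using sinh_less_mult_cosh[OF assms(3)] sg by simp
    then show ?thesis unfolding cb tan_def using assms(3) cg by (simp add: field_simps)
  qed
  moreover have "tan \<beta> - \<beta> \<le> tan \<gamma> - \<gamma>"
    using tan_minus_self_less[of \<beta> \<gamma>] assms \<beta>_pos by (cases "\<beta> = \<gamma>") auto
  ultimately show ?thesis unfolding lag_def by linarith
qed

lemma phase_nonzero: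
  assumes "- \<beta> < Im \<omega>" "Im \<omega> < 2 * pi" "\<omega> \<noteq> \<i> * of_real \<beta>"
  shows "phase \<omega> \<noteq> 0"
proof -
  consider "Im \<omega> < \<beta>" | "pi / 2 \<le> Im \<omega>" | "\<beta> \<le> Im \<omega>" "Im \<omega> < pi / 2" by linarith
  then show ?thesis
  proof cases
    case 1 then show ?thesis using phase_not_nonpos_lower[of \<omega>] assms by auto
  next
    case 2 then show ?thesis using phase_not_nonpos_upper[of \<omega>] assms by auto
  next
    case 3
    define \<sigma> \<gamma> where "\<sigma> = Re \<omega>" and "\<gamma> = Im \<omega>"
    have \<omega>: "\<omega> = of_real \<sigma> + \<i> * of_real \<gamma>" unfolding \<sigma>_def \<gamma>_def by (rule complex_coords)
    have \<gamma>: "\<beta> \<le> \<gamma>" "\<gamma> < pi / 2" using 3 by (auto simp: \<gamma>_def)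
    show ?thesis
    proof
      assume "phase \<omega> = 0"
      then have R: "\<gamma> + lag - cosh \<sigma> * sin \<gamma> / cos \<beta> = 0" and I: "sinh \<sigma> * cos \<gamma> / cos \<beta> - \<sigma> = 0"
        using Re_phase[of \<sigma> \<gamma>] Im_phase[of \<sigma> \<gamma>] unfolding \<omega> by simp_all
      consider "\<sigma> = 0" | "\<sigma> > 0" | "\<sigma> < 0" by linarith
      then show False
      proof cases
        case 1
        then have "\<gamma> \<noteq> \<beta>" using assms(3) \<omega> by auto
        then show False using imag_axis_phase_pos[of \<gamma>] R 1 \<gamma> \<beta>_pos pi_gt_zero by auto
      next
        case 2 then show False using phase_nonzero_middle_aux[OF \<gamma> 2] R I by simp
      next
        case 3 then show False using phase_nonzero_middle_aux[OF \<gamma>, of "-\<sigma>"] R I by simp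
      qed
    qed
  qed
qed

section \<open>The square root of the phase\<close>

abbreviation strip :: "complex set" where "strip \<equiv> {\<omega>. - \<beta> < Im \<omega> \<and> Im \<omega> < 2 * pi}"

lemma convex_Im_strip: "convex {\<omega>. l < Im \<omega> \<and> Im \<omega> < u}"
  using convex_Int[OF convex_halfspace_Im_gt[of l] convex_halfspace_Im_lt[of u]] by (simp add: Collect_conj_eq)

lemma open_Im_strip: "open {\<omega>. l < Im \<omega> \<and> Im \<omega> < u}"
  using open_Int[OF open_halfspace_Im_gt[of l] open_halfspace_Im_lt[of u]] by (simp add: Collect_conj_eq)

text \<open>The function \<open>phase_ratio cotp\<close> is zero-free on a convex set and so has a
  holomorphic root there; multiplication by \<open>i sqrt (tan \<beta> / 2) \<tau>\<close> restores
  the double zero. On the imaginary axis the result is real and changes sign at the saddle, and this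
  decides which branch it is below and above.\<close>

lemma sqrt_phase_exists:
  obtains r q where "r holomorphic_on strip" "\<And>\<omega>. \<omega> \<in> strip \<Longrightarrow> r \<omega> ^ 2 = phase \<omega>"
    and "\<And>\<omega>. - \<beta> < Im \<omega> \<Longrightarrow> Im \<omega> < \<beta> \<Longrightarrow> r \<omega> = csqrt (phase \<omega>)"
    and "\<And>\<omega>. pi / 2 \<le> Im \<omega> \<Longrightarrow> Im \<omega> < 2 * pi \<Longrightarrow> r \<omega> = - csqrt (phase \<omega>)"
    and "\<And>\<tau>. r (\<i> * of_real \<beta> + \<tau>) = \<i> * of_real (sqrt (tan \<beta> / 2)) * \<tau> * q \<tau>"
    and "q holomorphic_on {\<tau>. - 2 * \<beta> < Im \<tau> \<and> Im \<tau> < 2 * pi - \<beta>}" "q 0 = 1"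
    and "\<And>\<tau>. - 2 * \<beta> < Im \<tau> \<Longrightarrow> Im \<tau> < 2 * pi - \<beta> \<Longrightarrow> q \<tau> ^ 2 = phase_ratio cotp \<tau>"
    and "\<And>\<tau>. - 2 * \<beta> < Im \<tau> \<Longrightarrow> Im \<tau> < 2 * pi - \<beta> \<Longrightarrow> q \<tau> \<noteq> 0"
proof -
  let ?D = "{\<tau>. - 2 * \<beta> < Im \<tau> \<and> Im \<tau> < 2 * pi - \<beta>}"
  define k where "k = sqrt (tan \<beta> / 2)"
  have k: "k > 0" "k ^ 2 = tan \<beta> / 2" using tan_\<beta> by (auto simp: k_def)
  have hol: "phase_ratio cotp holomorphic_on ?D" using holomorphic_phase_ratio by (rule holomorphic_on_subset) auto
  have nz: "phase_ratio cotp \<tau> \<noteq> 0" if "\<tau> \<in> ?D" for \<tau>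
  proof (cases "\<tau> = 0")
    case False
    have "phase (\<i> * of_real \<beta> + \<tau>) \<noteq> 0"
      by (rule phase_nonzero) (use that False in auto)
    then show ?thesis by (auto simp: phase_at_saddle)
  qed simp
  have cv: "convex ?D" by (rule convex_Im_strip)
  have "\<exists>q0. q0 holomorphic_on ?D \<and> (\<forall>\<tau>\<in>?D. phase_ratio cotp \<tau> = q0 \<tau> ^ 2)"
    by (rule contractible_imp_holomorphic_sqrt[OF hol convex_imp_contractible[OF cv] nz]) blast+
  then obtain q0 where q0: "q0 holomorphic_on ?D" "\<And>\<tau>. \<tau> \<in> ?D \<Longrightarrow> phase_ratio cotp \<tau> = q0 \<tau> ^ 2"
    by blast
  have zero_in: "0 \<in> ?D" using \<beta>_pos \<beta>_less pi_gt_zero by auto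
  have q00: "q0 0 ^ 2 = 1" using q0(2)[OF zero_in] by simp
  \<comment> \<open>\<open>q0 0\<close> is 1 or -1; dividing by it fixes the sign of the
    root.\<close>
  define q where "q = (\<lambda>\<tau>. q0 \<tau> / q0 0)"
  have q0n: "q0 0 \<noteq> 0" using q00 by auto
  have q: "q holomorphic_on ?D" unfolding q_def by (intro holomorphic_intros q0) (use q0n in auto)
  have q1: "q 0 = 1" using q0n by (simp add: q_def)
  have q2: "q \<tau> ^ 2 = phase_ratio cotp \<tau>" if "- 2 * \<beta> < Im \<tau>" "Im \<tau> < 2 * pi - \<beta>" for \<tau>
    using q0(2)[of \<tau>] q00 that by (simp add: q_def power_divide)
  have qn: "q \<tau> \<noteq> 0" if "- 2 * \<beta> < Im \<tau>" "Im \<tau> < 2 * pi - \<beta>" for \<tau> using q2[OF that] nz[of \<tau>] that by auto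
  define r where "r = (\<lambda>\<omega>. \<i> * of_real k * (\<omega> - \<i> * of_real \<beta>) * q (\<omega> - \<i> * of_real \<beta>))"
  have r: "r holomorphic_on strip"
  proof -
    have "(q \<circ> (\<lambda>\<omega>. \<omega> - \<i> * of_real \<beta>)) holomorphic_on strip"
      by (rule holomorphic_on_compose_gen[OF _ q]) (auto intro!: holomorphic_intros)
    then show ?thesis unfolding r_def by (intro holomorphic_intros) (simp add: o_def)
  qed
  have r2: "r \<omega> ^ 2 = phase \<omega>" if "\<omega> \<in> strip" for \<omega>
  proof -
    have "r \<omega> ^ 2 = - of_real (k ^ 2) * (\<omega> - \<i> * of_real \<beta>) ^ 2 * q (\<omega> - \<i> * of_real \<beta>) ^ 2"
      by (simp add: r_def power_mult_distrib)
    also have "q (\<omega> - \<i> * of_real \<beta>) ^ 2 = phase_ratio cotp (\<omega> - \<i> * of_real \<beta>)"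
      by (rule q2) (use that in auto)
    finally show ?thesis using phase_at_saddle[of "\<omega> - \<i> * of_real \<beta>"] k by simp
  qed
  \<comment> \<open>On the imaginary axis the square of \<open>q\<close> is positive, so
    \<open>q\<close> is real and nonzero there, and its value 1 at 0 fixes the sign on the whole
    interval.\<close>
  have q_axis: "Re (q (\<i> * of_real y)) > 0 \<and> Im (q (\<i> * of_real y)) = 0" if y: "- 2 * \<beta> < y" "y < 2 * pi - \<beta>" for y
  proof -
    let ?I = "{- 2 * \<beta> <..< 2 * pi - \<beta>}"
    have real: "Im (q (\<i> * of_real y)) = 0 \<and> Re (q (\<i> * of_real y)) \<noteq> 0" if y: "y \<in> ?I" for y
    proof (cases "y = 0")
      case False
      define v where "v = (\<beta> + y) + lag - sin (\<beta> + y) / cos \<beta>"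
      have v: "v > 0" unfolding v_def by (rule imag_axis_phase_pos) (use y False in auto)
      have "phase (\<i> * of_real \<beta> + \<i> * of_real y) = of_real v"
      proof -
        have "phase (of_real 0 + \<i> * of_real (\<beta> + y)) = of_real v"
          using Re_phase[of 0 "\<beta> + y"] Im_phase[of 0 "\<beta> + y"] by (simp add: complex_eq_iff v_def)
        then show ?thesis by (simp add: algebra_simps)
      qed
      then have "of_real v = of_real (tan \<beta> / 2 * y ^ 2) * q (\<i> * of_real y) ^ 2"
        unfolding phase_at_saddle using q2[of "\<i> * of_real y"] y by (simp add: power_mult_distrib)
      moreover have "tan \<beta> / 2 * y ^ 2 \<noteq> 0" using tan_\<beta> False by simp
      ultimately have "q (\<i> * of_real y) ^ 2 = of_real (v / (tan \<beta> / 2 * y ^ 2))"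
        by (simp only: of_real_divide) (simp add: field_simps)
      moreover have "v / (tan \<beta> / 2 * y ^ 2) > 0" using v tan_\<beta> False by (intro divide_pos_pos mult_pos_pos) auto
      ultimately obtain x where x: "x > 0" "q (\<i> * of_real y) ^ 2 = of_real x" by blast
      have "Re (q (\<i> * of_real y) ^ 2) = x" "Im (q (\<i> * of_real y) ^ 2) = 0" using x(2) by simp_all
      then show ?thesis using x(1) by (auto simp: power2_eq_square)
    qed (simp add: q1)
    have cont: "continuous_on ?I (\<lambda>y. Re (q (\<i> * of_real y)))"
      by (intro continuous_intros continuous_on_compose2[OF holomorphic_on_imp_continuous_on[OF q]]) auto
    have "Re (q (\<i> * of_real y)) > 0"
      by (rule continuous_on_connected_pos[OF _ cont, of 0]) (use real y \<beta>_pos \<beta>_less pi_gt_zero q1 in auto)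
    then show ?thesis using real y by auto
  qed
  have r_axis: "r (\<i> * of_real \<gamma>) = of_real (k * (\<beta> - \<gamma>) * Re (q (\<i> * of_real (\<gamma> - \<beta>))))" if "- \<beta> < \<gamma>" "\<gamma> < 2 * pi" for \<gamma>
  proof -
    have "q (\<i> * of_real (\<gamma> - \<beta>)) = of_real (Re (q (\<i> * of_real (\<gamma> - \<beta>))))"
      using q_axis[of "\<gamma> - \<beta>"] that by (simp add: complex_eq_iff)
    moreover have "r (\<i> * of_real \<gamma>) = \<i> * of_real k * (\<i> * of_real (\<gamma> - \<beta>)) * q (\<i> * of_real (\<gamma> - \<beta>))"
      by (simp add: r_def algebra_simps)
    ultimately have "r (\<i> * of_real \<gamma>) = \<i> * of_real k * (\<i> * of_real (\<gamma> - \<beta>)) * of_real (Re (q (\<i> * of_real (\<gamma> - \<beta>))))"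
      by metis
    then show ?thesis by (simp add: algebra_simps)
  qed
  \<comment> \<open>Where the real part of the root vanishes, its square lies on the closed negative
    axis. On a connected region where the phase avoids that axis, the sign of
    \<open>Re (r \<omega>)\<close> is therefore constant and can be read off at one point of the
    imaginary axis.\<close>
  have Re_nz: "Re (r \<omega>) \<noteq> 0" if "\<omega> \<in> strip" "phase \<omega> \<notin> \<real>\<^sub>\<le>\<^sub>0" for \<omega>
  proof
    assume "Re (r \<omega>) = 0"
    then have "r \<omega> ^ 2 \<in> \<real>\<^sub>\<le>\<^sub>0" by (simp add: complex_nonpos_Reals_iff power2_eq_square)
    then show False using that r2 by simp
  qed
  have contr: "continuous_on strip (\<lambda>\<omega>. Re (r \<omega>))"
    by (intro continuous_intros holomorphic_on_imp_continuous_on r)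
  have lower: "r \<omega> = csqrt (phase \<omega>)" if \<omega>: "- \<beta> < Im \<omega>" "Im \<omega> < \<beta>" for \<omega>
  proof -
    have "Re (r \<omega>) > 0"
    proof (rule continuous_on_connected_pos[of "{\<omega>. - \<beta> < Im \<omega> \<and> Im \<omega> < \<beta>}" "\<lambda>\<omega>. Re (r \<omega>)" 0])
      show "connected {\<omega>. - \<beta> < Im \<omega> \<and> Im \<omega> < \<beta>}" by (rule convex_connected[OF convex_Im_strip])
      show "continuous_on {\<omega>. - \<beta> < Im \<omega> \<and> Im \<omega> < \<beta>} (\<lambda>\<omega>. Re (r \<omega>))"
        by (rule continuous_on_subset[OF contr]) (use \<beta>_less in auto)
      show "Re (r x) \<noteq> 0" if "x \<in> {\<omega>. - \<beta> < Im \<omega> \<and> Im \<omega> < \<beta>}" for x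
        using that phase_not_nonpos_lower[of x] \<beta>_less by (intro Re_nz) auto
      show "Re (r 0) > 0"
        using r_axis[of 0] q_axis[of "0 - \<beta>"] \<beta>_pos k by simp
    qed (use \<omega> \<beta>_pos in auto)
    then have "csqrt (r \<omega> ^ 2) = r \<omega>" by (intro csqrt_square) auto
    moreover have "\<omega> \<in> strip" using \<omega> \<beta>_less by auto
    ultimately show ?thesis using r2 by simp
  qed
  have upper: "r \<omega> = - csqrt (phase \<omega>)" if \<omega>: "pi / 2 \<le> Im \<omega>" "Im \<omega> < 2 * pi" for \<omega>
  proof -
    have "Re (- r \<omega>) > 0"
    proof (rule continuous_on_connected_pos[of "{\<omega>. pi / 2 \<le> Im \<omega> \<and> Im \<omega> < 2 * pi}" "\<lambda>\<omega>. Re (- r \<omega>)" "\<i> * of_real pi"])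
      show "connected {\<omega>. pi / 2 \<le> Im \<omega> \<and> Im \<omega> < 2 * pi}"
        using convex_Int[OF convex_halfspace_Im_ge[of "pi / 2"] convex_halfspace_Im_lt[of "2 * pi"]]
        by (intro convex_connected) (simp add: Collect_conj_eq)
      show "continuous_on {\<omega>. pi / 2 \<le> Im \<omega> \<and> Im \<omega> < 2 * pi} (\<lambda>\<omega>. Re (- r \<omega>))"
        using continuous_on_minus[OF continuous_on_subset[OF contr]] \<beta>_pos pi_gt_zero by (simp add: subset_iff)
      show "Re (- r x) \<noteq> 0" if "x \<in> {\<omega>. pi / 2 \<le> Im \<omega> \<and> Im \<omega> < 2 * pi}" for x
        using that phase_not_nonpos_upper[of x] \<beta>_pos pi_gt_zero Re_nz[of x] by auto
      have "k * (pi - \<beta>) * Re (q (\<i> * of_real (pi - \<beta>))) > 0"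
        using q_axis[of "pi - \<beta>"] \<beta>_pos \<beta>_less pi_gt_zero k by (intro mult_pos_pos) auto
      then show "Re (- r (\<i> * of_real pi)) > 0"
      proof -
        have "Re (r (\<i> * of_real pi)) = k * (\<beta> - pi) * Re (q (\<i> * of_real (pi - \<beta>)))"
          using r_axis[of pi] \<beta>_pos \<beta>_less pi_gt_zero by (metis Re_complex_of_real add.inverse_neutral less_trans mult_2 neg_less_iff_less less_add_same_cancel1)
        moreover have "k * (\<beta> - pi) * X = - (k * (pi - \<beta>) * X)" for X by (simp add: algebra_simps)
        ultimately show ?thesis using \<open>k * (pi - \<beta>) * Re (q (\<i> * of_real (pi - \<beta>))) > 0\<close> by simp
      qed
    qed (use \<omega> pi_gt_zero in auto)
    then have "csqrt ((- r \<omega>) ^ 2) = - r \<omega>" by (intro csqrt_square) auto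
    moreover have "\<omega> \<in> strip" using \<omega> \<beta>_pos pi_gt_zero by auto
    ultimately show ?thesis using r2[of \<omega>] by simp
  qed
  show ?thesis
    by (rule that[of r q]) (use r r2 lower upper q q1 q2 qn in \<open>auto simp: r_def k_def\<close>)
qed

text \<open>The growth of \<open>sinh\<close> outweighs all other terms, uniformly in the height;
  any constant below 1/2 would serve in place of 1/8.\<close>

lemma norm_phase_growth:
  obtains S where "S > 0" "\<And>\<sigma> \<gamma>. \<bar>\<sigma>\<bar> \<ge> S \<Longrightarrow> - \<beta> \<le> \<gamma> \<Longrightarrow> \<gamma> \<le> 2 * pi \<Longrightarrow>
      norm (phase (of_real \<sigma> + \<i> * of_real \<gamma>)) \<ge> exp \<bar>\<sigma>\<bar> / 8"
proof -
  have "eventually (\<lambda>x::real. sinh x - x - (2 * pi + lag) \<ge> exp x / 8) at_top"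
    unfolding sinh_field_def by real_asymp
  then obtain S0 where S0: "\<And>x. x \<ge> S0 \<Longrightarrow> sinh x - x - (2 * pi + lag) \<ge> exp x / 8"
    by (auto simp: eventually_at_top_linorder)
  have main: "norm (phase (of_real \<sigma> + \<i> * of_real \<gamma>)) \<ge> exp \<bar>\<sigma>\<bar> / 8"
    if "\<bar>\<sigma>\<bar> \<ge> max S0 1" "- \<beta> \<le> \<gamma>" "\<gamma> \<le> 2 * pi" for \<sigma> \<gamma>
  proof -
    define \<omega> where "\<omega> = of_real \<sigma> + \<i> * of_real \<gamma>"
    have "norm (sinh \<omega>) \<ge> sinh \<bar>\<sigma>\<bar>"
    proof -
      have "norm (exp \<omega> - exp (- \<omega>)) \<ge> \<bar>norm (exp \<omega>) - norm (exp (- \<omega>))\<bar>" by (rule norm_triangle_ineq3)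
      then have "norm (exp \<omega> - exp (- \<omega>)) \<ge> \<bar>exp \<sigma> - exp (- \<sigma>)\<bar>" by (simp add: \<omega>_def)
      moreover have "\<bar>exp \<sigma> - exp (- \<sigma>)\<bar> \<ge> exp \<bar>\<sigma>\<bar> - exp (- \<bar>\<sigma>\<bar>)" by (cases "\<sigma> \<ge> 0") auto
      ultimately show ?thesis by (simp add: sinh_field_def norm_divide)
    qed
    moreover have "norm (sinh \<omega> / of_real (cos \<beta>)) \<ge> norm (sinh \<omega>)"
    proof -
      have "norm (sinh \<omega>) * cos \<beta> \<le> norm (sinh \<omega>) * 1" by (intro mult_left_mono) auto
      then show ?thesis using cos_\<beta> by (simp add: norm_divide pos_le_divide_eq)
    qed
    moreover have "norm \<omega> \<le> \<bar>\<sigma>\<bar> + 2 * pi"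
    proof -
      have "norm \<omega> \<le> \<bar>\<sigma>\<bar> + \<bar>\<gamma>\<bar>" unfolding \<omega>_def by (rule norm_triangle_le) (simp add: norm_mult)
      then show ?thesis using that \<beta>_less pi_gt_zero by auto
    qed
    moreover have "norm (phase \<omega>) \<ge> norm (sinh \<omega> / of_real (cos \<beta>)) - norm \<omega> - lag"
    proof -
      have "norm (sinh \<omega> / of_real (cos \<beta>)) - norm \<omega> \<le> norm (\<i> * (sinh \<omega> / of_real (cos \<beta>) - \<omega>))"
        unfolding norm_mult by (simp add: norm_triangle_ineq2)
      also have "\<dots> \<le> norm (phase \<omega>) + norm (of_real lag :: complex)"
        using norm_triangle_ineq4[of "phase \<omega>" "of_real lag"] by (simp add: phase_def)
      finally show ?thesis using lag_pos by simp
    qed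
    ultimately show ?thesis using S0[of "\<bar>\<sigma>\<bar>"] that unfolding \<omega>_def[symmetric] by linarith
  qed
  show ?thesis by (rule that[of "max S0 1"]) (use main in auto)
qed

end

section \<open>Laplace transforms with algebraic weights\<close>

lemma integral_powr_exp:
  fixes s x :: real assumes s: "s > 0" and x: "x > 0"
  shows "set_integrable lborel {0<..} (\<lambda>t. t powr (x - 1) * exp (- t * s))"
    and "(LINT t:{0<..}|lborel. t powr (x - 1) * exp (- t * s)) = Gamma x / s powr x"
proof -
  define f where "f = (\<lambda>t::real. indicat_real {0..} t *\<^sub>R (t powr (x - 1) / exp t))"
  have "(\<lambda>t. t powr (x - 1) / exp t) absolutely_integrable_on {0..}"
    using Gamma_integral_real[OF x] by (intro nonnegative_absolutely_integrable_1) (auto simp: integrable_on_def)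
  then have si: "set_integrable lborel {0..} (\<lambda>t. t powr (x - 1) / exp t)"
    by (rule set_integrable_lborelI) auto
  then have fi: "integrable lborel f" by (simp add: f_def set_integrable_def)
  have "(LINT t:{0..}|lborel. t powr (x - 1) / exp t) = Gamma x"
    using set_borel_integral_eq_integral(2)[OF si] Gamma_integral_real[OF x] by (simp add: integral_unique)
  then have fG: "(LINT t|lborel. f t) = Gamma x" by (simp add: f_def set_lebesgue_integral_def)
  have eq: "f (0 + s * t) = s powr (x - 1) * (indicat_real {0<..} t *\<^sub>R (t powr (x - 1) * exp (- t * s)))" for t
  proof (cases "t > 0")
    case True
    then show ?thesis using s by (simp add: f_def powr_mult exp_minus field_simps)
  next
    case False
    then show ?thesis using s by (cases "t = 0") (auto simp: f_def indicator_def zero_le_mult_iff)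
  qed
  have sp: "s powr (x - 1) > 0" using s by simp
  have "integrable lborel (\<lambda>t. f (0 + s * t))" using fi s by (intro lborel_integrable_real_affine) auto
  then have "integrable lborel (\<lambda>t. s powr (x - 1) * (indicat_real {0<..} t *\<^sub>R (t powr (x - 1) * exp (- t * s))))"
    unfolding eq .
  then show "set_integrable lborel {0<..} (\<lambda>t. t powr (x - 1) * exp (- t * s))"
    unfolding set_integrable_def using sp by simp
  have "Gamma x = s * (LINT t|lborel. f (0 + s * t))"
    using s fG by (subst (asm) lborel_integral_real_affine[of s f 0]) auto
  also have "\<dots> = s * s powr (x - 1) * (LINT t:{0<..}|lborel. t powr (x - 1) * exp (- t * s))"
    unfolding eq set_lebesgue_integral_def by simp
  also have "s * s powr (x - 1) = s powr x" using s by (simp add: powr_diff)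
  finally show "(LINT t:{0<..}|lborel. t powr (x - 1) * exp (- t * s)) = Gamma x / s powr x"
    using s by (simp add: field_simps)
qed

text \<open>One class for both weights in use, the powers \<open>t^(n - 1/2)\<close> and the
  rational weight \<open>t^(-1/2) / (1 + t / x)\<close>, so that holomorphy and Fubini are settled
  once.\<close>

definition laplace_weight :: "nat \<Rightarrow> (real \<Rightarrow> real) \<Rightarrow> bool" where
  "laplace_weight n w \<longleftrightarrow> w \<in> borel_measurable borel \<and> (\<forall>t>0. 0 \<le> w t \<and> w t \<le> t powr (real n - 1/2))"

definition laplace_int :: "(real \<Rightarrow> real) \<Rightarrow> complex \<Rightarrow> complex" where
  "laplace_int w z = (LINT t:{0<..}|lborel. of_real (w t) * exp (- of_real t * z))"

lemma laplace_weight_bound: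
  assumes w: "laplace_weight n w" and t: "t > 0" and z: "s \<le> Re z"
  shows "norm (of_real (w t) * exp (- of_real t * z)) \<le> t powr (real n + 1/2 - 1) * exp (- t * s)"
proof -
  have "norm (of_real (w t) * exp (- of_real t * z)) = w t * exp (- t * Re z)"
    using w t by (simp add: norm_mult laplace_weight_def)
  also have "\<dots> \<le> t powr (real n - 1/2) * exp (- t * s)"
    using w t z by (intro mult_mono) (auto simp: laplace_weight_def)
  finally show ?thesis by (simp add: algebra_simps)
qed

lemma laplace_weight_measurable:
  "laplace_weight n w \<Longrightarrow> w \<in> borel_measurable borel"
  by (simp add: laplace_weight_def)

lemma laplace_int_integrable:
  assumes w: "laplace_weight n w" and z: "Re z > 0"
  shows "set_integrable lborel {0<..} (\<lambda>t. of_real (w t) * exp (- of_real t * z))"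
  unfolding set_integrable_def
proof (rule Bochner_Integration.integrable_bound)
  show "integrable lborel (\<lambda>t. indicat_real {0<..} t *\<^sub>R (t powr (real n + 1/2 - 1) * exp (- t * Re z)))"
    using integral_powr_exp(1)[OF z, of "real n + 1/2"] by (simp add: set_integrable_def)
  have [measurable]: "w \<in> borel_measurable borel" using w by (rule laplace_weight_measurable)
  show "(\<lambda>t. indicat_real {0<..} t *\<^sub>R (of_real (w t) * exp (- of_real t * z))) \<in> borel_measurable lborel"
    by measurable
  show "AE t in lborel. norm (indicat_real {0<..} t *\<^sub>R (of_real (w t) * exp (- of_real t * z)))
      \<le> norm (indicat_real {0<..} t *\<^sub>R (t powr (real n + 1/2 - 1) * exp (- t * Re z)))"
    using laplace_weight_bound[OF w _ order_refl, of _ z] by (intro AE_I2) (auto simp: indicator_def)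
qed

lemma holomorphic_laplace_int:
  assumes w: "laplace_weight n w"
  shows "laplace_int w holomorphic_on {z. Re z > 0}"
proof -
  have [measurable]: "w \<in> borel_measurable borel" using w by (rule laplace_weight_measurable)
  have "(\<lambda>z. LINT t|lborel. indicat_real {0<..} t *\<^sub>R (of_real (w t) * exp (- of_real t * z))) holomorphic_on {z. Re z > 0}"
  proof (rule holomorphic_on_integral)
    show "open {z. Re z > 0}" by (simp add: open_halfspace_Re_gt)
    show "(\<lambda>z. indicat_real {0<..} x *\<^sub>R (of_real (w x) * exp (- of_real x * z))) holomorphic_on {z. Re z > 0}" for x
      unfolding scaleR_conv_of_real by (intro holomorphic_intros)
    fix z :: complex assume z: "z \<in> {z. Re z > 0}"
    show "(\<lambda>t. indicat_real {0<..} t *\<^sub>R (of_real (w t) * exp (- of_real t * z))) \<in> borel_measurable lborel"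
      by measurable
    define s where "s = Re z / 2"
    have s: "s > 0" using z by (simp add: s_def)
    define g where "g = (\<lambda>t. indicat_real {0<..} t *\<^sub>R (t powr (real n + 1/2 - 1) * exp (- t * s)))"
    have Re: "s \<le> Re u" if "u \<in> cball z s" for u
    proof -
      have "\<bar>Re (z - u)\<bar> \<le> s" using abs_Re_le_cmod[of "z - u"] that by (simp add: dist_norm)
      then have "Re z - Re u \<le> s" by simp
      then show ?thesis by (simp add: s_def)
    qed
    have "integrable lborel g"
      using integral_powr_exp(1)[OF s, of "real n + 1/2"] by (simp add: set_integrable_def g_def)
    moreover have "norm (indicat_real {0<..} t *\<^sub>R (of_real (w t) * exp (- of_real t * u))) \<le> g t" if "u \<in> cball z s" for u t
      using laplace_weight_bound[OF w _ Re[OF that], of t] by (auto simp: g_def indicator_def)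
    moreover have "cball z s \<subseteq> {z. Re z > 0}" using Re s by force
    ultimately show "\<exists>\<rho>>0. \<exists>g. cball z \<rho> \<subseteq> {z. Re z > 0} \<and> integrable lborel g \<and>
        (\<forall>u\<in>cball z \<rho>. \<forall>t\<in>space lborel. norm (indicat_real {0<..} t *\<^sub>R (of_real (w t) * exp (- of_real t * u))) \<le> g t)"
      using s by blast
  qed
  then show ?thesis by (simp add: laplace_int_def[abs_def] set_lebesgue_integral_def)
qed

lemma holomorphic_csqrt_right: "csqrt holomorphic_on {z. Re z > 0}"
  by (rule holomorphic_on_subset[OF holomorphic_on_csqrt]) (auto simp: complex_nonpos_Reals_iff)

lemma laplace_int_of_real:
  "laplace_int w (of_real s) = of_real (LINT t:{0<..}|lborel. w t * exp (- t * s))"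
proof -
  have "laplace_int w (of_real s) = (LINT t|lborel. of_real (indicat_real {0<..} t *\<^sub>R (w t * exp (- t * s))))"
    unfolding laplace_int_def set_lebesgue_integral_def
    by (intro Bochner_Integration.integral_cong refl)
       (simp add: scaleR_conv_of_real flip: exp_of_real)
  then show ?thesis by (simp add: set_lebesgue_integral_def del: of_real_mult)
qed

lemma laplace_weight_powr: "laplace_weight n (\<lambda>t. t powr (real n - 1/2))"
  by (simp add: laplace_weight_def)

text \<open>For real arguments this is Euler's integral with the positive root; \<open>csqrt\<close>
  continues that root to the right half plane.\<close>

lemma laplace_int_powr:
  assumes "Re z > 0"
  shows "laplace_int (\<lambda>t. t powr (real n - 1/2)) z = of_real (Gamma (real n + 1/2)) / csqrt z ^ (2 * n + 1)"
proof (rule holomorphic_eq_on_right_half_plane[OF holomorphic_laplace_int[OF laplace_weight_powr[of n]] _ _ assms])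
  show "(\<lambda>z. of_real (Gamma (real n + 1/2)) / csqrt z ^ (2 * n + 1)) holomorphic_on {z. Re z > 0}"
    by (intro holomorphic_intros holomorphic_csqrt_right) auto
  fix s :: real assume s: "s > 0"
  have e: "real n - 1/2 = (real n + 1/2) - 1" by simp
  have "(LINT t:{0<..}|lborel. t powr (real n - 1/2) * exp (- t * s)) = Gamma (real n + 1/2) / s powr (real n + 1/2)"
    unfolding e by (rule integral_powr_exp(2)[OF s]) simp
  moreover have "s powr (real n + 1/2) = sqrt s ^ (2 * n + 1)"
  proof -
    have "sqrt s ^ (2 * n + 1) = (s powr (1/2)) powr real (2 * n + 1)"
      using s by (subst powr_realpow) (auto simp: powr_half_sqrt)
    also have "\<dots> = s powr (real n + 1/2)" by (simp add: powr_powr field_simps)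
    finally show ?thesis by simp
  qed
  ultimately show "laplace_int (\<lambda>t. t powr (real n - 1/2)) (of_real s)
      = of_real (Gamma (real n + 1/2)) / csqrt (of_real s) ^ (2 * n + 1)"
    using s by (simp add: laplace_int_of_real csqrt_of_real_nonneg)
qed

text \<open>\<open>2 x \<surd>\<pi> \<integral> exp (- x r\<^sup>2 - 2 x u r) dr = \<pi> \<surd>x exp (x u\<^sup>2) erfc (u \<surd>x)\<close>, written so that it is visibly entire.\<close>

definition erfc_like :: "real \<Rightarrow> complex \<Rightarrow> complex" where
  "erfc_like x u = of_real (2 * x * sqrt pi) * (LINT r:{0..}|lborel. exp (- of_real (x * r ^ 2) - of_real (2 * x * r) * u))"

text \<open>The exponent of the constant is the maximum of
  \<open>(1 + 2 * x * R) * r - x * r ^ 2\<close>, found by completing the square; the summand 1 in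
  it is what leaves the factor \<open>exp (- r)\<close>.\<close>

lemma erfc_kernel_bound:
  fixes u :: complex
  assumes x: "x > 0" and r: "r \<ge> 0" and u: "norm u \<le> R"
  shows "norm (exp (- of_real (x * r ^ 2) - of_real (2 * x * r) * u)) \<le> exp ((1 + 2 * x * R) ^ 2 / (4 * x)) * exp (- r)"
proof -
  have "- Re u \<le> R" using abs_Re_le_cmod[of u] u by linarith
  then have "2 * x * r * (- Re u) \<le> 2 * x * r * R" using x r by (intro mult_left_mono) auto
  then have "- (2 * x * r * Re u) \<le> 2 * x * r * R" by simp
  moreover have "- (x * r ^ 2) + 2 * x * r * R \<le> (1 + 2 * x * R) ^ 2 / (4 * x) - r"
  proof -
    have "0 \<le> (2 * x * r - (1 + 2 * x * R)) ^ 2 / (4 * x)" using x by simp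
    also have "\<dots> = (1 + 2 * x * R) ^ 2 / (4 * x) - r - (- (x * r ^ 2) + 2 * x * r * R)"
      using x by (simp add: field_simps power2_eq_square)
    finally show ?thesis by simp
  qed
  ultimately have "- (x * r ^ 2) - 2 * x * r * Re u \<le> (1 + 2 * x * R) ^ 2 / (4 * x) - r" by linarith
  then show ?thesis by (simp flip: exp_add)
qed

lemma erfc_kernel_integrable:
  fixes u :: complex
  assumes x: "x > 0"
  shows "set_integrable lborel {0..} (\<lambda>r. exp (- of_real (x * r ^ 2) - of_real (2 * x * r) * u))"
  unfolding set_integrable_def
proof (rule Bochner_Integration.integrable_bound)
  let ?C = "exp ((1 + 2 * x * norm u) ^ 2 / (4 * x))"
  show "integrable lborel (\<lambda>r. ?C * (indicat_real {0..} r *\<^sub>R exp (- r)))"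
    using set_integrable_exp_neg unfolding set_integrable_def by (rule integrable_mult_right)
  have [measurable]: "(\<lambda>r::real. exp (- of_real (x * r ^ 2) - of_real (2 * x * r) * u)) \<in> borel_measurable borel"
    by (intro borel_measurable_continuous_onI continuous_intros)
  show "(\<lambda>r. indicat_real {0..} r *\<^sub>R exp (- of_real (x * r ^ 2) - of_real (2 * x * r) * u)) \<in> borel_measurable lborel"
    by measurable
  show "AE r in lborel. norm (indicat_real {0..} r *\<^sub>R exp (- of_real (x * r ^ 2) - of_real (2 * x * r) * u))
      \<le> norm (?C * (indicat_real {0..} r *\<^sub>R exp (- r)))"
    using erfc_kernel_bound[OF x _ order_refl, of _ u] by (intro AE_I2) (auto simp: indicator_def)
qed

lemma holomorphic_erfc_like:
  assumes x: "x > 0" shows "erfc_like x holomorphic_on A"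
proof -
  have "(\<lambda>u. LINT r|lborel. indicat_real {0..} r *\<^sub>R exp (- of_real (x * r ^ 2) - of_real (2 * x * r) * u)) holomorphic_on UNIV"
  proof (rule holomorphic_on_integral)
    show "(\<lambda>u. indicat_real {0..} r *\<^sub>R exp (- of_real (x * r ^ 2) - of_real (2 * x * r) * u)) holomorphic_on UNIV" for r
      unfolding scaleR_conv_of_real by (intro holomorphic_intros)
    fix z :: complex
    have [measurable]: "(\<lambda>r::real. exp (- of_real (x * r ^ 2) - of_real (2 * x * r) * z)) \<in> borel_measurable borel"
      by (intro borel_measurable_continuous_onI continuous_intros)
    show "(\<lambda>r. indicat_real {0..} r *\<^sub>R exp (- of_real (x * r ^ 2) - of_real (2 * x * r) * z)) \<in> borel_measurable lborel"
      by measurable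
    let ?C = "exp ((1 + 2 * x * (norm z + 1)) ^ 2 / (4 * x))"
    have "integrable lborel (\<lambda>r. ?C * (indicat_real {0..} r *\<^sub>R exp (- r)))"
      using set_integrable_exp_neg unfolding set_integrable_def by (rule integrable_mult_right)
    moreover have "norm (indicat_real {0..} r *\<^sub>R exp (- of_real (x * r ^ 2) - of_real (2 * x * r) * u)) \<le> ?C * (indicat_real {0..} r *\<^sub>R exp (- r))"
      if "u \<in> cball z 1" for u r
    proof -
      have "norm u \<le> norm z + 1" using norm_triangle_ineq2[of u z] that by (simp add: dist_norm norm_minus_commute)
      then show ?thesis using erfc_kernel_bound[OF x, of r u] by (auto simp: indicator_def)
    qed
    ultimately show "\<exists>\<rho>>0. \<exists>w. cball z \<rho> \<subseteq> UNIV \<and> integrable lborel w \<and>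
        (\<forall>u\<in>cball z \<rho>. \<forall>r\<in>space lborel. norm (indicat_real {0..} r *\<^sub>R exp (- of_real (x * r ^ 2) - of_real (2 * x * r) * u)) \<le> w r)"
      by (intro exI[of _ 1] conjI exI[of _ "\<lambda>r. ?C * (indicat_real {0..} r *\<^sub>R exp (- r))"]) auto
  qed auto
  then have "erfc_like x holomorphic_on UNIV"
    unfolding erfc_like_def[abs_def] set_lebesgue_integral_def by (intro holomorphic_intros)
  then show ?thesis by (rule holomorphic_on_subset) auto
qed

lemma gaussian_integral:
  fixes x :: real assumes x: "x > 0"
  shows "integrable lborel (\<lambda>r. exp (- (x * r ^ 2)))" and "(LINT r|lborel. exp (- (x * r ^ 2))) = sqrt (pi / x)"
proof -
  have k: "sqrt x \<noteq> 0" using x by simp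
  have eq: "exp (- (0 + sqrt x * r)\<^sup>2) = exp (- (x * r ^ 2))" for r :: real
    using x by (simp add: power_mult_distrib)
  have g: "has_bochner_integral lborel (\<lambda>r::real. exp (- r\<^sup>2)) (sqrt pi)"
    using has_bochner_integral_even_function[OF gaussian_moment_0] by simp
  from lborel_integrable_real_affine[OF integrable.intros[OF g] k, of 0]
  show "integrable lborel (\<lambda>r. exp (- (x * r ^ 2)))" unfolding eq .
  have "sqrt pi = sqrt x * (LINT r|lborel. exp (- (0 + sqrt x * r)\<^sup>2))"
    using lborel_integral_real_affine[OF k, of "\<lambda>r. exp (- r\<^sup>2)" 0] has_bochner_integral_integral_eq[OF g] x by simp
  then show "(LINT r|lborel. exp (- (x * r ^ 2))) = sqrt (pi / x)"
    unfolding eq using x by (simp add: real_sqrt_divide field_simps)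
qed

lemma erfc_like_of_real:
  "erfc_like x (of_real u) = of_real (2 * x * sqrt pi * (LINT r:{0..}|lborel. exp (- (x * r ^ 2) - 2 * x * r * u)))"
proof -
  have "(LINT r:{0..}|lborel. exp (- of_real (x * r ^ 2) - of_real (2 * x * r) * of_real u :: complex))
      = (LINT r|lborel. of_real (indicat_real {0..} r *\<^sub>R exp (- (x * r ^ 2) - 2 * x * r * u)))"
    unfolding set_lebesgue_integral_def
    by (intro Bochner_Integration.integral_cong refl) (simp add: scaleR_conv_of_real flip: exp_of_real)
  also have "\<dots> = of_real (LINT r:{0..}|lborel. exp (- (x * r ^ 2) - 2 * x * r * u))"
    unfolding set_lebesgue_integral_def by (rule integral_complex_of_real)
  finally show ?thesis by (simp only: erfc_like_def of_real_mult)
qed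

lemma erfc_kernel_integrable_real:
  fixes u :: real
  assumes x: "x > 0"
  shows "set_integrable lborel {0..} (\<lambda>r. exp (- (x * r ^ 2) - 2 * x * r * u))"
proof -
  have "integrable lborel (\<lambda>r. Re (indicat_real {0..} r *\<^sub>R exp (- of_real (x * r ^ 2) - of_real (2 * x * r) * of_real u)))"
    using erfc_kernel_integrable[OF x, of "of_real u"] unfolding set_integrable_def by (rule integrable_Re)
  moreover have "Re (indicat_real {0..} r *\<^sub>R exp (- of_real (x * r ^ 2) - of_real (2 * x * r) * of_real u))
     = indicat_real {0..} r *\<^sub>R exp (- (x * r ^ 2) - 2 * x * r * u)" for r
    by (simp add: Re_exp)
  ultimately show ?thesis unfolding set_integrable_def by (simp only:)
qed

text \<open>The value at \<open>- u\<close> is the same Gaussian integral taken over the negative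
  half line. Together the two run over the whole line, where completing the square gives the closed
  form.\<close>

lemma erfc_like_reflection_real:
  fixes u :: real
  assumes x: "x > 0"
  shows "erfc_like x (of_real u) + erfc_like x (- of_real u) = of_real (2 * pi * sqrt x) * exp (of_real (x * u ^ 2))"
proof -
  define f where "f = (\<lambda>r. exp (- (x * r ^ 2) - 2 * x * r * u))"
  have i1: "set_integrable lborel {0..} f" unfolding f_def by (rule erfc_kernel_integrable_real[OF x])
  have refl: "(LINT r:{0..}|lborel. exp (- (x * r ^ 2) - 2 * x * r * - u)) = (LINT r:{..0}|lborel. f r)"
  proof -
    have "(LINT r:{..0}|lborel. f r) = (LINT r|lborel. indicat_real {..0} (0 + (-1) * r) *\<^sub>R f (0 + (-1) * r))"
      unfolding set_lebesgue_integral_def by (subst lborel_integral_real_affine[of "-1" _ 0]) auto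
    also have "\<dots> = (LINT r:{0..}|lborel. exp (- (x * r ^ 2) - 2 * x * r * - u))"
      unfolding set_lebesgue_integral_def by (intro Bochner_Integration.integral_cong) (auto simp: indicator_def f_def)
    finally show ?thesis by simp
  qed
  have i2: "set_integrable lborel {..<0} f"
  proof -
    have "set_integrable lborel {0..} (\<lambda>r. exp (- (x * r ^ 2) - 2 * x * r * (- u)))"
      by (rule erfc_kernel_integrable_real[OF x])
    then have "integrable lborel (\<lambda>r. indicat_real {0..} (0 + (-1) * r) *\<^sub>R exp (- (x * (0 + (-1) * r) ^ 2) - 2 * x * (0 + (-1) * r) * (- u)))"
      unfolding set_integrable_def by (rule lborel_integrable_real_affine) auto
    then have "set_integrable lborel {..0} f"
      unfolding set_integrable_def
      by (rule Bochner_Integration.integrable_cong[THEN iffD1, rotated 2]) (auto simp: indicator_def f_def)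
    then show ?thesis by (rule set_integrable_subset) auto
  qed
  have "(LINT r:{..0}|lborel. f r) = (LINT r:{..<0}|lborel. f r)"
    by (rule set_integral_discrete_difference[where X = "{0}"]) auto
  then have "(LINT r:{0..}|lborel. f r) + (LINT r:{..0}|lborel. f r) = (LINT r:{..<0} \<union> {0..}|lborel. f r)"
    using i1 i2 by (subst set_integral_Un) auto
  also have "{..<0} \<union> {0..} = (UNIV :: real set)" by auto
  also have "(LINT r:UNIV|lborel. f r) = (LINT r|lborel. f r)" by (simp add: set_lebesgue_integral_def)
  also have "\<dots> = (LINT r|lborel. f (- u + 1 * r))"
    by (subst lborel_integral_real_affine[of 1 _ "- u"]) auto
  also have "\<dots> = (LINT r|lborel. exp (x * u ^ 2) * exp (- (x * r ^ 2)))"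
    by (intro Bochner_Integration.integral_cong) (auto simp: f_def power2_eq_square algebra_simps simp flip: exp_add)
  also have "\<dots> = exp (x * u ^ 2) * sqrt (pi / x)" using gaussian_integral[OF x] by simp
  finally have "(LINT r:{0..}|lborel. f r) + (LINT r:{0..}|lborel. exp (- (x * r ^ 2) - 2 * x * r * - u)) = exp (x * u ^ 2) * sqrt (pi / x)"
    unfolding refl .
  moreover have "2 * x * sqrt pi * (exp (x * u ^ 2) * sqrt (pi / x)) = 2 * pi * sqrt x * exp (x * u ^ 2)"
    using x by (simp add: real_sqrt_divide field_simps)
  moreover have "erfc_like x (of_real u) + erfc_like x (of_real (- u)) = of_real (2 * x * sqrt pi * ((LINT r:{0..}|lborel. f r) +
      (LINT r:{0..}|lborel. exp (- (x * r ^ 2) - 2 * x * r * - u))))"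
    unfolding erfc_like_of_real f_def by (simp add: algebra_simps)
  ultimately have "erfc_like x (of_real u) + erfc_like x (of_real (- u)) = of_real (2 * pi * sqrt x * exp (x * u ^ 2))" by metis
  then show ?thesis by (simp flip: exp_of_real)
qed

lemma erfc_like_reflection:
  assumes x: "x > 0"
  shows "erfc_like x u + erfc_like x (- u) = of_real (2 * pi * sqrt x) * exp (of_real x * u ^ 2)"
proof -
  let ?f = "\<lambda>u. erfc_like x u + erfc_like x (- u) - of_real (2 * pi * sqrt x) * exp (of_real x * u ^ 2)"
  have "(erfc_like x \<circ> uminus) holomorphic_on UNIV"
    by (intro holomorphic_on_compose holomorphic_erfc_like x holomorphic_intros)
  then have hol: "?f holomorphic_on UNIV"
    using holomorphic_erfc_like[OF x] by (intro holomorphic_intros) (simp_all add: o_def)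
  have "?f u = 0"
  proof (rule analytic_continuation[OF hol, of "range of_real" 0])
    show "(0::complex) islimpt range of_real"
      unfolding islimpt_approachable
    proof (intro allI impI)
      fix e :: real assume "e > 0"
      then show "\<exists>x'\<in>range complex_of_real. x' \<noteq> 0 \<and> dist x' 0 < e"
        by (intro bexI[of _ "of_real (e/2)"] rangeI) auto
    qed
    fix z :: complex assume "z \<in> range of_real"
    then obtain v :: real where z: "z = of_real v" by auto
    show "?f z = 0" unfolding z using erfc_like_reflection_real[OF x, of v] by simp
  qed auto
  then show ?thesis by simp
qed

text \<open>Integration by parts gives the decay on the closed right half plane; the reflection formula
  then controls the left half plane.\<close>

lemma norm_erfc_like_right:
  assumes x: "x > 0" and u: "Re u \<ge> 0" "u \<noteq> 0"
  shows "norm (erfc_like x u) \<le> 2 * sqrt pi / norm u"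
proof -
  define k where "k = (\<lambda>r::real. exp (- of_real (x * r ^ 2) - of_real (2 * x * r) * u))"
  have ki: "set_integrable lborel {0..} k" unfolding k_def by (rule erfc_kernel_integrable[OF x])
  have kn: "norm (k r) \<le> exp (- (x * r ^ 2))" if "r \<ge> 0" for r
    using x u that by (simp add: k_def)
  \<comment> \<open>\<open>w\<close> is the derivative of \<open>- exp (- (x * r ^ 2))\<close> and
    so has total mass 1; it dominates the integrand that integration by parts leaves behind.\<close>
  define w where "w = (\<lambda>r. 2 * x * r * exp (- (x * r ^ 2)))"
  have wi: "set_integrable lborel {0..} w"
    unfolding set_integrable_def
  proof (rule Bochner_Integration.integrable_bound)
    \<comment> \<open>With \<open>u = - 1 / (2 * x)\<close> the kernel is
      \<open>exp (- (x * r ^ 2) + r)\<close>, and \<open>r \<le> exp r\<close> compares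
      \<open>w\<close> with it.\<close>
    have "set_integrable lborel {0..} (\<lambda>r. exp (- (x * r ^ 2) - 2 * x * r * (- 1 / (2 * x))))"
      by (rule erfc_kernel_integrable_real[OF x])
    then show "integrable lborel (\<lambda>r. 2 * x * (indicat_real {0..} r *\<^sub>R exp (- (x * r ^ 2) - 2 * x * r * (- 1 / (2 * x)))))"
      unfolding set_integrable_def by (rule integrable_mult_right)
    have [measurable]: "w \<in> borel_measurable borel"
      unfolding w_def by (intro borel_measurable_continuous_onI continuous_intros)
    show "(\<lambda>r. indicat_real {0..} r *\<^sub>R w r) \<in> borel_measurable lborel" by measurable
    have "w r \<le> 2 * x * exp (- (x * r ^ 2) - 2 * x * r * (- 1 / (2 * x)))" "w r \<ge> 0" if "r \<ge> 0" for r
    proof -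
      have "r \<le> exp r" using exp_ge_add_one_self[of r] by linarith
      then have "r * exp (- (x * r ^ 2)) \<le> exp r * exp (- (x * r ^ 2))" by (intro mult_right_mono) auto
      then show "w r \<le> 2 * x * exp (- (x * r ^ 2) - 2 * x * r * (- 1 / (2 * x)))"
        using x by (simp add: w_def flip: exp_add)
      show "w r \<ge> 0" using x that by (simp add: w_def)
    qed
    then show "AE r in lborel. norm (indicat_real {0..} r *\<^sub>R w r)
        \<le> norm (2 * x * (indicat_real {0..} r *\<^sub>R exp (- (x * r ^ 2) - 2 * x * r * (- 1 / (2 * x)))))"
      using x by (intro AE_I2) (auto simp: indicator_def)
  qed
  have wci: "set_integrable lborel {0..} (\<lambda>r. complex_of_real (w r))"
    using wi unfolding set_integrable_def by (simp add: scaleR_conv_of_real flip: of_real_mult)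
  have lim: "((\<lambda>r. exp (- (x * r ^ 2))) \<longlongrightarrow> 0) at_top" using x by real_asymp
  have "(LINT r:{0..}|lborel. complex_of_real (w r)) = of_real (- 0) - of_real (- exp (- (x * 0 ^ 2)))"
  proof (rule integral_Ici_vector_derivative)
    fix r :: real
    have "((\<lambda>r. - exp (- (x * r ^ 2))) has_real_derivative w r) (at r)"
      unfolding w_def by (auto intro!: derivative_eq_intros)
    then show "((\<lambda>r. complex_of_real (- exp (- (x * r ^ 2)))) has_vector_derivative of_real (w r)) (at r)"
      by (intro has_vector_derivative_of_real) (simp add: has_real_derivative_iff_has_vector_derivative)
    show "continuous_on UNIV (\<lambda>r. complex_of_real (w r))" unfolding w_def by (intro continuous_intros)
    show "((\<lambda>r. complex_of_real (- exp (- (x * r ^ 2)))) \<longlongrightarrow> of_real (- 0)) at_top"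
      by (intro tendsto_of_real tendsto_minus lim)
  qed (rule wci)
  then have w1: "(LINT r:{0..}|lborel. w r) = 1"
    by (simp add: set_lebesgue_integral_def scaleR_conv_of_real flip: of_real_mult)
  have d: "set_integrable lborel {0..} (\<lambda>r. of_real (2 * x * r) * k r)"
    unfolding set_integrable_def
  proof (rule Bochner_Integration.integrable_bound[OF wi[unfolded set_integrable_def]])
    have [measurable]: "(\<lambda>r. of_real (2 * x * r) * k r) \<in> borel_measurable borel"
      unfolding k_def by (intro borel_measurable_continuous_onI continuous_intros)
    show "(\<lambda>r. indicat_real {0..} r *\<^sub>R (of_real (2 * x * r) * k r)) \<in> borel_measurable lborel" by measurable
    have "norm (of_real (2 * x * r) * k r) \<le> w r" if "r \<ge> 0" for r
      using mult_left_mono[OF kn[OF that], of "2 * x * r"] x that by (simp add: norm_mult w_def)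
    then show "AE r in lborel. norm (indicat_real {0..} r *\<^sub>R (of_real (2 * x * r) * k r)) \<le> norm (indicat_real {0..} r *\<^sub>R w r)"
      by (intro AE_I2) (auto simp: indicator_def intro: order_trans[OF _ abs_ge_self])
  qed
  have I: "(LINT r:{0..}|lborel. - (of_real (2 * x * r) * k r) - of_real (2 * x) * u * k r) = 0 - k 0"
  proof (rule integral_Ici_vector_derivative)
    fix r :: real
    have "((\<lambda>r. exp (- of_real x * r ^ 2 - 2 * of_real x * r * u)) has_field_derivative
        (- (2 * of_real x * of_real r * exp (- of_real x * of_real r ^ 2 - 2 * of_real x * of_real r * u))
          - 2 * of_real x * u * exp (- of_real x * of_real r ^ 2 - 2 * of_real x * of_real r * u))) (at (complex_of_real r))"
      by (auto intro!: derivative_eq_intros simp: algebra_simps)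
    then have "((\<lambda>r. exp (- of_real x * of_real r ^ 2 - 2 * of_real x * of_real r * u)) has_vector_derivative
        (- (2 * of_real x * of_real r * exp (- of_real x * of_real r ^ 2 - 2 * of_real x * of_real r * u))
          - 2 * of_real x * u * exp (- of_real x * of_real r ^ 2 - 2 * of_real x * of_real r * u))) (at r)"
      by (rule has_vector_derivative_real_field)
    then show "(k has_vector_derivative - (of_real (2 * x * r) * k r) - of_real (2 * x) * u * k r) (at r)"
      by (simp add: k_def)
    show "continuous_on UNIV (\<lambda>r. - (of_real (2 * x * r) * k r) - of_real (2 * x) * u * k r)"
      unfolding k_def by (intro continuous_intros)
    show "(k \<longlongrightarrow> 0) at_top"
      by (rule Lim_null_comparison[OF _ lim]) (use kn in \<open>auto intro!: eventually_at_top_linorderI[of 0]\<close>)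
  next
    show "set_integrable lborel {0..} (\<lambda>r. - (of_real (2 * x * r) * k r) - of_real (2 * x) * u * k r)"
      using d ki by (intro set_integral_diff set_integral_uminus set_integrable_mult_right) (auto simp: set_integrable_def)
  qed
  have "(LINT r:{0..}|lborel. - (of_real (2 * x * r) * k r) - of_real (2 * x) * u * k r)
      = - (LINT r:{0..}|lborel. of_real (2 * x * r) * k r) - of_real (2 * x) * u * (LINT r:{0..}|lborel. k r)"
  proof -
    have "set_integrable lborel {0..} (\<lambda>r. of_real (2 * x) * u * k r)" using ki by (intro set_integrable_mult_right)
    moreover have "set_integrable lborel {0..} (\<lambda>r. - (of_real (2 * x * r) * k r))" using d unfolding set_integrable_def by simp
    ultimately show ?thesis
      by (subst set_integral_diff(2)) (auto simp: set_lebesgue_integral_def)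
  qed
  then have "of_real (2 * x) * u * (LINT r:{0..}|lborel. k r) = 1 - (LINT r:{0..}|lborel. of_real (2 * x * r) * k r)"
    using I by (simp add: k_def algebra_simps)
  moreover have "norm (LINT r:{0..}|lborel. of_real (2 * x * r) * k r) \<le> 1"
  proof -
    have wb: "norm (indicat_real {0..} r *\<^sub>R (of_real (2 * x * r) * k r)) \<le> indicat_real {0..} r *\<^sub>R w r" for r
    proof (cases "r \<ge> 0")
      case True
      then show ?thesis using mult_left_mono[OF kn[OF True], of "2 * x * r"] x by (simp add: norm_mult w_def)
    qed simp
    have "norm (LINT r:{0..}|lborel. of_real (2 * x * r) * k r)
        \<le> (LINT r|lborel. norm (indicat_real {0..} r *\<^sub>R (of_real (2 * x * r) * k r)))"
      unfolding set_lebesgue_integral_def by (rule integral_norm_bound)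
    also have "\<dots> \<le> (LINT r:{0..}|lborel. w r)"
      unfolding set_lebesgue_integral_def
      by (rule integral_mono[OF integrable_norm[OF d[unfolded set_integrable_def]] wi[unfolded set_integrable_def] wb])
    finally have "norm (LINT r:{0..}|lborel. of_real (2 * x * r) * k r) \<le> (LINT r:{0..}|lborel. w r)" .
    then show ?thesis using w1 by simp
  qed
  ultimately have "norm (of_real (2 * x) * u * (LINT r:{0..}|lborel. k r)) \<le> 2"
    using norm_triangle_ineq4[of 1 "LINT r:{0..}|lborel. of_real (2 * x * r) * k r"] by simp
  then have "sqrt pi * norm (of_real (2 * x) * u * (LINT r:{0..}|lborel. k r)) \<le> sqrt pi * 2" by (intro mult_left_mono) auto
  moreover have "norm (erfc_like x u) * norm u = sqrt pi * norm (of_real (2 * x) * u * (LINT r:{0..}|lborel. k r))"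
    using x by (simp add: erfc_like_def k_def norm_mult)
  ultimately show ?thesis using u by (simp add: pos_le_divide_eq mult.commute)
qed

section \<open>The Laplace transform of the rational weight\<close>

lemma laplace_weight_rational: "x > 0 \<Longrightarrow> laplace_weight 0 (\<lambda>t. t powr (- 1/2) / (1 + t / x))"
  unfolding laplace_weight_def
proof (intro conjI allI impI)
  fix t :: real assume x: "x > 0" and t: "t > 0"
  then have 1: "1 \<le> 1 + t / x" by simp
  then show "0 \<le> t powr (- 1/2) / (1 + t / x)" by (intro divide_nonneg_nonneg) auto
  have "t powr (- 1/2) / (1 + t / x) \<le> t powr (- 1/2) / 1"
    using 1 by (intro divide_left_mono) auto
  then show "t powr (- 1/2) / (1 + t / x) \<le> t powr (real 0 - 1/2)" by simp
qed measurable

text \<open>With \<open>1 / (1 + t / x)\<close> written as the integral of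
  \<open>x * exp (- (x + t) * v)\<close> over \<open>v \<ge> 0\<close>, Tonelli's theorem leaves the
  \<open>t\<close>-integral of \<open>t^(-1/2) * exp (- t * (s + v))\<close>, which is
  \<open>sqrt pi / sqrt (s + v)\<close>. The substitution \<open>v = r^2 + 2 * r * sqrt s\<close>
  turns \<open>sqrt (s + v)\<close> into \<open>r + sqrt s\<close>, which cancels against its
  derivative.\<close>

lemma laplace_rational_real:
  fixes x s :: real
  assumes x: "x > 0" and s: "s > 0"
  shows "(LINT t:{0<..}|lborel. t powr (- 1/2) / (1 + t / x) * exp (- t * s))
     = 2 * x * sqrt pi * (LINT r:{0..}|lborel. exp (- (x * r ^ 2) - 2 * x * r * sqrt s))"
proof -
  define K where "K = (\<lambda>t v. indicat_real {0<..} t * (indicat_real {0..} v * (t powr (- 1/2) * exp (- t * s) * (x * exp (- (x + t) * v)))))"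
  define f where "f = (\<lambda>v. x * exp (- x * v) * (sqrt pi / sqrt (s + v)))"
  have Km [measurable]: "(\<lambda>(t, v). K t v) \<in> borel_measurable (lborel \<Otimes>\<^sub>M lborel)"
    unfolding K_def by measurable
  have K0: "K t v \<ge> 0" for t v using x by (auto simp: K_def indicator_def)
  have inner_v: "(\<integral>\<^sup>+v. ennreal (K t v) \<partial>lborel) = ennreal (indicat_real {0<..} t * (t powr (- 1/2) / (1 + t / x) * exp (- t * s)))" for t
  proof (cases "t > 0")
    case True
    have "((\<lambda>v. exp (- (x + t) * v)) has_integral exp (- (x + t) * 0) / (x + t)) {0..}"
      by (rule has_integral_exp_minus_to_infinity) (use x True in auto)
    from has_integral_mult_right[OF this, of "t powr (- 1/2) * exp (- t * s) * x"]
    have "((\<lambda>v. t powr (- 1/2) * exp (- t * s) * (x * exp (- (x + t) * v))) has_integral t powr (- 1/2) / (1 + t / x) * exp (- t * s)) {0..}"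
      using x True by (simp add: field_simps)
    from nn_integral_has_integral_lebesgue[OF _ this] show ?thesis
      using x True by (simp add: K_def)
  qed (simp add: K_def)
  have inner_t: "(\<integral>\<^sup>+t. ennreal (K t v) \<partial>lborel) = ennreal (indicat_real {0..} v * f v)" for v
  proof (cases "v \<ge> 0")
    case True
    have sv: "s + v > 0" using s True by simp
    have si: "set_integrable lborel {0<..} (\<lambda>t. t powr (1/2 - 1) * exp (- t * (s + v)))"
      and sI: "(LINT t:{0<..}|lborel. t powr (1/2 - 1) * exp (- t * (s + v))) = Gamma (1/2) / (s + v) powr (1/2)"
      using integral_powr_exp[OF sv, of "1/2"] by auto
    have Keq: "K t v = x * exp (- x * v) * (indicat_real {0<..} t *\<^sub>R (t powr (1/2 - 1) * exp (- t * (s + v))))" for t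
      using True by (simp add: K_def algebra_simps exp_add exp_diff exp_minus field_simps)
    have "integrable lborel (\<lambda>t. K t v)"
      unfolding Keq using si unfolding set_integrable_def by (rule integrable_mult_right)
    then have "(\<integral>\<^sup>+t. ennreal (K t v) \<partial>lborel) = ennreal (LINT t|lborel. K t v)"
      by (intro nn_integral_eq_integral) (use K0 in auto)
    also have "(LINT t|lborel. K t v) = x * exp (- x * v) * (Gamma (1/2) / (s + v) powr (1/2))"
      unfolding Keq sI[symmetric] set_lebesgue_integral_def by (rule integral_mult_right_zero)
    also have "\<dots> = f v" using sv by (simp add: f_def Gamma_one_half_real powr_half_sqrt)
    finally show ?thesis using True by simp
  qed (simp add: K_def)
  have "(\<integral>\<^sup>+t. \<integral>\<^sup>+v. ennreal (K t v) \<partial>lborel \<partial>lborel) = (\<integral>\<^sup>+v. \<integral>\<^sup>+t. ennreal (K t v) \<partial>lborel \<partial>lborel)"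
    by (rule lborel_pair.Fubini') measurable
  then have nn: "(\<integral>\<^sup>+t. ennreal (indicat_real {0<..} t * (t powr (- 1/2) / (1 + t / x) * exp (- t * s))) \<partial>lborel)
      = (\<integral>\<^sup>+v. ennreal (indicat_real {0..} v * f v) \<partial>lborel)"
    unfolding inner_v inner_t .
  define h where "h = (\<lambda>r. 2 * x * sqrt pi * exp (- (x * r ^ 2) - 2 * x * r * sqrt s))"
  have h0: "set_integrable lborel {0..} (\<lambda>r. exp (- (x * r ^ 2) - 2 * x * r * sqrt s))"
    by (rule erfc_kernel_integrable_real[OF x])
  have h1: "set_integrable lborel {0<..} h"
    unfolding h_def by (rule set_integrable_mult_right, rule set_integrable_subset[OF h0]) auto
  define g where "g = (\<lambda>r::real. r ^ 2 + 2 * r * sqrt s)"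
  have gs: "sqrt (s + g r) = r + sqrt s" if "r \<ge> 0" for r
  proof -
    have "s + g r = (r + sqrt s) ^ 2" using s by (simp add: g_def power2_eq_square algebra_simps)
    then show ?thesis using that s by simp
  qed
  have fg: "f (g r) * (2 * r + 2 * sqrt s) = h r" if "r \<ge> 0" for r
  proof -
    have "r + sqrt s > 0" using that s by (simp add: add_nonneg_pos)
    moreover have "2 * r + 2 * sqrt s = 2 * (r + sqrt s)" by simp
    moreover have "- x * g r = - (x * r ^ 2) - 2 * x * r * sqrt s" by (simp add: g_def algebra_simps)
    moreover have "x * e * (p / q) * (2 * q) = 2 * x * p * e" if "q > 0" for e p q :: real using that by simp
    ultimately show ?thesis unfolding f_def h_def gs[OF that] by metis
  qed
  have sub: "set_integrable lborel (einterval 0 \<infinity>) f" "(LBINT v=0..\<infinity>. f v) = (LBINT r=0..\<infinity>. f (g r) * (2 * r + 2 * sqrt s))"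
  proof -
    have "set_integrable lborel (einterval 0 \<infinity>) (\<lambda>r. f (g r) * (2 * r + 2 * sqrt s))"
    proof -
      have "set_integrable lborel (einterval 0 \<infinity>) h" using h1 by (simp add: zero_ereal_def)
      then show ?thesis
        by (rule set_integrable_cong[THEN iffD1, rotated 3]) (auto simp: zero_ereal_def fg)
    qed
    note * = interval_integral_substitution_nonneg[where g = g and g' = "\<lambda>r. 2 * r + 2 * sqrt s" and f = f and a = 0 and b = \<infinity> and A = 0 and B = \<infinity>, OF _ _ _ _ _ _ _ _ this]
    have 1: "DERIV g r :> 2 * r + 2 * sqrt s" for r
      unfolding g_def by (auto intro!: derivative_eq_intros)
    have 2: "isCont f (g r)" if "0 < ereal r" for r
    proof -
      have "r > 0" using that by (simp add: zero_ereal_def)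
      then have "s + g r > 0" using s by (simp add: g_def add_pos_pos)
      then show ?thesis unfolding f_def by (intro continuous_intros) auto
    qed
    have 3: "0 \<le> f (g r)" if "0 < ereal r" for r
      using x s that by (auto simp: f_def g_def zero_ereal_def)
    have 4: "((ereal \<circ> g \<circ> real_of_ereal) \<longlongrightarrow> 0) (at_right 0)"
    proof -
      have "(g \<longlongrightarrow> g 0) (at_right 0)" unfolding g_def by (intro tendsto_intros)
      then show ?thesis unfolding zero_ereal_def ereal_tendsto_simps1 ereal_tendsto_simps2 by (simp add: g_def)
    qed
    have 5: "((ereal \<circ> g \<circ> real_of_ereal) \<longlongrightarrow> \<infinity>) (at_left \<infinity>)"
    proof -
      have "filterlim g at_top at_top"
      proof (rule filterlim_at_top_mono)
        show "filterlim (\<lambda>r::real. r ^ 2) at_top at_top" by real_asymp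
        show "eventually (\<lambda>r. r ^ 2 \<le> g r) at_top"
          using s by (intro eventually_at_top_linorderI[of 0]) (auto simp: g_def)
      qed
      then show ?thesis unfolding ereal_tendsto_simps1 ereal_tendsto_simps2 .
    qed
    have 6: "0 \<le> 2 * r + 2 * sqrt s" if "0 \<le> ereal r" for r using that s by (simp add: zero_ereal_def)
    show "set_integrable lborel (einterval 0 \<infinity>) f" "(LBINT v=0..\<infinity>. f v) = (LBINT r=0..\<infinity>. f (g r) * (2 * r + 2 * sqrt s))"
      by (rule *; use 1 2 3 4 5 6 in \<open>auto intro!: continuous_intros\<close>)+
  qed
  note sub(2)
  also have "(LBINT r=0..\<infinity>. f (g r) * (2 * r + 2 * sqrt s)) = (LINT r:{0<..}|lborel. f (g r) * (2 * r + 2 * sqrt s))"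
    by (simp add: zero_ereal_def interval_integral_to_infinity_eq)
  also have "\<dots> = (LINT r:{0<..}|lborel. h r)"
    by (rule set_lebesgue_integral_cong) (auto simp: fg)
  finally have "(LBINT v=0..\<infinity>. f v) = (LINT r:{0<..}|lborel. h r)" .
  then have fh: "(LINT v:{0<..}|lborel. f v) = (LINT r:{0<..}|lborel. h r)"
    by (simp add: zero_ereal_def interval_integral_to_infinity_eq)
  have z1: "(LINT v:{0..}|lborel. f v) = (LINT v:{0<..}|lborel. f v)" for f :: "real \<Rightarrow> real"
    by (rule set_integral_discrete_difference[where X = "{0}"]) auto
  have "(LINT t:{0<..}|lborel. t powr (- 1/2) / (1 + t / x) * exp (- t * s))
      = enn2real (\<integral>\<^sup>+t. ennreal (indicat_real {0<..} t * (t powr (- 1/2) / (1 + t / x) * exp (- t * s))) \<partial>lborel)"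
    unfolding set_lebesgue_integral_def
    by (subst integral_eq_nn_integral) (use x in \<open>auto intro!: AE_I2 simp: indicator_def\<close>)
  also have "\<dots> = enn2real (\<integral>\<^sup>+v. ennreal (indicat_real {0..} v * f v) \<partial>lborel)" unfolding nn ..
  also have "\<dots> = (LINT v:{0..}|lborel. f v)"
    unfolding set_lebesgue_integral_def
  proof (subst integral_eq_nn_integral)
    have [measurable]: "f \<in> borel_measurable borel" unfolding f_def by measurable
    show "(\<lambda>v. indicat_real {0..} v *\<^sub>R f v) \<in> borel_measurable lborel" by measurable
  qed (use x s in \<open>auto intro!: AE_I2 simp: indicator_def f_def\<close>)
  also have "\<dots> = (LINT r:{0..}|lborel. h r)" unfolding z1 by (rule fh)
  also have "\<dots> = 2 * x * sqrt pi * (LINT r:{0..}|lborel. exp (- (x * r ^ 2) - 2 * x * r * sqrt s))"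
    unfolding h_def by simp
  finally show ?thesis .
qed

lemma laplace_int_rational:
  assumes x: "x > 0" and z: "Re z > 0"
  shows "laplace_int (\<lambda>t. t powr (- 1/2) / (1 + t / x)) z = erfc_like x (csqrt z)"
proof (rule holomorphic_eq_on_right_half_plane[OF holomorphic_laplace_int[OF laplace_weight_rational[OF x]] _ _ z])
  have "(erfc_like x \<circ> csqrt) holomorphic_on {z. Re z > 0}"
    by (intro holomorphic_on_compose holomorphic_csqrt_right holomorphic_erfc_like x)
  then show "(\<lambda>z. erfc_like x (csqrt z)) holomorphic_on {z. Re z > 0}" by (simp add: o_def)
  fix s :: real assume s: "s > 0"
  show "laplace_int (\<lambda>t. t powr (- 1/2) / (1 + t / x)) (of_real s) = erfc_like x (csqrt (of_real s))"
  proof -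
    have "csqrt (of_real s) = of_real (sqrt s)" using s by (simp add: csqrt_of_real_nonneg)
    then show ?thesis by (simp only: laplace_int_of_real laplace_rational_real[OF x s] erfc_like_of_real)
  qed
qed

lemma cosh_ge_exp_abs: "exp \<bar>x\<bar> / 2 \<le> cosh (x::real)"
  by (cases "x \<ge> 0") (auto simp: cosh_def)

text \<open>The \<open>t\<close>-integral of the modulus is at most a constant times
  \<open>cosh \<sigma>\<close> to the power \<open>- (n + 1/2)\<close>, hence at most a multiple of
  \<open>exp (- \<bar>\<sigma>\<bar> / 2)\<close>, so that Fubini's theorem applies.\<close>

lemma laplace_int_fubini:
  fixes L :: "real \<Rightarrow> complex"
  assumes w: "laplace_weight n w" and L: "continuous_on UNIV L" and \<delta>: "\<delta> > 0"
    and ReL: "\<And>\<sigma>. Re (L \<sigma>) \<ge> \<delta> * cosh \<sigma>"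
  shows "integrable lborel (\<lambda>\<sigma>. laplace_int w (L \<sigma>))"
    and "set_integrable lborel {0<..} (\<lambda>t. of_real (w t) * (LINT \<sigma>|lborel. exp (- of_real t * L \<sigma>)))"
    and "(LINT t:{0<..}|lborel. of_real (w t) * (LINT \<sigma>|lborel. exp (- of_real t * L \<sigma>))) = (LINT \<sigma>|lborel. laplace_int w (L \<sigma>))"
proof -
  define k where "k = (\<lambda>\<sigma> t. indicat_real {0<..} t *\<^sub>R (of_real (w t) * exp (- of_real t * L \<sigma>)))"
  have [measurable]: "w \<in> borel_measurable borel" using w by (rule laplace_weight_measurable)
  have [measurable]: "L \<in> borel_measurable borel" using L by (rule borel_measurable_continuous_onI)
  have km: "(\<lambda>(\<sigma>, t). k \<sigma> t) \<in> borel_measurable (lborel \<Otimes>\<^sub>M lborel)" unfolding k_def by measurable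
  define a where "a = real n + 1/2"
  have a: "a > 0" "a \<ge> 1/2" by (auto simp: a_def)
  have Lpos: "Re (L \<sigma>) > 0" for \<sigma> using ReL[of \<sigma>] \<delta> cosh_real_pos[of \<sigma>] by (smt (verit) mult_pos_pos)
  have ki: "integrable lborel (k \<sigma>)" for \<sigma>
    using laplace_int_integrable[OF w Lpos[of \<sigma>]] by (simp add: k_def set_integrable_def)
  have kn: "(LINT t|lborel. norm (k \<sigma> t)) \<le> Gamma a / (\<delta> / 2) powr a * exp (- (1/2) * \<bar>\<sigma>\<bar>)" for \<sigma>
  proof -
    have dc: "\<delta> * cosh \<sigma> > 0" using \<delta> by simp
    have "(LINT t|lborel. norm (k \<sigma> t)) \<le> (LINT t|lborel. indicat_real {0<..} t *\<^sub>R (t powr (a - 1) * exp (- t * (\<delta> * cosh \<sigma>))))"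
    proof (rule integral_mono)
      show "integrable lborel (\<lambda>t. norm (k \<sigma> t))" using ki by simp
      show "integrable lborel (\<lambda>t. indicat_real {0<..} t *\<^sub>R (t powr (a - 1) * exp (- t * (\<delta> * cosh \<sigma>))))"
        using integral_powr_exp(1)[OF dc a(1)] by (simp add: set_integrable_def)
      show "norm (k \<sigma> t) \<le> indicat_real {0<..} t *\<^sub>R (t powr (a - 1) * exp (- t * (\<delta> * cosh \<sigma>)))" for t
        using laplace_weight_bound[OF w _ ReL[of \<sigma>], of t] by (auto simp: k_def indicator_def a_def)
    qed
    also have "\<dots> = Gamma a / (\<delta> * cosh \<sigma>) powr a"
      using integral_powr_exp(2)[OF dc a(1)] by (simp add: set_lebesgue_integral_def)
    also have "\<dots> \<le> Gamma a / ((\<delta> / 2) powr a * exp ((1/2) * \<bar>\<sigma>\<bar>))"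
    proof (intro divide_left_mono mult_pos_pos)
      have "(\<delta> / 2) powr a * exp ((1/2) * \<bar>\<sigma>\<bar>) \<le> (\<delta> / 2) powr a * exp (a * \<bar>\<sigma>\<bar>)"
        using mult_right_mono[OF a(2), of "\<bar>\<sigma>\<bar>"] by (intro mult_left_mono) auto
      also have "\<dots> = (\<delta> / 2 * exp \<bar>\<sigma>\<bar>) powr a"
        using \<delta> by (subst powr_mult) (auto simp: exp_powr_real mult.commute)
      also have "\<dots> \<le> (\<delta> * cosh \<sigma>) powr a"
      proof (rule powr_mono2)
        show "\<delta> / 2 * exp \<bar>\<sigma>\<bar> \<le> \<delta> * cosh \<sigma>"
          using mult_left_mono[OF cosh_ge_exp_abs[of \<sigma>], of \<delta>] \<delta> by simp
      qed (use a \<delta> in auto)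
      finally show "(\<delta> / 2) powr a * exp ((1/2) * \<bar>\<sigma>\<bar>) \<le> (\<delta> * cosh \<sigma>) powr a" .
    qed (use \<delta> a dc in \<open>auto intro: less_imp_le Gamma_real_pos\<close>)
    also have "\<dots> = Gamma a / (\<delta> / 2) powr a * exp (- (1/2) * \<bar>\<sigma>\<bar>)" by (simp add: exp_minus field_simps)
    finally show ?thesis .
  qed
  have int: "integrable (lborel \<Otimes>\<^sub>M lborel) (\<lambda>(\<sigma>, t). k \<sigma> t)"
  proof (rule lborel_pair.Fubini_integrable[OF km])
    show "AE \<sigma> in lborel. integrable lborel (\<lambda>t. case (\<sigma>, t) of (\<sigma>, t) \<Rightarrow> k \<sigma> t)" using ki by simp
    have "integrable lborel (\<lambda>\<sigma>. LINT t|lborel. norm (k \<sigma> t))"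
    proof (rule Bochner_Integration.integrable_bound)
      show "integrable lborel (\<lambda>\<sigma>::real. Gamma a / (\<delta> / 2) powr a * exp (- (1/2) * \<bar>\<sigma>\<bar>))"
        by (intro integrable_mult_right integrable_exp_neg_abs) simp
      have [measurable]: "(\<lambda>(\<sigma>, t). norm (k \<sigma> t)) \<in> borel_measurable (lborel \<Otimes>\<^sub>M lborel)"
        using km by (simp add: case_prod_beta')
      show "(\<lambda>\<sigma>. LINT t|lborel. norm (k \<sigma> t)) \<in> borel_measurable lborel" by measurable
      show "AE \<sigma> in lborel. norm (LINT t|lborel. norm (k \<sigma> t)) \<le> norm (Gamma a / (\<delta> / 2) powr a * exp (- (1/2) * \<bar>\<sigma>\<bar>))"
      proof (intro AE_I2)
        fix \<sigma>
        from order_trans[OF kn abs_ge_self]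
        show "norm (LINT t|lborel. norm (k \<sigma> t)) \<le> norm (Gamma a / (\<delta> / 2) powr a * exp (- (1/2) * \<bar>\<sigma>\<bar>))"
          by simp
      qed
    qed
    then show "integrable lborel (\<lambda>\<sigma>. LINT t|lborel. norm (case (\<sigma>, t) of (\<sigma>, t) \<Rightarrow> k \<sigma> t))" by simp
  qed
  have k\<sigma>: "(LINT t|lborel. k \<sigma> t) = laplace_int w (L \<sigma>)" for \<sigma>
    by (simp add: k_def laplace_int_def set_lebesgue_integral_def)
  have kt: "(LINT \<sigma>|lborel. k \<sigma> t) = indicat_real {0<..} t *\<^sub>R (of_real (w t) * (LINT \<sigma>|lborel. exp (- of_real t * L \<sigma>)))" for t
    by (simp add: k_def scaleR_conv_of_real)
  show "integrable lborel (\<lambda>\<sigma>. laplace_int w (L \<sigma>))"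
    using lborel_pair.integrable_fst'[OF int] by (simp add: k\<sigma>)
  show "set_integrable lborel {0<..} (\<lambda>t. of_real (w t) * (LINT \<sigma>|lborel. exp (- of_real t * L \<sigma>)))"
    using lborel_pair.integrable_snd[OF int] by (simp add: kt set_integrable_def)
  show "(LINT t:{0<..}|lborel. of_real (w t) * (LINT \<sigma>|lborel. exp (- of_real t * L \<sigma>))) = (LINT \<sigma>|lborel. laplace_int w (L \<sigma>))"
    using lborel_pair.Fubini_integral[OF int] by (simp add: k\<sigma> kt set_lebesgue_integral_def)
qed

section \<open>Integral representations along the imaginary axis\<close>

lemma integral_reflect_real:
  fixes f :: "real \<Rightarrow> complex"
  shows "(LINT x|lborel. f (- x)) = (LINT x|lborel. f x)"
  using lborel_integral_real_affine[of "-1" f 0] by simp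

lemma cosh_ge_abs: "\<bar>x\<bar> \<le> cosh (x::real)"
  using sinh_le_cosh_real[of "\<bar>x\<bar>"] abs_sinh_gt[of x] by (cases "x = 0") (auto simp: abs_if split: if_splits)

context debye_angle
begin

definition kernelK :: "real \<Rightarrow> complex" where
  "kernelK t = \<i> * hankel1_log (\<i> * of_real t) (Ln (\<i> * of_real t / of_real (cos \<beta>)))"

lemma Ln_imaginary:
  assumes "t > 0"
  shows "Ln (\<i> * of_real t / of_real (cos \<beta>)) = of_real (ln (t / cos \<beta>)) + \<i> * of_real (pi / 2)"
proof -
  have "\<i> * of_real t / of_real (cos \<beta>) = \<i> * of_real (t / cos \<beta>)" by simp
  moreover have pos: "t / cos \<beta> > 0" using assms cos_\<beta> by simp
  moreover have nz: "complex_of_real (t / cos \<beta>) \<noteq> 0"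
    using pos unfolding of_real_eq_0_iff by linarith
  ultimately have "Ln (\<i> * of_real t / of_real (cos \<beta>)) = of_real (ln (t / cos \<beta>)) + \<i> * of_real pi / 2"
    using Ln_times_ii[OF nz] by (simp add: Ln_of_real del: of_real_divide)
  moreover have "\<i> * of_real pi / 2 = \<i> * complex_of_real (pi / 2)" by simp
  ultimately show ?thesis by (simp only:)
qed

lemma imaginary_not_Ints: "t \<noteq> 0 \<Longrightarrow> \<i> * of_real t \<notin> \<int>"
  by (auto elim!: Ints_cases simp: complex_eq_iff)

lemma kernelK_eq:
  assumes t: "t > 0"
  shows "kernelK t = of_real (exp (pi * t / 2) / pi) * (LINT \<sigma>|lborel. exp (- of_real (t / cos \<beta> * cosh \<sigma>) + \<i> * of_real (t * \<sigma>)))"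
proof -
  define y where "y = t / (2 * cos \<beta>)"
  have y: "y > 0" "2 * y = t / cos \<beta>" using t cos_\<beta> by (auto simp: y_def)
  show ?thesis
    using hankel1_imaginary_order[of t y] t y(1)
    unfolding kernelK_def Ln_imaginary[OF t] y(2) hankel1_log_def by (simp add: imaginary_not_Ints)
qed

text \<open>At these two heights the cosine vanishes, so the phase is a multiple of
  \<open>cosh \<sigma>\<close> plus a constant minus \<open>i \<sigma>\<close>, as in the exponent
  of the integral for \<open>K\<close>. The multiple is positive at the lower height, where
  \<open>exp (- t \<phi>)\<close> decays, and negative at the upper one, where
  \<open>exp (x \<phi>)\<close> does.\<close>

lemma phase_vertical:
  "phase (of_real \<sigma> + \<i> * of_real (- (pi / 2))) = of_real (lag - pi / 2 + cosh \<sigma> / cos \<beta>) - \<i> * of_real \<sigma>"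
  "phase (of_real \<sigma> + \<i> * of_real (pi / 2)) = of_real (lag + pi / 2 - cosh \<sigma> / cos \<beta>) - \<i> * of_real \<sigma>"
  using Re_phase[of \<sigma> "- (pi/2)"] Im_phase[of \<sigma> "- (pi/2)"] Re_phase[of \<sigma> "pi/2"] Im_phase[of \<sigma> "pi/2"]
  by (simp_all add: complex_eq_iff)

text \<open>The lower contour; by \<open>phase_periodic\<close> the upper one carries the values \<open>bottom \<sigma> + 2 \<pi>\<close>.\<close>

definition bottom :: "real \<Rightarrow> complex" where
  "bottom \<sigma> = phase (of_real \<sigma> + \<i> * of_real (- (\<beta> / 2)))"

lemma half_\<beta>: "sin (\<beta> / 2) > 0" using \<beta>_pos \<beta>_less pi_gt_zero by (intro sin_gt_zero) auto

text \<open>The integral for \<open>K\<close> lives at height \<open>- pi / 2\<close>, which is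
  below the strip on which the square root is available, and is moved up to
  \<open>- \<beta> / 2\<close>. Between these heights the sine is at most
  \<open>- sin (\<beta> / 2)\<close>, which forces the real part of the phase to grow at least
  linearly in \<open>\<bar>\<sigma>\<bar>\<close>.\<close>

lemma kernelK_bottom:
  assumes t: "t > 0"
  shows "of_real (exp (- t * lag)) * kernelK t = of_real (1 / pi) * (LINT \<sigma>|lborel. exp (- of_real t * bottom \<sigma>))"
proof -
  define \<kappa> where "\<kappa> = sin (\<beta> / 2) / cos \<beta>"
  have \<kappa>: "\<kappa> > 0" using half_\<beta> cos_\<beta> by (simp add: \<kappa>_def)
  define f where "f = (\<lambda>\<omega>. exp (- of_real t * phase \<omega>))"
  have shift: "(LINT \<sigma>|lborel. f (of_real \<sigma> + \<i> * of_real (- (pi / 2)))) = (LINT \<sigma>|lborel. f (of_real \<sigma> + \<i> * of_real (- (\<beta> / 2))))"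
  proof (rule horizontal_line_integrals_eq(3)[where a = "-pi" and b = pi and c = "t * \<kappa>" and S = 0 and C = "exp (t * pi)"])
    show "f holomorphic_on {z. - pi < Im z \<and> Im z < pi}" unfolding f_def by (intro holomorphic_intros)
    fix \<sigma> \<theta> :: real assume \<theta>: "- (pi / 2) \<le> \<theta>" "\<theta> \<le> - (\<beta> / 2)"
    have "sin (\<beta> / 2) \<le> sin (- \<theta>)" using \<theta> \<beta>_pos \<beta>_less by (intro sin_monotone_2pi_le) auto
    then have "cosh \<sigma> * (- sin \<theta>) \<ge> \<bar>\<sigma>\<bar> * sin (\<beta> / 2)"
      using half_\<beta> cosh_ge_abs[of \<sigma>] by (intro mult_mono) auto
    then have "\<bar>\<sigma>\<bar> * sin (\<beta> / 2) / cos \<beta> \<le> cosh \<sigma> * (- sin \<theta>) / cos \<beta>"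
      using cos_\<beta> by (intro divide_right_mono) auto
    then have "\<kappa> * \<bar>\<sigma>\<bar> \<le> - (cosh \<sigma> * sin \<theta> / cos \<beta>)" by (simp add: \<kappa>_def mult.commute)
    then have "Re (phase (of_real \<sigma> + \<i> * of_real \<theta>)) \<ge> \<kappa> * \<bar>\<sigma>\<bar> - pi"
      unfolding Re_phase using \<theta> lag_pos pi_gt_zero by linarith
    then have "t * (\<kappa> * \<bar>\<sigma>\<bar> - pi) \<le> t * Re (phase (of_real \<sigma> + \<i> * of_real \<theta>))" using t by (intro mult_left_mono) auto
    then show "norm (f (of_real \<sigma> + \<i> * of_real \<theta>)) \<le> exp (t * pi) * exp (- (t * \<kappa>) * \<bar>\<sigma>\<bar>)"
      by (simp add: f_def algebra_simps flip: exp_add)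
  qed (use t \<kappa> \<beta>_pos \<beta>_less pi_gt_zero in auto)
  have "f (of_real \<sigma> + \<i> * of_real (- (pi / 2))) = of_real (exp (- t * lag)) * of_real (exp (pi * t / 2)) * exp (- of_real (t / cos \<beta> * cosh \<sigma>) + \<i> * of_real (t * \<sigma>))" for \<sigma>
  proof -
    have "- of_real t * phase (of_real \<sigma> + \<i> * of_real (- (pi / 2)))
        = of_real (- t * lag) + of_real (pi * t / 2) + (- of_real (t / cos \<beta> * cosh \<sigma>) + \<i> * of_real (t * \<sigma>))"
      unfolding phase_vertical by (simp add: algebra_simps)
    then show ?thesis unfolding f_def by (simp only: exp_add exp_of_real)
  qed
  then have "(LINT \<sigma>|lborel. f (of_real \<sigma> + \<i> * of_real (- (pi / 2))))
      = of_real (exp (- t * lag)) * of_real (exp (pi * t / 2)) * (LINT \<sigma>|lborel. exp (- of_real (t / cos \<beta> * cosh \<sigma>) + \<i> * of_real (t * \<sigma>)))"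
    by simp
  then have "of_real (exp (- t * lag)) * kernelK t = of_real (1 / pi) * (LINT \<sigma>|lborel. f (of_real \<sigma> + \<i> * of_real (- (pi / 2))))"
    unfolding kernelK_eq[OF t] by (simp only: of_real_divide) simp
  then show ?thesis unfolding shift by (simp add: f_def bottom_def)
qed

lemma kernelK_middle:
  assumes x: "x > 0"
  shows "(LINT \<sigma>|lborel. exp (of_real x * phase (of_real \<sigma> + \<i> * of_real (pi / 2)))) = of_real (pi * exp (x * lag)) * kernelK x"
proof -
  define h where "h = (\<lambda>\<sigma>. exp (- of_real (x / cos \<beta> * cosh \<sigma>) + \<i> * of_real (x * \<sigma>)))"
  have "exp (of_real x * phase (of_real \<sigma> + \<i> * of_real (pi / 2))) = of_real (exp (x * lag) * exp (pi * x / 2)) * h (- \<sigma>)" for \<sigma>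
  proof -
    have "of_real x * phase (of_real \<sigma> + \<i> * of_real (pi / 2))
        = of_real (x * lag) + of_real (pi * x / 2) + (- of_real (x / cos \<beta> * cosh (- \<sigma>)) + \<i> * of_real (x * (- \<sigma>)))"
      unfolding phase_vertical by (simp add: algebra_simps)
    then have "exp (of_real x * phase (of_real \<sigma> + \<i> * of_real (pi / 2))) = of_real (exp (x * lag)) * of_real (exp (pi * x / 2)) * h (- \<sigma>)"
      unfolding h_def by (simp only: exp_add exp_of_real)
    then show ?thesis by (simp only: of_real_mult)
  qed
  then have "(LINT \<sigma>|lborel. exp (of_real x * phase (of_real \<sigma> + \<i> * of_real (pi / 2))))
      = of_real (exp (x * lag) * exp (pi * x / 2)) * (LINT \<sigma>|lborel. h (- \<sigma>))" by simp
  also have "(LINT \<sigma>|lborel. h (- \<sigma>)) = (LINT \<sigma>|lborel. h \<sigma>)" by (rule integral_reflect_real)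
  finally show ?thesis unfolding kernelK_eq[OF x] h_def by simp
qed

lemma bottom_bound: obtains \<delta> where "\<delta> > 0" "\<And>\<sigma>. Re (bottom \<sigma>) \<ge> \<delta> * cosh \<sigma>"
proof -
  define \<kappa> where "\<kappa> = sin (\<beta> / 2) / cos \<beta>"
  have \<kappa>: "\<kappa> > 0" using half_\<beta> cos_\<beta> by (simp add: \<kappa>_def)
  have v: "\<kappa> + (lag - \<beta> / 2) > 0"
    using imag_axis_phase_pos[of "- (\<beta> / 2)"] \<beta>_pos pi_gt_zero by (simp add: \<kappa>_def)
  have Re: "Re (bottom \<sigma>) = (lag - \<beta> / 2) + \<kappa> * cosh \<sigma>" for \<sigma>
    unfolding bottom_def Re_phase by (simp add: \<kappa>_def)
  show ?thesis
  \<comment> \<open>The real part is \<open>(lag - \<beta> / 2) + \<kappa> * cosh \<sigma>\<close>,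
    and it is positive at 0. A negative constant term is absorbed by means of
    \<open>cosh \<sigma> \<ge> 1\<close>, which replaces \<open>\<kappa>\<close> by the value at
    0.\<close>
  proof (rule that[of "min \<kappa> (\<kappa> + (lag - \<beta> / 2))"])
    show "min \<kappa> (\<kappa> + (lag - \<beta> / 2)) > 0" using \<kappa> v by simp
    fix \<sigma>
    show "Re (bottom \<sigma>) \<ge> min \<kappa> (\<kappa> + (lag - \<beta> / 2)) * cosh \<sigma>"
    proof (cases "lag - \<beta> / 2 \<ge> 0")
      case True
      then show ?thesis unfolding Re by simp
    next
      case False
      then have "(lag - \<beta> / 2) * cosh \<sigma> \<le> (lag - \<beta> / 2) * 1"
        using cosh_real_ge_1[of \<sigma>] by (intro mult_left_mono_neg) auto
      then show ?thesis unfolding Re using False by (simp add: min_def algebra_simps)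
    qed
  qed
qed

lemma continuous_bottom: "continuous_on UNIV bottom"
  unfolding bottom_def
  by (rule continuous_on_compose2[OF continuous_on_phase[of UNIV]]) (auto intro!: continuous_intros)

lemma top_eq: "phase (of_real \<sigma> + \<i> * of_real (2 * pi - \<beta> / 2)) = bottom \<sigma> + 2 * of_real pi"
  using phase_periodic[of "of_real \<sigma> + \<i> * of_real (- (\<beta> / 2))"] by (simp add: bottom_def algebra_simps)

lemma Fker_eq:
  assumes t: "t > 0"
  shows "of_real (exp (- t * lag)) * Fker \<beta> t = of_real (1 / pi) *
     ((LINT \<sigma>|lborel. exp (- of_real t * bottom \<sigma>)) + (LINT \<sigma>|lborel. exp (- of_real t * (bottom \<sigma> + 2 * of_real pi))))"
proof -
  have "exp (- of_real t * (bottom \<sigma> + 2 * of_real pi)) = of_real (exp (- 2 * pi * t)) * exp (- of_real t * bottom \<sigma>)" for \<sigma>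
    by (simp add: algebra_simps flip: exp_add exp_of_real)
  then have "(LINT \<sigma>|lborel. exp (- of_real t * (bottom \<sigma> + 2 * of_real pi))) = of_real (exp (- 2 * pi * t)) * (LINT \<sigma>|lborel. exp (- of_real t * bottom \<sigma>))"
    by simp
  moreover have "of_real (exp (- t * lag)) * Fker \<beta> t = (1 + of_real (exp (- 2 * pi * t))) * (of_real (exp (- t * lag)) * kernelK t)"
    by (simp add: Fker_def kernelK_def)
  ultimately show ?thesis unfolding kernelK_bottom[OF t] by (simp add: algebra_simps add_divide_distrib)
qed

text \<open>The values on the upper line exceed those on the lower one by \<open>2 * pi\<close>, so
  the same \<open>\<delta>\<close> serves for both applications of Fubini's theorem.\<close>

lemma weighted_Fker_integral:
  assumes w: "laplace_weight n w"
  shows "set_integrable lborel {0<..} (\<lambda>t. of_real (w t * exp (- t * lag)) * Fker \<beta> t)"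
    and "(LINT t:{0<..}|lborel. of_real (w t * exp (- t * lag)) * Fker \<beta> t)
       = of_real (1 / pi) * ((LINT \<sigma>|lborel. laplace_int w (bottom \<sigma>)) + (LINT \<sigma>|lborel. laplace_int w (bottom \<sigma> + 2 * of_real pi)))"
proof -
  obtain \<delta> where \<delta>: "\<delta> > 0" "\<And>\<sigma>. Re (bottom \<sigma>) \<ge> \<delta> * cosh \<sigma>" using bottom_bound by blast
  have \<delta>2: "Re (bottom \<sigma> + 2 * of_real pi) \<ge> \<delta> * cosh \<sigma>" for \<sigma> using \<delta>(2)[of \<sigma>] by (simp add: add_increasing2)
  have c2: "continuous_on UNIV (\<lambda>\<sigma>. bottom \<sigma> + 2 * of_real pi)" by (intro continuous_intros continuous_bottom)
  note F1 = laplace_int_fubini[OF w continuous_bottom \<delta>]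
  note F2 = laplace_int_fubini[OF w c2 \<delta>(1) \<delta>2]
  let ?a = "\<lambda>t. of_real (w t) * (LINT \<sigma>|lborel. exp (- of_real t * bottom \<sigma>))"
  let ?b = "\<lambda>t. of_real (w t) * (LINT \<sigma>|lborel. exp (- of_real t * (bottom \<sigma> + 2 * of_real pi)))"
  have eq: "of_real (w t * exp (- t * lag)) * Fker \<beta> t = of_real (1 / pi) * (?a t + ?b t)" if "t \<in> {0<..}" for t
  proof -
    have "of_real (w t * exp (- t * lag)) * Fker \<beta> t = of_real (w t) * (of_real (exp (- t * lag)) * Fker \<beta> t)" by simp
    then show ?thesis using that unfolding Fker_eq[OF that[unfolded greaterThan_iff]] by (simp add: algebra_simps)
  qed
  have si: "set_integrable lborel {0<..} (\<lambda>t. of_real (1 / pi) * (?a t + ?b t))"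
    using F1(2) F2(2) by (intro set_integrable_mult_right set_integral_add)
  have "indicat_real {0<..} t *\<^sub>R (of_real (w t * exp (- t * lag)) * Fker \<beta> t)
      = indicat_real {0<..} t *\<^sub>R (of_real (1 / pi) * (?a t + ?b t))" for t
  proof (cases "t \<in> {0<..}")
    case True
    then show ?thesis by (simp only: eq)
  qed simp
  then show "set_integrable lborel {0<..} (\<lambda>t. of_real (w t * exp (- t * lag)) * Fker \<beta> t)"
    using si unfolding set_integrable_def by (simp only:)
  have "(LINT t:{0<..}|lborel. of_real (w t * exp (- t * lag)) * Fker \<beta> t) = (LINT t:{0<..}|lborel. of_real (1 / pi) * (?a t + ?b t))"
    by (rule set_lebesgue_integral_cong) (use eq in auto)
  also have "\<dots> = of_real (1 / pi) * ((LINT t:{0<..}|lborel. ?a t) + (LINT t:{0<..}|lborel. ?b t))"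
    by (subst set_integral_mult_right, subst set_integral_add(2)) (use F1(2) F2(2) in auto)
  finally show "(LINT t:{0<..}|lborel. of_real (w t * exp (- t * lag)) * Fker \<beta> t)
       = of_real (1 / pi) * ((LINT \<sigma>|lborel. laplace_int w (bottom \<sigma>)) + (LINT \<sigma>|lborel. laplace_int w (bottom \<sigma> + 2 * of_real pi)))"
    unfolding F1(3) F2(3) .
qed

lemma Re_bottom_pos: "Re (bottom \<sigma>) > 0"
proof -
  obtain \<delta> where \<delta>: "\<delta> > 0" "\<And>\<sigma>. Re (bottom \<sigma>) \<ge> \<delta> * cosh \<sigma>" using bottom_bound by blast
  have "\<delta> * cosh \<sigma> > 0" using \<delta>(1) by simp
  then show ?thesis using \<delta>(2)[of \<sigma>] by linarith
qed

lemma sqrt_growth: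
  fixes z r :: complex
  assumes "norm z \<ge> exp s / 8" "r ^ 2 = z"
  shows "1 / norm r \<le> sqrt 8 * exp (- (1/2) * s)" "norm r \<ge> exp (s / 2) / sqrt 8"
proof -
  have "norm r ^ 2 = norm z" using norm_power[of r 2] assms(2) by simp
  moreover have "(exp (s / 2) / sqrt 8) ^ 2 = exp s / 8"
    using exp_double[of "s / 2"] by (simp add: power_divide)
  ultimately have "(exp (s / 2) / sqrt 8) ^ 2 \<le> norm r ^ 2" using assms(1) by simp
  then show 1: "norm r \<ge> exp (s / 2) / sqrt 8" by (rule power2_le_imp_le) simp
  have p: "exp (s / 2) / sqrt 8 > 0" by simp
  then have "norm r > 0" using 1 by linarith
  then have "1 / norm r \<le> 1 / (exp (s / 2) / sqrt 8)"
    using 1 p by (intro divide_left_mono mult_pos_pos) auto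
  then show "1 / norm r \<le> sqrt 8 * exp (- (1/2) * s)" by (simp add: exp_minus field_simps)
qed

section \<open>Moments of the kernel and the formula on the ray\<close>

lemma Gamma_nat_plus_half: "Gamma (real n + 1/2) = fact (2 * n) / (4 ^ n * fact n) * sqrt pi"
proof (induction n)
  case 0
  then show ?case by (simp add: Gamma_one_half_real)
next
  case (Suc n)
  have "Gamma (real (Suc n) + 1/2) = (real n + 1/2) * Gamma (real n + 1/2)"
  proof -
    have "real n + 1/2 \<notin> \<int>\<^sub>\<le>\<^sub>0"
    proof
      assume "real n + 1/2 \<in> \<int>\<^sub>\<le>\<^sub>0"
      then obtain k :: int where "real n + 1/2 = of_int k" "k \<le> 0" by (elim nonpos_Ints_cases)
      then have "real n + 1/2 \<le> 0" by simp
      then show False by simp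
    qed
    from Gamma_plus1[OF this] show ?thesis by (simp add: add_ac)
  qed
  also have "\<dots> = fact (2 * Suc n) / (4 ^ Suc n * fact (Suc n)) * sqrt pi"
    unfolding Suc.IH by (simp add: divide_simps) (simp add: algebra_simps)
  finally show ?case .
qed

theorem debye_integral:
  shows "(LINT t:{0<..}|lborel. of_real (t powr (real n - 1/2) * exp (- t * lag)) * Fker \<beta> t)
     = of_real (cbeta \<beta>) * (of_real (cos \<beta> / sin \<beta>) ^ n * debye_factor n * debye_coeff n cotp)"
proof -
  obtain r q where r: "r holomorphic_on strip" and r2: "\<And>\<omega>. \<omega> \<in> strip \<Longrightarrow> r \<omega> ^ 2 = phase \<omega>"
    and lower: "\<And>\<omega>. - \<beta> < Im \<omega> \<Longrightarrow> Im \<omega> < \<beta> \<Longrightarrow> r \<omega> = csqrt (phase \<omega>)"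
    and upper: "\<And>\<omega>. pi / 2 \<le> Im \<omega> \<Longrightarrow> Im \<omega> < 2 * pi \<Longrightarrow> r \<omega> = - csqrt (phase \<omega>)"
    and rq: "\<And>\<tau>. r (\<i> * of_real \<beta> + \<tau>) = \<i> * of_real (sqrt (tan \<beta> / 2)) * \<tau> * q \<tau>"
    and q: "q holomorphic_on {\<tau>. - 2 * \<beta> < Im \<tau> \<and> Im \<tau> < 2 * pi - \<beta>}" "q 0 = 1"
    and q2: "\<And>\<tau>. - 2 * \<beta> < Im \<tau> \<Longrightarrow> Im \<tau> < 2 * pi - \<beta> \<Longrightarrow> q \<tau> ^ 2 = phase_ratio cotp \<tau>"
    by (rule sqrt_phase_exists) blast
  define f where "f = (\<lambda>\<omega>. 1 / r \<omega> ^ (2 * n + 1))"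
  define p where "p = \<i> * complex_of_real \<beta>"
  define k where "k = sqrt (tan \<beta> / 2)"
  have k: "k > 0" "k ^ 2 = tan \<beta> / 2" using tan_\<beta> by (auto simp: k_def)
  have rnz: "r \<omega> \<noteq> 0" if "\<omega> \<in> strip - {p}" for \<omega>
    using phase_nonzero[of \<omega>] r2[of \<omega>] that by (auto simp: p_def)
  have fhol: "f holomorphic_on strip - {p}"
    unfolding f_def by (intro holomorphic_intros holomorphic_on_subset[OF r]) (use rnz in auto)
  obtain S where S: "S > 0" "\<And>\<sigma> \<gamma>. \<bar>\<sigma>\<bar> \<ge> S \<Longrightarrow> - \<beta> \<le> \<gamma> \<Longrightarrow> \<gamma> \<le> 2 * pi \<Longrightarrow>
      norm (phase (of_real \<sigma> + \<i> * of_real \<gamma>)) \<ge> exp \<bar>\<sigma>\<bar> / 8"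
    using norm_phase_growth by blast
  \<comment> \<open>The bound 3 makes \<open>exp \<bar>\<sigma>\<bar>\<close> at least 8 and hence
    \<open>r\<close> at least 1 in modulus, so that the power \<open>2 * n + 1\<close> can be
    estimated by the first power.\<close>
  have decay: "norm (f (of_real \<sigma> + \<i> * of_real \<theta>)) \<le> sqrt 8 * exp (- (1/2) * \<bar>\<sigma>\<bar>)"
    if "\<bar>\<sigma>\<bar> \<ge> max S 3" "- (\<beta> / 2) \<le> \<theta>" "\<theta> \<le> 2 * pi - \<beta> / 2" for \<sigma> \<theta>
  proof -
    let ?\<omega> = "of_real \<sigma> + \<i> * of_real \<theta>"
    have "?\<omega> \<in> strip" using that \<beta>_pos by auto
    then have sq: "r ?\<omega> ^ 2 = phase ?\<omega>" by (rule r2)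
    have g: "norm (phase ?\<omega>) \<ge> exp \<bar>\<sigma>\<bar> / 8" using that \<beta>_pos by (intro S(2)) auto
    have "1 \<le> norm (r ?\<omega>)"
    proof -
      have "8 \<le> exp \<bar>\<sigma>\<bar>"
        using exp_lower_Taylor_quadratic[of "\<bar>\<sigma>\<bar>"] that mult_mono[of 3 "\<bar>\<sigma>\<bar>" 3 "\<bar>\<sigma>\<bar>"] by (simp add: power2_eq_square)
      then have "1 \<le> norm (phase ?\<omega>)" using g by linarith
      then have "1 ^ 2 \<le> norm (r ?\<omega>) ^ 2" using sq by (simp add: norm_power[symmetric])
      then show ?thesis by (rule power2_le_imp_le) simp
    qed
    then have "norm (r ?\<omega>) ^ 1 \<le> norm (r ?\<omega>) ^ (2 * n + 1)" by (intro power_increasing) auto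
    then have "norm (f ?\<omega>) \<le> 1 / norm (r ?\<omega>)"
      using \<open>1 \<le> norm (r ?\<omega>)\<close> unfolding f_def norm_divide norm_power norm_one
      by (intro divide_left_mono mult_pos_pos) auto
    then show ?thesis using sqrt_growth(1)[OF g sq] by linarith
  qed
  have pIm: "Im p = \<beta>" by (simp add: p_def)
  have D: "(LINT \<sigma>|lborel. f (of_real \<sigma> + \<i> * of_real (- (\<beta> / 2)))) - (LINT \<sigma>|lborel. f (of_real \<sigma> + \<i> * of_real (2 * pi - \<beta> / 2)))
          = 2 * pi * \<i> * residue f p"
    by (rule horizontal_line_integrals_diff(3)[where S = "max S 3", OF fhol _ _ _ _ _ decay]) (use \<beta>_pos \<beta>_less pi_gt_zero pIm in auto)
  \<comment> \<open>About the saddle, \<open>f\<close> is the power \<open>- (2 * n + 1)\<close> of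
    \<open>q\<close>, divided by the power \<open>2 * n + 1\<close> of \<open>i k \<tau>\<close>;
    the residue is therefore the Taylor coefficient of index \<open>2 * n\<close>.\<close>
  have res: "residue f p = 1 / (\<i> * of_real k) ^ (2 * n + 1) * debye_coeff n cotp"
  proof -
    have op: "open {\<tau>. - 2 * \<beta> < Im \<tau> \<and> Im \<tau> < 2 * pi - \<beta>}" by (rule open_Im_strip)
    have zin: "0 \<in> {\<tau>. - 2 * \<beta> < Im \<tau> \<and> Im \<tau> < 2 * pi - \<beta>}" using \<beta>_pos \<beta>_less pi_gt_zero by auto
    have c: "isCont q 0"
      using holomorphic_on_imp_continuous_on[OF q(1)] op zin continuous_on_eq_continuous_at by blast
    have e: "eventually (\<lambda>\<tau>. q \<tau> ^ 2 = phase_ratio cotp \<tau>) (nhds 0)"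
      using eventually_nhds_in_open[OF op zin] by eventually_elim (use q2 in auto)
    have "(\<lambda>\<tau>. 1 / (\<i> * of_real k) ^ (2 * n + 1) * inverse (q \<tau>) ^ (2 * n + 1)) has_fps_expansion
        fps_const (1 / (\<i> * of_real k) ^ (2 * n + 1)) * fps_phase_powr (- (of_nat n + 1/2)) cotp"
      by (intro fps_expansion_intros inverse_sqrt_power_has_fps_expansion c e q(2))
    from residue_fps_expansion_over_power_at_0[OF this, of "2 * n"]
    have "residue (\<lambda>\<tau>. 1 / (\<i> * of_real k) ^ (2 * n + 1) * inverse (q \<tau>) ^ (2 * n + 1) / \<tau> ^ Suc (2 * n)) 0
        = 1 / (\<i> * of_real k) ^ (2 * n + 1) * debye_coeff n cotp" by (simp add: debye_coeff_def)
    moreover have "f (p + \<tau>) = 1 / (\<i> * of_real k) ^ (2 * n + 1) * inverse (q \<tau>) ^ (2 * n + 1) / \<tau> ^ Suc (2 * n)" for \<tau>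
      unfolding f_def p_def rq k_def[symmetric] power_mult_distrib Suc_eq_plus1[symmetric]
      by (simp add: power_inverse divide_inverse mult_ac)
    moreover have "residue f p = residue (\<lambda>\<tau>. f (p + \<tau>)) 0" by (rule residue_shift_0)
    ultimately show ?thesis by simp
  qed
  let ?w = "\<lambda>t. t powr (real n - 1/2)"
  let ?G = "complex_of_real (Gamma (real n + 1/2))"
  have L0: "laplace_int ?w (bottom \<sigma>) = ?G * f (of_real \<sigma> + \<i> * of_real (- (\<beta> / 2)))" for \<sigma>
  proof -
    have "r (of_real \<sigma> + \<i> * of_real (- (\<beta> / 2))) = csqrt (bottom \<sigma>)" unfolding bottom_def by (rule lower) (use \<beta>_pos in auto)
    then show ?thesis using laplace_int_powr[OF Re_bottom_pos, of n \<sigma>] by (simp add: f_def)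
  qed
  \<comment> \<open>On the upper line \<open>r\<close> is minus the principal root and the exponent
    is odd. This sign gives the two lines opposite orientations, as the residue theorem
    requires.\<close>
  have L1: "laplace_int ?w (bottom \<sigma> + 2 * of_real pi) = - (?G * f (of_real \<sigma> + \<i> * of_real (2 * pi - \<beta> / 2)))" for \<sigma>
  proof -
    have "r (of_real \<sigma> + \<i> * of_real (2 * pi - \<beta> / 2)) = - csqrt (bottom \<sigma> + 2 * of_real pi)"
      unfolding top_eq[symmetric] by (rule upper) (use \<beta>_pos \<beta>_less pi_gt_zero in auto)
    moreover have "Re (bottom \<sigma> + 2 * of_real pi) > 0" using Re_bottom_pos[of \<sigma>] by (simp add: add_pos_pos)
    ultimately show ?thesis using laplace_int_powr[of "bottom \<sigma> + 2 * of_real pi" n] by (simp add: f_def power_minus_odd)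
  qed
  have "(LINT t:{0<..}|lborel. of_real (t powr (real n - 1/2) * exp (- t * lag)) * Fker \<beta> t)
      = of_real (1 / pi) * (?G * (LINT \<sigma>|lborel. f (of_real \<sigma> + \<i> * of_real (- (\<beta> / 2)))) - ?G * (LINT \<sigma>|lborel. f (of_real \<sigma> + \<i> * of_real (2 * pi - \<beta> / 2))))"
    unfolding weighted_Fker_integral(2)[OF laplace_weight_powr] L0 L1 by simp
  also have "\<dots> = of_real (1 / pi) * (?G * (2 * pi * \<i> * residue f p))"
    unfolding D[symmetric] by (simp only: right_diff_distrib)
  also have "\<dots> = of_real (cbeta \<beta>) * (of_real (cos \<beta> / sin \<beta>) ^ n * debye_factor n * debye_coeff n cotp)"
  proof -
    have ik: "(\<i> * of_real k) ^ (2 * n + 1) = \<i> * (-1) ^ n * of_real ((tan \<beta> / 2) ^ n * k)"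
    proof -
      have "(\<i> * of_real k) ^ 2 = (-1) * complex_of_real (tan \<beta> / 2)"
        unfolding k(2)[symmetric] by (simp add: power_mult_distrib)
      moreover have "(\<i> * of_real k) ^ (2 * n + 1) = ((\<i> * of_real k) ^ 2) ^ n * (\<i> * of_real k)"
        by (simp only: power_add power_mult power_one_right)
      ultimately have "(\<i> * of_real k) ^ (2 * n + 1) = (-1) ^ n * complex_of_real (tan \<beta> / 2) ^ n * (\<i> * of_real k)"
        by (simp only: power_mult_distrib)
      then show ?thesis by (simp only: of_real_mult of_real_power mult_ac)
    qed
    \<comment> \<open>The origin of the constant \<open>cbeta\<close>: it combines \<open>k\<close>
      from the expansion at the saddle with the \<open>sqrt pi\<close> in
      \<open>Gamma (n + 1/2)\<close>.\<close>
    have ck: "cbeta \<beta> * k = 2 * sqrt pi"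
    proof -
      have "cbeta \<beta> * k = 2 * sqrt (2 * pi * (cos \<beta> / sin \<beta>) * (tan \<beta> / 2))"
        by (simp only: cbeta_def k_def real_sqrt_mult mult.assoc)
      also have "2 * pi * (cos \<beta> / sin \<beta>) * (tan \<beta> / 2) = pi" using cos_\<beta> sin_\<beta> by (simp add: tan_def)
      finally show ?thesis .
    qed
    have real: "2 * Gamma (real n + 1/2) / ((tan \<beta> / 2) ^ n * k) = cbeta \<beta> * ((cos \<beta> / sin \<beta>) ^ n * (fact (2 * n) / (2 ^ n * fact n)))"
    proof -
      have "2 * Gamma (real n + 1/2) / ((tan \<beta> / 2) ^ n * k) = (2 * sqrt pi / k) * (fact (2 * n) / (4 ^ n * fact n) / (tan \<beta> / 2) ^ n)"
        unfolding Gamma_nat_plus_half by (simp add: mult_ac)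
      also have "2 * sqrt pi / k = cbeta \<beta>" using ck k by (simp add: field_simps)
      also have "fact (2 * n) / (4 ^ n * fact n) / (tan \<beta> / 2) ^ n = (cos \<beta> / sin \<beta>) ^ n * (fact (2 * n) / (2 ^ n * fact n) :: real)"
      proof -
        have "(4::real) ^ n = 2 ^ n * 2 ^ n" by (simp add: power_mult_distrib[symmetric])
        then show ?thesis using cos_\<beta> sin_\<beta> by (simp add: tan_def power_divide field_simps)
      qed
      finally show ?thesis .
    qed
    have "of_real (1 / pi) * (?G * (2 * pi * \<i> * residue f p)) = (-1) ^ n * of_real (2 * Gamma (real n + 1/2) / ((tan \<beta> / 2) ^ n * k)) * debye_coeff n cotp"
      unfolding res ik by (cases "even n") (simp_all add: field_simps)
    then show ?thesis unfolding real by (simp add: debye_factor_def)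
  qed
  finally show ?thesis .
qed

theorem resurgence_on_ray:
  assumes x: "x > 0"
  shows "(LINT t:{0<..}|lborel. of_real (t powr (- 1/2) / (1 + t / x) * exp (- t * lag)) * Fker \<beta> t)
     = of_real (2 * pi * sqrt x * exp (x * lag)) * kernelK x"
proof -
  obtain r q where r: "r holomorphic_on strip" and r2: "\<And>\<omega>. \<omega> \<in> strip \<Longrightarrow> r \<omega> ^ 2 = phase \<omega>"
    and lower: "\<And>\<omega>. - \<beta> < Im \<omega> \<Longrightarrow> Im \<omega> < \<beta> \<Longrightarrow> r \<omega> = csqrt (phase \<omega>)"
    and upper: "\<And>\<omega>. pi / 2 \<le> Im \<omega> \<Longrightarrow> Im \<omega> < 2 * pi \<Longrightarrow> r \<omega> = - csqrt (phase \<omega>)"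
    by (rule sqrt_phase_exists) blast
  obtain S where S: "S > 0" "\<And>\<sigma> \<gamma>. \<bar>\<sigma>\<bar> \<ge> S \<Longrightarrow> - \<beta> \<le> \<gamma> \<Longrightarrow> \<gamma> \<le> 2 * pi \<Longrightarrow>
      norm (phase (of_real \<sigma> + \<i> * of_real \<gamma>)) \<ge> exp \<bar>\<sigma>\<bar> / 8"
    using norm_phase_growth by blast
  have right: "norm (erfc_like x u) \<le> 2 * sqrt pi * sqrt 8 * exp (- (1/2) * s)"
    if "Re u \<ge> 0" "u ^ 2 = z" "norm z \<ge> exp s / 8" for u z s
  proof -
    have "u \<noteq> 0" using that by (auto simp: not_le)
    then have "norm (erfc_like x u) \<le> 2 * sqrt pi * (1 / norm u)" using norm_erfc_like_right[OF x that(1)] by simp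
    also have "\<dots> \<le> 2 * sqrt pi * (sqrt 8 * exp (- (1/2) * s))"
      using sqrt_growth(1)[OF that(3,2)] by (intro mult_left_mono) auto
    finally show ?thesis by simp
  qed
  define E1 E2 where "E1 = (\<lambda>\<omega>. erfc_like x (r \<omega>))" and "E2 = (\<lambda>\<omega>. erfc_like x (- r \<omega>))"
  have E1h: "E1 holomorphic_on strip"
  proof -
    have "(erfc_like x \<circ> r) holomorphic_on strip" by (intro holomorphic_on_compose r holomorphic_erfc_like x)
    then show ?thesis by (simp add: E1_def o_def)
  qed
  have E2h: "E2 holomorphic_on strip"
  proof -
    have "(erfc_like x \<circ> (\<lambda>\<omega>. - r \<omega>)) holomorphic_on strip"
      by (intro holomorphic_on_compose holomorphic_erfc_like x holomorphic_intros r)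
    then show ?thesis by (simp add: E2_def o_def)
  qed
  \<comment> \<open>The second summand pays for the exponential term of the reflection formula,
    which is used where the real part of \<open>r\<close> is negative.\<close>
  define C where "C = 2 * sqrt pi * sqrt 8 + 2 * pi * sqrt x * (exp (x * (pi / 2 + lag)) * (2 / (x * tan \<beta>)))"
  have CC: "2 * sqrt pi * sqrt 8 \<le> C" unfolding C_def using x tan_\<beta> by simp
  have decay1: "norm (E1 (of_real \<sigma> + \<i> * of_real \<theta>)) \<le> C * exp (- (1/2) * \<bar>\<sigma>\<bar>)"
    if "\<bar>\<sigma>\<bar> \<ge> S" "- (\<beta> / 2) \<le> \<theta>" "\<theta> \<le> pi / 2" for \<sigma> \<theta>
  proof -
    let ?\<omega> = "of_real \<sigma> + \<i> * of_real \<theta>"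
    have \<theta>: "- \<beta> < \<theta>" "\<theta> < 2 * pi" using that \<beta>_pos pi_gt_zero by linarith+
    then have st: "?\<omega> \<in> strip" by simp
    then have sq: "r ?\<omega> ^ 2 = phase ?\<omega>" by (rule r2)
    have g: "norm (phase ?\<omega>) \<ge> exp \<bar>\<sigma>\<bar> / 8" using that(1) \<theta> by (intro S(2)) auto
    show ?thesis
    proof (cases "Re (r ?\<omega>) \<ge> 0")
      case True
      have "norm (E1 ?\<omega>) \<le> 2 * sqrt pi * sqrt 8 * exp (- (1/2) * \<bar>\<sigma>\<bar>)"
        unfolding E1_def by (rule right[OF True sq g])
      also have "\<dots> \<le> C * exp (- (1/2) * \<bar>\<sigma>\<bar>)" using CC by (intro mult_right_mono) auto
      finally show ?thesis .
    next
      case False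
      \<comment> \<open>Below height \<open>\<beta>\<close> the root is the principal one, so a
        negative real part forces \<open>\<theta> \<ge> \<beta>\<close>. There
        \<open>sin \<theta> \<ge> sin \<beta>\<close>, so the real part of the phase falls at least
        as fast as a negative multiple of \<open>exp \<bar>\<sigma>\<bar>\<close>, and the
        exponential term of the reflection formula is tiny.\<close>
      have "\<theta> \<ge> \<beta>"
      proof (rule ccontr)
        assume "\<not> \<theta> \<ge> \<beta>"
        then have "r ?\<omega> = csqrt (phase ?\<omega>)" using that \<beta>_pos by (intro lower) auto
        then have "Re (r ?\<omega>) \<ge> 0" using Re_csqrt[of "phase ?\<omega>"] by (metis)
        then show False using False by simp
      qed
      then have "sin \<beta> \<le> sin \<theta>" using that \<beta>_pos by (intro sin_monotone_2pi_le) auto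
      then have "exp \<bar>\<sigma>\<bar> / 2 * sin \<beta> \<le> cosh \<sigma> * sin \<theta>" using cosh_ge_exp_abs[of \<sigma>] sin_\<beta> by (intro mult_mono) auto
      then have "exp \<bar>\<sigma>\<bar> / 2 * sin \<beta> / cos \<beta> \<le> cosh \<sigma> * sin \<theta> / cos \<beta>" using cos_\<beta> by (intro divide_right_mono) auto
      then have "Re (phase ?\<omega>) \<le> (pi / 2 + lag) - exp \<bar>\<sigma>\<bar> / 2 * tan \<beta>"
        unfolding Re_phase tan_def using that by simp
      then have "x * Re (phase ?\<omega>) \<le> x * ((pi / 2 + lag) - exp \<bar>\<sigma>\<bar> / 2 * tan \<beta>)" using x by (intro mult_left_mono) auto
      then have "exp (x * Re (phase ?\<omega>)) \<le> exp (x * (pi / 2 + lag)) * exp (- (x * (exp \<bar>\<sigma>\<bar> / 2 * tan \<beta>)))"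
        by (simp add: right_diff_distrib flip: exp_add)
      also have "\<dots> \<le> exp (x * (pi / 2 + lag)) * (2 / (x * tan \<beta>) * exp (- (1/2) * \<bar>\<sigma>\<bar>))"
      proof (intro mult_left_mono)
        define y where "y = x * (exp \<bar>\<sigma>\<bar> / 2 * tan \<beta>)"
        have y: "y > 0" using x tan_\<beta> by (simp add: y_def)
        have "y \<le> exp y" using exp_ge_add_one_self[of y] by linarith
        then have "exp (- y) \<le> 1 / y" using y by (simp add: exp_minus field_simps)
        also have "\<dots> = 2 / (x * tan \<beta>) * exp (- \<bar>\<sigma>\<bar>)" using x tan_\<beta> by (simp add: y_def exp_minus field_simps)
        also have "\<dots> \<le> 2 / (x * tan \<beta>) * exp (- (1/2) * \<bar>\<sigma>\<bar>)" using x tan_\<beta> by (intro mult_left_mono) auto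
        finally show "exp (- (x * (exp \<bar>\<sigma>\<bar> / 2 * tan \<beta>))) \<le> 2 / (x * tan \<beta>) * exp (- (1/2) * \<bar>\<sigma>\<bar>)" by (simp add: y_def)
      qed simp
      finally have ex: "exp (x * Re (phase ?\<omega>)) \<le> exp (x * (pi / 2 + lag)) * (2 / (x * tan \<beta>)) * exp (- (1/2) * \<bar>\<sigma>\<bar>)" by simp
      have "E1 ?\<omega> = of_real (2 * pi * sqrt x) * exp (of_real x * phase ?\<omega>) - erfc_like x (- r ?\<omega>)"
        using erfc_like_reflection[OF x, of "r ?\<omega>"] unfolding sq E1_def by (simp add: algebra_simps)
      then have "norm (E1 ?\<omega>) \<le> norm (of_real (2 * pi * sqrt x) * exp (of_real x * phase ?\<omega>)) + norm (erfc_like x (- r ?\<omega>))"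
        by (metis norm_triangle_ineq4)
      also have "norm (of_real (2 * pi * sqrt x) * exp (of_real x * phase ?\<omega>)) = 2 * pi * sqrt x * exp (x * Re (phase ?\<omega>))"
        using x by (simp add: norm_mult)
      also have "\<dots> \<le> 2 * pi * sqrt x * (exp (x * (pi / 2 + lag)) * (2 / (x * tan \<beta>)) * exp (- (1/2) * \<bar>\<sigma>\<bar>))"
        using ex x by (intro mult_left_mono) auto
      also have "norm (erfc_like x (- r ?\<omega>)) \<le> 2 * sqrt pi * sqrt 8 * exp (- (1/2) * \<bar>\<sigma>\<bar>)"
        by (rule right[OF _ _ g]) (use False sq in auto)
      finally show ?thesis by (simp add: C_def algebra_simps)
    qed
  qed
  have decay2: "norm (E2 (of_real \<sigma> + \<i> * of_real \<theta>)) \<le> 2 * sqrt pi * sqrt 8 * exp (- (1/2) * \<bar>\<sigma>\<bar>)"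
    if "\<bar>\<sigma>\<bar> \<ge> S" "pi / 2 \<le> \<theta>" "\<theta> \<le> 2 * pi - \<beta> / 2" for \<sigma> \<theta>
  proof -
    let ?\<omega> = "of_real \<sigma> + \<i> * of_real \<theta>"
    have \<theta>: "- \<beta> < \<theta>" "\<theta> < 2 * pi" using that \<beta>_pos pi_gt_zero by linarith+
    then have st: "?\<omega> \<in> strip" by simp
    have u: "- r ?\<omega> = csqrt (phase ?\<omega>)" using upper[of ?\<omega>] that \<beta>_pos by simp
    show ?thesis unfolding E2_def
    proof (rule right)
      show "Re (- r ?\<omega>) \<ge> 0" unfolding u by (rule Re_csqrt)
      show "(- r ?\<omega>) ^ 2 = phase ?\<omega>" using r2[OF st] by simp
      show "norm (phase ?\<omega>) \<ge> exp \<bar>\<sigma>\<bar> / 8" using that(1) \<theta> by (intro S(2)) auto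
    qed
  qed
  have "- \<beta> < - (\<beta> / 2)" "- (\<beta> / 2) < pi / 2" "pi / 2 < 2 * pi" "- \<beta> < pi / 2" "pi / 2 < 2 * pi - \<beta> / 2" "2 * pi - \<beta> / 2 < 2 * pi"
    using \<beta>_pos \<beta>_less pi_gt_zero by auto
  note ineqs = this
  \<comment> \<open>Each of \<open>r\<close> and \<open>- r\<close> is the principal root on the
    line from which its integral starts, so there the integrands \<open>E1\<close> and
    \<open>E2\<close> are the Laplace transforms.\<close>
  have h1: "(LINT \<sigma>|lborel. E1 (of_real \<sigma> + \<i> * of_real (- (\<beta> / 2)))) = (LINT \<sigma>|lborel. E1 (of_real \<sigma> + \<i> * of_real (pi / 2)))"
    "integrable lborel (\<lambda>\<sigma>. E1 (of_real \<sigma> + \<i> * of_real (pi / 2)))"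
    by (rule horizontal_line_integrals_eq[OF E1h _ _ _ _ decay1]; use ineqs in auto)+
  have h2: "(LINT \<sigma>|lborel. E2 (of_real \<sigma> + \<i> * of_real (pi / 2))) = (LINT \<sigma>|lborel. E2 (of_real \<sigma> + \<i> * of_real (2 * pi - \<beta> / 2)))"
    "integrable lborel (\<lambda>\<sigma>. E2 (of_real \<sigma> + \<i> * of_real (pi / 2)))"
    by (rule horizontal_line_integrals_eq[OF E2h _ _ _ _ decay2]; use ineqs in auto)+
  let ?w = "\<lambda>t. t powr (- 1/2) / (1 + t / x)"
  have L0: "laplace_int ?w (bottom \<sigma>) = E1 (of_real \<sigma> + \<i> * of_real (- (\<beta> / 2)))" for \<sigma>
  proof -
    have "r (of_real \<sigma> + \<i> * of_real (- (\<beta> / 2))) = csqrt (bottom \<sigma>)" unfolding bottom_def by (rule lower) (use \<beta>_pos in auto)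
    then show ?thesis using laplace_int_rational[OF x Re_bottom_pos, of \<sigma>] by (simp add: E1_def)
  qed
  have L1: "laplace_int ?w (bottom \<sigma> + 2 * of_real pi) = E2 (of_real \<sigma> + \<i> * of_real (2 * pi - \<beta> / 2))" for \<sigma>
  proof -
    have "- r (of_real \<sigma> + \<i> * of_real (2 * pi - \<beta> / 2)) = csqrt (bottom \<sigma> + 2 * of_real pi)"
      unfolding top_eq[symmetric] using upper[of "of_real \<sigma> + \<i> * of_real (2 * pi - \<beta> / 2)"] \<beta>_pos \<beta>_less pi_gt_zero by simp
    moreover have "Re (bottom \<sigma> + 2 * of_real pi) > 0" using Re_bottom_pos[of \<sigma>] by (simp add: add_pos_pos)
    ultimately show ?thesis using laplace_int_rational[OF x, of "bottom \<sigma> + 2 * of_real pi"] by (simp add: E2_def)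
  qed
  have "(LINT t:{0<..}|lborel. of_real (t powr (- 1/2) / (1 + t / x) * exp (- t * lag)) * Fker \<beta> t)
      = of_real (1 / pi) * ((LINT \<sigma>|lborel. E1 (of_real \<sigma> + \<i> * of_real (pi / 2))) + (LINT \<sigma>|lborel. E2 (of_real \<sigma> + \<i> * of_real (pi / 2))))"
    unfolding weighted_Fker_integral(2)[OF laplace_weight_rational[OF x]] L0 L1 h1(1) h2(1) ..
  also have "(LINT \<sigma>|lborel. E1 (of_real \<sigma> + \<i> * of_real (pi / 2))) + (LINT \<sigma>|lborel. E2 (of_real \<sigma> + \<i> * of_real (pi / 2)))
      = (LINT \<sigma>|lborel. E1 (of_real \<sigma> + \<i> * of_real (pi / 2)) + E2 (of_real \<sigma> + \<i> * of_real (pi / 2)))"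
    using h1(2) h2(2) by (rule Bochner_Integration.integral_add[symmetric])
  also have "\<dots> = (LINT \<sigma>|lborel. of_real (2 * pi * sqrt x) * exp (of_real x * phase (of_real \<sigma> + \<i> * of_real (pi / 2))))"
  proof (rule Bochner_Integration.integral_cong[OF refl])
    fix \<sigma> :: real
    have "r (of_real \<sigma> + \<i> * of_real (pi / 2)) ^ 2 = phase (of_real \<sigma> + \<i> * of_real (pi / 2))"
      by (rule r2) (use ineqs in auto)
    then show "E1 (of_real \<sigma> + \<i> * of_real (pi / 2)) + E2 (of_real \<sigma> + \<i> * of_real (pi / 2)) =
        of_real (2 * pi * sqrt x) * exp (of_real x * phase (of_real \<sigma> + \<i> * of_real (pi / 2)))"
      unfolding E1_def E2_def using erfc_like_reflection[OF x] by metis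
  qed
  also have "\<dots> = of_real (2 * pi * sqrt x) * (of_real (pi * exp (x * lag)) * kernelK x)"
    unfolding kernelK_middle[OF x, symmetric] by (rule integral_mult_right_zero)
  finally show ?thesis by simp
qed

end

section \<open>Bessel functions near integer order\<close>

definition besselJ_term :: "complex \<Rightarrow> complex \<Rightarrow> nat \<Rightarrow> complex" where
  "besselJ_term mu L k = (-1) ^ k * exp ((mu + 2 * of_nat k) * (L - of_real (ln 2))) * rGamma (mu + of_nat k + 1) / fact k"

text \<open>For \<open>k \<ge> k0\<close> the arguments have modulus at least 1, so by the
  functional equation the values cannot grow any more; the earlier \<open>k\<close> are covered by
  one compact disc.\<close>

lemma rGamma_shift_bounded:
  obtains C where "C \<ge> 0" "\<And>mu k. norm mu \<le> M \<Longrightarrow> norm (rGamma (mu + of_nat k + 1 :: complex)) \<le> C"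
proof -
  obtain k0 :: nat where k0: "M \<le> real k0" using real_arch_simple by blast
  have "compact (rGamma ` cball (0 :: complex) (M + real k0 + 1))"
    by (intro compact_continuous_image continuous_intros) auto
  then obtain C where C: "\<And>z :: complex. norm z \<le> M + real k0 + 1 \<Longrightarrow> norm (rGamma z) \<le> C"
    by (force dest!: compact_imp_bounded simp: bounded_iff)
  have main: "norm (rGamma (mu + of_nat k + 1)) \<le> max C 0" if mu: "norm mu \<le> M" for mu :: complex and k
  proof (cases "k \<le> k0")
    case True
    have "norm (mu + of_nat k + 1) \<le> norm mu + norm (of_nat (k + 1) :: complex)"
      using norm_triangle_ineq[of mu "of_nat (k + 1)"] by (simp add: add_ac)
    also have "norm (of_nat (k + 1) :: complex) = real (k + 1)" by (rule norm_of_nat)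
    finally have "norm (mu + of_nat k + 1) \<le> M + real k0 + 1" using mu True by simp
    from C[OF this] show ?thesis by simp
  next
    case False
    then have "k0 \<le> k" by simp
    then show ?thesis
    proof (induction k rule: dec_induct)
      case base
      have "norm (mu + of_nat k0 + 1) \<le> norm mu + norm (of_nat (k0 + 1) :: complex)"
        using norm_triangle_ineq[of mu "of_nat (k0 + 1)"] by (simp add: add_ac)
      also have "norm (of_nat (k0 + 1) :: complex) = real (k0 + 1)" by (rule norm_of_nat)
      finally have "norm (mu + of_nat k0 + 1) \<le> M + real k0 + 1" using mu by simp
      from C[OF this] show ?case by simp
    next
      case (step k)
      let ?z = "mu + of_nat k + 1"
      have "norm (of_nat (k + 1) :: complex) - norm (- mu) \<le> norm (of_nat (k + 1) - (- mu))" by (rule norm_triangle_ineq2)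
      moreover have "of_nat (k + 1) - (- mu) = ?z" by simp
      moreover have "norm (of_nat (k + 1) :: complex) = real (k + 1)" by (rule norm_of_nat)
      ultimately have "real (k + 1) - norm mu \<le> norm ?z" by (simp only: norm_minus_cancel)
      moreover have "real k0 \<le> real k" using step.hyps by simp
      ultimately have z1: "norm ?z \<ge> 1" using mu k0 by simp
      have "rGamma ?z = ?z * rGamma (?z + 1)" by (rule rGamma_plus1[symmetric])
      then have "norm (rGamma ?z) = norm ?z * norm (rGamma (?z + 1))" by (simp only: norm_mult)
      then have "norm (rGamma (?z + 1)) \<le> norm (rGamma ?z)"
        using z1 mult_right_mono[OF z1, of "norm (rGamma (?z + 1))"] by simp
      then show ?case using step.IH by (simp add: add_ac)
    qed
  qed
  show ?thesis by (rule that[of "max C 0"]) (use main in auto)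
qed

lemma besselJ_term_bound:
  obtains C E where "C \<ge> 0" "E \<ge> 0" "\<And>mu L k. norm mu \<le> M \<Longrightarrow> norm L \<le> M \<Longrightarrow> norm (besselJ_term mu L k) \<le> C * (E ^ k / fact k)"
proof -
  obtain C where C: "C \<ge> 0" "\<And>mu k. norm mu \<le> M \<Longrightarrow> norm (rGamma (mu + of_nat k + 1 :: complex)) \<le> C"
    by (rule rGamma_shift_bounded[where M = M]) blast
  define K where "K = \<bar>M\<bar> + ln 2"
  have K: "K \<ge> 0" by (simp add: K_def)
  show ?thesis
  proof (rule that[of "exp (K * K) * C" "exp (2 * K)"])
    fix mu L :: complex and k assume mu: "norm mu \<le> M" and L: "norm L \<le> M"
    have "norm (L - of_real (ln 2)) \<le> norm L + norm (of_real (ln 2) :: complex)" by (rule norm_triangle_ineq4)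
    also have "norm (of_real (ln 2) :: complex) = ln 2" by (simp only: norm_of_real) simp
    finally have l: "norm (L - of_real (ln 2)) \<le> K" using L by (simp add: K_def)
    have "norm (mu + 2 * of_nat k) \<le> norm mu + norm (2 * of_nat k :: complex)" by (rule norm_triangle_ineq)
    also have "norm (2 * of_nat k :: complex) = 2 * real k" by (simp add: norm_mult)
    finally have m: "norm (mu + 2 * of_nat k) \<le> K + 2 * real k" using mu abs_ge_self[of M] ln_gt_zero[of 2] unfolding K_def by linarith
    have "norm (exp ((mu + 2 * of_nat k) * (L - of_real (ln 2)))) \<le> exp (norm ((mu + 2 * of_nat k) * (L - of_real (ln 2))))"
      by (rule norm_exp)
    also have "\<dots> \<le> exp ((K + 2 * real k) * K)"
      using m l K by (simp only: norm_mult exp_le_cancel_iff) (intro mult_mono, auto)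
    also have "\<dots> = exp (K * K) * exp (2 * K) ^ k"
      by (simp add: algebra_simps flip: exp_of_nat_mult exp_add)
    finally have e: "norm (exp ((mu + 2 * of_nat k) * (L - of_real (ln 2)))) \<le> exp (K * K) * exp (2 * K) ^ k" .
    have "norm (besselJ_term mu L k) = norm (exp ((mu + 2 * of_nat k) * (L - of_real (ln 2)))) * norm (rGamma (mu + of_nat k + 1)) / fact k"
      by (simp add: besselJ_term_def norm_mult norm_divide norm_power)
    also have "\<dots> \<le> (exp (K * K) * exp (2 * K) ^ k) * C / fact k"
      by (intro divide_right_mono mult_mono e C(2) mu) auto
    finally show "norm (besselJ_term mu L k) \<le> exp (K * K) * C * (exp (2 * K) ^ k / fact k)" by (simp add: mult_ac)
  qed (use C K in auto)
qed

lemma uniform_limit_besselJ: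
  "uniform_limit {x. norm (fst x) \<le> M \<and> norm (snd x) \<le> M}
     (\<lambda>n x. \<Sum>k<n. besselJ_term (fst x) (snd x) k) (\<lambda>x. besselJ_log (fst x) (snd x)) sequentially"
proof -
  obtain C E where CE: "C \<ge> 0" "E \<ge> 0"
    "\<And>mu L k. norm mu \<le> M \<Longrightarrow> norm L \<le> M \<Longrightarrow> norm (besselJ_term mu L k) \<le> C * (E ^ k / fact k)"
    by (rule besselJ_term_bound[where M = M]) blast
  have "summable (\<lambda>k. C * (E ^ k / fact k))"
    using summable_exp[of E] by (intro summable_mult) (simp add: field_simps)
  then have "uniform_limit {x. norm (fst x) \<le> M \<and> norm (snd x) \<le> M}
     (\<lambda>n x. \<Sum>k<n. besselJ_term (fst x) (snd x) k) (\<lambda>x. suminf (besselJ_term (fst x) (snd x))) sequentially"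
    by (intro Weierstrass_m_test) (use CE in auto)
  then show ?thesis by (simp add: besselJ_log_def besselJ_term_def[abs_def])
qed

lemma besselJ_log_sums: "besselJ_term mu L sums besselJ_log mu L"
proof -
  obtain C E where CE: "C \<ge> 0" "E \<ge> 0"
    "\<And>u l k. norm u \<le> max (norm mu) (norm L) \<Longrightarrow> norm l \<le> max (norm mu) (norm L) \<Longrightarrow> norm (besselJ_term u l k) \<le> C * (E ^ k / fact k)"
    by (rule besselJ_term_bound[where M = "max (norm mu) (norm L)"]) blast
  have "summable (\<lambda>k. C * (E ^ k / fact k))"
    using summable_exp[of E] by (intro summable_mult) (simp add: field_simps)
  then have "summable (besselJ_term mu L)"
    by (rule summable_comparison_test') (use CE in auto)
  then show ?thesis by (simp add: summable_sums besselJ_log_def besselJ_term_def[abs_def])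
qed

lemma continuous_on_besselJ_log:
  "continuous_on {x. norm (fst x) \<le> M \<and> norm (snd x) \<le> M} (\<lambda>x. besselJ_log (fst x) (snd x))"
proof (rule uniform_limit_theorem[OF _ uniform_limit_besselJ])
  have r: "continuous_on A (\<lambda>x. rGamma (fst x + of_nat k + 1 :: complex))" for A :: "(complex \<times> complex) set" and k
    by (rule continuous_on_compose2[OF continuous_on_rGamma[of UNIV]]) (auto intro!: continuous_intros)
  show "eventually (\<lambda>n. continuous_on {x. norm (fst x) \<le> M \<and> norm (snd x) \<le> M} (\<lambda>x. \<Sum>k<n. besselJ_term (fst x) (snd x) k)) sequentially"
    unfolding besselJ_term_def by (intro always_eventually allI continuous_intros r) auto
qed simp

text \<open>Order and logarithm both depend on the variable, since later the order is
  \<open>exp w\<close> and the logarithm is \<open>w\<close> plus a constant. The bounds on the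
  terms are uniform on bounded sets of pairs.\<close>

lemma holomorphic_on_besselJ_log:
  assumes S: "open S" and f: "f holomorphic_on S" and g: "g holomorphic_on S"
  shows "(\<lambda>z. besselJ_log (f z) (g z)) holomorphic_on S"
proof (rule holomorphic_uniform_sequence[OF S])
  show "(\<lambda>z. \<Sum>k<n. besselJ_term (f z) (g z) k) holomorphic_on S" for n
    unfolding besselJ_term_def by (intro holomorphic_intros f g holomorphic_rGamma') auto
  fix x assume "x \<in> S"
  then obtain d where d: "d > 0" "cball x d \<subseteq> S" using S open_contains_cball by blast
  have "compact (f ` cball x d)" "compact (g ` cball x d)"
    using holomorphic_on_imp_continuous_on[OF f] holomorphic_on_imp_continuous_on[OF g] d
    by (auto intro!: compact_continuous_image intro: continuous_on_subset)
  then obtain A B where AB: "\<And>z. z \<in> cball x d \<Longrightarrow> norm (f z) \<le> A" "\<And>z. z \<in> cball x d \<Longrightarrow> norm (g z) \<le> B"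
    by (force dest!: compact_imp_bounded simp: bounded_iff)
  define M where "M = max A B"
  have sub: "(\<lambda>z. (f z, g z)) ` cball x d \<subseteq> {x. norm (fst x) \<le> M \<and> norm (snd x) \<le> M}"
    using AB by (force simp: M_def)
  have "uniform_limit (cball x d) (\<lambda>n z. \<Sum>k<n. besselJ_term (f z) (g z) k) (\<lambda>z. besselJ_log (f z) (g z)) sequentially"
    using uniform_limit_besselJ[of M] sub unfolding uniform_limit_iff
    by (simp add: image_subset_iff) (fastforce elim!: eventually_mono)
  with d show "\<exists>d>0. cball x d \<subseteq> S \<and> uniform_limit (cball x d) (\<lambda>n z. \<Sum>k<n. besselJ_term (f z) (g z) k) (\<lambda>z. besselJ_log (f z) (g z)) sequentially"
    by blast
qed

text \<open>The reciprocal Gamma function vanishes at the nonpositive integers, so the first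
  \<open>n\<close> terms of the series of order \<open>- n\<close> drop out, and the others are
  those of order \<open>n\<close> up to a common sign.\<close>

lemma besselJ_log_minus_nat: "besselJ_log (- of_nat n) L = (-1) ^ n * besselJ_log (of_nat n) L"
proof -
  have "besselJ_term (- of_nat n) L sums ((-1) ^ n * besselJ_log (of_nat n) L)"
  proof (rule sums_zero_iff_shift[THEN iffD1])
    show "besselJ_term (- of_nat n) L i = 0" if "i < n" for i
    proof -
      have "- of_nat n + of_nat i + 1 = - (of_nat (n - i - 1) :: complex)" using that by (simp add: of_nat_diff)
      then have "rGamma (- of_nat n + of_nat i + 1 :: complex) = 0" by (simp add: rGamma_eq_zero_iff)
      then show ?thesis by (simp add: besselJ_term_def)
    qed
    have "besselJ_term (- of_nat n) L (j + n) = (-1) ^ n * besselJ_term (of_nat n) L j" for j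
    proof -
      have 1: "rGamma (- of_nat n + of_nat (j + n) + 1 :: complex) = 1 / fact j"
        by (simp add: rGamma_inverse_Gamma Gamma_fact[symmetric] divide_inverse add_ac)
      have 2: "rGamma (of_nat n + of_nat j + 1 :: complex) = 1 / fact (j + n)"
        using Gamma_fact[of "j + n", where 'a = complex] by (simp add: rGamma_inverse_Gamma divide_inverse add_ac)
      have 3: "- of_nat n + 2 * of_nat (j + n) = (of_nat n + 2 * of_nat j :: complex)" by simp
      show ?thesis unfolding besselJ_term_def 1 2 3 by (simp add: power_add mult_ac)
    qed
    then show "(\<lambda>i. besselJ_term (- of_nat n) L (i + n)) sums ((-1) ^ n * besselJ_log (of_nat n) L)"
      using sums_mult[OF besselJ_log_sums] by simp
  qed
  then show ?thesis using besselJ_log_sums sums_unique2 by blast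
qed

text \<open>In contrast to the quotient \<open>hankel1_nonint\<close>, its numerator is holomorphic
  in order and logarithm, integer orders included.\<close>

definition hankel_num :: "complex \<Rightarrow> complex \<Rightarrow> complex" where
  "hankel_num mu L = besselJ_log (- mu) L - exp (- mu * of_real pi * \<i>) * besselJ_log mu L"

lemma hankel1_nonint_eq: "hankel1_nonint mu L = hankel_num mu L / (\<i> * sin (mu * of_real pi))"
  by (simp add: hankel1_nonint_def hankel_num_def)

lemma exp_nat_pi:
  "exp (of_nat n * of_real pi * \<i>) = (-1 :: complex) ^ n" "exp (- (of_nat n * of_real pi * \<i>)) = (-1 :: complex) ^ n"
proof -
  show 1: "exp (of_nat n * of_real pi * \<i>) = (-1 :: complex) ^ n"
    by (simp add: exp_of_nat_mult mult.assoc)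
  show "exp (- (of_nat n * of_real pi * \<i>)) = (-1 :: complex) ^ n"
    unfolding exp_minus 1 by (cases "even n") auto
qed

lemma hankel_num_int:
  assumes "mu \<in> \<int>" shows "hankel_num mu L = 0"
proof -
  obtain k :: int where k: "mu = of_int k" using assms by (rule Ints_cases)
  have sq: "(-1) ^ n * ((-1) ^ n * X) = (X :: complex)" for n X by (cases "even n") auto
  show ?thesis
  proof (cases "k \<ge> 0")
    case True
    then obtain n where n: "k = int n" using nonneg_int_cases by blast
    have mu: "mu = of_nat n" by (simp add: k n)
    show ?thesis using besselJ_log_minus_nat[of n L] exp_nat_pi(2)[of n] by (simp add: mu hankel_num_def)
  next
    case False
    define n where "n = nat (- k)"
    have n: "k = - int n" using False by (simp add: n_def)
    have mu: "mu = - of_nat n" by (simp add: k n)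
    show ?thesis using besselJ_log_minus_nat[of n L] exp_nat_pi(1)[of n] by (simp add: mu hankel_num_def sq)
  qed
qed

lemma holomorphic_on_hankel_num:
  assumes S: "open S" and f: "f holomorphic_on S" and g: "g holomorphic_on S"
  shows "(\<lambda>z. hankel_num (f z) (g z)) holomorphic_on S"
  unfolding hankel_num_def by (intro holomorphic_intros holomorphic_on_besselJ_log S f g)

lemma continuous_on_hankel_num:
  "continuous_on {x. norm (fst x) \<le> M \<and> norm (snd x) \<le> M} (\<lambda>x. hankel_num (fst x) (snd x))"
proof -
  have "continuous_on {x. norm (fst x) \<le> M \<and> norm (snd x) \<le> M} (\<lambda>x. besselJ_log (fst (- fst x, snd x)) (snd (- fst x, snd x)))"
    by (rule continuous_on_compose2[OF continuous_on_besselJ_log[of M]]) (auto intro!: continuous_intros)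
  then show ?thesis unfolding hankel_num_def by (intro continuous_intros continuous_on_besselJ_log) auto
qed

text \<open>The numerator of the Hankel function vanishes identically in \<open>L\<close> at integer order, so its
  variation in \<open>L\<close> is of smaller order than the distance of the order to the integer.\<close>

lemma hankel_num_variation:
  assumes k: "k \<in> \<int>" and e: "e > 0"
  shows "eventually (\<lambda>m. \<forall>L. norm (L - L0) \<le> 1/2 \<longrightarrow> norm (hankel_num m L - hankel_num m L0) \<le> e * norm (L - L0)) (nhds k)"
proof -
  define M where "M = norm k + norm L0 + 1"
  let ?K = "cball k 1 \<times> cball L0 1"
  have sub: "?K \<subseteq> {x. norm (fst x) \<le> M \<and> norm (snd x) \<le> M}"
  proof
    fix x assume "x \<in> ?K"
    then have "norm (fst x - k) \<le> 1" "norm (snd x - L0) \<le> 1" by (auto simp: dist_norm norm_minus_commute)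
    then show "x \<in> {x. norm (fst x) \<le> M \<and> norm (snd x) \<le> M}"
      using norm_triangle_ineq2[of "fst x" k] norm_triangle_ineq2[of "snd x" L0] norm_ge_zero[of k] norm_ge_zero[of L0]
      unfolding M_def mem_Collect_eq by linarith
  qed
  have "compact ?K" by (intro compact_Times compact_cball)
  \<comment> \<open>The numerator is 0 at order \<open>k\<close>, so uniform continuity makes it at
    most \<open>e / 2\<close> on the whole disc of logarithms for all orders near \<open>k\<close>.
    Cauchy's inequality on discs of radius 1/2 then bounds its derivative in the logarithm by
    \<open>e\<close>.\<close>
  then have "uniformly_continuous_on ?K (\<lambda>x. hankel_num (fst x) (snd x))"
    using continuous_on_subset[OF continuous_on_hankel_num sub] by (rule compact_uniformly_continuous[rotated])
  then obtain d where d: "d > 0" "\<And>x y. x \<in> ?K \<Longrightarrow> y \<in> ?K \<Longrightarrow> dist y x < d \<Longrightarrow>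
      dist (hankel_num (fst y) (snd y)) (hankel_num (fst x) (snd x)) < e / 2"
    unfolding uniformly_continuous_on_def using e by (metis half_gt_zero)
  have "eventually (\<lambda>m. m \<in> ball k (min d 1)) (nhds k)" using d by (intro eventually_nhds_in_open) auto
  then show ?thesis
  proof eventually_elim
    case (elim m)
    have small: "norm (hankel_num m l) \<le> e / 2" if "l \<in> cball L0 1" for l
    proof -
      have "dist (hankel_num (fst (m, l)) (snd (m, l))) (hankel_num (fst (k, l)) (snd (k, l))) < e / 2"
        by (rule d(2)) (use elim that in \<open>auto simp: dist_Pair_Pair dist_commute\<close>)
      then show ?thesis using hankel_num_int[OF k, of l] by simp
    qed
    have hol: "(\<lambda>l. hankel_num m l) holomorphic_on UNIV"
      by (rule holomorphic_on_hankel_num) (auto intro!: holomorphic_intros)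
    show ?case
    proof (intro allI impI)
      fix L assume L: "norm (L - L0) \<le> 1/2"
      show "norm (hankel_num m L - hankel_num m L0) \<le> e * norm (L - L0)"
      proof (rule field_differentiable_bound[of "cball L0 (1/2)" _ "deriv (hankel_num m)"])
        show "(hankel_num m has_field_derivative deriv (hankel_num m) z) (at z within cball L0 (1/2))" for z
          using holomorphic_derivI[OF hol, of z] by (auto intro: has_field_derivative_at_within)
        fix z assume z: "z \<in> cball L0 (1/2)"
        have "norm ((deriv ^^ 1) (hankel_num m) z) \<le> fact 1 * (e / 2) / (1/2) ^ 1"
        proof (rule Cauchy_inequality)
          show "hankel_num m holomorphic_on ball z (1/2)" "continuous_on (cball z (1/2)) (hankel_num m)"
            using hol holomorphic_on_subset holomorphic_on_imp_continuous_on by (blast, blast)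
          fix x assume x: "norm (z - x) = 1/2"
          have "dist L0 x \<le> dist L0 z + dist z x" by (rule dist_triangle)
          then show "norm (hankel_num m x) \<le> e / 2" using z x by (intro small) (auto simp: dist_norm)
        qed auto
        then show "norm (deriv (hankel_num m) z) \<le> e" by simp
      qed (use L in \<open>auto simp: dist_norm norm_minus_commute\<close>)
    qed
  qed
qed

lemma sin_pi_near_int:
  fixes k :: complex
  assumes k: "k \<in> \<int>"
  shows "((\<lambda>m. sin (m * of_real pi) / (m - k)) \<longlongrightarrow> cos (k * of_real pi) * of_real pi) (at k)"
    and "cos (k * of_real pi) \<noteq> 0" and "sin (k * of_real pi) = 0"
proof -
  obtain n :: int where n: "k = of_int n" using k by (rule Ints_cases)
  have *: "k * of_real pi = of_real (of_int n * pi)" by (simp add: n)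
  show s: "sin (k * of_real pi) = 0" unfolding * sin_of_real by (auto simp: sin_zero_iff_int2)
  have "cos (k * of_real pi) ^ 2 = 1" using sin_cos_squared_add[of "k * of_real pi"] s by simp
  then show "cos (k * of_real pi) \<noteq> 0" by auto
  have "((\<lambda>m. sin (m * of_real pi)) has_field_derivative cos (k * of_real pi) * of_real pi) (at k)"
    by (auto intro!: derivative_eq_intros)
  then show "((\<lambda>m. sin (m * of_real pi) / (m - k)) \<longlongrightarrow> cos (k * of_real pi) * of_real pi) (at k)"
    unfolding has_field_derivative_iff s by simp
qed

lemma sin_pi_nonzero: "m \<notin> \<int> \<Longrightarrow> sin (m * of_real pi :: complex) \<noteq> 0"
proof
  assume m: "m \<notin> \<int>" and "sin (m * of_real pi) = 0"
  then obtain n :: int where "m * of_real pi = of_real (of_int n * pi)" by (auto simp: sin_eq_0)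
  then have "m = of_int n" by simp
  then show False using m by simp
qed

lemma eventually_not_Ints: "eventually (\<lambda>m. m \<notin> \<int>) (at (k :: complex))"
proof -
  have "closed (\<int> - {k})" by (rule closed_subset_Ints) auto
  then have "open (- (\<int> - {k}))" by (rule open_Compl)
  from eventually_at_in_open'[OF this, of k]
  have "eventually (\<lambda>m. m \<in> - (\<int> - {k})) (at k)" by auto
  moreover have "eventually (\<lambda>m. m \<noteq> k) (at k)" by (simp add: eventually_at_filter)
  ultimately show ?thesis by eventually_elim auto
qed

text \<open>The values are known along a curve of logarithms \<open>Lf m\<close>, while the limit
  defining the function at an integer order keeps the logarithm at \<open>L0\<close>. Between the
  two the numerator changes by \<open>o(m - k)\<close>, as \<open>hankel_num_variation\<close>
  shows, and the denominator has a simple zero, so the limits agree.\<close>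

lemma tendsto_hankel1_nonint_int:
  assumes k: "k \<in> \<int>" and Lf: "(Lf has_field_derivative D) (at k)" "Lf k = L0"
    and R: "(R \<longlongrightarrow> R0) (at k)"
    and eq: "eventually (\<lambda>m. hankel_num m (Lf m) = \<i> * sin (m * of_real pi) * R m) (at k)"
  shows "((\<lambda>m. hankel1_nonint m L0) \<longlongrightarrow> R0) (at k)"
proof -
  define d where "d = (\<lambda>m. (hankel_num m (Lf m) - hankel_num m L0) / (m - k))"
  have d0: "(d \<longlongrightarrow> 0) (at k)"
  proof (rule tendstoI)
    fix e :: real assume e: "e > 0"
    define c where "c = norm D + 1"
    have c: "c > 0" by (simp add: c_def add_nonneg_pos)
    have "((\<lambda>m. norm ((Lf m - L0) / (m - k))) \<longlongrightarrow> norm D) (at k)"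
      using Lf unfolding has_field_derivative_iff by (intro tendsto_norm) simp
    then have 1: "eventually (\<lambda>m. norm ((Lf m - L0) / (m - k)) < c) (at k)"
      by (rule order_tendstoD) (simp add: c_def)
    have "(Lf \<longlongrightarrow> L0) (at k)" using DERIV_isCont[OF Lf(1)] Lf(2) by (simp add: isCont_def)
    then have 2: "eventually (\<lambda>m. dist (Lf m) L0 < 1/2) (at k)" by (rule tendstoD) simp
    have 3: "eventually (\<lambda>m. \<forall>L. norm (L - L0) \<le> 1/2 \<longrightarrow> norm (hankel_num m L - hankel_num m L0) \<le> (e / c) * norm (L - L0)) (at k)"
      using hankel_num_variation[OF k, of "e / c" L0] e c by (simp add: eventually_nhds_conv_at)
    have 4: "eventually (\<lambda>m. m \<noteq> k) (at k)" by (simp add: eventually_at_filter)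
    show "eventually (\<lambda>m. dist (d m) 0 < e) (at k)"
      using 1 2 3 4
    proof eventually_elim
      case (elim m)
      have mk: "norm (m - k) > 0" using elim by simp
      have "norm (hankel_num m (Lf m) - hankel_num m L0) \<le> (e / c) * norm (Lf m - L0)"
        using elim by (simp add: dist_norm)
      from divide_right_mono[OF this, of "norm (m - k)"]
      have "norm (d m) \<le> (e / c) * norm ((Lf m - L0) / (m - k))"
        by (simp add: d_def norm_divide)
      also have "\<dots> < (e / c) * c" using elim e c by (intro mult_strict_left_mono) auto
      finally show ?case using c by simp
    qed
  qed
  have "((\<lambda>m. R m - d m / (\<i> * (sin (m * of_real pi) / (m - k)))) \<longlongrightarrow> R0 - 0 / (\<i> * (cos (k * of_real pi) * of_real pi))) (at k)"
    by (intro tendsto_intros R d0 sin_pi_near_int k) (use sin_pi_near_int(2)[OF k] in auto)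
  moreover have "eventually (\<lambda>m. R m - d m / (\<i> * (sin (m * of_real pi) / (m - k))) = hankel1_nonint m L0) (at k)"
    using eq eventually_not_Ints[of k]
  proof eventually_elim
    case (elim m)
    have s: "sin (m * of_real pi) \<noteq> 0" using elim sin_pi_nonzero by blast
    have mk: "m - k \<noteq> 0" using elim k by auto
    show ?case unfolding d_def elim hankel1_nonint_eq using s mk by (simp add: field_simps)
  qed
  ultimately show ?thesis by (simp add: Lim_transform_eventually)
qed

lemma besselJ_log_shift_pi: "besselJ_log mu (L + \<i> * of_real pi) = exp (\<i> * of_real pi * mu) * besselJ_log mu L"
proof -
  have shift: "besselJ_term mu (L + \<i> * of_real pi) k = exp (\<i> * of_real pi * mu) * besselJ_term mu L k" for k
  proof -
    have "exp ((mu + 2 * of_nat k) * (L + \<i> * of_real pi - of_real (ln 2)))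
        = exp (\<i> * of_real pi * mu) * exp ((mu + 2 * of_nat k) * (L - of_real (ln 2))) * exp (of_nat k * (2 * of_real pi * \<i>))"
    proof -
      have "(mu + 2 * of_nat k) * (L + \<i> * of_real pi - of_real (ln 2))
          = \<i> * of_real pi * mu + (mu + 2 * of_nat k) * (L - of_real (ln 2)) + of_nat k * (2 * of_real pi * \<i>)"
        by (simp add: algebra_simps)
      then show ?thesis by (simp only: exp_add)
    qed
    also have "exp (of_nat k * (2 * of_real pi * \<i>)) = 1" by (simp add: exp_of_nat_mult)
    finally show ?thesis by (simp add: besselJ_term_def)
  qed
  have "besselJ_term mu (L + \<i> * of_real pi) sums (exp (\<i> * of_real pi * mu) * besselJ_log mu L)"
    using sums_mult[OF besselJ_log_sums[of mu L], of "exp (\<i> * of_real pi * mu)"] by (simp only: shift[symmetric])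
  then show ?thesis using besselJ_log_sums sums_unique2 by blast
qed

text \<open>The classical connection formula for a rotation of the argument by \<open>pi\<close>. It
  reduces everything about the second Hankel function to the first one, at the negative
  order.\<close>

lemma hankel2_nonint_eq: "hankel2_nonint mu L = - hankel1_nonint (- mu) (L + \<i> * of_real pi)"
proof -
  have "exp (- (- mu) * of_real pi * \<i>) * exp (\<i> * of_real pi * - mu) = 1"
    by (simp flip: exp_add add: algebra_simps)
  then have "exp (- (- mu) * of_real pi * \<i>) * (exp (\<i> * of_real pi * - mu) * X) = X" for X
    by (simp only: mult.assoc[symmetric] mult_1_left)
  moreover have "exp (\<i> * of_real pi * mu) = exp (mu * of_real pi * \<i>)"
    by (simp only: mult_ac)
  moreover have "sin (- mu * of_real pi) = - sin (mu * of_real pi)" by simp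
  moreover have "(a - e * b) / (- \<i> * s) = - ((e * b - a) / (\<i> * - s))" for a b e s :: complex
    by (simp flip: minus_divide_left minus_divide_right add: diff_divide_distrib)
  ultimately show ?thesis
    unfolding hankel1_nonint_def hankel2_nonint_def besselJ_log_shift_pi by (simp only: minus_minus)
qed

lemma besselJ_log_hankel:
  assumes "mu \<notin> \<int>"
  shows "besselJ_log mu L = (hankel1_nonint mu L + hankel2_nonint mu L) / 2"
proof -
  let ?s = "sin (mu * of_real pi)"
  have s: "?s \<noteq> 0" using assms by (rule sin_pi_nonzero)
  have e: "exp (mu * of_real pi * \<i>) - exp (- mu * of_real pi * \<i>) = 2 * \<i> * ?s"
    by (simp add: sin_exp_eq mult_ac)
  have "hankel1_nonint mu L + hankel2_nonint mu L
      = (exp (mu * of_real pi * \<i>) - exp (- mu * of_real pi * \<i>)) * besselJ_log mu L / (\<i> * ?s)"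
    by (simp add: hankel1_nonint_def hankel2_nonint_def algebra_simps minus_divide_right diff_divide_distrib)
  then show ?thesis unfolding e using s by simp
qed

lemma besselY_nonint_hankel:
  "besselY_nonint mu L = (hankel1_nonint mu L - hankel2_nonint mu L) / (2 * \<i>)"
proof (cases "sin (mu * of_real pi) = 0")
  case True
  \<comment> \<open>At zeros of the sine all three quotients are divisions by 0 and take the value
    0.\<close>
  then show ?thesis by (simp add: besselY_nonint_def hankel1_nonint_def hankel2_nonint_def)
next
  case False
  let ?s = "sin (mu * of_real pi)"
  have e: "exp (mu * of_real pi * \<i>) + exp (- mu * of_real pi * \<i>) = 2 * cos (mu * of_real pi)"
    by (simp add: cos_exp_eq mult_ac)
  have "hankel1_nonint mu L - hankel2_nonint mu L
      = (2 * besselJ_log (- mu) L - (exp (mu * of_real pi * \<i>) + exp (- mu * of_real pi * \<i>)) * besselJ_log mu L) / (\<i> * ?s)"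
    by (simp add: hankel1_nonint_def hankel2_nonint_def algebra_simps minus_divide_right diff_divide_distrib add_divide_distrib)
  moreover have "(2 * a - 2 * c * b) / (\<i> * s) / (2 * \<i>) = (b * c - a) / s" if "s \<noteq> 0" for a b c s :: complex
  proof -
    have "(2 * a - 2 * c * b) / (\<i> * s) / (2 * \<i>) = (2 * (a - c * b)) / (2 * (\<i> * \<i> * s))"
      by (simp only: divide_divide_eq_left right_diff_distrib mult_ac)
    also have "\<dots> = (a - c * b) / (\<i> * \<i> * s)" by (rule mult_divide_mult_cancel_left) simp
    also have "\<dots> = (b * c - a) / s" using that by (simp add: field_simps)
    finally show ?thesis .
  qed
  ultimately show ?thesis unfolding e besselY_nonint_def using False by simp
qed

lemma isCont_besselJ_log: "isCont (\<lambda>m. besselJ_log m L) k"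
  using holomorphic_on_imp_continuous_on[OF holomorphic_on_besselJ_log[OF open_UNIV holomorphic_on_ident holomorphic_on_const]]
  by (simp add: continuous_on_eq_continuous_at)

section \<open>Analytic continuation and remainder terms\<close>

context debye_angle
begin

definition dens :: "nat \<Rightarrow> real \<Rightarrow> complex" where
  "dens n t = of_real (t powr (real n - 1/2) * exp (- t * lag)) * Fker \<beta> t"

lemma dens_Suc: "t > 0 \<Longrightarrow> dens (Suc n) t = of_real t * dens n t"
proof -
  assume t: "t > 0"
  have "real (Suc n) - 1/2 = 1 + (real n - 1/2)" by simp
  then have "t powr (real (Suc n) - 1/2) = t * t powr (real n - 1/2)"
    using t by (simp only: powr_add) simp
  then show ?thesis by (simp add: dens_def mult.assoc)
qed

lemma set_integrable_dens: "set_integrable lborel {0<..} (dens n)"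
  using weighted_Fker_integral(1)[OF laplace_weight_powr[of n]] by (simp add: dens_def[abs_def])

lemma set_integrable_mult_dens:
  assumes cont: "continuous_on {0<..} q" and bound: "\<And>t. t > 0 \<Longrightarrow> norm (q t) \<le> C"
  shows "set_integrable lborel {0<..} (\<lambda>t. q t * dens n t)"
proof -
  have int: "integrable lborel (\<lambda>t. indicator {0<..} t *\<^sub>R dens n t)"
    using set_integrable_dens by (simp add: set_integrable_def)
  have "integrable lborel (\<lambda>t. (indicator {0<..} t *\<^sub>R q t) * (indicator {0<..} t *\<^sub>R dens n t))"
  proof (rule Bochner_Integration.integrable_bound)
    show "integrable lborel (\<lambda>t. C * norm (indicator {0<..} t *\<^sub>R dens n t))"
      by (intro integrable_mult_right integrable_norm int)
    have "(\<lambda>t. indicator {0<..} t *\<^sub>R q t) \<in> borel_measurable borel"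
      using cont by (intro borel_measurable_continuous_on_indicator) auto
    then show "(\<lambda>t. (indicator {0<..} t *\<^sub>R q t) * (indicator {0<..} t *\<^sub>R dens n t)) \<in> borel_measurable lborel"
      using borel_measurable_integrable[OF int] by (intro borel_measurable_times) auto
    show "AE t in lborel. norm ((indicator {0<..} t *\<^sub>R q t) * (indicator {0<..} t *\<^sub>R dens n t))
        \<le> norm (C * norm (indicator {0<..} t *\<^sub>R dens n t))"
    proof (rule AE_I2)
      fix t :: real
      show "norm ((indicator {0<..} t *\<^sub>R q t) * (indicator {0<..} t *\<^sub>R dens n t))
        \<le> norm (C * norm (indicator {0<..} t *\<^sub>R dens n t))"
        using bound[of t] by (cases "t > 0") (auto simp: norm_mult abs_mult intro!: mult_right_mono)
    qed
  qed
  moreover have "(\<lambda>t. (indicator {0<..} t *\<^sub>R q t) * (indicator {0<..} t *\<^sub>R dens n t))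
      = (\<lambda>t. indicator {0<..} t *\<^sub>R (q t * dens n t))"
    by (auto simp: indicator_def)
  ultimately show ?thesis by (simp add: set_integrable_def)
qed

definition dens_int :: "nat \<Rightarrow> (real \<Rightarrow> complex) \<Rightarrow> complex" where
  "dens_int n q = (LINT t:{0<..}|lborel. q t * dens n t)"

lemma integral_dens_int:
  assumes "continuous_on {0<..} q" "\<And>t. t > 0 \<Longrightarrow> norm (q t) \<le> C"
    and "\<And>t. t > 0 \<Longrightarrow> f t = q t * dens n t"
  shows "integral {0<..} f = dens_int n q"
proof -
  have "integral {0<..} f = integral {0<..} (\<lambda>t. q t * dens n t)"
    by (rule integral_cong) (use assms in auto)
  then show ?thesis
    using set_borel_integral_eq_integral(2)[OF set_integrable_mult_dens[OF assms(1,2)]]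
    by (simp add: dens_int_def)
qed

text \<open>The plane without the closed negative imaginary axis: no zero of
  \<open>1 + i t / \<nu>\<close> with \<open>t > 0\<close> lies in it. It is the projection of the
  sector \<open>- pi/2 < arg \<nu> < 3 pi/2\<close> of (b).\<close>

definition cut_plane :: "complex set" where "cut_plane = {\<nu>. Re \<nu> \<noteq> 0 \<or> Im \<nu> > 0}"

text \<open>A lower bound for the distance to the cut, chosen because it is Lipschitz with constant
  1 and positive exactly on \<open>cut_plane\<close>.\<close>

definition cut_dist :: "complex \<Rightarrow> real" where "cut_dist \<nu> = max \<bar>Re \<nu>\<bar> (Im \<nu>)"

lemma cut_dist_pos: "\<nu> \<in> cut_plane \<longleftrightarrow> cut_dist \<nu> > 0"
  by (auto simp: cut_plane_def cut_dist_def)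

lemma cut_dist_le: "t \<ge> 0 \<Longrightarrow> cut_dist \<nu> \<le> norm (\<nu> + \<i> * of_real t)"
  using abs_Re_le_cmod[of "\<nu> + \<i> * of_real t"] abs_Im_le_cmod[of "\<nu> + \<i> * of_real t"]
  by (auto simp: cut_dist_def)

lemma cut_dist_Lipschitz: "cut_dist \<nu> - norm (u - \<nu>) \<le> cut_dist u"
  using abs_Re_le_cmod[of "u - \<nu>"] abs_Im_le_cmod[of "u - \<nu>"] by (auto simp: cut_dist_def)

lemma open_cut_plane: "open cut_plane"
proof -
  have *: "cut_plane = {\<nu>. Re \<nu> > 0} \<union> {\<nu>. Re \<nu> < 0} \<union> {\<nu>. Im \<nu> > 0}" by (auto simp: cut_plane_def)
  show ?thesis unfolding * by (simp add: open_Un open_halfspace_Re_gt open_halfspace_Re_lt open_halfspace_Im_gt)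
qed

lemma cut_plane_nonzero: "\<nu> \<in> cut_plane \<Longrightarrow> \<nu> \<noteq> 0"
  by (auto simp: cut_plane_def)

lemma cut_plane_denom: "\<nu> \<in> cut_plane \<Longrightarrow> t \<ge> 0 \<Longrightarrow> \<nu> + \<i> * of_real t \<noteq> 0"
  by (auto simp: cut_plane_def complex_eq_iff)

lemma cut_plane_denom': "\<nu> \<in> cut_plane \<Longrightarrow> t \<ge> 0 \<Longrightarrow> 1 + \<i> * of_real t / \<nu> \<noteq> 0"
  using cut_plane_denom[of \<nu> t] cut_plane_nonzero[of \<nu>] by (auto simp: add_divide_eq_iff)

lemma norm_resolvent_le:
  assumes "\<nu> \<in> cut_plane" "t \<ge> 0"
  shows "norm (1 / (1 + \<i> * of_real t / \<nu>)) \<le> norm \<nu> / cut_dist \<nu>"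
proof -
  have "1 / (1 + \<i> * of_real t / \<nu>) = \<nu> / (\<nu> + \<i> * of_real t)"
    using cut_plane_nonzero[OF assms(1)] by (simp add: add_divide_eq_iff)
  then show ?thesis
    using cut_dist_le[OF assms(2), of \<nu>] assms(1) by (simp add: norm_divide cut_dist_pos frac_le)
qed

lemma continuous_on_resolvent: "\<nu> \<in> cut_plane \<Longrightarrow> continuous_on {0<..} (\<lambda>t. 1 / (1 + \<i> * of_real t / \<nu>))"
  using cut_plane_denom' cut_plane_nonzero by (intro continuous_intros) auto

lemma RH_eq:
  assumes "\<nu> \<in> cut_plane"
  shows "RH N \<nu> \<beta> = 1 / (of_real (cbeta \<beta>) * (\<i> * \<nu>) ^ N) * dens_int N (\<lambda>t. 1 / (1 + \<i> * of_real t / \<nu>))"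
proof -
  have "integral {0<..} (\<lambda>t. of_real (t powr (real N - 1/2) * exp (- t * (tan \<beta> - \<beta>))) / (1 + \<i> * of_real t / \<nu>) * Fker \<beta> t)
      = dens_int N (\<lambda>t. 1 / (1 + \<i> * of_real t / \<nu>))"
    by (rule integral_dens_int[OF continuous_on_resolvent[OF assms] norm_resolvent_le[OF assms]])
       (simp_all add: dens_def lag_def)
  then show ?thesis by (simp add: RH_def)
qed

text \<open>On a disc of radius \<open>cut_dist \<nu> / 2\<close> the resolvent is bounded uniformly
  in \<open>t\<close>, so a multiple of the modulus of \<open>dens 0\<close> dominates.\<close>

lemma holomorphic_on_RH0: "(\<lambda>\<nu>. RH 0 \<nu> \<beta>) holomorphic_on cut_plane"
proof -
  let ?f = "\<lambda>\<nu> t. indicator {0<..} t *\<^sub>R (1 / (1 + \<i> * of_real t / \<nu>) * dens 0 t)"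
  have "(\<lambda>\<nu>. LINT t|lborel. ?f \<nu> t) holomorphic_on cut_plane"
  proof (rule holomorphic_on_integral[OF open_cut_plane])
    fix t :: real
    show "(\<lambda>\<nu>. ?f \<nu> t) holomorphic_on cut_plane"
    proof (cases "t > 0")
      case True
      then show ?thesis using cut_plane_nonzero cut_plane_denom' by (auto intro!: holomorphic_intros)
    qed auto
  next
    fix \<nu> assume "\<nu> \<in> cut_plane"
    from set_integrable_mult_dens[OF continuous_on_resolvent[OF this] norm_resolvent_le[OF this], of 0]
    show "?f \<nu> \<in> borel_measurable lborel" by (simp add: set_integrable_def borel_measurable_integrable)
  next
    fix \<nu> assume \<nu>: "\<nu> \<in> cut_plane"
    define \<rho> where "\<rho> = cut_dist \<nu> / 2"
    have \<rho>: "\<rho> > 0" using \<nu> by (simp add: \<rho>_def cut_dist_pos)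
    have dist: "cut_dist u \<ge> \<rho>" if "u \<in> cball \<nu> \<rho>" for u
      using cut_dist_Lipschitz[of \<nu> u] that unfolding \<rho>_def by (simp add: dist_norm norm_minus_commute)
    then have sub: "cball \<nu> \<rho> \<subseteq> cut_plane" using \<rho> unfolding cut_dist_pos subset_eq by fastforce
    let ?w = "\<lambda>t. ((norm \<nu> + \<rho>) / \<rho>) * norm (indicator {0<..} t *\<^sub>R dens 0 t)"
    have "integrable lborel ?w"
      using set_integrable_dens[of 0] unfolding set_integrable_def
      by (intro integrable_mult_right integrable_norm)
    moreover have "norm (?f u t) \<le> ?w t" if u: "u \<in> cball \<nu> \<rho>" for u t
    proof (cases "t > 0")
      case True
      have "norm u \<le> norm \<nu> + \<rho>"
        using norm_triangle_ineq2[of u \<nu>] u by (simp add: dist_norm norm_minus_commute)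
      then have "norm u / cut_dist u \<le> (norm \<nu> + \<rho>) / \<rho>" using dist[OF u] \<rho> by (intro frac_le) auto
      then have "norm (1 / (1 + \<i> * of_real t / u)) \<le> (norm \<nu> + \<rho>) / \<rho>"
        using norm_resolvent_le[of u t] sub u True by force
      then have "norm (1 / (1 + \<i> * of_real t / u)) * norm (dens 0 t) \<le> (norm \<nu> + \<rho>) / \<rho> * norm (dens 0 t)"
        by (rule mult_right_mono) simp
      then show ?thesis using True by (simp only: norm_mult indicator_simps greaterThan_iff norm_scaleR)
    qed auto
    ultimately show "\<exists>\<rho>>0. \<exists>w. cball \<nu> \<rho> \<subseteq> cut_plane \<and> integrable lborel w \<and>
                (\<forall>u\<in>cball \<nu> \<rho>. \<forall>t\<in>space lborel. norm (?f u t) \<le> w t)"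
      using \<rho> sub by blast
  qed
  then have "(\<lambda>\<nu>. 1 / of_real (cbeta \<beta>) * (LINT t|lborel. ?f \<nu> t)) holomorphic_on cut_plane"
    by (intro holomorphic_intros)
  then show ?thesis
    by (rule holomorphic_transform) (simp add: RH_eq dens_int_def set_lebesgue_integral_def)
qed

lemma cbeta_pos: "cbeta \<beta> > 0"
  using sin_\<beta> cos_\<beta> by (simp add: cbeta_def)

lemma debyeU_integral: "U n cotp = \<i> ^ n / of_real (cbeta \<beta>) * dens_int n (\<lambda>_. 1)"
proof -
  have "dens_int n (\<lambda>_. 1) = of_real (cbeta \<beta>) * (of_real (cos \<beta> / sin \<beta>) ^ n * debye_factor n * debye_coeff n cotp)"
    using debye_integral[of n] by (simp add: dens_int_def dens_def)
  moreover have "cotp ^ n = \<i> ^ n * of_real (cos \<beta> / sin \<beta>) ^ n" by (simp only: cotp_def power_mult_distrib)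
  ultimately show ?thesis
    unfolding debyeU_eq_debye_coeff using cbeta_pos by simp
qed

lemma debyeU_derivative:
  "U n cotp = (-1) ^ n * cotp ^ n / (2 ^ n * fact n) * (deriv ^^ (2 * n))
     (\<lambda>t::complex. if t = 0 then 1 else ((1/2) * t ^ 2 / (cotp * (t - sinh t) + cosh t - 1)) powr (of_nat n + 1/2)) 0"
  unfolding deriv_phase_ratio_powr debyeU_eq_debye_coeff debye_factor_def by simp

text \<open>One step of the geometric series, \<open>1 / (1 + z) = 1 - z / (1 + z)\<close> with
  \<open>z = i t / \<nu>\<close>. The first part is a moment and hence a Debye polynomial; in the
  second the factor \<open>t\<close> raises the index of the density.\<close>

lemma RH_Suc:
  assumes \<nu>: "\<nu> \<in> cut_plane"
  shows "RH N \<nu> \<beta> = (-1) ^ N * U N cotp / \<nu> ^ N + RH (Suc N) \<nu> \<beta>"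
proof -
  let ?q = "\<lambda>t. 1 / (1 + \<i> * of_real t / \<nu>)"
  note nz = cut_plane_nonzero[OF \<nu>]
  have i1: "set_integrable lborel {0<..} (\<lambda>t. 1 * dens N t)"
    by (rule set_integrable_mult_dens[where C = 1]) auto
  have i2: "set_integrable lborel {0<..} (\<lambda>t. (\<i> / \<nu>) * (?q t * dens (Suc N) t))"
    using set_integrable_mult_dens[OF continuous_on_resolvent[OF \<nu>] norm_resolvent_le[OF \<nu>], of "Suc N"]
    by (intro set_integrable_mult_right) auto
  have "dens_int N ?q = (LINT t:{0<..}|lborel. 1 * dens N t - (\<i> / \<nu>) * (?q t * dens (Suc N) t))"
    unfolding dens_int_def
  proof (rule set_lebesgue_integral_cong)
    show "\<forall>t. t \<in> {0<..} \<longrightarrow> ?q t * dens N t = 1 * dens N t - (\<i> / \<nu>) * (?q t * dens (Suc N) t)"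
    proof (intro allI impI)
      fix t :: real assume "t \<in> {0<..}"
      then have t: "t > 0" by simp
      have "?q t = 1 - (\<i> / \<nu>) * (?q t * of_real t)"
      proof -
        have "1 / (1 + z) = 1 - 1 / (1 + z) * z" if "1 + z \<noteq> 0" for z :: complex
          using that by (simp add: field_simps)
        then have "?q t = 1 - ?q t * (\<i> * of_real t / \<nu>)"
          using cut_plane_denom'[OF \<nu>, of t] t by (meson less_imp_le)
        moreover have "?q t * (\<i> * of_real t / \<nu>) = (\<i> / \<nu>) * (?q t * of_real t)" by simp
        ultimately show ?thesis by (simp only:)
      qed
      then have "?q t * dens N t = (1 - (\<i> / \<nu>) * (?q t * of_real t)) * dens N t" by (rule arg_cong)
      then show "?q t * dens N t = 1 * dens N t - (\<i> / \<nu>) * (?q t * dens (Suc N) t)"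
        by (simp only: dens_Suc[OF t] left_diff_distrib mult.assoc)
    qed
  qed simp
  also have "\<dots> = dens_int N (\<lambda>_. 1) - (\<i> / \<nu>) * dens_int (Suc N) ?q"
    unfolding dens_int_def set_integral_diff(2)[OF i1 i2] by (simp only: set_integral_mult_right)
  finally have e: "dens_int N ?q = dens_int N (\<lambda>_. 1) - (\<i> / \<nu>) * dens_int (Suc N) ?q" .
  have c: "complex_of_real (cbeta \<beta>) \<noteq> 0" using cbeta_pos by simp
  \<comment> \<open>\<open>RH\<close> carries the power of \<open>i\<close> in the denominator, the
    moment formula for the polynomials in the numerator; this accounts for the alternating sign in
    the first sum of (b).\<close>
  have i: "1 / \<i> ^ N = (-1) ^ N * \<i> ^ N"
  proof -
    have "((-1) ^ N * \<i> ^ N) * \<i> ^ N = (1 :: complex)" by (simp flip: power_mult_distrib)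
    then show ?thesis by (simp only: nonzero_divide_eq_eq[OF power_not_zero[OF complex_i_not_zero]])
  qed
  have U: "(-1) ^ N * U N cotp / \<nu> ^ N = 1 / (of_real (cbeta \<beta>) * (\<i> * \<nu>) ^ N) * dens_int N (\<lambda>_. 1)"
  proof -
    have "1 / (of_real (cbeta \<beta>) * (\<i> * \<nu>) ^ N) = (1 / \<i> ^ N) / (of_real (cbeta \<beta>) * \<nu> ^ N)"
      by (simp add: power_mult_distrib)
    then show ?thesis unfolding debyeU_integral i by simp
  qed
  have ii: "a / (c * p) * (- (\<i> / \<nu>) * y) = a / (c * ((\<i> * \<nu>) * p)) * y" for a c p y :: complex
  proof -
    have "- (\<i> / \<nu>) = 1 / (\<i> * \<nu>)" using nz by (simp add: field_simps)
    then show ?thesis by simp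
  qed
  have "RH N \<nu> \<beta> = 1 / (of_real (cbeta \<beta>) * (\<i> * \<nu>) ^ N) * dens_int N (\<lambda>_. 1)
      + 1 / (of_real (cbeta \<beta>) * (\<i> * \<nu>) ^ N) * (- (\<i> / \<nu>) * dens_int (Suc N) ?q)"
    unfolding RH_eq[OF \<nu>] e by (simp add: algebra_simps)
  also have "1 / (of_real (cbeta \<beta>) * (\<i> * \<nu>) ^ N) * (- (\<i> / \<nu>) * dens_int (Suc N) ?q) = RH (Suc N) \<nu> \<beta>"
    unfolding RH_eq[OF \<nu>] ii power_Suc by simp
  finally show ?thesis unfolding U .
qed

lemma RH_expansion:
  "\<nu> \<in> cut_plane \<Longrightarrow> RH 0 \<nu> \<beta> = (\<Sum>n<N. (-1) ^ n * U n cotp / \<nu> ^ n) + RH N \<nu> \<beta>"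
proof (induction N)
  case (Suc N)
  then show ?case using RH_Suc[of \<nu> N] by (simp only: sum.lessThan_Suc add.assoc)
qed simp

section \<open>Continuation in the logarithm of the order\<close>

lemma exp_in_cut_plane:
  assumes "- pi / 2 < Im w" "Im w < 3 * pi / 2"
  shows "exp w \<in> cut_plane"
proof (rule ccontr)
  assume "exp w \<notin> cut_plane"
  then have "Re (exp w) = 0" "Im (exp w) \<le> 0" by (auto simp: cut_plane_def)
  then have c: "cos (Im w) = 0" and s: "sin (Im w) \<le> 0" by (auto simp: Re_exp Im_exp mult_le_0_iff)
  have z: "sin (Im w - pi / 2) = 0" using c by (simp add: sin_diff)
  have b: "- pi < Im w - pi / 2" "Im w - pi / 2 < pi" using assms by linarith+
  have "Im w - pi / 2 = 0" by (rule sin_eq_0_pi[OF b z])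
  then have "Im w = pi / 2" by linarith
  then show False using s by (simp only: sin_pi_half)
qed

definition strip1 :: "complex set" where "strip1 = {w. - pi / 2 < Im w \<and> Im w < 3 * pi / 2}"

text \<open>Added to the logarithm of the order, it gives the logarithm of
  \<open>\<nu> sec \<beta>\<close>.\<close>

definition log_shift :: complex where "log_shift = of_real (ln (1 / cos \<beta>))"

text \<open>With \<open>exp (w / 2)\<close> for the square root of the order,
  \<open>exp (w / 2) * lead\<close> is the denominator in (b).\<close>

definition lead :: real where "lead = sqrt (pi * tan \<beta> / 2)"

text \<open>The right-hand sides of (b) for \<open>N = 0\<close>, with \<open>w\<close> the logarithm of the order.\<close>

definition debye_rhs1 :: "complex \<Rightarrow> complex" where
  "debye_rhs1 w = exp (\<i> * exp w * of_real lag - of_real (pi / 4) * \<i>) / (exp (w / 2) * of_real lead) * RH 0 (exp w) \<beta>"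

definition debye_rhs2 :: "complex \<Rightarrow> complex" where
  "debye_rhs2 w = exp (- \<i> * exp w * of_real lag + of_real (pi / 4) * \<i>) / (exp (w / 2) * of_real lead) * RH 0 (- exp w) \<beta>"

lemma exp_half_pi: "exp (\<i> * complex_of_real (pi / 2)) = \<i>"
  by (simp only: exp_Euler cos_of_real sin_of_real cos_pi_half sin_pi_half) simp

lemma exp_ray: "x > 0 \<Longrightarrow> exp (complex_of_real (ln x) + \<i> * of_real (pi / 2)) = \<i> * of_real x"
  by (simp only: exp_add exp_of_real exp_half_pi exp_ln mult.commute)

lemma lead_pos: "lead > 0"
  using tan_\<beta> by (simp add: lead_def)

lemma cbeta_lead: "cbeta \<beta> * lead = 2 * pi"
proof -
  have "sqrt (2 * pi * (cos \<beta> / sin \<beta>)) * lead = sqrt ((2 * pi * (cos \<beta> / sin \<beta>)) * (pi * tan \<beta> / 2))"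
    by (simp only: lead_def real_sqrt_mult)
  also have "(2 * pi * (cos \<beta> / sin \<beta>)) * (pi * tan \<beta> / 2) = pi * pi"
    using sin_\<beta> cos_\<beta> by (simp add: tan_def field_simps)
  finally show ?thesis by (simp add: cbeta_def)
qed

lemma strip1_open: "open strip1"
  unfolding strip1_def by (intro open_Collect_conj open_Collect_less continuous_intros)

lemma strip1_connected: "connected strip1"
proof -
  have *: "strip1 = {w. - pi / 2 < Im w} \<inter> {w. Im w < 3 * pi / 2}" by (auto simp: strip1_def)
  show ?thesis
    unfolding * by (intro convex_connected convex_Int convex_halfspace_Im_gt convex_halfspace_Im_lt)
qed

lemma exp_strip1: "w \<in> strip1 \<Longrightarrow> exp w \<in> cut_plane"
  by (simp add: strip1_def exp_in_cut_plane)

lemma holomorphic_on_debye_rhs1: "debye_rhs1 holomorphic_on strip1"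
proof -
  have "((\<lambda>\<nu>. RH 0 \<nu> \<beta>) \<circ> exp) holomorphic_on strip1"
    by (rule holomorphic_on_compose_gen[OF _ holomorphic_on_RH0]) (auto intro!: holomorphic_intros simp: exp_strip1)
  then have RH: "(\<lambda>w. RH 0 (exp w) \<beta>) holomorphic_on strip1" by (simp add: o_def)
  show ?thesis unfolding debye_rhs1_def
    using lead_pos by (intro holomorphic_intros RH) auto
qed

lemma debye_rhs1_ray:
  assumes x: "x > 0"
  shows "debye_rhs1 (of_real (ln x) + \<i> * of_real (pi / 2)) = hankel1_nonint (\<i> * of_real x) (of_real (ln x) + \<i> * of_real (pi / 2) + log_shift)"
proof -
  let ?w = "of_real (ln x) + \<i> * of_real (pi / 2) :: complex"
  have pos: "sqrt x > 0" "exp (x * lag) > 0" using x by auto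
  note ew = exp_ray[OF x]
  \<comment> \<open>Half the logarithm contributes \<open>exp (i pi / 4)\<close> to the denominator,
    and so does the phase factor; their product is \<open>i\<close> and cancels the \<open>i\<close>
    in front of the Hankel function in \<open>kernelK\<close>.\<close>
  have "?w / 2 = of_real (ln (sqrt x)) + \<i> * of_real (pi / 4)" using x by (simp add: ln_sqrt field_simps)
  then have ew2: "exp (?w / 2) = of_real (sqrt x) * exp (\<i> * of_real (pi / 4))"
    using pos by (simp only: exp_add exp_of_real exp_ln)
  have e4: "exp (\<i> * of_real (pi / 4)) * exp (\<i> * of_real (pi / 4)) = \<i>"
  proof -
    have "exp (\<i> * of_real (pi / 4)) * exp (\<i> * of_real (pi / 4)) = exp (\<i> * of_real (pi / 2))"
      by (simp flip: exp_add)
    then show ?thesis by (simp only: exp_half_pi)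
  qed
  have e1: "exp (\<i> * exp ?w * of_real lag - of_real (pi / 4) * \<i>) = 1 / (of_real (exp (x * lag)) * exp (\<i> * of_real (pi / 4)))"
  proof -
    have "\<i> * exp ?w * of_real lag - of_real (pi / 4) * \<i> = - (of_real (x * lag) + \<i> * of_real (pi / 4))"
      unfolding ew by simp
    then show ?thesis by (simp only: exp_minus exp_add exp_of_real inverse_eq_divide)
  qed
  have cut: "\<i> * of_real x \<in> cut_plane" using x by (simp add: cut_plane_def)
  have "dens_int 0 (\<lambda>t. 1 / (1 + \<i> * of_real t / (\<i> * of_real x))) =
      (LINT t:{0<..}|lborel. of_real (t powr (- 1/2) / (1 + t / x) * exp (- t * lag)) * Fker \<beta> t)"
    unfolding dens_int_def
    by (rule set_lebesgue_integral_cong) (auto simp: dens_def)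
  then have "RH 0 (\<i> * of_real x) \<beta> = 1 / of_real (cbeta \<beta>) * (of_real (2 * pi * sqrt x * exp (x * lag)) * kernelK x)"
    unfolding RH_eq[OF cut] resurgence_on_ray[OF x] by simp
  moreover have "complex_of_real (2 * pi) = of_real (cbeta \<beta>) * of_real lead" by (simp only: cbeta_lead flip: of_real_mult)
  ultimately have R: "RH 0 (exp ?w) \<beta> = of_real lead * of_real (sqrt x) * of_real (exp (x * lag)) * kernelK x"
    unfolding ew using cbeta_pos by (simp only: of_real_mult) simp
  have "debye_rhs1 ?w = kernelK x / (exp (\<i> * of_real (pi / 4)) * exp (\<i> * of_real (pi / 4)))"
  proof -
    have "1 / (E * q) / (s * q * l) * (l * s * E * K) = K / (q * q)"
      if "E \<noteq> 0" "s \<noteq> 0" "l \<noteq> 0" "q \<noteq> 0" for E q s l K :: complex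
      using that by (simp add: field_simps)
    from this[of "of_real (exp (x * lag))" "of_real (sqrt x)" "of_real lead" "exp (\<i> * of_real (pi / 4))" "kernelK x"]
    show ?thesis unfolding debye_rhs1_def e1 R ew2 using x lead_pos by simp
  qed
  also have "\<dots> = hankel1_log (\<i> * of_real x) (Ln (\<i> * of_real x / of_real (cos \<beta>)))"
    unfolding e4 kernelK_def by simp
  also have "\<dots> = hankel1_nonint (\<i> * of_real x) (Ln (\<i> * of_real x / of_real (cos \<beta>)))"
    using imaginary_not_Ints[of x] x by (simp add: hankel1_log_def)
  also have "Ln (\<i> * of_real x / of_real (cos \<beta>)) = ?w + log_shift"
    unfolding Ln_imaginary[OF x] log_shift_def using x cos_\<beta> by (simp add: ln_div)
  finally show ?thesis .
qed

text \<open>Multiplying by \<open>sin (\<nu> \<pi>)\<close> keeps both sides holomorphic across the integer orders.\<close>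

lemma hankel_num_debye:
  assumes w: "w \<in> strip1"
  shows "hankel_num (exp w) (w + log_shift) = \<i> * sin (exp w * of_real pi) * debye_rhs1 w"
proof -
  let ?f = "\<lambda>w. hankel_num (exp w) (w + log_shift) - \<i> * sin (exp w * of_real pi) * debye_rhs1 w"
  have "?f w = 0"
  \<comment> \<open>The identity is known on the line \<open>Im w = pi / 2\<close>, where the order
    is purely imaginary and never an integer.\<close>
  proof (rule analytic_continuation[where S = strip1 and U = "{w. Im w = pi / 2}" and \<xi> = "\<i> * of_real (pi / 2)" and f = ?f and w = w])
    show "?f holomorphic_on strip1"
      by (intro holomorphic_intros holomorphic_on_hankel_num strip1_open holomorphic_on_debye_rhs1)
    show "{w. Im w = pi / 2} \<subseteq> strip1"
    proof
      fix z :: complex assume "z \<in> {w. Im w = pi / 2}"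
      then have "Im z = pi / 2" by simp
      then have "- pi / 2 < Im z" "Im z < 3 * pi / 2" using pi_gt_zero by linarith+
      then show "z \<in> strip1" by (simp only: strip1_def mem_Collect_eq simp_thms)
    qed
    show "\<i> * of_real (pi / 2) \<in> strip1" by (simp add: strip1_def)
    show "\<i> * of_real (pi / 2) islimpt {w. Im w = pi / 2}"
      unfolding islimpt_approachable
    proof (intro allI impI)
      fix e :: real assume "e > 0"
      then show "\<exists>x'\<in>{w. Im w = pi / 2}. x' \<noteq> \<i> * of_real (pi / 2) \<and> dist x' (\<i> * of_real (pi / 2)) < e"
        by (intro bexI[of _ "of_real (e / 2) + \<i> * of_real (pi / 2)"]) (auto simp: dist_norm)
    qed
    fix z :: complex assume "z \<in> {w. Im w = pi / 2}"
    then have z: "z = of_real (ln (exp (Re z))) + \<i> * of_real (pi / 2)" by (simp add: complex_eq_iff)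
    define x where "x = exp (Re z)"
    have x: "x > 0" by (simp add: x_def)
    have z: "z = of_real (ln x) + \<i> * of_real (pi / 2)" using z by (simp only: x_def)
    have ez: "exp z = \<i> * of_real x" unfolding z by (rule exp_ray[OF x])
    have s: "sin (exp z * of_real pi) \<noteq> 0"
      unfolding ez using imaginary_not_Ints[of x] x by (intro sin_pi_nonzero) auto
    have "debye_rhs1 z = hankel1_nonint (exp z) (z + log_shift)"
      using debye_rhs1_ray[OF x] unfolding ez unfolding z .
    then show "?f z = 0" unfolding hankel1_nonint_eq using s by simp
  qed (use w strip1_open strip1_connected in auto)
  then show ?thesis by simp
qed

lemma tendsto_hankel1_debye:
  assumes w: "w \<in> strip1" and int: "exp w \<in> \<int>"
  shows "((\<lambda>m. hankel1_nonint m (w + log_shift)) \<longlongrightarrow> debye_rhs1 w) (at (exp w))"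
proof -
  define k where "k = exp w"
  have k: "k \<noteq> 0" by (simp add: k_def)
  \<comment> \<open>A local logarithm of the order \<open>m\<close> that passes through
    \<open>w\<close> at \<open>m = k\<close>, and so stays on the sheet of \<open>w\<close>.\<close>
  let ?l = "\<lambda>m. w + Ln (m / k)"
  have der: "(?l has_field_derivative 1 / k) (at k)"
    using k by (auto intro!: derivative_eq_intros)
  have lim: "(?l \<longlongrightarrow> w) (at k)" using DERIV_isCont[OF der] k by (simp add: isCont_def)
  have "isCont debye_rhs1 w"
    using holomorphic_on_imp_continuous_on[OF holomorphic_on_debye_rhs1] w strip1_open
    by (simp add: continuous_on_eq_continuous_at)
  then have R: "((\<lambda>m. debye_rhs1 (?l m)) \<longlongrightarrow> debye_rhs1 w) (at k)"
    using lim by (rule isCont_tendsto_compose)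
  have "eventually (\<lambda>m. ?l m \<in> strip1) (at k)" by (rule topological_tendstoD[OF lim strip1_open w])
  moreover have "eventually (\<lambda>m. m \<noteq> 0) (at k)" by (rule tendsto_imp_eventually_ne[OF tendsto_ident_at k])
  ultimately have "eventually (\<lambda>m. hankel_num m (?l m + log_shift) = \<i> * sin (m * of_real pi) * debye_rhs1 (?l m)) (at k)"
  proof eventually_elim
    case (elim m)
    then have "exp (?l m) = m" using k by (simp add: exp_add k_def)
    then show ?case using hankel_num_debye[OF elim(1)] by simp
  qed
  moreover have "((\<lambda>m. ?l m + log_shift) has_field_derivative 1 / k) (at k)"
    using k by (auto intro!: derivative_eq_intros)
  ultimately show ?thesis
    using tendsto_hankel1_nonint_int[of k "\<lambda>m. ?l m + log_shift" "1 / k" "w + log_shift"] R int k by (simp add: k_def)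
qed

lemma hankel1_nonint_debye:
  assumes "w \<in> strip1" "exp w \<notin> \<int>"
  shows "hankel1_nonint (exp w) (w + log_shift) = debye_rhs1 w"
  unfolding hankel1_nonint_eq hankel_num_debye[OF assms(1)] using sin_pi_nonzero[OF assms(2)] by simp

lemma hankel1_log_debye:
  assumes "w \<in> strip1"
  shows "hankel1_log (exp w) (w + log_shift) = debye_rhs1 w"
  using hankel1_nonint_debye[OF assms] tendsto_Lim[OF _ tendsto_hankel1_debye[OF assms]]
  by (auto simp: hankel1_log_def)

text \<open>The counterpart of \<open>hankel2_nonint_eq\<close> on the right-hand side. Adding
  \<open>i pi\<close> to \<open>w\<close> changes the sign of the order; the phase factor and the
  half logarithm each differ by a factor \<open>i\<close>, and together these produce the minus
  sign.\<close>

lemma debye_rhs2_shift: "debye_rhs2 w = - debye_rhs1 (w + \<i> * of_real pi)"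
proof -
  have e: "exp (w + \<i> * of_real pi) = - exp w" by (simp add: exp_add)
  have "(w + \<i> * of_real pi) / 2 = w / 2 + \<i> * of_real (pi / 2)" by (simp add: add_divide_distrib)
  then have e2: "exp ((w + \<i> * of_real pi) / 2) = exp (w / 2) * \<i>" by (simp only: exp_add exp_half_pi)
  have "- \<i> * exp w * of_real lag + of_real (pi / 4) * \<i>
     = (\<i> * (- exp w) * of_real lag - of_real (pi / 4) * \<i>) + \<i> * of_real (pi / 2)" by (simp add: field_simps)
  then have e3: "exp (- \<i> * exp w * of_real lag + of_real (pi / 4) * \<i>)
     = exp (\<i> * (- exp w) * of_real lag - of_real (pi / 4) * \<i>) * \<i>" by (simp only: exp_add exp_half_pi)
  have "E * \<i> / (a * l) * R = - (E / (a * \<i> * l) * R)" for E a l R :: complex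
    by (simp add: divide_inverse mult_ac)
  then show ?thesis unfolding debye_rhs1_def debye_rhs2_def e e2 e3 .
qed

definition strip2 :: "complex set" where "strip2 = {w. - 3 * pi / 2 < Im w \<and> Im w < pi / 2}"

lemma strip2_shift: "w \<in> strip2 \<Longrightarrow> w + \<i> * of_real pi \<in> strip1"
  by (auto simp: strip1_def strip2_def)

lemma exp_shift: "exp (w + \<i> * of_real pi) = - exp w"
  by (simp add: exp_add)

lemma hankel2_nonint_debye:
  assumes "w \<in> strip2" "exp w \<notin> \<int>"
  shows "hankel2_nonint (exp w) (w + log_shift) = debye_rhs2 w"
  using hankel1_nonint_debye[OF strip2_shift[OF assms(1)]] assms(2)
  unfolding hankel2_nonint_eq debye_rhs2_shift exp_shift by (simp add: add_ac)

lemma tendsto_hankel2_debye: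
  assumes "w \<in> strip2" "exp w \<in> \<int>"
  shows "((\<lambda>m. hankel2_nonint m (w + log_shift)) \<longlongrightarrow> debye_rhs2 w) (at (exp w))"
proof -
  have 1: "((\<lambda>m. hankel1_nonint m (w + \<i> * of_real pi + log_shift)) \<longlongrightarrow> debye_rhs1 (w + \<i> * of_real pi)) (at (- exp w))"
    using tendsto_hankel1_debye[OF strip2_shift[OF assms(1)]] assms(2) unfolding exp_shift by simp
  have "filterlim uminus (at (- exp w)) (at (exp w))"
    unfolding filterlim_at by (auto intro!: tendsto_intros simp: eventually_at_filter)
  from filterlim_compose[OF 1 this]
  have "((\<lambda>m. - hankel1_nonint (- m) (w + \<i> * of_real pi + log_shift)) \<longlongrightarrow> - debye_rhs1 (w + \<i> * of_real pi)) (at (exp w))"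
    by (intro tendsto_minus)
  then show ?thesis unfolding hankel2_nonint_eq debye_rhs2_shift by (simp add: add_ac)
qed

lemma hankel2_log_debye:
  assumes "w \<in> strip2"
  shows "hankel2_log (exp w) (w + log_shift) = debye_rhs2 w"
  using hankel2_nonint_debye[OF assms] tendsto_Lim[OF _ tendsto_hankel2_debye[OF assms]]
  by (auto simp: hankel2_log_def)

text \<open>Away from the integers these are the usual combinations of the Hankel functions. At
  integer orders \<open>J\<close> is continuous in the order and thus equals the limit of half their
  sum, while \<open>Y\<close> is a limit by definition.\<close>

lemma bessel_debye:
  assumes w: "w \<in> strip1" "w \<in> strip2"
  shows "besselJ_log (exp w) (w + log_shift) = (debye_rhs1 w + debye_rhs2 w) / 2" (is "?J")
    and "besselY_log (exp w) (w + log_shift) = (debye_rhs1 w - debye_rhs2 w) / (2 * \<i>)" (is "?Y")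
proof -
  have "?J \<and> ?Y"
  proof (cases "exp w \<in> \<int>")
    case False
    then show ?thesis
      by (simp add: besselY_log_def besselY_nonint_hankel besselJ_log_hankel hankel1_nonint_debye hankel2_nonint_debye w)
  next
    case True
    note lims = tendsto_hankel1_debye[OF w(1) True] tendsto_hankel2_debye[OF w(2) True]
    have "((\<lambda>m. (hankel1_nonint m (w + log_shift) + hankel2_nonint m (w + log_shift)) / 2) \<longlongrightarrow> (debye_rhs1 w + debye_rhs2 w) / 2) (at (exp w))"
      by (intro tendsto_intros lims) simp
    moreover have "eventually (\<lambda>m. (hankel1_nonint m (w + log_shift) + hankel2_nonint m (w + log_shift)) / 2 = besselJ_log m (w + log_shift)) (at (exp w))"
      using eventually_not_Ints by eventually_elim (simp add: besselJ_log_hankel)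
    ultimately have "((\<lambda>m. besselJ_log m (w + log_shift)) \<longlongrightarrow> (debye_rhs1 w + debye_rhs2 w) / 2) (at (exp w))"
      by (rule Lim_transform_eventually)
    moreover have "((\<lambda>m. besselJ_log m (w + log_shift)) \<longlongrightarrow> besselJ_log (exp w) (w + log_shift)) (at (exp w))"
      using isCont_besselJ_log by (simp add: isCont_def)
    ultimately have ?J by (intro tendsto_unique) auto
    have "((\<lambda>m. besselY_nonint m (w + log_shift)) \<longlongrightarrow> (debye_rhs1 w - debye_rhs2 w) / (2 * \<i>)) (at (exp w))"
      unfolding besselY_nonint_hankel by (intro tendsto_intros lims) simp
    then have ?Y using True by (simp add: besselY_log_def tendsto_Lim)
    with \<open>?J\<close> show ?thesis by blast
  qed
  then show ?J ?Y by blast+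
qed

section \<open>Expansions with finitely many terms\<close>

lemma hankel1_debye_expansion:
  assumes w: "w \<in> strip1"
  shows "debye_rhs1 w = exp (\<i> * exp w * of_real lag - of_real (pi / 4) * \<i>) / (exp (w / 2) * of_real lead)
      * ((\<Sum>n<N. (-1) ^ n * U n cotp / exp w ^ n) + RH N (exp w) \<beta>)"
  unfolding debye_rhs1_def RH_expansion[OF exp_strip1[OF w], of N] ..

lemma hankel2_debye_expansion:
  assumes w: "w \<in> strip2"
  shows "debye_rhs2 w = exp (- \<i> * exp w * of_real lag + of_real (pi / 4) * \<i>) / (exp (w / 2) * of_real lead)
      * ((\<Sum>n<N. U n cotp / exp w ^ n) + RH N (- exp w) \<beta>)"
proof -
  have cut: "- exp w \<in> cut_plane" using exp_strip1[OF strip2_shift[OF w]] by (simp only: exp_shift)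
  have "(-1) ^ n * U n cotp / (- exp w) ^ n = U n cotp / exp w ^ n" for n
  proof -
    have "(- exp w) ^ n = (-1) ^ n * exp w ^ n" by (rule power_minus)
    then show ?thesis by simp
  qed
  then show ?thesis unfolding debye_rhs2_def RH_expansion[OF cut, of N] by simp
qed

text \<open>Expanding the resolvent by \<open>1 - i t / \<nu>\<close> makes its denominator
  \<open>1 + (t / \<nu>)^2\<close>. That factor is the reciprocal of the resolvent at
  \<open>- \<nu>\<close>, which also lies in the cut plane as \<open>Re \<nu> \<noteq> 0\<close>, so
  continuity and bounds follow from those of the two resolvents.\<close>

lemma RH_even:
  assumes \<nu>: "Re \<nu> \<noteq> 0"
  shows "RH (2 * N) \<nu> \<beta> = (-1) ^ N / (of_real (cbeta \<beta>) * \<nu> ^ (2 * N)) * IJ (2 * N) \<nu> \<beta> (- 1/2)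
      - \<i> * ((-1) ^ N / (of_real (cbeta \<beta>) * \<nu> ^ (2 * N + 1)) * IJ (2 * N) \<nu> \<beta> (1/2))"
proof -
  have p: "\<nu> \<in> cut_plane" and m: "- \<nu> \<in> cut_plane" and nz: "\<nu> \<noteq> 0" using \<nu> by (auto simp: cut_plane_def)
  let ?q = "\<lambda>t. 1 / (1 + \<i> * of_real t / \<nu>)"
  let ?r = "\<lambda>t. 1 / (1 + \<i> * of_real t / (- \<nu>))"
  let ?s = "\<lambda>t. 1 / (1 + (of_real t / \<nu>) ^ 2)"
  have prod: "(1 + \<i> * T / \<nu>) * (1 + \<i> * T / (- \<nu>)) = 1 + (T / \<nu>) ^ 2" for T
    using nz by (simp add: field_simps power2_eq_square)
  have s: "?s t = ?q t * ?r t" for t unfolding prod[symmetric] by simp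
  have cont: "continuous_on {0<..} ?s"
    unfolding s by (intro continuous_on_mult continuous_on_resolvent p m)
  have bound: "norm (?s t) \<le> (norm \<nu> / cut_dist \<nu>) * (norm (- \<nu>) / cut_dist (- \<nu>))" if "t > 0" for t
    unfolding s norm_mult
    using that p m by (intro mult_mono norm_resolvent_le) (auto simp: cut_dist_pos intro!: divide_nonneg_pos)
  have A: "IJ (2 * N) \<nu> \<beta> (- 1/2) = dens_int (2 * N) ?s"
    unfolding IJ_def
    by (rule integral_dens_int[OF cont bound]) (simp_all add: dens_def lag_def)
  have B: "IJ (2 * N) \<nu> \<beta> (1/2) = dens_int (Suc (2 * N)) ?s"
  proof -
    have e: "real (2 * N) + 1/2 = real (Suc (2 * N)) - 1/2" by simp
    show ?thesis unfolding IJ_def e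
      by (rule integral_dens_int[OF cont bound]) (simp_all add: dens_def lag_def)
  qed
  have i1: "set_integrable lborel {0<..} (\<lambda>t. ?s t * dens (2 * N) t)"
    by (rule set_integrable_mult_dens[OF cont bound])
  have i2: "set_integrable lborel {0<..} (\<lambda>t. (\<i> / \<nu>) * (?s t * dens (Suc (2 * N)) t))"
    by (intro set_integrable_mult_right impI set_integrable_mult_dens[OF cont bound])
  have "dens_int (2 * N) ?q = (LINT t:{0<..}|lborel. ?s t * dens (2 * N) t - (\<i> / \<nu>) * (?s t * dens (Suc (2 * N)) t))"
    unfolding dens_int_def
  proof (rule set_lebesgue_integral_cong)
    show "\<forall>t. t \<in> {0<..} \<longrightarrow> ?q t * dens (2 * N) t = ?s t * dens (2 * N) t - (\<i> / \<nu>) * (?s t * dens (Suc (2 * N)) t)"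
    proof (intro allI impI)
      fix t :: real assume "t \<in> {0<..}"
      then have t: "t > 0" by simp
      have nr: "1 + \<i> * of_real t / (- \<nu>) \<noteq> 0" using cut_plane_denom'[OF m, of t] t by (meson less_imp_le)
      have "?s t * (1 + \<i> * of_real t / (- \<nu>)) = ?q t * (?r t * (1 + \<i> * of_real t / (- \<nu>)))"
        by (simp only: s mult.assoc)
      also have "?r t * (1 + \<i> * of_real t / (- \<nu>)) = 1" 
      proof -
        have "1 / z * z = 1" if "z \<noteq> 0" for z :: complex using that by simp
        from this[OF nr] show ?thesis .
      qed
      finally have "?q t = ?s t * (1 + \<i> * of_real t / (- \<nu>))" by (simp only: mult_1_right)
      also have "\<dots> = ?s t - (\<i> / \<nu>) * (?s t * of_real t)"
      proof -
        have "a * (1 + \<i> * T / (- \<nu>)) = a - (\<i> / \<nu>) * (a * T)" for a T :: complex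
          by (simp add: algebra_simps)
        then show ?thesis .
      qed
      finally have "?q t * dens (2 * N) t = (?s t - (\<i> / \<nu>) * (?s t * of_real t)) * dens (2 * N) t" by (rule arg_cong)
      then show "?q t * dens (2 * N) t = ?s t * dens (2 * N) t - (\<i> / \<nu>) * (?s t * dens (Suc (2 * N)) t)"
        by (simp only: dens_Suc[OF t] left_diff_distrib mult.assoc)
    qed
  qed simp
  also have "\<dots> = dens_int (2 * N) ?s - (\<i> / \<nu>) * dens_int (Suc (2 * N)) ?s"
    unfolding dens_int_def set_integral_diff(2)[OF i1 i2] by (simp only: set_integral_mult_right)
  finally have e: "dens_int (2 * N) ?q = dens_int (2 * N) ?s - (\<i> / \<nu>) * dens_int (Suc (2 * N)) ?s" .
  have "(\<i> * \<nu>) ^ (2 * N) = (-1) ^ N * \<nu> ^ (2 * N)"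
    by (simp add: power_mult_distrib power_mult power_minus[of "\<nu>\<^sup>2"])
  then have f: "1 / (of_real (cbeta \<beta>) * (\<i> * \<nu>) ^ (2 * N)) = (-1) ^ N / (of_real (cbeta \<beta>) * \<nu> ^ (2 * N))"
    by (cases "even N") simp_all
  show ?thesis unfolding RH_eq[OF p] e A B f by (simp add: algebra_simps)
qed

lemma sum_even_odd: "(\<Sum>n<2 * N. f n :: complex) = (\<Sum>n<N. f (2 * n)) + (\<Sum>n<N. f (2 * n + 1))" for N :: nat
  by (induction N) (simp_all add: algebra_simps)

lemma IJ_minus: "IJ m (- \<nu>) \<beta> a = IJ m \<nu> \<beta> a"
  by (simp add: IJ_def power_divide)

lemma strip1_Int_strip2: "\<bar>Im w\<bar> < pi / 2 \<Longrightarrow> w \<in> strip1 \<and> w \<in> strip2 \<and> Re (exp w) \<noteq> 0"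
proof -
  assume "\<bar>Im w\<bar> < pi / 2"
  then have w: "- (pi / 2) < Im w" "Im w < pi / 2" by linarith+
  then have "cos (Im w) > 0" by (intro cos_gt_zero_pi)
  then have "Re (exp w) \<noteq> 0" by (simp add: Re_exp)
  moreover have "- pi / 2 < Im w" "Im w < 3 * pi / 2" "- 3 * pi / 2 < Im w" using w pi_gt_zero by linarith+
  ultimately show ?thesis using w(2) by (simp only: strip1_def strip2_def mem_Collect_eq simp_thms)
qed

text \<open>The Hankel expansions are taken with \<open>2 * N\<close> terms, so that even and odd
  indices contribute \<open>N\<close> terms each. Writing \<open>exp (i \<xi>)\<close> and
  \<open>exp (- i \<xi>)\<close> through cosine and sine, the sum and the difference separate the
  two parities.\<close>

lemma bessel_debye_expansion:
  fixes w :: complex and N :: nat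
  assumes w: "\<bar>Im w\<bar> < pi / 2"
  defines "\<nu> \<equiv> exp w"
  defines "\<xi> \<equiv> \<nu> * of_real lag - of_real (pi / 4)"
  defines "S0 \<equiv> (\<Sum>n<N. U (2 * n) cotp / \<nu> ^ (2 * n))"
  defines "S1 \<equiv> (\<Sum>n<N. U (2 * n + 1) cotp / \<nu> ^ (2 * n + 1))"
  defines "pre \<equiv> exp (- w / 2) * of_real (sqrt (2 / (pi * tan \<beta>)))"
  shows "besselJ_log \<nu> (w + log_shift) = pre * (cos \<xi> * S0 - \<i> * sin \<xi> * S1 + RJ N \<nu> \<beta>)"
    and "besselY_log \<nu> (w + log_shift) = pre * (sin \<xi> * S0 + \<i> * cos \<xi> * S1 + RY N \<nu> \<beta>)"
proof -
  have s: "w \<in> strip1" "w \<in> strip2" and re: "Re \<nu> \<noteq> 0" using strip1_Int_strip2[OF w] by (auto simp: \<nu>_def)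
  define P where "P = (-1) ^ N / (of_real (cbeta \<beta>) * \<nu> ^ (2 * N)) * IJ (2 * N) \<nu> \<beta> (- 1/2)"
  define Q where "Q = (-1) ^ N / (of_real (cbeta \<beta>) * \<nu> ^ (2 * N + 1)) * IJ (2 * N) \<nu> \<beta> (1/2)"
  have R1: "RH (2 * N) \<nu> \<beta> = P - \<i> * Q" using RH_even[OF re, of N] by (simp only: P_def Q_def)
  \<comment> \<open>The integrals \<open>IJ\<close> depend on \<open>\<nu>\<close> only through its
    square, so passing to \<open>- \<nu>\<close> just changes the sign of the odd power in front of
    the second one.\<close>
  have R2: "RH (2 * N) (- \<nu>) \<beta> = P + \<i> * Q"
  proof -
    have "Re (- \<nu>) \<noteq> 0" using re by simp
    moreover have "(- \<nu>) ^ (2 * N) = \<nu> ^ (2 * N)" "(- \<nu>) ^ (2 * N + 1) = - (\<nu> ^ (2 * N + 1))" by simp_all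
    ultimately show ?thesis using RH_even[of "- \<nu>" N] by (simp only: IJ_minus P_def Q_def) simp
  qed
  have E1: "(\<Sum>n<2 * N. (-1) ^ n * U n cotp / \<nu> ^ n) = S0 - S1"
    unfolding sum_even_odd S0_def S1_def by (simp add: sum_negf del: debyeU.simps flip: minus_divide_left)
  have E2: "(\<Sum>n<2 * N. U n cotp / \<nu> ^ n) = S0 + S1"
    unfolding sum_even_odd S0_def S1_def ..
  have pre: "1 / (exp (w / 2) * of_real lead) = pre"
  proof -
    have "sqrt (2 / (pi * tan \<beta>)) * lead = sqrt ((2 / (pi * tan \<beta>)) * (pi * tan \<beta> / 2))"
      by (simp only: lead_def real_sqrt_mult)
    also have "(2 / (pi * tan \<beta>)) * (pi * tan \<beta> / 2) = 1" using tan_\<beta> by simp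
    finally have "sqrt (2 / (pi * tan \<beta>)) * lead = 1" by (simp only: real_sqrt_one)
    then have "1 / lead = sqrt (2 / (pi * tan \<beta>))"
      using lead_pos by (simp only: divide_eq_eq) simp
    then have "of_real (sqrt (2 / (pi * tan \<beta>))) = 1 / complex_of_real lead" by (metis of_real_1 of_real_divide)
    moreover have "exp (- w / 2) = 1 / exp (w / 2)" by (simp add: exp_minus inverse_eq_divide)
    ultimately show ?thesis unfolding pre_def by (simp only: times_divide_times_eq mult_1_left)
  qed
  have D1: "debye_rhs1 w = pre * exp (\<i> * \<xi>) * (S0 - S1 + (P - \<i> * Q))"
  proof -
    have "\<i> * exp w * of_real lag - of_real (pi / 4) * \<i> = \<i> * \<xi>" by (simp add: \<xi>_def \<nu>_def algebra_simps)
    then show ?thesis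
      using hankel1_debye_expansion[OF s(1), of "2 * N"] E1 R1 unfolding pre[symmetric] \<nu>_def[symmetric] by simp
  qed
  have D2: "debye_rhs2 w = pre * exp (- (\<i> * \<xi>)) * (S0 + S1 + (P + \<i> * Q))"
  proof -
    have "- \<i> * exp w * of_real lag + of_real (pi / 4) * \<i> = - (\<i> * \<xi>)" by (simp add: \<xi>_def \<nu>_def algebra_simps)
    then show ?thesis
      using hankel2_debye_expansion[OF s(2), of "2 * N"] E2 R2 unfolding pre[symmetric] \<nu>_def[symmetric] by simp
  qed
  have J: "RJ N \<nu> \<beta> = cos \<xi> * P + sin \<xi> * Q"
    by (simp add: RJ_def Let_def P_def Q_def \<xi>_def lag_def mult.assoc)
  have Y: "RY N \<nu> \<beta> = sin \<xi> * P - cos \<xi> * Q"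
    by (simp add: RY_def Let_def P_def Q_def \<xi>_def lag_def mult.assoc)
  have ex: "exp (\<i> * \<xi>) = cos \<xi> + \<i> * sin \<xi>" "exp (- (\<i> * \<xi>)) = cos \<xi> - \<i> * sin \<xi>"
    by (simp_all only: exp_Euler exp_minus_Euler)
  have ii: "\<i> * (\<i> * z) = - z" for z by simp
  have "debye_rhs1 w + debye_rhs2 w = 2 * (pre * (cos \<xi> * S0 - \<i> * sin \<xi> * S1 + RJ N \<nu> \<beta>))"
    unfolding D1 D2 ex J by (simp add: algebra_simps ii)
  then show "besselJ_log \<nu> (w + log_shift) = pre * (cos \<xi> * S0 - \<i> * sin \<xi> * S1 + RJ N \<nu> \<beta>)"
    using bessel_debye(1)[OF s] by (simp only: \<nu>_def[symmetric]) simp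
  have "debye_rhs1 w - debye_rhs2 w = (2 * \<i>) * (pre * (sin \<xi> * S0 + \<i> * cos \<xi> * S1 + RY N \<nu> \<beta>))"
    unfolding D1 D2 ex Y by (simp add: algebra_simps ii)
  then show "besselY_log \<nu> (w + log_shift) = pre * (sin \<xi> * S0 + \<i> * cos \<xi> * S1 + RY N \<nu> \<beta>)"
    using bessel_debye(2)[OF s] by (simp only: \<nu>_def[symmetric]) simp
qed

end

theorem theorem1:
  fixes \<beta> :: real and N :: nat
  assumes "0 < \<beta>" and "\<beta> < pi / 2"
  shows
   "(\<forall>n::nat.
      U n (\<i> * of_real (cos \<beta> / sin \<beta>)) =
        (-1) ^ n * (\<i> * of_real (cos \<beta> / sin \<beta>)) ^ n / (2 ^ n * fact n) *
        (deriv ^^ (2 * n))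
          (\<lambda>t::complex. if t = 0 then 1 else
             ((1/2) * t ^ 2 / (\<i> * of_real (cos \<beta> / sin \<beta>) * (t - sinh t) + cosh t - 1))
               powr (of_nat n + 1/2)) 0
    \<and> U n (\<i> * of_real (cos \<beta> / sin \<beta>)) =
        \<i> ^ n / of_real (cbeta \<beta>) *
        integral {0<..} (\<lambda>t. of_real (t powr (real n - 1/2) * exp (- t * (tan \<beta> - \<beta>))) * Fker \<beta> t))
  \<and> (\<forall>w::complex. - pi / 2 < Im w \<and> Im w < 3 * pi / 2 \<longrightarrow>
      hankel1_log (exp w) (w + of_real (ln (1 / cos \<beta>))) =
        exp (\<i> * exp w * of_real (tan \<beta> - \<beta>) - of_real (pi / 4) * \<i>)
          / (exp (w / 2) * of_real (sqrt (pi * tan \<beta> / 2)))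
        * ((\<Sum>n<N. (-1) ^ n * U n (\<i> * of_real (cos \<beta> / sin \<beta>)) / exp w ^ n) + RH N (exp w) \<beta>))
  \<and> (\<forall>w::complex. - 3 * pi / 2 < Im w \<and> Im w < pi / 2 \<longrightarrow>
      hankel2_log (exp w) (w + of_real (ln (1 / cos \<beta>))) =
        exp (- \<i> * exp w * of_real (tan \<beta> - \<beta>) + of_real (pi / 4) * \<i>)
          / (exp (w / 2) * of_real (sqrt (pi * tan \<beta> / 2)))
        * ((\<Sum>n<N. U n (\<i> * of_real (cos \<beta> / sin \<beta>)) / exp w ^ n) + RH N (- exp w) \<beta>))
  \<and> (\<forall>w::complex. \<bar>Im w\<bar> < pi / 2 \<longrightarrow>
      (let \<nu> = exp w; \<xi> = \<nu> * of_real (tan \<beta> - \<beta>) - of_real (pi / 4);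
           p = \<i> * of_real (cos \<beta> / sin \<beta>);
           S0 = (\<Sum>n<N. U (2 * n) p / \<nu> ^ (2 * n));
           S1 = (\<Sum>n<N. U (2 * n + 1) p / \<nu> ^ (2 * n + 1));
           pre = exp (- w / 2) * of_real (sqrt (2 / (pi * tan \<beta>)))
       in besselJ_log \<nu> (w + of_real (ln (1 / cos \<beta>))) =
            pre * (cos \<xi> * S0 - \<i> * sin \<xi> * S1 + RJ N \<nu> \<beta>)
        \<and> besselY_log \<nu> (w + of_real (ln (1 / cos \<beta>))) =
            pre * (sin \<xi> * S0 + \<i> * cos \<xi> * S1 + RY N \<nu> \<beta>)))"
proof -
  interpret debye_angle \<beta> using assms by unfold_locales
  have a: "U n cotp = \<i> ^ n / of_real (cbeta \<beta>) *
        integral {0<..} (\<lambda>t. of_real (t powr (real n - 1/2) * exp (- t * lag)) * Fker \<beta> t)" for n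
  proof -
    have "integral {0<..} (\<lambda>t. of_real (t powr (real n - 1/2) * exp (- t * lag)) * Fker \<beta> t) = dens_int n (\<lambda>_. 1)"
      by (rule integral_dens_int[where C = 1]) (simp_all add: dens_def)
    then show ?thesis by (simp only: debyeU_integral)
  qed
  have h1: "hankel1_log (exp w) (w + log_shift) =
        exp (\<i> * exp w * of_real lag - of_real (pi / 4) * \<i>) / (exp (w / 2) * of_real lead)
        * ((\<Sum>n<N. (-1) ^ n * U n cotp / exp w ^ n) + RH N (exp w) \<beta>)"
    if "- pi / 2 < Im w" "Im w < 3 * pi / 2" for w
  proof -
    have "w \<in> strip1" using that by (simp only: strip1_def mem_Collect_eq simp_thms)
    then show ?thesis by (simp only: hankel1_log_debye hankel1_debye_expansion[of w N])
  qed
  have h2: "hankel2_log (exp w) (w + log_shift) =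
        exp (- \<i> * exp w * of_real lag + of_real (pi / 4) * \<i>) / (exp (w / 2) * of_real lead)
        * ((\<Sum>n<N. U n cotp / exp w ^ n) + RH N (- exp w) \<beta>)"
    if "- 3 * pi / 2 < Im w" "Im w < pi / 2" for w
  proof -
    have "w \<in> strip2" using that by (simp only: strip2_def mem_Collect_eq simp_thms)
    then show ?thesis by (simp only: hankel2_log_debye hankel2_debye_expansion[of w N])
  qed
  show ?thesis
    unfolding Let_def lag_def[symmetric] cotp_def[symmetric] log_shift_def[symmetric] lead_def[symmetric]
    by (intro conjI allI impI debyeU_derivative a h1 h2 bessel_debye_expansion) ((elim conjE)?, assumption)+
qed

end
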